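(* Let $k$ be a field and let $\mathcal{C}$ be an essentially small, finitely split semisimple, $k$-linear, additive, left-autonomous monoidal category such that $\mathrm{Hom}(X,Y)$ is finite-dimensional over $k$ for all objects $X,Y$. Let $M$ be an object that generates $\mathcal{C}$ as a fusion category, let $\mathcal{G}$ be the dimension graph of $\mathcal{C}$ with respect to $M$, and let $H=\mathbf{coend}(\mathcal{C},\omega)$ be the universal coend with respect to the long canonical functor $\omega$. Then there is a surjection of WBAs $\pi\colon H[\mathcal{G}]\to H$ such that: 1. $\pi([j|\ell]_0)=[e^j_{(\mathbf 1)}|e_\ell^{(\mathbf 1)}]_{\mathbf 1}$ for all $j,\ell\in\mathcal{G}^0$. 2. $\pi([p|q]_1)=[e^p_{(M)}|e_q^{(M)}]_M$ for all $p,q\in\mathcal{G}^1$. 3. $\pi$ pushes forward the right $H[\mathcal{G}]$-comodule $k\mathcal{G}^1$ to the right $H$-comodule $\omega M$, i.e. $(\mathrm{id}_{k\mathcal{G}^1}\otimes\pi)\circ\beta_{k\mathcal{G}^1}=\beta_{\omega M}$. 4. $\pi$ pushes forward the right $H[\mathcal{G}]$-comodule $k\mathcal{G}^0$ to the right $H$-comodule $\omega\mathbf{1}$, i.e. $(\mathrm{id}_{k\mathcal{G}^0}\otimes\pi)\circ\beta_{k\mathcal{G}^0}=\beta_{\omega\mathbf{1}}$. Here $k\mathcal{G}^1=\omega M$ and $k\mathcal{G}^0=\omega\mathbf 1$ are identified via $p\mapsto e^{(M)}_p$ and $j\mapsto e_j^{(\mathbf 1)}$.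
   Context: **Weak Bialgebras.** A Weak Bialgebra (WBA) over a field $k$ is a $k$-vector space $H$ with an associative unital algebra structure (unit element $1$) and a coassociative counital coalgebra structure $(\Delta,\varepsilon)$ such that, writing $\Delta(x)=x'\otimes x''$ (Sweedler notation), for all $x,y,z\in H$: $\Delta(xy)=\Delta(x)\Delta(y)$; $\varepsilon(xyz)=\varepsilon(xy')\varepsilon(y''z)=\varepsilon(xy'')\varepsilon(y'z)$; $(\Delta\otimes\mathrm{id})\Delta(1)=(\Delta(1)\otimes1)(1\otimes\Delta(1))=(1\otimes\Delta(1))(\Delta(1)\otimes1)$. A homomorphism of WBAs is a linear map that is a homomorphism of unital algebras and of counital coalgebras; a surjection of WBAs is a surjective such homomorphism. **The category.** In a $k$-linear category, $X$ is simple if $\mathrm{End}(X)\cong k$. $\mathcal{C}$ is *finitely split semisimple* if there is a finite family $(V_j)_{j\in I}$ of simple objects with $\mathrm{Hom}(V_j,V_\ell)=0$ for $j\neq\ell$ such that every object is a finite direct sum of objects $V_j$. The tensor product of a $k$-linear monoidal category $(\mathcal{C},\otimes,\mathbf{1},\alpha,\lambda,\rho)$ is $k$-bilinear on morphisms. $\mathcal{C}$ is *left-autonomous* if every object is equipped with a specified left dual. The unit $\mathbf{1}$ need not be simple. A (non-zero) object $M$ *generates $\mathcal{C}$ as a fusion category* if (i) every $V_j$ is a direct summand of $M^{\otimes n}$ for some $n\in\mathbb{N}_0$ (with $M^{\otimes0}=\mathbf{1}$); (ii) $M$ is multiplicity free: if $M\cong X\oplus Y\oplus Z$ with $X,Y\neq0$,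 then $X\not\cong Y$; (iii) no non-zero object is a direct summand of both $\mathbf{1}$ and $M$. **Long canonical functor and coend.** Let $\hat V=\bigoplus_{j\in I}V_j$, $R=\mathrm{End}(\hat V)\cong k^{|I|}$ with orthogonal idempotents $\lambda_j=\mathrm{id}_{V_j}$, and $\varepsilon_R\colon R\to k$ linear with $\varepsilon_R(\lambda_j)=1$ for all $j$. The long canonical functor is $\omega X=\mathrm{Hom}(\hat V,\hat V\otimes X)$, $(\omega f)(v)=(\mathrm{id}_{\hat V}\otimes f)\circ v$. Identify $(\omega X)^*$ with $\mathrm{Hom}(\hat V\otimes X,\hat V)$ by the non-degenerate pairing $g_X(\theta\otimes v)=\varepsilon_R(\theta\circ v)$. $H=\mathbf{coend}(\mathcal{C},\omega)$ is spanned by symbols $[\theta|v]_X$ ($X$ an object, $\theta\in(\omega X)^*$, $v\in\omega X$), bilinear in $\theta,v$, subject to $[\zeta|(\mathrm{id}_{\hat V}\otimes f)\circ v]_Y=[\zeta\circ(\mathrm{id}_{\hat V}\otimes f)|v]_X$ for all $f\colon X\to Y$; as a coalgebra $H=\bigoplus_{j\in I}(\omega V_j)^*\otimes\omega V_j$. Its WBA operations are $[\theta|v]_X[\zeta|w]_Y=[\zeta\circ(\theta\otimes\mathrm{id}_Y)\circ\alpha^{-1}_{\hat V,X,Y}\,|\,\alpha_{\hat V,X,Y}\circ(v\otimes\mathrm{id}_Y)\circ w]_{X\otimes Y}$, $1=[\rho_{\hat V}|\rho_{\hat V}^{-1}]_{\mathbf 1}$, $\Delta([\theta|v]_X)=\sum_j[\theta|e_j]_X\otimes[e^j|v]_X$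 (dual bases with respect to $g_X$), $\varepsilon([\theta|v]_X)=\varepsilon_R(\theta\circ v)$. Each $\omega X$ is a right $H$-comodule with $\beta_{\omega X}(v)=\sum_j e_j\otimes[e^j|v]_X$. **Graphs and $H[\mathcal{G}]$.** A finite directed graph has finite sets $\mathcal{G}^0$ (vertices), $\mathcal{G}^1$ (edges) and source and target maps $\sigma,\tau\colon\mathcal{G}^1\to\mathcal{G}^0$; $\sigma(v)=\tau(v)=v$ for vertices. For $m\ge1$, $\mathcal{G}^m$ is the set of paths $(p_1,\dots,p_m)$ of edges with $\sigma(p_j)=\tau(p_{j+1})$, with $\tau(p)=\tau(p_1)$, $\sigma(p)=\sigma(p_m)$; $pq$ is concatenation, defined if $\sigma(p)=\tau(q)$ (vertices act as identities). The WBA $H[\mathcal{G}]=\bigoplus_{m\in\mathbb{N}_0}(k\mathcal{G}^m)^*\otimes k\mathcal{G}^m$ has basis $[p|q]_m$ ($p,q\in\mathcal{G}^m$) and $1=\sum_{j,\ell\in\mathcal{G}^0}[j|\ell]_0$, $[p|q]_m[r|s]_\ell=\delta_{\sigma(p),\tau(r)}\delta_{\sigma(q),\tau(s)}[pr|qs]_{m+\ell}$, $\Delta([p|q]_m)=\sum_{r\in\mathcal{G}^m}[p|r]_m\otimes[r|q]_m$, $\varepsilon([p|q]_m)=\delta_{pq}$. Each $k\mathcal{G}^m$ is a right $H[\mathcal{G}]$-comodule with $\beta_{k\mathcal{G}^m}(p)=\sum_{q\in\mathcal{G}^m}q\otimes[q|p]_m$. **Dimension graph.** $\mathcal{G}^0=I$,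 and the set of edges from $j$ to $\ell$ (source $j$, target $\ell$) is a basis of $\mathrm{Hom}(V_j,V_\ell\otimes M)$. So $\mathcal{G}^1$ is a basis $(e^{(M)}_p)_{p\in\mathcal{G}^1}$ of $\omega M$; $(e^p_{(M)})$ is its dual basis with respect to $g_M$. For $j\in I$, $e_j^{(\mathbf 1)}=\rho_{\hat V}^{-1}\circ\lambda_j\in\omega\mathbf{1}$ and $e^j_{(\mathbf 1)}=\lambda_j\circ\rho_{\hat V}$ (dual bases with respect to $g_{\mathbf 1}$). *)

theory Defs
  imports
    "HOL-Algebra.Module"
    "HOL-Library.Poly_Mapping"
    "Graph_Theory.Digraph"
begin

section \<open>Vector spaces: linear maps, free spaces, presentations, tensor products\<close>

text \<open>
  The ground field is a type \<open>'k\<close> of class \<^class>\<open>field\<close>. Vector spaces that arise as quotients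
  (the coend, tensor products) are HOL-Algebra modules over \<open>kfield\<close>, which is the field regarded
  as a ring and as a module over itself. Where a record only serves as a vector space, its ring
  multiplication and its unit are left undefined.
\<close>

definition kfield :: "('k::field, 'k) module" where
  "kfield = \<lparr>carrier = UNIV, monoid.mult = (*), one = 1, ring.zero = 0, add = (+), smult = (*)\<rparr>"

definition linear_map ::
    "('k, 'a, 'x) module_scheme \<Rightarrow> ('k, 'b, 'y) module_scheme \<Rightarrow> ('a \<Rightarrow> 'b) \<Rightarrow> bool" where
  "linear_map V W f \<longleftrightarrow>
     f \<in> carrier V \<rightarrow> carrier W \<and>
     (\<forall>x\<in>carrier V. \<forall>y\<in>carrier V. f (x \<oplus>\<^bsub>V\<^esub> y) = f x \<oplus>\<^bsub>W\<^esub> f y) \<and>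
     (\<forall>c. \<forall>x\<in>carrier V. f (c \<odot>\<^bsub>V\<^esub> x) = c \<odot>\<^bsub>W\<^esub> f x)"

abbreviation gen :: "'s \<Rightarrow> 's \<Rightarrow>\<^sub>0 'k::field" where
  "gen s \<equiv> Poly_Mapping.single s 1"

definition pscale :: "'k::field \<Rightarrow> ('s \<Rightarrow>\<^sub>0 'k) \<Rightarrow> 's \<Rightarrow>\<^sub>0 'k" where
  "pscale c x = Poly_Mapping.map ((*) c) x"

definition free_space :: "'s set \<Rightarrow> ('k::field, 's \<Rightarrow>\<^sub>0 'k) module" where
  "free_space S =
     \<lparr>carrier = {x. Poly_Mapping.keys x \<subseteq> S}, monoid.mult = undefined, one = undefined,
      ring.zero = 0, add = (+), smult = pscale\<rparr>"

definition lin_ext ::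
    "('k::field, 'a, 'x) module_scheme \<Rightarrow> ('s \<Rightarrow> 'a) \<Rightarrow> ('s \<Rightarrow>\<^sub>0 'k) \<Rightarrow> 'a" where
  "lin_ext W f x = (\<Oplus>\<^bsub>W\<^esub>s\<in>Poly_Mapping.keys x. Poly_Mapping.lookup x s \<odot>\<^bsub>W\<^esub> f s)"

text \<open>The space with generators \<open>S\<close> and relations \<open>r = 0\<close> for \<open>r \<in> R\<close>: the free space on \<open>S\<close>
  modulo the span of \<open>R\<close>. Its elements are cosets.\<close>

definition cls :: "('s \<Rightarrow>\<^sub>0 'k::field) set \<Rightarrow> ('s \<Rightarrow>\<^sub>0 'k) \<Rightarrow> ('s \<Rightarrow>\<^sub>0 'k) set" where
  "cls R x = {y. y - x \<in> module.span pscale R}"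

definition presented_space ::
    "'s set \<Rightarrow> ('s \<Rightarrow>\<^sub>0 'k::field) set \<Rightarrow> ('k, ('s \<Rightarrow>\<^sub>0 'k) set) module" where
  "presented_space S R =
     \<lparr>carrier = cls R ` {x. Poly_Mapping.keys x \<subseteq> S}, monoid.mult = undefined, one = undefined,
      ring.zero = cls R 0,
      add = (\<lambda>A B. \<Union>x\<in>A. \<Union>y\<in>B. cls R (x + y)),
      smult = (\<lambda>c A. \<Union>x\<in>A. cls R (pscale c x))\<rparr>"

text \<open>The linear map out of a presented space with prescribed values \<open>f s\<close> on the generators.
  It is evaluated on a representative of the coset, so it is meaningful for those \<open>f\<close> that respect
  the relations; every use below is of this kind.\<close>

definition ext ::
    "('k::field, 'a, 'x) module_scheme \<Rightarrow> ('s \<Rightarrow> 'a) \<Rightarrow> ('s \<Rightarrow>\<^sub>0 'k) set \<Rightarrow> 'a" where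
  "ext W f A = lin_ext W f (SOME x. x \<in> A)"

type_synonym ('k, 'a, 'b) tensor = "('a \<times> 'b \<Rightarrow>\<^sub>0 'k) set"

definition tensor_rel ::
    "('k::field, 'a, 'x) module_scheme \<Rightarrow> ('k, 'b, 'y) module_scheme \<Rightarrow> ('a \<times> 'b \<Rightarrow>\<^sub>0 'k) set" where
  "tensor_rel V W =
     {gen (v \<oplus>\<^bsub>V\<^esub> v', w) - gen (v, w) - gen (v', w) | v v' w.
        v \<in> carrier V \<and> v' \<in> carrier V \<and> w \<in> carrier W} \<union>
     {gen (v, w \<oplus>\<^bsub>W\<^esub> w') - gen (v, w) - gen (v, w') | v w w'.
        v \<in> carrier V \<and> w \<in> carrier W \<and> w' \<in> carrier W} \<union>
     {gen (c \<odot>\<^bsub>V\<^esub> v, w) - pscale c (gen (v, w)) | c v w. v \<in> carrier V \<and> w \<in> carrier W} \<union>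
     {gen (v, c \<odot>\<^bsub>W\<^esub> w) - pscale c (gen (v, w)) | c v w. v \<in> carrier V \<and> w \<in> carrier W}"

definition tens ::
    "('k::field, 'a, 'x) module_scheme \<Rightarrow> ('k, 'b, 'y) module_scheme \<Rightarrow> 'a \<Rightarrow> 'b \<Rightarrow> ('k, 'a, 'b) tensor"
  where "tens V W v w = cls (tensor_rel V W) (gen (v, w))"

definition tensor_space ::
    "('k::field, 'a, 'x) module_scheme \<Rightarrow> ('k, 'b, 'y) module_scheme \<Rightarrow> ('k, ('k, 'a, 'b) tensor) module"
  where "tensor_space V W = presented_space (carrier V \<times> carrier W) (tensor_rel V W)"

definition tensor_map ::
    "('k::field, 'c, 'x) module_scheme \<Rightarrow> ('k, 'd, 'y) module_scheme \<Rightarrow>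
     ('a \<Rightarrow> 'c) \<Rightarrow> ('b \<Rightarrow> 'd) \<Rightarrow> ('k, 'a, 'b) tensor \<Rightarrow> ('k, 'c, 'd) tensor" where
  "tensor_map V' W' f g = ext (tensor_space V' W') (\<lambda>(v, w). tens V' W' (f v) (g w))"

definition tensor_assoc ::
    "('k::field, 'a, 'x) module_scheme \<Rightarrow> ('k, 'b, 'y) module_scheme \<Rightarrow> ('k, 'c, 'z) module_scheme \<Rightarrow>
     ('k, ('k, 'a, 'b) tensor, 'c) tensor \<Rightarrow> ('k, 'a, ('k, 'b, 'c) tensor) tensor" where
  "tensor_assoc U V W =
     (let T = tensor_space U (tensor_space V W)
      in ext T (\<lambda>(t, w). ext T (\<lambda>(u, v). tens U (tensor_space V W) u (tens V W v w)) t))"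

definition tensor_alg ::
    "('k::field, 'a, 'x) module_scheme \<Rightarrow> ('k, 'b, 'y) module_scheme \<Rightarrow> ('k, ('k, 'a, 'b) tensor) module"
  where "tensor_alg A B =
    (tensor_space A B)
      \<lparr>monoid.mult := (\<lambda>s t. ext (tensor_space A B)
         (\<lambda>(a, b). ext (tensor_space A B) (\<lambda>(c, d). tens A B (a \<otimes>\<^bsub>A\<^esub> c) (b \<otimes>\<^bsub>B\<^esub> d)) t) s),
       one := tens A B \<one>\<^bsub>A\<^esub> \<one>\<^bsub>B\<^esub>\<rparr>"


section \<open>Weak bialgebras\<close>

record (overloaded) ('k, 'h) bialg = "('k, 'h) module" +
  comult :: "'h \<Rightarrow> ('k, 'h, 'h) tensor"
  counit :: "'h \<Rightarrow> 'k"

text \<open>Sweedler sums such as \<open>\<epsilon>(x y') \<epsilon>(y'' z)\<close> are obtained by extending the bilinear expression in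
  \<open>(y', y'')\<close> to the tensor \<open>\<Delta>(y)\<close>. The two equations for \<open>(\<Delta> \<otimes> id) \<Delta>(1)\<close> are read in
  \<open>H \<otimes> (H \<otimes> H)\<close>, elements of \<open>(H \<otimes> H) \<otimes> H\<close> being transported by the associator.\<close>

locale weak_bialgebra = ring H + Module.module kfield H
  for H :: "('k::field, 'h) bialg" (structure) +
  assumes smult_mult_left:
      "\<lbrakk>x \<in> carrier H; y \<in> carrier H\<rbrakk> \<Longrightarrow> (c \<odot> x) \<otimes> y = c \<odot> (x \<otimes> y)"
    and smult_mult_right:
      "\<lbrakk>x \<in> carrier H; y \<in> carrier H\<rbrakk> \<Longrightarrow> x \<otimes> (c \<odot> y) = c \<odot> (x \<otimes> y)"
    and comult_linear: "linear_map H (tensor_space H H) (comult H)"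
    and counit_linear: "linear_map H kfield (counit H)"
    and coassoc:
      "x \<in> carrier H \<Longrightarrow>
         tensor_assoc H H H (tensor_map (tensor_space H H) H (comult H) id (comult H x))
         = tensor_map H (tensor_space H H) id (comult H) (comult H x)"
    and counit_left:
      "x \<in> carrier H \<Longrightarrow> ext H (\<lambda>(x', x''). counit H x' \<odot> x'') (comult H x) = x"
    and counit_right:
      "x \<in> carrier H \<Longrightarrow> ext H (\<lambda>(x', x''). counit H x'' \<odot> x') (comult H x) = x"
    and comult_mult:
      "\<lbrakk>x \<in> carrier H; y \<in> carrier H\<rbrakk> \<Longrightarrow>
         comult H (x \<otimes> y) = comult H x \<otimes>\<^bsub>tensor_alg H H\<^esub> comult H y"
    and counit_mult:
      "\<lbrakk>x \<in> carrier H; y \<in> carrier H; z \<in> carrier H\<rbrakk> \<Longrightarrow>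
         counit H (x \<otimes> y \<otimes> z)
         = ext kfield (\<lambda>(y', y''). counit H (x \<otimes> y') * counit H (y'' \<otimes> z)) (comult H y)"
    and counit_mult':
      "\<lbrakk>x \<in> carrier H; y \<in> carrier H; z \<in> carrier H\<rbrakk> \<Longrightarrow>
         counit H (x \<otimes> y \<otimes> z)
         = ext kfield (\<lambda>(y', y''). counit H (x \<otimes> y'') * counit H (y' \<otimes> z)) (comult H y)"
    and comult_one:
      "tensor_assoc H H H (tensor_map (tensor_space H H) H (comult H) id (comult H \<one>))
       = tensor_assoc H H H (tens (tensor_space H H) H (comult H \<one>) \<one>)
           \<otimes>\<^bsub>tensor_alg H (tensor_alg H H)\<^esub> tens H (tensor_space H H) \<one> (comult H \<one>)"
    and comult_one':
      "tensor_assoc H H H (tensor_map (tensor_space H H) H (comult H) id (comult H \<one>))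
       = tens H (tensor_space H H) \<one> (comult H \<one>)
           \<otimes>\<^bsub>tensor_alg H (tensor_alg H H)\<^esub>
         tensor_assoc H H H (tens (tensor_space H H) H (comult H \<one>) \<one>)"

definition wba_hom ::
    "('k::field, 'a) bialg \<Rightarrow> ('k, 'b) bialg \<Rightarrow> ('a \<Rightarrow> 'b) \<Rightarrow> bool" where
  "wba_hom A B f \<longleftrightarrow>
     weak_bialgebra A \<and> weak_bialgebra B \<and> linear_map A B f \<and>
     f \<one>\<^bsub>A\<^esub> = \<one>\<^bsub>B\<^esub> \<and>
     (\<forall>x\<in>carrier A. \<forall>y\<in>carrier A. f (x \<otimes>\<^bsub>A\<^esub> y) = f x \<otimes>\<^bsub>B\<^esub> f y) \<and>
     (\<forall>x\<in>carrier A. counit B (f x) = counit A x) \<and>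
     (\<forall>x\<in>carrier A. comult B (f x) = tensor_map B B f f (comult A x))"

definition wba_surjection ::
    "('k::field, 'a) bialg \<Rightarrow> ('k, 'b) bialg \<Rightarrow> ('a \<Rightarrow> 'b) \<Rightarrow> bool" where
  "wba_surjection A B f \<longleftrightarrow> wba_hom A B f \<and> f ` carrier A = carrier B"

text \<open>The coaction of the comodule obtained by pushing \<open>(W, \<beta>)\<close> forward along \<open>f\<close>, with values
  in \<open>W \<otimes> H'\<close>.\<close>

definition pushforward_coaction ::
    "('k::field, 'w, 'x) module_scheme \<Rightarrow> ('k, 'b, 'y) module_scheme \<Rightarrow> ('a \<Rightarrow> 'b) \<Rightarrow>
     ('w \<Rightarrow> ('k, 'w, 'a) tensor) \<Rightarrow> 'w \<Rightarrow> ('k, 'w, 'b) tensor" where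
  "pushforward_coaction W H' f \<beta> = tensor_map W H' id f \<circ> \<beta>"


section \<open>Linear monoidal categories\<close>

text \<open>
  The spaces \<open>Hom X Y\<close> are subspaces of one ambient vector space \<open>'m\<close> with scalar multiplication
  \<open>scl\<close>; for any category with a set of objects the direct sum of all Hom-spaces serves as \<open>'m\<close>.
  Different Hom-spaces share at least the zero vector, and compositions and tensor products are
  bilinear, so no object labels are needed on morphisms. The operations are constrained only on
  the Hom-spaces.
\<close>

record ('k, 'o, 'm) lin_cat =
  Obj :: "'o set"
  Hom :: "'o \<Rightarrow> 'o \<Rightarrow> 'm set"
  scl :: "'k \<Rightarrow> 'm \<Rightarrow> 'm"
  ident :: "'o \<Rightarrow> 'm"
  cmp :: "'m \<Rightarrow> 'm \<Rightarrow> 'm" (infixr \<open>\<cdot>\<index>\<close> 70)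

record ('k, 'o, 'm) mon_cat = "('k, 'o, 'm) lin_cat" +
  unit_obj :: 'o
  tobj :: "'o \<Rightarrow> 'o \<Rightarrow> 'o" (infixr \<open>\<boxtimes>\<index>\<close> 75)
  tmor :: "'m \<Rightarrow> 'm \<Rightarrow> 'm" (infixr \<open>\<star>\<index>\<close> 75)
  assoc :: "'o \<Rightarrow> 'o \<Rightarrow> 'o \<Rightarrow> 'm"
  lunit :: "'o \<Rightarrow> 'm"
  runit :: "'o \<Rightarrow> 'm"

record ('k, 'o, 'm) aut_cat = "('k, 'o, 'm) mon_cat" +
  ldual :: "'o \<Rightarrow> 'o"
  ev :: "'o \<Rightarrow> 'm"
  coev :: "'o \<Rightarrow> 'm"

locale linear_category = vector_space "scl C"
  for C :: "('k::field, 'o, 'm::ab_group_add, 'z) lin_cat_scheme" (structure) +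
  assumes Hom_subspace: "\<lbrakk>X \<in> Obj C; Y \<in> Obj C\<rbrakk> \<Longrightarrow> subspace (Hom C X Y)"
    and ident_Hom: "X \<in> Obj C \<Longrightarrow> ident C X \<in> Hom C X X"
    and cmp_Hom:
      "\<lbrakk>X \<in> Obj C; Y \<in> Obj C; Z \<in> Obj C; f \<in> Hom C X Y; g \<in> Hom C Y Z\<rbrakk> \<Longrightarrow> g \<cdot> f \<in> Hom C X Z"
    and cmp_ident_left:
      "\<lbrakk>X \<in> Obj C; Y \<in> Obj C; f \<in> Hom C X Y\<rbrakk> \<Longrightarrow> ident C Y \<cdot> f = f"
    and cmp_ident_right:
      "\<lbrakk>X \<in> Obj C; Y \<in> Obj C; f \<in> Hom C X Y\<rbrakk> \<Longrightarrow> f \<cdot> ident C X = f"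
    and cmp_assoc:
      "\<lbrakk>W \<in> Obj C; X \<in> Obj C; Y \<in> Obj C; Z \<in> Obj C;
        f \<in> Hom C W X; g \<in> Hom C X Y; h \<in> Hom C Y Z\<rbrakk> \<Longrightarrow> (h \<cdot> g) \<cdot> f = h \<cdot> (g \<cdot> f)"
    and cmp_add_left:
      "\<lbrakk>X \<in> Obj C; Y \<in> Obj C; Z \<in> Obj C; f \<in> Hom C X Y; g \<in> Hom C Y Z; g' \<in> Hom C Y Z\<rbrakk>
       \<Longrightarrow> (g + g') \<cdot> f = g \<cdot> f + g' \<cdot> f"
    and cmp_add_right:
      "\<lbrakk>X \<in> Obj C; Y \<in> Obj C; Z \<in> Obj C; f \<in> Hom C X Y; f' \<in> Hom C X Y; g \<in> Hom C Y Z\<rbrakk>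
       \<Longrightarrow> g \<cdot> (f + f') = g \<cdot> f + g \<cdot> f'"
    and cmp_scl_left:
      "\<lbrakk>X \<in> Obj C; Y \<in> Obj C; Z \<in> Obj C; f \<in> Hom C X Y; g \<in> Hom C Y Z\<rbrakk>
       \<Longrightarrow> scl C c g \<cdot> f = scl C c (g \<cdot> f)"
    and cmp_scl_right:
      "\<lbrakk>X \<in> Obj C; Y \<in> Obj C; Z \<in> Obj C; f \<in> Hom C X Y; g \<in> Hom C Y Z\<rbrakk>
       \<Longrightarrow> g \<cdot> scl C c f = scl C c (g \<cdot> f)"

definition is_inverse ::
    "('k, 'o, 'm, 'z) lin_cat_scheme \<Rightarrow> 'o \<Rightarrow> 'o \<Rightarrow> 'm \<Rightarrow> 'm \<Rightarrow> bool" where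
  "is_inverse C X Y f g \<longleftrightarrow>
     g \<in> Hom C Y X \<and> g \<cdot>\<^bsub>C\<^esub> f = ident C X \<and> f \<cdot>\<^bsub>C\<^esub> g = ident C Y"

definition iso_mor :: "('k, 'o, 'm, 'z) lin_cat_scheme \<Rightarrow> 'o \<Rightarrow> 'o \<Rightarrow> 'm \<Rightarrow> bool" where
  "iso_mor C X Y f \<longleftrightarrow> f \<in> Hom C X Y \<and> (\<exists>g. is_inverse C X Y f g)"

definition inv_mor :: "('k, 'o, 'm, 'z) lin_cat_scheme \<Rightarrow> 'o \<Rightarrow> 'o \<Rightarrow> 'm \<Rightarrow> 'm" where
  "inv_mor C X Y f = (THE g. is_inverse C X Y f g)"

definition iso_obj :: "('k, 'o, 'm, 'z) lin_cat_scheme \<Rightarrow> 'o \<Rightarrow> 'o \<Rightarrow> bool" where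
  "iso_obj C X Y \<longleftrightarrow> (\<exists>f. iso_mor C X Y f)"

locale linear_monoidal_category = linear_category C
  for C :: "('k::field, 'o, 'm::ab_group_add, 'z) mon_cat_scheme" (structure) +
  assumes unit_Obj: "unit_obj C \<in> Obj C"
    and tobj_Obj: "\<lbrakk>X \<in> Obj C; Y \<in> Obj C\<rbrakk> \<Longrightarrow> X \<boxtimes> Y \<in> Obj C"
    and tmor_Hom:
      "\<lbrakk>X \<in> Obj C; X' \<in> Obj C; Y \<in> Obj C; Y' \<in> Obj C; f \<in> Hom C X X'; g \<in> Hom C Y Y'\<rbrakk>
       \<Longrightarrow> f \<star> g \<in> Hom C (X \<boxtimes> Y) (X' \<boxtimes> Y')"
    and tmor_ident:
      "\<lbrakk>X \<in> Obj C; Y \<in> Obj C\<rbrakk> \<Longrightarrow> ident C X \<star> ident C Y = ident C (X \<boxtimes> Y)"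
    and tmor_cmp:
      "\<lbrakk>X \<in> Obj C; X' \<in> Obj C; X'' \<in> Obj C; Y \<in> Obj C; Y' \<in> Obj C; Y'' \<in> Obj C;
        f \<in> Hom C X X'; f' \<in> Hom C X' X''; g \<in> Hom C Y Y'; g' \<in> Hom C Y' Y''\<rbrakk>
       \<Longrightarrow> (f' \<cdot> f) \<star> (g' \<cdot> g) = (f' \<star> g') \<cdot> (f \<star> g)"
    and tmor_add_left:
      "\<lbrakk>X \<in> Obj C; X' \<in> Obj C; Y \<in> Obj C; Y' \<in> Obj C;
        f \<in> Hom C X X'; f' \<in> Hom C X X'; g \<in> Hom C Y Y'\<rbrakk>
       \<Longrightarrow> (f + f') \<star> g = f \<star> g + f' \<star> g"
    and tmor_add_right:
      "\<lbrakk>X \<in> Obj C; X' \<in> Obj C; Y \<in> Obj C; Y' \<in> Obj C;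
        f \<in> Hom C X X'; g \<in> Hom C Y Y'; g' \<in> Hom C Y Y'\<rbrakk>
       \<Longrightarrow> f \<star> (g + g') = f \<star> g + f \<star> g'"
    and tmor_scl_left:
      "\<lbrakk>X \<in> Obj C; X' \<in> Obj C; Y \<in> Obj C; Y' \<in> Obj C; f \<in> Hom C X X'; g \<in> Hom C Y Y'\<rbrakk>
       \<Longrightarrow> scl C c f \<star> g = scl C c (f \<star> g)"
    and tmor_scl_right:
      "\<lbrakk>X \<in> Obj C; X' \<in> Obj C; Y \<in> Obj C; Y' \<in> Obj C; f \<in> Hom C X X'; g \<in> Hom C Y Y'\<rbrakk>
       \<Longrightarrow> f \<star> scl C c g = scl C c (f \<star> g)"
    and assoc_iso:
      "\<lbrakk>X \<in> Obj C; Y \<in> Obj C; Z \<in> Obj C\<rbrakk>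
       \<Longrightarrow> iso_mor C ((X \<boxtimes> Y) \<boxtimes> Z) (X \<boxtimes> (Y \<boxtimes> Z)) (assoc C X Y Z)"
    and assoc_natural:
      "\<lbrakk>X \<in> Obj C; X' \<in> Obj C; Y \<in> Obj C; Y' \<in> Obj C; Z \<in> Obj C; Z' \<in> Obj C;
        f \<in> Hom C X X'; g \<in> Hom C Y Y'; h \<in> Hom C Z Z'\<rbrakk>
       \<Longrightarrow> assoc C X' Y' Z' \<cdot> ((f \<star> g) \<star> h) = (f \<star> (g \<star> h)) \<cdot> assoc C X Y Z"
    and lunit_iso: "X \<in> Obj C \<Longrightarrow> iso_mor C (unit_obj C \<boxtimes> X) X (lunit C X)"
    and lunit_natural:
      "\<lbrakk>X \<in> Obj C; Y \<in> Obj C; f \<in> Hom C X Y\<rbrakk>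
       \<Longrightarrow> lunit C Y \<cdot> (ident C (unit_obj C) \<star> f) = f \<cdot> lunit C X"
    and runit_iso: "X \<in> Obj C \<Longrightarrow> iso_mor C (X \<boxtimes> unit_obj C) X (runit C X)"
    and runit_natural:
      "\<lbrakk>X \<in> Obj C; Y \<in> Obj C; f \<in> Hom C X Y\<rbrakk>
       \<Longrightarrow> runit C Y \<cdot> (f \<star> ident C (unit_obj C)) = f \<cdot> runit C X"
    and triangle:
      "\<lbrakk>X \<in> Obj C; Y \<in> Obj C\<rbrakk>
       \<Longrightarrow> (ident C X \<star> lunit C Y) \<cdot> assoc C X (unit_obj C) Y = runit C X \<star> ident C Y"
    and pentagon:
      "\<lbrakk>W \<in> Obj C; X \<in> Obj C; Y \<in> Obj C; Z \<in> Obj C\<rbrakk>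
       \<Longrightarrow> assoc C W X (Y \<boxtimes> Z) \<cdot> assoc C (W \<boxtimes> X) Y Z
           = (ident C W \<star> assoc C X Y Z) \<cdot> assoc C W (X \<boxtimes> Y) Z
               \<cdot> (assoc C W X Y \<star> ident C Z)"

locale left_autonomous_category = linear_monoidal_category C
  for C :: "('k::field, 'o, 'm::ab_group_add) aut_cat" (structure) +
  assumes ldual_Obj: "X \<in> Obj C \<Longrightarrow> ldual C X \<in> Obj C"
    and ev_Hom: "X \<in> Obj C \<Longrightarrow> ev C X \<in> Hom C (ldual C X \<boxtimes> X) (unit_obj C)"
    and coev_Hom: "X \<in> Obj C \<Longrightarrow> coev C X \<in> Hom C (unit_obj C) (X \<boxtimes> ldual C X)"
    and zigzag_obj:
      "X \<in> Obj C \<Longrightarrow>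
         runit C X \<cdot> (ident C X \<star> ev C X) \<cdot> assoc C X (ldual C X) X
           \<cdot> (coev C X \<star> ident C X) \<cdot> inv_mor C (unit_obj C \<boxtimes> X) X (lunit C X)
         = ident C X"
    and zigzag_dual:
      "X \<in> Obj C \<Longrightarrow>
         lunit C (ldual C X) \<cdot> (ev C X \<star> ident C (ldual C X))
           \<cdot> inv_mor C ((ldual C X \<boxtimes> X) \<boxtimes> ldual C X) (ldual C X \<boxtimes> (X \<boxtimes> ldual C X))
                 (assoc C (ldual C X) X (ldual C X))
           \<cdot> (ident C (ldual C X) \<star> coev C X)
           \<cdot> inv_mor C (ldual C X \<boxtimes> unit_obj C) (ldual C X) (runit C (ldual C X))
         = ident C (ldual C X)"

text \<open>\<open>S\<close> is a direct sum (biproduct) of the finite family \<open>(F i)\<close>, \<open>i \<in> J\<close>. The empty direct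
  sums are the zero objects.\<close>

definition direct_sum ::
    "('k, 'o, 'm::ab_group_add, 'z) lin_cat_scheme \<Rightarrow> 'i set \<Rightarrow> ('i \<Rightarrow> 'o) \<Rightarrow> 'o \<Rightarrow>
     ('i \<Rightarrow> 'm) \<Rightarrow> ('i \<Rightarrow> 'm) \<Rightarrow> bool" where
  "direct_sum C J F S inc prj \<longleftrightarrow>
     finite J \<and> S \<in> Obj C \<and>
     (\<forall>i\<in>J. F i \<in> Obj C \<and> inc i \<in> Hom C (F i) S \<and> prj i \<in> Hom C S (F i)) \<and>
     (\<forall>i\<in>J. \<forall>j\<in>J. prj i \<cdot>\<^bsub>C\<^esub> inc j = (if i = j then ident C (F i) else 0)) \<and>
     (\<Sum>i\<in>J. inc i \<cdot>\<^bsub>C\<^esub> prj i) = ident C S"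

definition is_sum ::
    "('k, 'o, 'm::ab_group_add, 'z) lin_cat_scheme \<Rightarrow> 'o list \<Rightarrow> 'o \<Rightarrow> bool" where
  "is_sum C Xs S \<longleftrightarrow> (\<exists>inc prj. direct_sum C {..<length Xs} ((!) Xs) S inc prj)"

definition additive_category :: "('k, 'o, 'm::ab_group_add, 'z) lin_cat_scheme \<Rightarrow> bool" where
  "additive_category C \<longleftrightarrow> (\<forall>Xs. set Xs \<subseteq> Obj C \<longrightarrow> (\<exists>S. is_sum C Xs S))"

definition finite_dim_homs ::
    "('k::field, 'o, 'm::ab_group_add, 'z) lin_cat_scheme \<Rightarrow> bool" where
  "finite_dim_homs C \<longleftrightarrow>
     (\<forall>X\<in>Obj C. \<forall>Y\<in>Obj C. \<exists>B. finite B \<and> Hom C X Y = module.span (scl C) B)"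

definition simple_obj ::
    "('k::field, 'o, 'm::ab_group_add, 'z) lin_cat_scheme \<Rightarrow> 'o \<Rightarrow> bool" where
  "simple_obj C X \<longleftrightarrow>
     X \<in> Obj C \<and>
     (\<exists>\<phi>::'m \<Rightarrow> 'k. bij_betw \<phi> (Hom C X X) UNIV \<and> \<phi> (ident C X) = 1 \<and>
        (\<forall>f\<in>Hom C X X. \<forall>g\<in>Hom C X X. \<phi> (f + g) = \<phi> f + \<phi> g \<and> \<phi> (f \<cdot>\<^bsub>C\<^esub> g) = \<phi> f * \<phi> g) \<and>
        (\<forall>c. \<forall>f\<in>Hom C X X. \<phi> (scl C c f) = c * \<phi> f))"

definition zero_obj :: "('k, 'o, 'm::ab_group_add, 'z) lin_cat_scheme \<Rightarrow> 'o \<Rightarrow> bool" where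
  "zero_obj C X \<longleftrightarrow> X \<in> Obj C \<and> (\<forall>Y\<in>Obj C. Hom C X Y = {0} \<and> Hom C Y X = {0})"

text \<open>\<open>(V j)\<close>, \<open>j \<in> I\<close>, is a family of simple objects that exhibits \<open>C\<close> as finitely split
  semisimple.\<close>

definition finitely_split_semisimple ::
    "('k::field, 'o, 'm::ab_group_add, 'z) lin_cat_scheme \<Rightarrow> 'i set \<Rightarrow> ('i \<Rightarrow> 'o) \<Rightarrow> bool" where
  "finitely_split_semisimple C I V \<longleftrightarrow>
     finite I \<and> (\<forall>j\<in>I. simple_obj C (V j)) \<and>
     (\<forall>j\<in>I. \<forall>l\<in>I. j \<noteq> l \<longrightarrow> Hom C (V j) (V l) = {0}) \<and>
     (\<forall>X\<in>Obj C. \<exists>Xs. set Xs \<subseteq> V ` I \<and> is_sum C Xs X)"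

definition summand ::
    "('k, 'o, 'm::ab_group_add, 'z) lin_cat_scheme \<Rightarrow> 'o \<Rightarrow> 'o \<Rightarrow> bool" where
  "summand C A X \<longleftrightarrow> (\<exists>B\<in>Obj C. is_sum C [A, B] X)"

primrec tpow :: "('k, 'o, 'm, 'z) mon_cat_scheme \<Rightarrow> 'o \<Rightarrow> nat \<Rightarrow> 'o" where
  "tpow C M 0 = unit_obj C"
| "tpow C M (Suc n) = tpow C M n \<boxtimes>\<^bsub>C\<^esub> M"

definition generates_fusion ::
    "('k, 'o, 'm::ab_group_add, 'z) mon_cat_scheme \<Rightarrow> 'i set \<Rightarrow> ('i \<Rightarrow> 'o) \<Rightarrow> 'o \<Rightarrow> bool" where
  "generates_fusion C I V M \<longleftrightarrow>
     M \<in> Obj C \<and> \<not> zero_obj C M \<and>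
     (\<forall>j\<in>I. \<exists>n. summand C (V j) (tpow C M n)) \<and>
     (\<forall>X Y Z. is_sum C [X, Y, Z] M \<and> \<not> zero_obj C X \<and> \<not> zero_obj C Y \<longrightarrow> \<not> iso_obj C X Y) \<and>
     \<not> (\<exists>X. \<not> zero_obj C X \<and> summand C X (unit_obj C) \<and> summand C X M)"


section \<open>The long canonical functor and its coend\<close>

text \<open>Below, \<open>Vh\<close> stands for the direct sum of all simple objects and \<open>lam j\<close>, \<open>j \<in> I\<close>, for the
  corresponding orthogonal idempotents in \<open>R = End(Vh)\<close>.\<close>

definition omega_space ::
    "('k, 'o, 'm::ab_group_add, 'z) mon_cat_scheme \<Rightarrow> 'o \<Rightarrow> 'o \<Rightarrow> ('k, 'm) module" where
  "omega_space C Vh X =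
     \<lparr>carrier = Hom C Vh (Vh \<boxtimes>\<^bsub>C\<^esub> X), monoid.mult = undefined, one = undefined,
      ring.zero = 0, add = (+), smult = scl C\<rparr>"

text \<open>This is the linear form on \<open>R\<close> with value \<open>1\<close> on each of the basis vectors \<open>lam j\<close>.\<close>

definition eps_R ::
    "('k::field, 'o, 'm::ab_group_add, 'z) mon_cat_scheme \<Rightarrow> 'i set \<Rightarrow> ('i \<Rightarrow> 'm) \<Rightarrow> 'm \<Rightarrow> 'k" where
  "eps_R C I lam r = (\<Sum>j\<in>I. module.representation (scl C) (lam ` I) r (lam j))"

definition pairing ::
    "('k::field, 'o, 'm::ab_group_add, 'z) mon_cat_scheme \<Rightarrow> 'i set \<Rightarrow> ('i \<Rightarrow> 'm) \<Rightarrow> 'm \<Rightarrow> 'm \<Rightarrow> 'k"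
  where "pairing C I lam \<theta> v = eps_R C I lam (\<theta> \<cdot>\<^bsub>C\<^esub> v)"

text \<open>The dual basis, with respect to the non-degenerate pairing above, of a basis \<open>(b q)\<close>,
  \<open>q \<in> Q\<close>, of \<open>\<omega> X\<close>.\<close>

definition dual_basis ::
    "('k::field, 'o, 'm::ab_group_add, 'z) mon_cat_scheme \<Rightarrow> 'i set \<Rightarrow> 'o \<Rightarrow> ('i \<Rightarrow> 'm) \<Rightarrow> 'o \<Rightarrow>
     'q set \<Rightarrow> ('q \<Rightarrow> 'm) \<Rightarrow> 'q \<Rightarrow> 'm" where
  "dual_basis C I Vh lam X Q b p =
     (THE \<theta>. \<theta> \<in> Hom C (Vh \<boxtimes>\<^bsub>C\<^esub> X) Vh \<and>
        (\<forall>q\<in>Q. pairing C I lam \<theta> (b q) = (if q = p then 1 else 0)))"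

text \<open>An arbitrary basis of \<open>\<omega> X\<close>; what is defined with it does not depend on the choice.\<close>

definition omega_basis ::
    "('k::field, 'o, 'm::ab_group_add, 'z) mon_cat_scheme \<Rightarrow> 'o \<Rightarrow> 'o \<Rightarrow> 'm set" where
  "omega_basis C Vh X =
     (SOME B. finite B \<and> \<not> module.dependent (scl C) B \<and>
        module.span (scl C) B = Hom C Vh (Vh \<boxtimes>\<^bsub>C\<^esub> X))"

definition coend_gens ::
    "('k, 'o, 'm, 'z) mon_cat_scheme \<Rightarrow> 'o \<Rightarrow> ('o \<times> 'm \<times> 'm) set" where
  "coend_gens C Vh =
     {(X, \<theta>, v). X \<in> Obj C \<and> \<theta> \<in> Hom C (Vh \<boxtimes>\<^bsub>C\<^esub> X) Vh \<and> v \<in> Hom C Vh (Vh \<boxtimes>\<^bsub>C\<^esub> X)}"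

definition coend_rel ::
    "('k::field, 'o, 'm::ab_group_add, 'z) mon_cat_scheme \<Rightarrow> 'o \<Rightarrow> ('o \<times> 'm \<times> 'm \<Rightarrow>\<^sub>0 'k) set" where
  "coend_rel C Vh =
     {gen (X, \<theta> + \<theta>', v) - gen (X, \<theta>, v) - gen (X, \<theta>', v) | X \<theta> \<theta>' v.
        (X, \<theta>, v) \<in> coend_gens C Vh \<and> (X, \<theta>', v) \<in> coend_gens C Vh} \<union>
     {gen (X, \<theta>, v + v') - gen (X, \<theta>, v) - gen (X, \<theta>, v') | X \<theta> v v'.
        (X, \<theta>, v) \<in> coend_gens C Vh \<and> (X, \<theta>, v') \<in> coend_gens C Vh} \<union>
     {gen (X, scl C c \<theta>, v) - pscale c (gen (X, \<theta>, v)) | X \<theta> v c. (X, \<theta>, v) \<in> coend_gens C Vh} \<union>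
     {gen (X, \<theta>, scl C c v) - pscale c (gen (X, \<theta>, v)) | X \<theta> v c. (X, \<theta>, v) \<in> coend_gens C Vh} \<union>
     {gen (Y, \<zeta>, (ident C Vh \<star>\<^bsub>C\<^esub> f) \<cdot>\<^bsub>C\<^esub> v) - gen (X, \<zeta> \<cdot>\<^bsub>C\<^esub> (ident C Vh \<star>\<^bsub>C\<^esub> f), v) | X Y f \<zeta> v.
        X \<in> Obj C \<and> Y \<in> Obj C \<and> f \<in> Hom C X Y \<and>
        \<zeta> \<in> Hom C (Vh \<boxtimes>\<^bsub>C\<^esub> Y) Vh \<and> v \<in> Hom C Vh (Vh \<boxtimes>\<^bsub>C\<^esub> X)}"

text \<open>The vector \<open>[\<theta>|v]\<^sub>X\<close> of the coend.\<close>

definition coend_sym ::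
    "('k::field, 'o, 'm::ab_group_add, 'z) mon_cat_scheme \<Rightarrow> 'o \<Rightarrow> 'o \<Rightarrow> 'm \<Rightarrow> 'm \<Rightarrow>
     ('o \<times> 'm \<times> 'm \<Rightarrow>\<^sub>0 'k) set" where
  "coend_sym C Vh X \<theta> v = cls (coend_rel C Vh) (gen (X, \<theta>, v))"

definition coend_space ::
    "('k::field, 'o, 'm::ab_group_add, 'z) mon_cat_scheme \<Rightarrow> 'o \<Rightarrow>
     ('k, ('o \<times> 'm \<times> 'm \<Rightarrow>\<^sub>0 'k) set) module" where
  "coend_space C Vh = presented_space (coend_gens C Vh) (coend_rel C Vh)"

definition coend_mult ::
    "('k::field, 'o, 'm::ab_group_add, 'z) mon_cat_scheme \<Rightarrow> 'o \<Rightarrow>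
     ('o \<times> 'm \<times> 'm \<Rightarrow>\<^sub>0 'k) set \<Rightarrow> ('o \<times> 'm \<times> 'm \<Rightarrow>\<^sub>0 'k) set \<Rightarrow> ('o \<times> 'm \<times> 'm \<Rightarrow>\<^sub>0 'k) set" where
  "coend_mult C Vh A B =
     ext (coend_space C Vh) (\<lambda>(X, \<theta>, v). ext (coend_space C Vh) (\<lambda>(Y, \<zeta>, w).
       coend_sym C Vh (X \<boxtimes>\<^bsub>C\<^esub> Y)
         (\<zeta> \<cdot>\<^bsub>C\<^esub> (\<theta> \<star>\<^bsub>C\<^esub> ident C Y) \<cdot>\<^bsub>C\<^esub>
            inv_mor C ((Vh \<boxtimes>\<^bsub>C\<^esub> X) \<boxtimes>\<^bsub>C\<^esub> Y) (Vh \<boxtimes>\<^bsub>C\<^esub> (X \<boxtimes>\<^bsub>C\<^esub> Y)) (assoc C Vh X Y))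
         (assoc C Vh X Y \<cdot>\<^bsub>C\<^esub> (v \<star>\<^bsub>C\<^esub> ident C Y) \<cdot>\<^bsub>C\<^esub> w)) B) A"

definition runit_inv :: "('k, 'o, 'm, 'z) mon_cat_scheme \<Rightarrow> 'o \<Rightarrow> 'm" where
  "runit_inv C X = inv_mor C (X \<boxtimes>\<^bsub>C\<^esub> unit_obj C) X (runit C X)"

definition coend ::
    "('k::field, 'o, 'm::ab_group_add, 'z) mon_cat_scheme \<Rightarrow> 'i set \<Rightarrow> 'o \<Rightarrow> ('i \<Rightarrow> 'm) \<Rightarrow>
     ('k, ('o \<times> 'm \<times> 'm \<Rightarrow>\<^sub>0 'k) set) bialg" where
  "coend C I Vh lam =
     (let S = coend_space C Vh in
     \<lparr>carrier = carrier S,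
      monoid.mult = coend_mult C Vh,
      one = coend_sym C Vh (unit_obj C) (runit C Vh) (runit_inv C Vh),
      ring.zero = ring.zero S, add = add S, smult = smult S,
      comult = ext (tensor_space S S) (\<lambda>(X, \<theta>, v).
        \<Oplus>\<^bsub>tensor_space S S\<^esub>b\<in>omega_basis C Vh X.
          tens S S (coend_sym C Vh X \<theta> b)
            (coend_sym C Vh X (dual_basis C I Vh lam X (omega_basis C Vh X) id b) v)),
      counit = ext kfield (\<lambda>(X, \<theta>, v). pairing C I lam \<theta> v)\<rparr>)"

definition omega_coaction ::
    "('k::field, 'o, 'm::ab_group_add, 'z) mon_cat_scheme \<Rightarrow> 'i set \<Rightarrow> 'o \<Rightarrow> ('i \<Rightarrow> 'm) \<Rightarrow> 'o \<Rightarrow>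
     'm \<Rightarrow> ('k, 'm, ('o \<times> 'm \<times> 'm \<Rightarrow>\<^sub>0 'k) set) tensor" where
  "omega_coaction C I Vh lam X v =
     (let W = omega_space C Vh X; H = coend C I Vh lam; B = omega_basis C Vh X in
      \<Oplus>\<^bsub>tensor_space W H\<^esub>b\<in>B.
        tens W H b (coend_sym C Vh X (dual_basis C I Vh lam X B id b) v))"


section \<open>The weak bialgebra of a finite directed graph\<close>

text \<open>Graphs are those of Graph_Theory: \<open>tail\<close> is the source map and \<open>head\<close> the target map. Paths
  are read like compositions: the source of each edge is the target of the next one in the list.\<close>

datatype ('v, 'e) gpath = Vertex 'v | Edges "'e list"

definition paths :: "('v, 'e) pre_digraph \<Rightarrow> nat \<Rightarrow> ('v, 'e) gpath set" where
  "paths G m =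
     (if m = 0 then Vertex ` verts G
      else Edges ` {es. length es = m \<and> set es \<subseteq> arcs G \<and>
                        (\<forall>i. Suc i < m \<longrightarrow> tail G (es ! i) = head G (es ! Suc i))})"

primrec plen :: "('v, 'e) gpath \<Rightarrow> nat" where
  "plen (Vertex v) = 0"
| "plen (Edges es) = length es"

primrec psrc :: "('v, 'e) pre_digraph \<Rightarrow> ('v, 'e) gpath \<Rightarrow> 'v" where
  "psrc G (Vertex v) = v"
| "psrc G (Edges es) = tail G (last es)"

primrec ptgt :: "('v, 'e) pre_digraph \<Rightarrow> ('v, 'e) gpath \<Rightarrow> 'v" where
  "ptgt G (Vertex v) = v"
| "ptgt G (Edges es) = head G (hd es)"

fun pcat :: "('v, 'e) gpath \<Rightarrow> ('v, 'e) gpath \<Rightarrow> ('v, 'e) gpath" where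
  "pcat (Vertex v) q = q"
| "pcat p (Vertex v) = p"
| "pcat (Edges es) (Edges es') = Edges (es @ es')"

text \<open>The basis vector \<open>[p|q]\<^sub>m\<close> of \<open>H[G]\<close> is \<open>gen (p, q)\<close>; the degree \<open>m\<close> is the common
  length of \<open>p\<close> and \<open>q\<close>.\<close>

definition graph_space ::
    "('v, 'e) pre_digraph \<Rightarrow> ('k::field, ('v, 'e) gpath \<times> ('v, 'e) gpath \<Rightarrow>\<^sub>0 'k) module" where
  "graph_space G = free_space (\<Union>m. paths G m \<times> paths G m)"

definition graph_wba ::
    "('v, 'e) pre_digraph \<Rightarrow> ('k::field, ('v, 'e) gpath \<times> ('v, 'e) gpath \<Rightarrow>\<^sub>0 'k) bialg" where
  "graph_wba G =
     (let S = graph_space G in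
     \<lparr>carrier = carrier S,
      monoid.mult = (\<lambda>x y. lin_ext S (\<lambda>(p, q). lin_ext S (\<lambda>(r, s).
        if psrc G p = ptgt G r \<and> psrc G q = ptgt G s then gen (pcat p r, pcat q s) else 0) y) x),
      one = (\<Sum>j\<in>verts G. \<Sum>l\<in>verts G. gen (Vertex j, Vertex l)),
      ring.zero = ring.zero S, add = add S, smult = smult S,
      comult = lin_ext (tensor_space S S) (\<lambda>(p, q).
        \<Oplus>\<^bsub>tensor_space S S\<^esub>r\<in>paths G (plen p). tens S S (gen (p, r)) (gen (r, q))),
      counit = lin_ext kfield (\<lambda>(p, q). if p = q then 1 else 0)\<rparr>)"

definition path_space ::
    "('v, 'e) pre_digraph \<Rightarrow> nat \<Rightarrow> ('k::field, ('v, 'e) gpath \<Rightarrow>\<^sub>0 'k) module" where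
  "path_space G m = free_space (paths G m)"

definition path_coaction ::
    "('v, 'e) pre_digraph \<Rightarrow> nat \<Rightarrow> (('v, 'e) gpath \<Rightarrow>\<^sub>0 'k::field) \<Rightarrow>
     ('k, ('v, 'e) gpath \<Rightarrow>\<^sub>0 'k, ('v, 'e) gpath \<times> ('v, 'e) gpath \<Rightarrow>\<^sub>0 'k) tensor" where
  "path_coaction G m =
     (let W = path_space G m; H = graph_wba G in
      lin_ext (tensor_space W H) (\<lambda>p.
        \<Oplus>\<^bsub>tensor_space W H\<^esub>q\<in>paths G m. tens W H (gen q) (gen (q, p))))"


section \<open>The dimension graph\<close>

text \<open>The map \<open>e\<close> identifies the set of edges from \<open>j\<close> to \<open>l\<close> with a basis of
  \<open>Hom(V j, V l \<otimes> M)\<close>.\<close>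

definition dimension_graph ::
    "('k::field, 'o, 'm::ab_group_add, 'z) mon_cat_scheme \<Rightarrow> 'i set \<Rightarrow> ('i \<Rightarrow> 'o) \<Rightarrow> 'o \<Rightarrow>
     ('i, 'e) pre_digraph \<Rightarrow> ('e \<Rightarrow> 'm) \<Rightarrow> bool" where
  "dimension_graph C I V M G e \<longleftrightarrow>
     fin_digraph G \<and> verts G = I \<and>
     (\<forall>j\<in>I. \<forall>l\<in>I. let E = {p \<in> arcs G. tail G p = j \<and> head G p = l} in
        inj_on e E \<and> \<not> module.dependent (scl C) (e ` E) \<and>
        module.span (scl C) (e ` E) = Hom C (V j) (V l \<boxtimes>\<^bsub>C\<^esub> M))"

text \<open>The basis vector of \<open>\<omega> M\<close> given by an edge \<open>p\<close>: \<open>e p\<close> extended by zero to the other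
  components of \<open>Vh\<close>.\<close>

definition edge_vec ::
    "('k, 'o, 'm, 'z) mon_cat_scheme \<Rightarrow> ('i \<Rightarrow> 'm) \<Rightarrow> ('i \<Rightarrow> 'm) \<Rightarrow> 'o \<Rightarrow> ('i, 'e) pre_digraph \<Rightarrow>
     ('e \<Rightarrow> 'm) \<Rightarrow> 'e \<Rightarrow> 'm" where
  "edge_vec C inc prj M G e p =
     (inc (head G p) \<star>\<^bsub>C\<^esub> ident C M) \<cdot>\<^bsub>C\<^esub> e p \<cdot>\<^bsub>C\<^esub> prj (tail G p)"

definition unit_vec ::
    "('k, 'o, 'm, 'z) mon_cat_scheme \<Rightarrow> 'o \<Rightarrow> ('i \<Rightarrow> 'm) \<Rightarrow> 'i \<Rightarrow> 'm" where
  "unit_vec C Vh lam j = runit_inv C Vh \<cdot>\<^bsub>C\<^esub> lam j"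

definition unit_covec ::
    "('k, 'o, 'm, 'z) mon_cat_scheme \<Rightarrow> 'o \<Rightarrow> ('i \<Rightarrow> 'm) \<Rightarrow> 'i \<Rightarrow> 'm" where
  "unit_covec C Vh lam j = lam j \<cdot>\<^bsub>C\<^esub> runit C Vh"

text \<open>The identifications of \<open>k G\<^sup>0\<close> with \<open>\<omega> 1\<close> and of \<open>k G\<^sup>1\<close> with \<open>\<omega> M\<close> that send
  a vertex \<open>j\<close> to \<open>b j\<close> and an edge \<open>p\<close> to \<open>b p\<close>, respectively.\<close>

definition vertex_ident ::
    "('k::field, 'm, 'x) module_scheme \<Rightarrow> ('v \<Rightarrow> 'm) \<Rightarrow> (('v, 'e) gpath \<Rightarrow>\<^sub>0 'k) \<Rightarrow> 'm" where
  "vertex_ident W b = lin_ext W (case_gpath b (\<lambda>_. undefined))"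

definition edge_ident ::
    "('k::field, 'm, 'x) module_scheme \<Rightarrow> ('e \<Rightarrow> 'm) \<Rightarrow> (('v, 'e) gpath \<Rightarrow>\<^sub>0 'k) \<Rightarrow> 'm" where
  "edge_ident W b = lin_ext W (case_gpath (\<lambda>_. undefined) (\<lambda>es. b (hd es)))"

end

theory Submission
  imports Defs
begin

text \<open>
  The proof rests on decompositions of \<open>Vh \<otimes> X\<close> into simple objects, written as families
  \<open>b q\<close> in \<open>\<omega> X\<close> and \<open>b' q\<close> in its dual with \<open>b' q \<cdot> b r = \<delta> lam (s q)\<close> and
  \<open>\<Sum>q. b q \<cdot> b' q = 1\<close>. Such a family is a pair of dual bases, and the families of \<open>X\<close> and \<open>Y\<close>
  multiply to one of \<open>X \<otimes> Y\<close>, indexed by the composable pairs. Starting from the edges of the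
  dimension graph, this gives dual bases of \<open>\<omega> (M\<^sup>n)\<close> indexed by the paths of length \<open>n\<close>; the map
  \<open>\<pi>\<close> sends \<open>[p|q]\<^sub>n\<close> to the corresponding matrix coefficient. It is multiplicative by the
  associativity and unit coherence of the coend, and it is surjective because its image is closed
  under products and every simple object is a summand of some \<open>M\<^sup>n\<close>. The weak bialgebra axioms
  are only verified for \<open>H[G]\<close>, where they reduce to unique factorisation of paths; they pass to the
  coend along the surjection \<open>\<pi>\<close>.
\<close>

section \<open>Vector spaces and linear maps\<close>

text \<open>Dual bases for the pairing do not by themselves tell which factors of a product meet: a
  product of two vectors passes through some \<open>V j\<close> in the middle. Hence a source
  \<open>s\<close> and a target grading \<open>t\<close> are carried along, and only pairs with
  \<open>s q = t r\<close> are kept. As \<open>eps_R\<close> is 1 on each \<open>lam j\<close>, the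
  composite \<open>b' q \<cdot> b q = lam (s q)\<close> pairs to 1, so the categorical and the
  linear notion of dual basis agree. The comultiplication of the coend is written with an
  arbitrarily chosen basis of each \<open>\<omega> X\<close>. It is well defined because the
  canonical element, the sum of \<open>b q \<otimes> b' q\<close>, is the same for all dual bases
  and lets a morphism pass from one factor to the other. The same fact evaluates it in the path
  bases, where it becomes the matrix coproduct of \<open>H[G]\<close>, and it yields both comodule
  statements. Powers of \<open>M\<close> occur with two bracketings. \<open>path_obj\<close> adds
  the new factor on the left, so that an induction removes the first edge of a path;
  \<open>tpow\<close>, fixed by the notion of generation, adds it on the right. The two are never
  compared: surjectivity works with separate resolutions of the objects
  \<open>tpow C M n\<close>.\<close>

locale vect = abelian_group W
  for W :: "('k::field, 'a, 'x) module_scheme" (structure) +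
  assumes smult_closed [simp, intro]: "x \<in> carrier W \<Longrightarrow> c \<odot> x \<in> carrier W"
    and smult_add_left: "x \<in> carrier W \<Longrightarrow> (c + d) \<odot> x = c \<odot> x \<oplus> d \<odot> x"
    and smult_add_right:
      "\<lbrakk>x \<in> carrier W; y \<in> carrier W\<rbrakk> \<Longrightarrow> c \<odot> (x \<oplus> y) = c \<odot> x \<oplus> c \<odot> y"
    and smult_assoc: "x \<in> carrier W \<Longrightarrow> (c * d) \<odot> x = c \<odot> (d \<odot> x)"
    and smult_one [simp]: "x \<in> carrier W \<Longrightarrow> 1 \<odot> x = x"

lemma kfield_simps [simp]:
  "carrier kfield = UNIV" "monoid.mult kfield = (*)" "one kfield = 1" "ring.zero kfield = 0"
  "add kfield = (+)" "smult kfield = (*)"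
  by (simp_all add: kfield_def)

lemma cring_kfield: "cring (kfield :: ('k::field, 'k) module)"
proof (rule cringI)
  show "abelian_group (kfield :: ('k, 'k) module)"
    by (rule abelian_groupI) (auto simp: algebra_simps intro: exI[of _ "- x" for x] left_minus)
  show "comm_monoid (kfield :: ('k, 'k) module)"
    by (rule comm_monoidI) (auto simp: algebra_simps)
qed (auto simp: algebra_simps)

text \<open>\<open>vect\<close> has the module axioms with scalars ranging over the whole type, so
  that proofs need not unfold \<open>kfield\<close>. The locale \<open>weak_bialgebra\<close> asks
  for a module over \<open>kfield\<close>, and this equivalence serves that demand.\<close>

lemma module_kfield_iff: "Module.module kfield W \<longleftrightarrow> vect W"
proof
  assume "Module.module kfield W"
  then interpret Module.module kfield W .
  show "vect W"
    using smult_closed smult_l_distr smult_r_distr smult_assoc1 smult_one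
    by unfold_locales auto
next
  assume "vect W"
  then interpret vect W .
  show "Module.module kfield W"
    by (rule moduleI)
      (auto simp: cring_kfield smult_add_left smult_add_right smult_assoc abelian_group_axioms)
qed

context vect
begin

lemma smult_zero_left [simp]:
  assumes "x \<in> carrier W" shows "0 \<odot> x = \<zero>"
  using smult_add_left[OF assms, of 0 0] assms by (metis add_0 add.r_cancel_one' smult_closed)

lemma smult_zero_right [simp]: "c \<odot> \<zero> = \<zero>"
  using smult_add_right[of \<zero> \<zero> c] by (metis zero_closed l_zero add.r_cancel_one' smult_closed)

lemma finsum_smult:
  assumes "f \<in> A \<rightarrow> carrier W"
  shows "c \<odot> (\<Oplus>i\<in>A. f i) = (\<Oplus>i\<in>A. c \<odot> f i)"
  using assms
  by (induction A rule: infinite_finite_induct) (auto simp: smult_add_right Pi_def)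

lemma finsum_swap:
  assumes "finite A" "finite B" "\<And>a b. a \<in> A \<Longrightarrow> b \<in> B \<Longrightarrow> f a b \<in> carrier W"
  shows "(\<Oplus>a\<in>A. \<Oplus>b\<in>B. f a b) = (\<Oplus>b\<in>B. \<Oplus>a\<in>A. f a b)"
  using assms(1,3)
proof (induction A)
  case empty
  then show ?case by simp
next
  case (insert x A)
  have "(\<Oplus>a\<in>insert x A. \<Oplus>b\<in>B. f a b) = (\<Oplus>b\<in>B. f x b) \<oplus> (\<Oplus>b\<in>B. \<Oplus>a\<in>A. f a b)"
    using insert by (subst finsum_insert) (auto intro!: finsum_closed simp: Pi_def)
  also have "\<dots> = (\<Oplus>b\<in>B. f x b \<oplus> (\<Oplus>a\<in>A. f a b))"
    using insert by (subst finsum_addf) (auto intro!: finsum_closed simp: Pi_def)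
  also have "\<dots> = (\<Oplus>b\<in>B. \<Oplus>a\<in>insert x A. f a b)"
    using insert by (intro finsum_cong') (auto intro!: finsum_closed simp: Pi_def)
  finally show ?case .
qed

lemma finsum_Sigma:
  assumes "finite A" "\<And>a. a \<in> A \<Longrightarrow> finite (B a)"
    "\<And>a b. a \<in> A \<Longrightarrow> b \<in> B a \<Longrightarrow> f (a, b) \<in> carrier W"
  shows "(\<Oplus>x\<in>Sigma A B. f x) = (\<Oplus>a\<in>A. \<Oplus>b\<in>B a. f (a, b))"
  using assms
proof (induction A)
  case empty
  then show ?case by simp
next
  case (insert x A)
  have eq: "Sigma (insert x A) B = Pair x ` B x \<union> Sigma A B" by auto
  have "(\<Oplus>y\<in>Sigma (insert x A) B. f y) = (\<Oplus>y\<in>Pair x ` B x. f y) \<oplus> (\<Oplus>y\<in>Sigma A B. f y)"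
    unfolding eq using insert by (intro finsum_Un_disjoint) (auto simp: Pi_def)
  also have "(\<Oplus>y\<in>Pair x ` B x. f y) = (\<Oplus>b\<in>B x. f (x, b))"
    using insert by (intro finsum_reindex) (auto simp: Pi_def inj_on_def)
  also have "(\<Oplus>y\<in>Sigma A B. f y) = (\<Oplus>a\<in>A. \<Oplus>b\<in>B a. f (a, b))"
    using insert by auto
  also have "(\<Oplus>b\<in>B x. f (x, b)) \<oplus> \<dots> = (\<Oplus>a\<in>insert x A. \<Oplus>b\<in>B a. f (a, b))"
    using insert by (subst finsum_insert) (auto intro!: finsum_closed simp: Pi_def)
  finally show ?case .
qed

lemma finsum_mono_neutral:
  assumes "finite B" "A \<subseteq> B" "\<And>i. i \<in> B - A \<Longrightarrow> f i = \<zero>" "f \<in> A \<rightarrow> carrier W"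
  shows "(\<Oplus>i\<in>A. f i) = (\<Oplus>i\<in>B. f i)"
  using assms by (intro add.finprod_mono_neutral_cong_left) auto

lemma finsum_delta:
  assumes "finite A" "i \<in> A" "f i \<in> carrier W"
  shows "(\<Oplus>j\<in>A. if i = j then f j else \<zero>) = f i"
proof -
  have "(\<Oplus>j\<in>{i}. if i = j then f j else \<zero>) = (\<Oplus>j\<in>A. if i = j then f j else \<zero>)"
    using assms by (intro finsum_mono_neutral) auto
  moreover have "(\<Oplus>j\<in>{i}. if i = j then f j else \<zero>) = f i"
    using assms by (subst finsum_insert) auto
  ultimately show ?thesis by simp
qed

end

lemma linear_mapI:
  assumes "\<And>x. x \<in> carrier V \<Longrightarrow> f x \<in> carrier W"
    and "\<And>x y. \<lbrakk>x \<in> carrier V; y \<in> carrier V\<rbrakk> \<Longrightarrow> f (x \<oplus>\<^bsub>V\<^esub> y) = f x \<oplus>\<^bsub>W\<^esub> f y"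
    and "\<And>c x. x \<in> carrier V \<Longrightarrow> f (c \<odot>\<^bsub>V\<^esub> x) = c \<odot>\<^bsub>W\<^esub> f x"
  shows "linear_map V W f"
  using assms by (auto simp: linear_map_def)

lemma linear_mapD:
  assumes "linear_map V W f"
  shows linear_map_closed: "x \<in> carrier V \<Longrightarrow> f x \<in> carrier W"
    and linear_map_add: "\<lbrakk>x \<in> carrier V; y \<in> carrier V\<rbrakk> \<Longrightarrow> f (x \<oplus>\<^bsub>V\<^esub> y) = f x \<oplus>\<^bsub>W\<^esub> f y"
    and linear_map_smult: "x \<in> carrier V \<Longrightarrow> f (c \<odot>\<^bsub>V\<^esub> x) = c \<odot>\<^bsub>W\<^esub> f x"
  using assms by (auto simp: linear_map_def)

lemma linear_map_cong:
  assumes "linear_map V W f" "\<And>x. x \<in> carrier V \<Longrightarrow> g x = f x" "vect V"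
  shows "linear_map V W g"
proof -
  interpret V: vect V by fact
  show ?thesis using assms by (auto simp: linear_map_def)
qed

lemma linear_map_id: "linear_map V V (\<lambda>x. x)" "linear_map V V id"
  by (auto intro: linear_mapI)

lemma linear_map_comp:
  assumes "linear_map V W g" "linear_map U V f"
  shows "linear_map U W (\<lambda>x. g (f x))"
  using assms by (auto intro!: linear_mapI simp: linear_mapD[OF assms(1)] linear_mapD[OF assms(2)])

lemma linear_map_smult_fun:
  assumes "vect V" "vect W" "linear_map V W f"
  shows "linear_map V W (\<lambda>x. c \<odot>\<^bsub>W\<^esub> f x)"
proof -
  interpret V: vect V by fact
  interpret W: vect W by fact
  note f = linear_mapD[OF assms(3)]
  show ?thesis
    by (rule linear_mapI) (auto simp: f W.smult_add_right W.smult_assoc[symmetric] mult.commute)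
qed

lemma linear_map_zero:
  assumes "vect V" "vect W" "linear_map V W f"
  shows "f \<zero>\<^bsub>V\<^esub> = \<zero>\<^bsub>W\<^esub>"
proof -
  interpret V: vect V by fact
  interpret W: vect W by fact
  show ?thesis
    using linear_map_smult[OF assms(3), of "\<zero>\<^bsub>V\<^esub>" 0] linear_map_closed[OF assms(3)] by simp
qed

lemma linear_map_zero_fun:
  assumes "vect W"
  shows "linear_map V W (\<lambda>x. \<zero>\<^bsub>W\<^esub>)"
proof -
  interpret W: vect W by fact
  show ?thesis by (rule linear_mapI) auto
qed

lemma linear_map_finsum:
  assumes "vect V" "vect W" "linear_map V W f" "g \<in> A \<rightarrow> carrier V"
  shows "f (finsum V g A) = (\<Oplus>\<^bsub>W\<^esub>a\<in>A. f (g a))"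
proof -
  interpret V: vect V by fact
  interpret W: vect W by fact
  note f = linear_mapD[OF assms(3)]
  show ?thesis
    using assms(4)
    by (induction A rule: infinite_finite_induct)
       (auto simp: f linear_map_zero[OF assms(1-3)] Pi_def)
qed

lemma linear_image_finsum:
  assumes V: "vect V" and W: "vect W" and f: "linear_map V W f"
    and y: "\<And>a. a \<in> A \<Longrightarrow> y a \<in> f ` carrier V"
  shows "finsum W y A \<in> f ` carrier V"
proof -
  interpret V: vect V by fact
  interpret W: vect W by fact
  have "\<forall>a\<in>A. \<exists>x. x \<in> carrier V \<and> y a = f x" using y by blast
  from bchoice[OF this] obtain x where x: "\<And>a. a \<in> A \<Longrightarrow> x a \<in> carrier V \<and> y a = f (x a)"
    by blast
  have "finsum W y A = (\<Oplus>\<^bsub>W\<^esub>a\<in>A. f (x a))"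
    using x linear_map_closed[OF f] by (intro W.finsum_cong') auto
  also have "\<dots> = f (finsum V x A)"
    using x by (intro linear_map_finsum[OF V W f, symmetric]) auto
  finally show ?thesis
    using x by (auto intro!: V.finsum_closed)
qed

lemma linear_map_finsum_fun:
  assumes "vect V" "vect W" "\<And>a. a \<in> A \<Longrightarrow> linear_map V W (f a)"
  shows "linear_map V W (\<lambda>x. \<Oplus>\<^bsub>W\<^esub>a\<in>A. f a x)"
proof -
  interpret V: vect V by fact
  interpret W: vect W by fact
  note f = linear_mapD[OF assms(3)]
  show ?thesis
  proof (rule linear_mapI)
    fix x y assume xy: "x \<in> carrier V" "y \<in> carrier V"
    have "(\<Oplus>\<^bsub>W\<^esub>a\<in>A. f a (x \<oplus>\<^bsub>V\<^esub> y)) = (\<Oplus>\<^bsub>W\<^esub>a\<in>A. f a x \<oplus>\<^bsub>W\<^esub> f a y)"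
      using f xy by (intro W.finsum_cong') auto
    also have "\<dots> = (\<Oplus>\<^bsub>W\<^esub>a\<in>A. f a x) \<oplus>\<^bsub>W\<^esub> (\<Oplus>\<^bsub>W\<^esub>a\<in>A. f a y)"
      using f xy by (intro W.finsum_addf) auto
    finally show "(\<Oplus>\<^bsub>W\<^esub>a\<in>A. f a (x \<oplus>\<^bsub>V\<^esub> y)) = (\<Oplus>\<^bsub>W\<^esub>a\<in>A. f a x) \<oplus>\<^bsub>W\<^esub> (\<Oplus>\<^bsub>W\<^esub>a\<in>A. f a y)" .
  next
    fix c x assume x: "x \<in> carrier V"
    have "(\<Oplus>\<^bsub>W\<^esub>a\<in>A. f a (c \<odot>\<^bsub>V\<^esub> x)) = (\<Oplus>\<^bsub>W\<^esub>a\<in>A. c \<odot>\<^bsub>W\<^esub> f a x)"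
      using f x by (intro W.finsum_cong') auto
    also have "\<dots> = c \<odot>\<^bsub>W\<^esub> (\<Oplus>\<^bsub>W\<^esub>a\<in>A. f a x)"
      using f x by (intro W.finsum_smult[symmetric]) auto
    finally show "(\<Oplus>\<^bsub>W\<^esub>a\<in>A. f a (c \<odot>\<^bsub>V\<^esub> x)) = c \<odot>\<^bsub>W\<^esub> (\<Oplus>\<^bsub>W\<^esub>a\<in>A. f a x)" .
  qed (use f in \<open>auto intro!: W.finsum_closed\<close>)
qed

lemma finsum_eq_sum:
  assumes "vect W" "add W = (+)" "ring.zero W = (0::'a::ab_group_add)" "f \<in> A \<rightarrow> carrier W"
  shows "finsum W f A = sum f A"
proof -
  interpret W: vect W by fact
  show ?thesis
    using assms(4)
    by (induction A rule: infinite_finite_induct) (auto simp: assms(2,3) Pi_def)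
qed

lemma vect_kfield: "vect (kfield :: ('k::field, 'k) module)"
proof -
  interpret cring "kfield :: ('k, 'k) module" by (rule cring_kfield)
  show ?thesis by unfold_locales (auto simp: algebra_simps)
qed

section \<open>Free and presented spaces\<close>

lemma lookup_pscale [simp]: "Poly_Mapping.lookup (pscale c x) s = c * Poly_Mapping.lookup x s"
  by (simp add: pscale_def Poly_Mapping.map.rep_eq when_def)

global_interpretation pscale: vector_space pscale
  by unfold_locales (auto intro!: poly_mapping_eqI simp: lookup_add algebra_simps)

lemma keys_pscale: "Poly_Mapping.keys (pscale c x) \<subseteq> Poly_Mapping.keys x"
  by (auto simp: in_keys_iff)

lemma keys_uminus: "Poly_Mapping.keys (- x :: 's \<Rightarrow>\<^sub>0 'k::field) = Poly_Mapping.keys x"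
  by (auto simp: in_keys_iff)

lemma keys_minus: "Poly_Mapping.keys (x - y :: 's \<Rightarrow>\<^sub>0 'k::field) \<subseteq> Poly_Mapping.keys x \<union> Poly_Mapping.keys y"
  by (auto simp: in_keys_iff lookup_minus)

lemma keys_subset [simp]:
  fixes x y :: "'s \<Rightarrow>\<^sub>0 'k::field"
  assumes "Poly_Mapping.keys x \<subseteq> S"
  shows "Poly_Mapping.keys y \<subseteq> S \<Longrightarrow> Poly_Mapping.keys (x + y) \<subseteq> S"
    and "Poly_Mapping.keys y \<subseteq> S \<Longrightarrow> Poly_Mapping.keys (x - y) \<subseteq> S"
    and "Poly_Mapping.keys (pscale c x) \<subseteq> S"
  using assms keys_add[of x y] keys_minus[of x y] keys_pscale[of c x] by auto

lemma free_space_simps [simp]: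
  "carrier (free_space S) = {x. Poly_Mapping.keys x \<subseteq> S}"
  "ring.zero (free_space S) = 0" "add (free_space S) = (+)" "smult (free_space S) = pscale"
  by (simp_all add: free_space_def)

lemma vect_free_space:
  fixes S :: "'s set"
  shows "vect (free_space S :: ('k::field, 's \<Rightarrow>\<^sub>0 'k) module)"
proof unfold_locales
  have "x \<in> Units (add_monoid (free_space S))"
    if "Poly_Mapping.keys x \<subseteq> S" for x :: "'s \<Rightarrow>\<^sub>0 'k"
    using that by (auto simp: Units_def keys_uminus intro!: exI[of _ "- x"])
  then show "carrier (add_monoid (free_space S :: ('k, 's \<Rightarrow>\<^sub>0 'k) module))
      \<subseteq> Units (add_monoid (free_space S))"
    by (intro subsetI) (simp only: partial_object.simps free_space_simps mem_Collect_eq)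
qed (auto simp: algebra_simps pscale.scale_right_distrib pscale.scale_left_distrib
      dest: keys_subset(1)[THEN subsetD] keys_subset(3)[THEN subsetD])

lemma finsum_free_space: "f \<in> A \<rightarrow> carrier (free_space S) \<Longrightarrow> finsum (free_space S) f A = sum f A"
  by (intro finsum_eq_sum vect_free_space) simp_all

lemma poly_mapping_eq_sum_gen:
  "x = (\<Sum>s\<in>Poly_Mapping.keys x. pscale (Poly_Mapping.lookup x s) (gen s))"
  by (rule poly_mapping_eqI)
    (simp add: lookup_sum lookup_single when_def in_keys_iff if_distrib[of "\<lambda>t. _ * t"] cong: if_cong)

text \<open>\<open>lin_ext\<close> sums over the support, which changes under addition and scaling.
  Summing over a fixed larger finite set makes linearity in \<open>x\<close> a termwise
  statement.\<close>

lemma lin_ext_superset: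
  assumes "vect W" "f \<in> S \<rightarrow> carrier W" "finite K" "Poly_Mapping.keys x \<subseteq> K" "K \<subseteq> S"
  shows "lin_ext W f x = (\<Oplus>\<^bsub>W\<^esub>s\<in>K. Poly_Mapping.lookup x s \<odot>\<^bsub>W\<^esub> f s)"
proof -
  interpret W: vect W by fact
  show ?thesis
    unfolding lin_ext_def
  proof (rule W.finsum_mono_neutral)
    show "(\<lambda>s. Poly_Mapping.lookup x s \<odot>\<^bsub>W\<^esub> f s) \<in> Poly_Mapping.keys x \<rightarrow> carrier W"
      using assms by auto
    fix s assume "s \<in> K - Poly_Mapping.keys x"
    moreover from this have "f s \<in> carrier W" using assms by auto
    ultimately show "Poly_Mapping.lookup x s \<odot>\<^bsub>W\<^esub> f s = \<zero>\<^bsub>W\<^esub>"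
      by (simp add: in_keys_iff)
  qed (use assms in auto)
qed

lemma linear_map_lin_ext:
  fixes W :: "('k::field, 'a, 'x) module_scheme" and S :: "'s set"
  assumes W: "vect W" and f: "f \<in> S \<rightarrow> carrier W"
  shows "linear_map (free_space S) W (lin_ext W f)"
proof -
  interpret W: vect W by fact
  have fc: "f s \<in> carrier W" if "s \<in> S" for s using f that by auto
  show ?thesis
  proof (rule linear_mapI; simp)
    fix x :: "'s \<Rightarrow>\<^sub>0 'k" assume x: "Poly_Mapping.keys x \<subseteq> S"
    show "lin_ext W f x \<in> carrier W"
      unfolding lin_ext_def using x fc by (auto intro!: W.finsum_closed)
    fix c
    show "lin_ext W f (pscale c x) = c \<odot>\<^bsub>W\<^esub> lin_ext W f x"
      using x fc keys_pscale[of c x]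
      by (subst (1 2) lin_ext_superset[OF W f, of "Poly_Mapping.keys x"])
        (auto simp: W.finsum_smult Pi_def W.smult_assoc subset_iff intro!: W.finsum_cong')
  next
    fix x y :: "'s \<Rightarrow>\<^sub>0 'k" assume xy: "Poly_Mapping.keys x \<subseteq> S" "Poly_Mapping.keys y \<subseteq> S"
    let ?K = "Poly_Mapping.keys x \<union> Poly_Mapping.keys y"
    have eq: "lin_ext W f z = (\<Oplus>\<^bsub>W\<^esub>s\<in>?K. Poly_Mapping.lookup z s \<odot>\<^bsub>W\<^esub> f s)"
      if "Poly_Mapping.keys z \<subseteq> ?K" for z
      using that xy by (intro lin_ext_superset[OF W f]) auto
    have "lin_ext W f (x + y) = (\<Oplus>\<^bsub>W\<^esub>s\<in>?K. Poly_Mapping.lookup x s \<odot>\<^bsub>W\<^esub> f s \<oplus>\<^bsub>W\<^esub> Poly_Mapping.lookup y s \<odot>\<^bsub>W\<^esub> f s)"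
      unfolding eq[OF keys_add]
    proof (rule W.finsum_cong')
      show "(\<lambda>s. Poly_Mapping.lookup x s \<odot>\<^bsub>W\<^esub> f s \<oplus>\<^bsub>W\<^esub> Poly_Mapping.lookup y s \<odot>\<^bsub>W\<^esub> f s) \<in> ?K \<rightarrow> carrier W"
        using xy fc by auto
    qed (use xy fc in \<open>auto simp: lookup_add W.smult_add_left\<close>)
    also have "\<dots> = lin_ext W f x \<oplus>\<^bsub>W\<^esub> lin_ext W f y"
      using xy fc by (subst (1 2) eq) (auto intro!: W.finsum_addf simp: subset_iff)
    finally show "lin_ext W f (x + y) = lin_ext W f x \<oplus>\<^bsub>W\<^esub> lin_ext W f y" .
  qed
qed

lemma lin_ext_gen [simp]:
  assumes "vect W" "f s \<in> carrier W"
  shows "lin_ext W f (gen s) = f s"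
proof -
  interpret W: vect W by fact
  show ?thesis using assms(2) by (simp add: lin_ext_def Pi_def)
qed

lemma lin_ext_zero [simp]:
  assumes "vect W"
  shows "lin_ext W f 0 = \<zero>\<^bsub>W\<^esub>"
proof -
  interpret W: vect W by fact
  show ?thesis by (simp add: lin_ext_def)
qed

text \<open>Every relation of a presented space is a difference, while linearity of
  \<open>lin_ext\<close> is stated for sums and multiples. Adding \<open>y\<close> back and
  cancelling reduces the vanishing on a relation to the equality of two values.\<close>

lemma lin_ext_diff:
  assumes U: "vect U" and f: "f \<in> S \<rightarrow> carrier U"
    and x: "Poly_Mapping.keys x \<subseteq> S" and y: "Poly_Mapping.keys y \<subseteq> S" and eq: "lin_ext U f x = lin_ext U f y"
  shows "lin_ext U f (x - y) = \<zero>\<^bsub>U\<^esub>"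
proof -
  interpret U: vect U by fact
  note lin = linear_map_lin_ext[OF U f]
  have "lin_ext U f ((x - y) + y) = lin_ext U f (x - y) \<oplus>\<^bsub>U\<^esub> lin_ext U f y"
    using linear_map_add[OF lin, of "x - y" y] x y by simp
  then show ?thesis
    using x y eq linear_map_closed[OF lin, of y] linear_map_closed[OF lin, of "x - y"]
    by (metis U.add.r_cancel_one' free_space_simps(1) keys_subset(2) mem_Collect_eq
        diff_add_cancel U.a_comm)
qed

lemma free_space_linear_eq:
  fixes W :: "('k::field, 'a, 'x) module_scheme" and S :: "'s set"
  assumes "vect W" "linear_map (free_space S) W F" "linear_map (free_space S) W F'"
    and "\<And>s. s \<in> S \<Longrightarrow> F (gen s) = F' (gen s)" and x: "x \<in> carrier (free_space S)"
  shows "F x = F' x"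
proof -
  interpret W: vect W by fact
  interpret vect "free_space S :: ('k, 's \<Rightarrow>\<^sub>0 'k) module" by (rule vect_free_space)
  let ?g = "\<lambda>s. pscale (Poly_Mapping.lookup x s) (gen s)"
  have g: "?g \<in> Poly_Mapping.keys x \<rightarrow> carrier (free_space S)"
  proof
    fix s assume "s \<in> Poly_Mapping.keys x"
    then have "s \<in> S" using x by auto
    then show "?g s \<in> carrier (free_space S)" by simp
  qed
  have gs: "gen s \<in> carrier (free_space S)" if "s \<in> Poly_Mapping.keys x" for s
    using x that by auto
  have F: "H x = (\<Oplus>\<^bsub>W\<^esub>s\<in>Poly_Mapping.keys x. Poly_Mapping.lookup x s \<odot>\<^bsub>W\<^esub> H (gen s))"
    if H: "linear_map (free_space S) W H" for H
  proof -
    have "H x = H (finsum (free_space S) ?g (Poly_Mapping.keys x))"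
      using poly_mapping_eq_sum_gen[of x] finsum_free_space[OF g] by simp
    also have "\<dots> = (\<Oplus>\<^bsub>W\<^esub>s\<in>Poly_Mapping.keys x. H (?g s))"
      by (rule linear_map_finsum[OF vect_free_space assms(1) H g])
    also have "\<dots> = (\<Oplus>\<^bsub>W\<^esub>s\<in>Poly_Mapping.keys x. Poly_Mapping.lookup x s \<odot>\<^bsub>W\<^esub> H (gen s))"
      using linear_map_smult[OF H gs] linear_map_closed[OF H gs] by (intro W.finsum_cong') auto
    finally show ?thesis .
  qed
  have cl: "F' (gen s) \<in> carrier W" if "s \<in> Poly_Mapping.keys x" for s
    using linear_map_closed[OF assms(3) gs[OF that]] .
  show ?thesis
    unfolding F[OF assms(2)] F[OF assms(3)] using x assms(4) cl by (intro W.finsum_cong') auto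
qed

lemma cls_eq_iff: "cls R x = cls R y \<longleftrightarrow> y - x \<in> pscale.span R"
proof
  assume "cls R x = cls R y"
  then have "y \<in> cls R x" by (simp add: cls_def pscale.span_zero)
  then show "y - x \<in> pscale.span R" by (simp add: cls_def)
next
  assume *: "y - x \<in> pscale.span R"
  have "z - x \<in> pscale.span R \<longleftrightarrow> z - y \<in> pscale.span R" for z
    using pscale.span_add[OF _ *, of "z - y"] pscale.span_diff[OF _ *, of "z - x"] by auto
  then show "cls R x = cls R y" by (simp add: cls_def)
qed

lemma cls_eqI: "x - y \<in> R \<Longrightarrow> cls R x = cls R y"
  using pscale.span_neg[OF pscale.span_base[of "x - y" R]] by (simp add: cls_eq_iff)

lemma mem_cls_self [simp]: "x \<in> cls R x"
  by (simp add: cls_def pscale.span_zero)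

lemma mem_cls_iff: "y \<in> cls R x \<longleftrightarrow> cls R y = cls R x"
  by (metis cls_eq_iff cls_def mem_Collect_eq)

lemma cls_add_cong: "cls R x = cls R x' \<Longrightarrow> cls R y = cls R y' \<Longrightarrow> cls R (x + y) = cls R (x' + y')"
  unfolding cls_eq_iff by (drule (1) pscale.span_add) (simp add: algebra_simps)

lemma cls_pscale_cong: "cls R x = cls R x' \<Longrightarrow> cls R (pscale c x) = cls R (pscale c x')"
  unfolding cls_eq_iff by (drule pscale.span_scale[of _ _ c]) (simp add: pscale.scale_right_diff_distrib)

text \<open>The operations are unions over all representatives. The coset of the result does not
  depend on them, so each union is one of equal sets and collapses to a single coset.\<close>

lemma presented_space_simps [simp]:
  "carrier (presented_space S R) = cls R ` {x. Poly_Mapping.keys x \<subseteq> S}"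
  "ring.zero (presented_space S R) = cls R 0"
  "cls R x \<oplus>\<^bsub>presented_space S R\<^esub> cls R y = cls R (x + y)"
  "c \<odot>\<^bsub>presented_space S R\<^esub> cls R x = cls R (pscale c x)"
proof -
  have "(\<Union>x'\<in>cls R x. \<Union>y'\<in>cls R y. cls R (x' + y')) = cls R (x + y)"
  proof (intro antisym UN_least)
    show "cls R (x' + y') \<subseteq> cls R (x + y)" if "x' \<in> cls R x" "y' \<in> cls R y" for x' y'
      using cls_add_cong[of R x' x y' y] that by (simp add: mem_cls_iff)
  qed (use mem_cls_self in blast)
  then show "cls R x \<oplus>\<^bsub>presented_space S R\<^esub> cls R y = cls R (x + y)"
    by (simp add: presented_space_def)
  have "(\<Union>x'\<in>cls R x. cls R (pscale c x')) = cls R (pscale c x)"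
  proof (intro antisym UN_least)
    show "cls R (pscale c x') \<subseteq> cls R (pscale c x)" if "x' \<in> cls R x" for x'
      using cls_pscale_cong[of R x' x c] that by (simp add: mem_cls_iff)
  qed (use mem_cls_self in blast)
  then show "c \<odot>\<^bsub>presented_space S R\<^esub> cls R x = cls R (pscale c x)"
    by (simp add: presented_space_def)
qed (simp_all add: presented_space_def)

lemma vect_presented_space: "vect (presented_space S R)"
proof unfold_locales
  have "x \<in> Units (add_monoid (presented_space S R))"
    if x: "x \<in> cls R ` {x. Poly_Mapping.keys x \<subseteq> S}" for x
  proof -
    from x obtain x' where x': "x = cls R x'" "Poly_Mapping.keys x' \<subseteq> S" by auto
    then show ?thesis
      by (auto simp: Units_def keys_uminus intro!: exI[of _ "- x'"])
  qed
  then show "carrier (add_monoid (presented_space S R)) \<subseteq> Units (add_monoid (presented_space S R))"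
    by auto
qed (auto simp: algebra_simps pscale.scale_right_distrib pscale.scale_left_distrib
      intro!: imageI)

lemma linear_map_cls: "linear_map (free_space S) (presented_space S R) (cls R)"
  by (rule linear_mapI) auto

lemma presented_space_linear_eq:
  assumes "vect W" "linear_map (presented_space S R) W F" "linear_map (presented_space S R) W F'"
    and "\<And>s. s \<in> S \<Longrightarrow> F (cls R (gen s)) = F' (cls R (gen s))"
    and x: "x \<in> carrier (presented_space S R)"
  shows "F x = F' x"
proof -
  from x obtain y where y: "x = cls R y" "y \<in> carrier (free_space S)" by auto
  have "linear_map (free_space S) W (\<lambda>x. F (cls R x))" "linear_map (free_space S) W (\<lambda>x. F' (cls R x))"
    using linear_map_comp[OF assms(2) linear_map_cls] linear_map_comp[OF assms(3) linear_map_cls] .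
  from free_space_linear_eq[OF assms(1) this assms(4) y(2)] show ?thesis using y by simp
qed

text \<open>The support condition keeps the span of the relations inside the free space on
  \<open>S\<close>. \<open>lin_ext\<close> is known to be linear only there, whereas
  \<open>ext\<close> evaluates at an arbitrary representative of the coset.\<close>

locale presentation =
  fixes S :: "'s set" and R :: "('s \<Rightarrow>\<^sub>0 'k::field) set"
  assumes rel_keys: "r \<in> R \<Longrightarrow> Poly_Mapping.keys r \<subseteq> S"

definition compat :: "('k::field, 'a, 'x) module_scheme \<Rightarrow> 's set \<Rightarrow> ('s \<Rightarrow>\<^sub>0 'k) set \<Rightarrow> ('s \<Rightarrow> 'a) \<Rightarrow> bool"
  where "compat W S R f \<longleftrightarrow> f \<in> S \<rightarrow> carrier W \<and> (\<forall>r\<in>R. lin_ext W f r = \<zero>\<^bsub>W\<^esub>)"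

text \<open>The chosen representative \<open>y\<close> of \<open>cls R x\<close> differs from
  \<open>x\<close> by an element of the span of \<open>R\<close>. Induction over the span shows that
  \<open>lin_ext\<close> vanishes there; the support is carried through the induction because
  linearity is available on \<open>S\<close> only.\<close>

lemma (in presentation) ext_cls:
  assumes W: "vect W" and f: "compat W S R f" and x: "Poly_Mapping.keys x \<subseteq> S"
  shows "ext W f (cls R x) = lin_ext W f x"
proof -
  interpret W: vect W by fact
  have fS: "f \<in> S \<rightarrow> carrier W" using f by (simp add: compat_def)
  have lin: "linear_map (free_space S) W (lin_ext W f)"
    by (rule linear_map_lin_ext[OF W fS])
  define y where "y = (SOME y. y \<in> cls R x)"
  have "y \<in> cls R x" unfolding y_def by (rule someI) (rule mem_cls_self)
  then have yx: "y - x \<in> pscale.span R" by (simp add: cls_def)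
  have "Poly_Mapping.keys z \<subseteq> S \<and> lin_ext W f z = \<zero>\<^bsub>W\<^esub>" if "z \<in> pscale.span R" for z
    using that
  proof (induction rule: pscale.span_induct_alt)
    case (step c r z)
    then have "pscale c r \<in> carrier (free_space S)" "r \<in> carrier (free_space S)" "z \<in> carrier (free_space S)"
      using rel_keys by auto
    then show ?case
      using linear_map_add[OF lin, of "pscale c r" z] linear_map_smult[OF lin, of r c] f step
      by (auto simp: compat_def)
  qed (simp add: W)
  from this[OF yx] have 1: "y - x \<in> carrier (free_space S)" "lin_ext W f (y - x) = \<zero>\<^bsub>W\<^esub>" by auto
  then have "lin_ext W f y = lin_ext W f x"
    using linear_map_add[OF lin, of "y - x" x] x linear_map_closed[OF lin, of x] by simp
  then show ?thesis by (simp add: ext_def y_def)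
qed

lemma (in presentation) ext_gen:
  assumes W: "vect W" and f: "compat W S R f" and s: "s \<in> S"
  shows "ext W f (cls R (gen s)) = f s"
  using ext_cls[OF W f, of "gen s"] s W f by (auto simp: compat_def Pi_def)

lemma (in presentation) linear_map_ext:
  assumes W: "vect W" and f: "compat W S R f"
  shows "linear_map (presented_space S R) W (ext W f)"
proof -
  have lin: "linear_map (free_space S) W (lin_ext W f)"
    using f by (intro linear_map_lin_ext[OF W]) (simp add: compat_def)
  note * = ext_cls[OF W f] linear_mapD[OF lin, simplified]
  show ?thesis
    by (rule linear_mapI) (auto simp: *)
qed

lemma linear_map_lin_ext_param:
  assumes W: "vect W" and V: "vect V" and F: "\<And>s. s \<in> S \<Longrightarrow> linear_map V W (F s)"
    and x: "Poly_Mapping.keys x \<subseteq> S"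
  shows "linear_map V W (\<lambda>v. lin_ext W (\<lambda>s. F s v) x)"
  unfolding lin_ext_def using F x
  by (intro linear_map_finsum_fun linear_map_smult_fun V W) auto

text \<open>One representative \<open>x\<close> of \<open>A\<close>, supported in \<open>S\<close>,
  serves for all \<open>v\<close> at once; with it \<open>ext\<close> is a finite sum of maps that
  are linear in \<open>v\<close>.\<close>

lemma linear_map_ext_param:
  assumes W: "vect W" and V: "vect V" and p: "presentation S R"
    and F: "\<And>s. s \<in> S \<Longrightarrow> linear_map V W (F s)"
    and resp: "\<And>v. v \<in> carrier V \<Longrightarrow> compat W S R (\<lambda>s. F s v)"
    and A: "A \<in> carrier (presented_space S R)"
  shows "linear_map V W (\<lambda>v. ext W (\<lambda>s. F s v) A)"
proof -
  from A obtain x where x: "A = cls R x" "Poly_Mapping.keys x \<subseteq> S" by auto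
  show ?thesis
    using presentation.ext_cls[OF p W resp x(2)]
    by (intro linear_map_cong[OF linear_map_lin_ext_param[OF W V F x(2)] _ V]) (simp_all add: x(1))
qed

text \<open>A function on pairs of generators descends to the two quotients one argument after the
  other. That the inner extension respects the relations of the first space for every
  \<open>B\<close>, and not only for generators, is a linear statement in \<open>B\<close> and can
  therefore be tested on the generators of the second space.\<close>

lemma bilinear_ext:
  assumes W: "vect W" and p: "presentation S R" and p': "presentation S' R'"
    and left: "\<And>t. t \<in> S' \<Longrightarrow> compat W S R (\<lambda>s. f s t)"
    and right: "\<And>s. s \<in> S \<Longrightarrow> compat W S' R' (f s)"
  defines "F \<equiv> \<lambda>A B. ext W (\<lambda>s. ext W (f s) B) A"
  shows "B \<in> carrier (presented_space S' R') \<Longrightarrow> linear_map (presented_space S R) W (\<lambda>A. F A B)"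
    and "A \<in> carrier (presented_space S R) \<Longrightarrow> linear_map (presented_space S' R') W (F A)"
    and "\<lbrakk>s \<in> S; t \<in> S'\<rbrakk> \<Longrightarrow> F (cls R (gen s)) (cls R' (gen t)) = f s t"
proof -
  interpret W: vect W by fact
  interpret p: presentation S R by fact
  interpret p': presentation S' R' by fact
  have lin: "linear_map (presented_space S' R') W (ext W (f s))" if "s \<in> S" for s
    using p'.linear_map_ext[OF W right] that by simp
  have resp: "compat W S R (\<lambda>s. ext W (f s) B)" if B: "B \<in> carrier (presented_space S' R')" for B
    unfolding compat_def
  proof (intro conjI ballI)
    show "(\<lambda>s. ext W (f s) B) \<in> S \<rightarrow> carrier W"
      using linear_map_closed[OF lin B] by auto
    fix r assume r: "r \<in> R"
    show "lin_ext W (\<lambda>s. ext W (f s) B) r = \<zero>\<^bsub>W\<^esub>"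
    proof (rule presented_space_linear_eq[OF W _ linear_map_zero_fun[OF W] _ B])
      show "linear_map (presented_space S' R') W (\<lambda>B. lin_ext W (\<lambda>s. ext W (f s) B) r)"
        using lin p.rel_keys[OF r] by (intro linear_map_lin_ext_param W vect_presented_space)
      fix t assume t: "t \<in> S'"
      have "lin_ext W (\<lambda>s. ext W (f s) (cls R' (gen t))) r = lin_ext W (\<lambda>s. f s t) r"
        unfolding lin_ext_def using p.rel_keys[OF r] left[OF t] p'.ext_gen[OF W right t]
        by (intro W.finsum_cong') (auto simp: compat_def)
      then show "lin_ext W (\<lambda>s. ext W (f s) (cls R' (gen t))) r = \<zero>\<^bsub>W\<^esub>"
        using left[OF t] r by (simp add: compat_def)
    qed
  qed
  show "linear_map (presented_space S R) W (\<lambda>A. F A B)" if "B \<in> carrier (presented_space S' R')"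
    unfolding F_def using p.linear_map_ext[OF W resp[OF that]] .
  show "linear_map (presented_space S' R') W (F A)" if "A \<in> carrier (presented_space S R)"
    unfolding F_def using lin resp that
    by (intro linear_map_ext_param[OF W vect_presented_space p])
  show "F (cls R (gen s)) (cls R' (gen t)) = f s t" if "s \<in> S" "t \<in> S'"
  proof -
    have "cls R' (gen t) \<in> carrier (presented_space S' R')" using that by auto
    from p.ext_gen[OF W resp[OF this]] p'.ext_gen[OF W right] that show ?thesis
      by (simp add: F_def)
  qed
qed

section \<open>Tensor products\<close>

definition bilinear ::
    "('k, 'a, 'x) module_scheme \<Rightarrow> ('k, 'b, 'y) module_scheme \<Rightarrow> ('k, 'c, 'z) module_scheme \<Rightarrow>
     ('a \<Rightarrow> 'b \<Rightarrow> 'c) \<Rightarrow> bool" where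
  "bilinear V W U f \<longleftrightarrow>
     (\<forall>v\<in>carrier V. linear_map W U (f v)) \<and> (\<forall>w\<in>carrier W. linear_map V U (\<lambda>v. f v w))"

lemma bilinearI:
  assumes "\<And>v. v \<in> carrier V \<Longrightarrow> linear_map W U (f v)"
    and "\<And>w. w \<in> carrier W \<Longrightarrow> linear_map V U (\<lambda>v. f v w)"
  shows "bilinear V W U f"
  using assms by (simp add: bilinear_def)

lemma bilinearD:
  assumes "bilinear V W U f"
  shows bilinear_right: "v \<in> carrier V \<Longrightarrow> linear_map W U (f v)"
    and bilinear_left: "w \<in> carrier W \<Longrightarrow> linear_map V U (\<lambda>v. f v w)"
    and bilinear_closed: "\<lbrakk>v \<in> carrier V; w \<in> carrier W\<rbrakk> \<Longrightarrow> f v w \<in> carrier U"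
  using assms linear_map_closed[of W U "f v"] by (auto simp: bilinear_def)

lemma bilinear_comp:
  assumes "bilinear V W U h" "linear_map V' V f" "linear_map W' W g"
  shows "bilinear V' W' U (\<lambda>v w. h (f v) (g w))"
proof (rule bilinearI)
  show "linear_map W' U (\<lambda>w. h (f v) (g w))" if "v \<in> carrier V'" for v
    by (rule linear_map_comp[OF bilinear_right[OF assms(1) linear_map_closed[OF assms(2) that]] assms(3)])
  show "linear_map V' U (\<lambda>v. h (f v) (g w))" if "w \<in> carrier W'" for w
    by (rule linear_map_comp[OF bilinear_left[OF assms(1) linear_map_closed[OF assms(3) that]] assms(2)])
qed

lemma linear_bilinear_comp:
  assumes "linear_map U U' h" "bilinear V W U f"
  shows "bilinear V W U' (\<lambda>v w. h (f v w))"
  by (rule bilinearI; rule linear_map_comp[OF assms(1)]; rule bilinearD[OF assms(2)])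

lemma presentation_tensor:
  assumes "vect V" "vect W"
  shows "presentation (carrier V \<times> carrier W) (tensor_rel V W)"
proof -
  interpret V: vect V by fact
  interpret W: vect W by fact
  show ?thesis
    by unfold_locales (simp add: tensor_rel_def, elim disjE exE conjE; simp)
qed

lemma tensor_space_eq: "presented_space (carrier V \<times> carrier W) (tensor_rel V W) = tensor_space V W"
  by (simp add: tensor_space_def)

lemma vect_tensor_space: "vect (tensor_space V W)"
  unfolding tensor_space_def by (rule vect_presented_space)

lemma tens_closed [simp, intro]:
  "\<lbrakk>v \<in> carrier V; w \<in> carrier W\<rbrakk> \<Longrightarrow> tens V W v w \<in> carrier (tensor_space V W)"
  by (simp add: tensor_space_def tens_def)

lemma bilinear_tens:
  fixes V :: "('k::field, 'a, 'x) module_scheme" and W :: "('k, 'b, 'y) module_scheme"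
  assumes "vect V" "vect W"
  shows "bilinear V W (tensor_space V W) (tens V W)"
proof -
  interpret V: vect V by fact
  interpret W: vect W by fact
  let ?R = "tensor_rel V W"
  have "cls ?R (gen (v, w \<oplus>\<^bsub>W\<^esub> w')) = cls ?R (gen (v, w) + gen (v, w'))"
    if "v \<in> carrier V" "w \<in> carrier W" "w' \<in> carrier W" for v w w'
    by (rule cls_eqI) (unfold tensor_rel_def diff_diff_eq, use that in blast)
  moreover have "cls ?R (gen (v \<oplus>\<^bsub>V\<^esub> v', w)) = cls ?R (gen (v, w) + gen (v', w))"
    if "v \<in> carrier V" "v' \<in> carrier V" "w \<in> carrier W" for v v' w
    by (rule cls_eqI) (unfold tensor_rel_def diff_diff_eq, use that in blast)
  moreover have "cls ?R (gen (c \<odot>\<^bsub>V\<^esub> v, w)) = cls ?R (pscale c (gen (v, w)))"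
    if "v \<in> carrier V" "w \<in> carrier W" for c v w
    by (rule cls_eqI) (unfold tensor_rel_def diff_diff_eq, use that in blast)
  moreover have "cls ?R (gen (v, c \<odot>\<^bsub>W\<^esub> w)) = cls ?R (pscale c (gen (v, w)))"
    if "v \<in> carrier V" "w \<in> carrier W" for c v w
    by (rule cls_eqI) (unfold tensor_rel_def diff_diff_eq, use that in blast)
  ultimately show ?thesis
    by (intro bilinearI linear_mapI; simp add: tens_def tensor_space_def)
qed

text \<open>The four families of relations match additivity and homogeneity in either argument.
  Reading \<open>a - b - c\<close> as \<open>a - (b + c)\<close> gives all of them the shape
  required by \<open>lin_ext_diff\<close>.\<close>

lemma compat_tensor:
  assumes V: "vect V" and W: "vect W" and U: "vect U" and f: "bilinear V W U f"
  shows "compat U (carrier V \<times> carrier W) (tensor_rel V W) (\<lambda>(v, w). f v w)"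
proof -
  interpret V: vect V by fact
  interpret W: vect W by fact
  interpret U: vect U by fact
  let ?S = "carrier V \<times> carrier W" and ?f = "\<lambda>(v, w). f v w"
  have fS: "?f \<in> ?S \<rightarrow> carrier U"
    using bilinear_closed[OF f] by auto
  note lin = linear_map_lin_ext[OF U fS]
  show ?thesis
    unfolding compat_def
  proof (intro conjI fS ballI)
    note b = linear_map_add[OF lin, simplified] linear_map_smult[OF lin, simplified] U bilinear_closed[OF f] linear_mapD[OF bilinear_right[OF f]]
            linear_mapD[OF bilinear_left[OF f]]
    have 1: "lin_ext U ?f (gen (v \<oplus>\<^bsub>V\<^esub> v', w) - (gen (v, w) + gen (v', w))) = \<zero>\<^bsub>U\<^esub>"
      if "v \<in> carrier V" "v' \<in> carrier V" "w \<in> carrier W" for v v' w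
      by (rule lin_ext_diff[OF U fS]) (use that in \<open>simp_all add: b\<close>)
    have 2: "lin_ext U ?f (gen (v, w \<oplus>\<^bsub>W\<^esub> w') - (gen (v, w) + gen (v, w'))) = \<zero>\<^bsub>U\<^esub>"
      if "v \<in> carrier V" "w \<in> carrier W" "w' \<in> carrier W" for v w w'
      by (rule lin_ext_diff[OF U fS]) (use that in \<open>simp_all add: b\<close>)
    have 3: "lin_ext U ?f (gen (c \<odot>\<^bsub>V\<^esub> v, w) - pscale c (gen (v, w))) = \<zero>\<^bsub>U\<^esub>"
      if "v \<in> carrier V" "w \<in> carrier W" for c v w
      by (rule lin_ext_diff[OF U fS]) (use that in \<open>simp_all add: b\<close>)
    have 4: "lin_ext U ?f (gen (v, c \<odot>\<^bsub>W\<^esub> w) - pscale c (gen (v, w))) = \<zero>\<^bsub>U\<^esub>"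
      if "v \<in> carrier V" "w \<in> carrier W" for c v w
      by (rule lin_ext_diff[OF U fS]) (use that in \<open>simp_all add: b\<close>)
    fix r assume "r \<in> tensor_rel V W"
    then show "lin_ext U ?f r = \<zero>\<^bsub>U\<^esub>"
      unfolding tensor_rel_def diff_diff_eq
      by (elim UnE CollectE exE conjE) (simp_all only: 1 2 3 4)
  qed
qed

lemma ext_tens:
  assumes "vect V" "vect W" "vect U" "bilinear V W U f" "v \<in> carrier V" "w \<in> carrier W"
  shows "ext U (\<lambda>(v, w). f v w) (tens V W v w) = f v w"
  unfolding tens_def
  using presentation.ext_gen[OF presentation_tensor[OF assms(1,2)] assms(3)
      compat_tensor[OF assms(1-4)], of "(v, w)"] assms(5,6) by simp

lemma linear_map_ext_tensor:
  assumes "vect V" "vect W" "vect U" "bilinear V W U f"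
  shows "linear_map (tensor_space V W) U (ext U (\<lambda>(v, w). f v w))"
  unfolding tensor_space_def
  by (rule presentation.linear_map_ext[OF presentation_tensor[OF assms(1,2)] assms(3) compat_tensor[OF assms]])

lemma tensor_linear_eq:
  assumes "vect U" "linear_map (tensor_space V W) U F" "linear_map (tensor_space V W) U F'"
    and "\<And>v w. \<lbrakk>v \<in> carrier V; w \<in> carrier W\<rbrakk> \<Longrightarrow> F (tens V W v w) = F' (tens V W v w)"
    and "t \<in> carrier (tensor_space V W)"
  shows "F t = F' t"
proof (rule presented_space_linear_eq[OF assms(1) assms(2,3)[unfolded tensor_space_def] _
      assms(5)[unfolded tensor_space_def]])
  show "F (cls (tensor_rel V W) (gen s)) = F' (cls (tensor_rel V W) (gen s))"
    if "s \<in> carrier V \<times> carrier W" for s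
    using assms(4) that by (auto simp: tens_def)
qed

lemma ext_tensor_cong:
  assumes "vect V" "vect W" "vect U" "bilinear V W U f"
    and "\<And>v w. \<lbrakk>v \<in> carrier V; w \<in> carrier W\<rbrakk> \<Longrightarrow> f v w = g v w"
    and t: "t \<in> carrier (tensor_space V W)"
  shows "ext U (\<lambda>(v, w). f v w) t = ext U (\<lambda>(v, w). g v w) t"
proof -
  have g: "bilinear V W U g"
  proof (rule bilinearI)
    show "linear_map W U (g v)" if "v \<in> carrier V" for v
      using linear_map_cong[OF bilinear_right[OF assms(4) that] _ assms(2)] assms(5)[OF that] by simp
    show "linear_map V U (\<lambda>v. g v w)" if "w \<in> carrier W" for w
      using linear_map_cong[OF bilinear_left[OF assms(4) that] _ assms(1)] assms(5)[OF _ that] by simp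
  qed
  show ?thesis
    by (rule tensor_linear_eq[OF assms(3) linear_map_ext_tensor[OF assms(1-4)]
          linear_map_ext_tensor[OF assms(1-3) g] _ t])
      (simp add: ext_tens[OF assms(1-4)] ext_tens[OF assms(1-3) g] assms(5))
qed

lemma linear_map_ext_comp:
  assumes "vect V" "vect W" "vect U" "vect U'" "bilinear V W U f" "linear_map U U' h"
    and t: "t \<in> carrier (tensor_space V W)"
  shows "h (ext U (\<lambda>(v, w). f v w) t) = ext U' (\<lambda>(v, w). h (f v w)) t"
proof -
  note hf = linear_bilinear_comp[OF assms(6,5)]
  show ?thesis
    by (rule tensor_linear_eq[OF assms(4) linear_map_comp[OF assms(6) linear_map_ext_tensor[OF assms(1-3,5)]]
          linear_map_ext_tensor[OF assms(1,2,4) hf] _ t])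
      (use assms(1-5) hf in \<open>simp add: ext_tens\<close>)
qed

lemma bilinear_tens_comp:
  assumes "vect V'" "vect W'" "linear_map V V' f" "linear_map W W' g"
  shows "bilinear V W (tensor_space V' W') (\<lambda>v w. tens V' W' (f v) (g w))"
  by (rule bilinear_comp[OF bilinear_tens[OF assms(1,2)] assms(3,4)])

lemma linear_map_tensor_map:
  assumes "vect V" "vect W" "vect V'" "vect W'" "linear_map V V' f" "linear_map W W' g"
  shows "linear_map (tensor_space V W) (tensor_space V' W') (tensor_map V' W' f g)"
  unfolding tensor_map_def
  by (rule linear_map_ext_tensor[OF assms(1,2) vect_tensor_space bilinear_tens_comp[OF assms(3-6)]])

lemma tensor_map_tens:
  assumes "vect V" "vect W" "vect V'" "vect W'" "linear_map V V' f" "linear_map W W' g"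
    and "v \<in> carrier V" "w \<in> carrier W"
  shows "tensor_map V' W' f g (tens V W v w) = tens V' W' (f v) (g w)"
  unfolding tensor_map_def
  by (rule ext_tens[OF assms(1,2) vect_tensor_space bilinear_tens_comp[OF assms(3-6)] assms(7,8)])

lemma ext_tensor_map:
  assumes "vect V" "vect W" "vect V'" "vect W'" "vect U" "linear_map V V' f" "linear_map W W' g"
    and h: "bilinear V' W' U h" and t: "t \<in> carrier (tensor_space V W)"
  shows "ext U (\<lambda>(v, w). h v w) (tensor_map V' W' f g t) = ext U (\<lambda>(v, w). h (f v) (g w)) t"
proof (rule tensor_linear_eq[OF assms(5) _ _ _ t])
  have 1: "bilinear V W U (\<lambda>v w. h (f v) (g w))"
    by (rule bilinear_comp[OF h assms(6,7)])
  show "linear_map (tensor_space V W) U (ext U (\<lambda>(v, w). h (f v) (g w)))"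
    by (rule linear_map_ext_tensor[OF assms(1,2,5) 1])
  show "linear_map (tensor_space V W) U (\<lambda>t. ext U (\<lambda>(v, w). h v w) (tensor_map V' W' f g t))"
    by (rule linear_map_comp[OF linear_map_ext_tensor[OF assms(3-5) h] linear_map_tensor_map[OF assms(1-4,6,7)]])
  show "ext U (\<lambda>(v, w). h v w) (tensor_map V' W' f g (tens V W v w)) = ext U (\<lambda>(v, w). h (f v) (g w)) (tens V W v w)"
    if "v \<in> carrier V" "w \<in> carrier W" for v w
    using that assms 1 by (simp add: ext_tens tensor_map_tens linear_map_closed)
qed

lemma tensor_map_comp:
  assumes "vect V" "vect W" "vect V'" "vect W'" "vect V''" "vect W''"
    and "linear_map V V' f" "linear_map W W' g" "linear_map V' V'' f'" "linear_map W' W'' g'"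
    and t: "t \<in> carrier (tensor_space V W)"
  shows "tensor_map V'' W'' f' g' (tensor_map V' W' f g t)
    = tensor_map V'' W'' (\<lambda>v. f' (f v)) (\<lambda>w. g' (g w)) t"
  unfolding tensor_map_def[of V'' W'']
  by (rule ext_tensor_map[OF assms(1-4) vect_tensor_space assms(7,8) bilinear_tens_comp[OF assms(5,6,9,10)] t])

lemma tensor_map_cong:
  assumes "vect V" "vect W" "vect V'" "vect W'" "linear_map V V' f" "linear_map W W' g"
    and "\<And>v. v \<in> carrier V \<Longrightarrow> f v = f' v" "\<And>w. w \<in> carrier W \<Longrightarrow> g w = g' w"
    and t: "t \<in> carrier (tensor_space V W)"
  shows "tensor_map V' W' f g t = tensor_map V' W' f' g' t"
  unfolding tensor_map_def
  by (rule ext_tensor_cong[OF assms(1,2) vect_tensor_space bilinear_tens_comp[OF assms(3-6)] _ t])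
    (simp add: assms(7,8))

text \<open>Contracting two arguments of a trilinear map leaves a bilinear one. This handles the
  nested extensions in \<open>tensor_assoc\<close> and the outer variables in the counit
  axioms.\<close>

lemma bilinear_ext_param:
  assumes "vect V" "vect W" "vect U" "vect X"
    and "\<And>x. x \<in> carrier X \<Longrightarrow> bilinear V W U (\<lambda>v w. f x v w)"
    and "\<And>v w. \<lbrakk>v \<in> carrier V; w \<in> carrier W\<rbrakk> \<Longrightarrow> linear_map X U (\<lambda>x. f x v w)"
  shows "bilinear X (tensor_space V W) U (\<lambda>x. ext U (\<lambda>(v, w). f x v w))"
proof (rule bilinearI)
  show "linear_map (tensor_space V W) U (ext U (\<lambda>(v, w). f x v w))" if "x \<in> carrier X" for x
    by (rule linear_map_ext_tensor[OF assms(1-3) assms(5)[OF that]])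
  fix t assume t: "t \<in> carrier (tensor_space V W)"
  have "linear_map X U (\<lambda>x. ext U (\<lambda>s. (\<lambda>(v, w). f x v w) s) t)"
  proof (rule linear_map_ext_param[OF assms(3,4) presentation_tensor[OF assms(1,2)]])
    show "t \<in> carrier (presented_space (carrier V \<times> carrier W) (tensor_rel V W))"
      using t by (simp add: tensor_space_def)
    show "compat U (carrier V \<times> carrier W) (tensor_rel V W) (\<lambda>s. (\<lambda>(v, w). f x v w) s)"
      if "x \<in> carrier X" for x
      using compat_tensor[OF assms(1-3) assms(5)[OF that]] by simp
    show "linear_map X U (\<lambda>x. (\<lambda>(v, w). f x v w) s)" if "s \<in> carrier V \<times> carrier W" for s
      using assms(6) that by auto
  qed
  then show "linear_map X U (\<lambda>x. ext U (\<lambda>(v, w). f x v w) t)" by simp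
qed

lemma bilinear_flip: "bilinear V W U f \<Longrightarrow> bilinear W V U (\<lambda>w v. f v w)"
  by (simp add: bilinear_def)

context
  fixes U :: "('k::field, 'a, 'x) module_scheme" and V :: "('k, 'b, 'y) module_scheme"
    and W :: "('k, 'c, 'z) module_scheme"
  assumes vects: "vect U" "vect V" "vect W"
begin

lemma tensor_assoc_inner:
  "bilinear (tensor_space U V) W (tensor_space U (tensor_space V W))
     (\<lambda>t w. ext (tensor_space U (tensor_space V W))
       (\<lambda>(u, v). tens U (tensor_space V W) u (tens V W v w)) t)"
proof (rule bilinear_flip, rule bilinear_ext_param[OF vects(1,2) vect_tensor_space vects(3)])
  note T = bilinear_tens[OF vects(1) vect_tensor_space[of V W]] and T' = bilinear_tens[OF vects(2,3)]
  show "bilinear U V (tensor_space U (tensor_space V W)) (\<lambda>u v. tens U (tensor_space V W) u (tens V W v w))"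
    if "w \<in> carrier W" for w
    using bilinear_comp[OF T linear_map_id(1) bilinear_left[OF T' that]] .
  show "linear_map W (tensor_space U (tensor_space V W)) (\<lambda>w. tens U (tensor_space V W) u (tens V W v w))"
    if "u \<in> carrier U" "v \<in> carrier V" for u v
    using linear_map_comp[OF bilinear_right[OF T that(1)] bilinear_right[OF T' that(2)]] .
qed

lemma linear_map_tensor_assoc:
  "linear_map (tensor_space (tensor_space U V) W) (tensor_space U (tensor_space V W)) (tensor_assoc U V W)"
  unfolding tensor_assoc_def Let_def
  by (rule linear_map_ext_tensor[OF vect_tensor_space vects(3) vect_tensor_space tensor_assoc_inner])

lemma tensor_assoc_tens:
  assumes "u \<in> carrier U" "v \<in> carrier V" "w \<in> carrier W"
  shows "tensor_assoc U V W (tens (tensor_space U V) W (tens U V u v) w)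
    = tens U (tensor_space V W) u (tens V W v w)"
proof -
  note T = bilinear_tens[OF vects(1) vect_tensor_space[of V W]] and T' = bilinear_tens[OF vects(2,3)]
  have "bilinear U V (tensor_space U (tensor_space V W)) (\<lambda>u v. tens U (tensor_space V W) u (tens V W v w))"
    using bilinear_comp[OF T linear_map_id(1) bilinear_left[OF T' assms(3)]] .
  then show ?thesis
    unfolding tensor_assoc_def Let_def
    using assms vects by (simp add: ext_tens[OF vect_tensor_space vects(3) vect_tensor_space tensor_assoc_inner]
        ext_tens vect_tensor_space)
qed

lemma tensor3_linear_eq:
  assumes X: "vect X"
    and F: "linear_map (tensor_space (tensor_space U V) W) X F"
    and F': "linear_map (tensor_space (tensor_space U V) W) X F'"
    and eq: "\<And>u v w. \<lbrakk>u \<in> carrier U; v \<in> carrier V; w \<in> carrier W\<rbrakk> \<Longrightarrow>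
      F (tens (tensor_space U V) W (tens U V u v) w) = F' (tens (tensor_space U V) W (tens U V u v) w)"
    and t: "t \<in> carrier (tensor_space (tensor_space U V) W)"
  shows "F t = F' t"
proof (rule tensor_linear_eq[OF X F F' _ t])
  fix s w assume s: "s \<in> carrier (tensor_space U V)" and w: "w \<in> carrier W"
  note T = bilinear_left[OF bilinear_tens[OF vect_tensor_space vects(3)] w]
  show "F (tens (tensor_space U V) W s w) = F' (tens (tensor_space U V) W s w)"
    by (rule tensor_linear_eq[OF X linear_map_comp[OF F T] linear_map_comp[OF F' T] eq[OF _ _ w] s])
qed

end

text \<open>Both sides are linear and agree on pure tensors, where the associator merely rebrackets
  \<open>f u\<close>, \<open>g v\<close>, \<open>h w\<close>. This is what moves the axioms stated
  on the triple tensor power along a homomorphism.\<close>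

lemma tensor_assoc_natural:
  assumes "vect U" "vect V" "vect W" "vect U'" "vect V'" "vect W'"
    and "linear_map U U' f" "linear_map V V' g" "linear_map W W' h"
    and t: "t \<in> carrier (tensor_space (tensor_space U V) W)"
  shows "tensor_assoc U' V' W' (tensor_map (tensor_space U' V') W' (tensor_map U' V' f g) h t)
    = tensor_map U' (tensor_space V' W') f (tensor_map V' W' g h) (tensor_assoc U V W t)"
proof (rule tensor3_linear_eq[OF assms(1-3) vect_tensor_space _ _ _ t])
  note a = assms vect_tensor_space linear_map_tensor_map
  show "linear_map (tensor_space (tensor_space U V) W) (tensor_space U' (tensor_space V' W'))
     (\<lambda>t. tensor_assoc U' V' W' (tensor_map (tensor_space U' V') W' (tensor_map U' V' f g) h t))"
    by (rule linear_map_comp[OF linear_map_tensor_assoc[OF assms(4-6)]]) (simp add: a)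
  show "linear_map (tensor_space (tensor_space U V) W) (tensor_space U' (tensor_space V' W'))
     (\<lambda>t. tensor_map U' (tensor_space V' W') f (tensor_map V' W' g h) (tensor_assoc U V W t))"
    by (rule linear_map_comp[OF _ linear_map_tensor_assoc[OF assms(1-3)]]) (simp add: a)
  show "tensor_assoc U' V' W' (tensor_map (tensor_space U' V') W' (tensor_map U' V' f g) h
        (tens (tensor_space U V) W (tens U V u v) w))
      = tensor_map U' (tensor_space V' W') f (tensor_map V' W' g h)
          (tensor_assoc U V W (tens (tensor_space U V) W (tens U V u v) w))"
    if "u \<in> carrier U" "v \<in> carrier V" "w \<in> carrier W" for u v w
    using that assms
    by (simp add: tensor_assoc_tens tensor_map_tens[OF _ _ _ _ linear_map_tensor_map]
        tensor_map_tens[OF _ _ _ _ _ linear_map_tensor_map] tensor_map_tens vect_tensor_space linear_map_closed)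
qed

subsection \<open>Spaces with the same underlying vector space\<close>

text \<open>Linear maps, finite sums and tensor products see only these four fields. The operations
  of \<open>graph_wba\<close> and \<open>coend\<close> are defined over tensor products of the bare
  vector space, while the weak bialgebra axioms use tensor products of the bialgebra record; this
  relation identifies the two.\<close>

definition same_space :: "('k, 'a, 'x) module_scheme \<Rightarrow> ('k, 'a, 'y) module_scheme \<Rightarrow> bool" where
  "same_space V W \<longleftrightarrow> carrier V = carrier W \<and> ring.zero V = ring.zero W \<and> add V = add W \<and> smult V = smult W"

lemma same_space_refl [simp]: "same_space V V"
  by (simp add: same_space_def)

lemma same_space_sym: "same_space V W \<Longrightarrow> same_space W V"
  by (simp add: same_space_def)

lemma vect_same_space:
  assumes "same_space V W" "vect V"
  shows "vect W"
proof -
  interpret V: vect V by fact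
  note e = assms(1)[unfolded same_space_def, THEN conjunct1, symmetric]
    assms(1)[unfolded same_space_def, THEN conjunct2, THEN conjunct1, symmetric]
    assms(1)[unfolded same_space_def, THEN conjunct2, THEN conjunct2, THEN conjunct1, symmetric]
    assms(1)[unfolded same_space_def, THEN conjunct2, THEN conjunct2, THEN conjunct2, symmetric]
  have "abelian_group W"
  proof (rule abelian_groupI)
    show "\<exists>y\<in>carrier W. y \<oplus>\<^bsub>W\<^esub> x = \<zero>\<^bsub>W\<^esub>" if "x \<in> carrier W" for x
      using that unfolding e by (intro bexI[of _ "\<ominus>\<^bsub>V\<^esub> x"]) (auto simp: V.l_neg)
  qed (auto simp: e V.a_ac)
  then show ?thesis
    unfolding vect_def vect_axioms_def e
    by (auto simp: V.smult_add_left V.smult_add_right V.smult_assoc)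
qed

lemma linear_map_same_space:
  "same_space V V' \<Longrightarrow> same_space W W' \<Longrightarrow> linear_map V W f \<longleftrightarrow> linear_map V' W' f"
  by (simp add: same_space_def linear_map_def)

lemma bilinear_same_space:
  "same_space V V' \<Longrightarrow> same_space W W' \<Longrightarrow> same_space U U' \<Longrightarrow> bilinear V W U f \<longleftrightarrow> bilinear V' W' U' f"
  by (simp add: bilinear_def linear_map_same_space) (simp add: same_space_def)

lemma finsum_same_space: "same_space V W \<Longrightarrow> finsum V f A = finsum W f A"
  by (simp add: same_space_def finsum_def finprod_def)

lemma tensor_same_space:
  assumes "same_space V V'" "same_space W W'"
  shows "tensor_space V W = tensor_space V' W'" "tens V W = tens V' W'"
    "tensor_rel V W = tensor_rel V' W'"
proof -
  show *: "tensor_rel V W = tensor_rel V' W'"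
    using assms by (simp add: tensor_rel_def same_space_def)
  show "tensor_space V W = tensor_space V' W'" "tens V W = tens V' W'"
    using assms by (auto simp: tensor_space_def tens_def fun_eq_iff * same_space_def)
qed

lemma lin_ext_same_space: "same_space V W \<Longrightarrow> lin_ext V f x = lin_ext W f x"
  by (simp add: lin_ext_def finsum_same_space) (simp add: same_space_def)

lemma tensor_map_same_space:
  assumes "same_space V V'" "same_space W W'"
  shows "tensor_map V W = tensor_map V' W'"
  by (intro ext) (simp add: tensor_map_def tensor_same_space[OF assms])

subsection \<open>Tensor products of algebras\<close>

text \<open>A bilinear product, neither associative nor unital. This much suffices for tensor
  products of algebras, and it is available for the coend before its ring axioms have been
  transferred.\<close>

definition pre_algebra :: "('k::field, 'a, 'x) module_scheme \<Rightarrow> bool" where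
  "pre_algebra A \<longleftrightarrow> vect A \<and> bilinear A A A (monoid.mult A)"

lemma same_space_tensor_alg: "same_space (tensor_alg A B) (tensor_space A B)"
  by (simp add: same_space_def tensor_alg_def)

lemma vect_tensor_alg: "vect (tensor_alg A B)"
  by (rule vect_same_space[OF same_space_sym[OF same_space_tensor_alg] vect_tensor_space])

lemma tensor_alg_carrier [simp]: "carrier (tensor_alg A B) = carrier (tensor_space A B)"
  by (simp add: tensor_alg_def)

text \<open>The product on tensors is a double extension from pairs of generators, so
  \<open>bilinear_ext\<close> gives bilinearity and the value on pure tensors together.\<close>

lemma
  assumes A: "pre_algebra A" and B: "pre_algebra B"
  shows pre_algebra_tensor_alg: "pre_algebra (tensor_alg A B)"
    and tensor_alg_mult_tens:
      "\<lbrakk>a \<in> carrier A; b \<in> carrier B; c \<in> carrier A; d \<in> carrier B\<rbrakk> \<Longrightarrow>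
        tens A B a b \<otimes>\<^bsub>tensor_alg A B\<^esub> tens A B c d = tens A B (a \<otimes>\<^bsub>A\<^esub> c) (b \<otimes>\<^bsub>B\<^esub> d)"
proof -
  let ?T = "tensor_space A B"
  note v = A[unfolded pre_algebra_def, THEN conjunct1] B[unfolded pre_algebra_def, THEN conjunct1]
  note b = A[unfolded pre_algebra_def, THEN conjunct2] B[unfolded pre_algebra_def, THEN conjunct2]
  define m where "m = (\<lambda>s t. ext ?T (\<lambda>(a, b). ext ?T (\<lambda>(c, d). tens A B (a \<otimes>\<^bsub>A\<^esub> c) (b \<otimes>\<^bsub>B\<^esub> d)) t) s)"
  have m: "monoid.mult (tensor_alg A B) = m"
    by (simp add: tensor_alg_def m_def)
  note T = bilinear_tens[OF v] and P = presentation_tensor[OF v]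
  have inner: "bilinear A B ?T (\<lambda>c d. tens A B (a \<otimes>\<^bsub>A\<^esub> c) (b \<otimes>\<^bsub>B\<^esub> d))"
    if "a \<in> carrier A" "b \<in> carrier B" for a b
    by (rule bilinear_comp[OF T bilinear_right[OF b(1) that(1)] bilinear_right[OF b(2) that(2)]])
  have outer: "bilinear A B ?T (\<lambda>a b. tens A B (a \<otimes>\<^bsub>A\<^esub> c) (b \<otimes>\<^bsub>B\<^esub> d))"
    if "c \<in> carrier A" "d \<in> carrier B" for c d
    by (rule bilinear_comp[OF T bilinear_left[OF b(1) that(1)] bilinear_left[OF b(2) that(2)]])
  let ?f = "\<lambda>s t. (\<lambda>(a, b) (c, d). tens A B (a \<otimes>\<^bsub>A\<^esub> c) (b \<otimes>\<^bsub>B\<^esub> d)) s t"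
  have l: "compat ?T (carrier A \<times> carrier B) (tensor_rel A B) (\<lambda>s. ?f s t)"
    if "t \<in> carrier A \<times> carrier B" for t
    using compat_tensor[OF v vect_tensor_space outer, of "fst t" "snd t"] that by (auto simp: case_prod_beta')
  have r: "compat ?T (carrier A \<times> carrier B) (tensor_rel A B) (?f s)"
    if "s \<in> carrier A \<times> carrier B" for s
    using compat_tensor[OF v vect_tensor_space inner, of "fst s" "snd s"] that by (auto simp: case_prod_beta')
  note be = bilinear_ext[where f = ?f, OF vect_tensor_space P P l r, unfolded tensor_space_eq]
  have me: "m = (\<lambda>A' B'. ext ?T (\<lambda>s. ext ?T (?f s) B') A')"
    by (simp add: m_def case_prod_beta')
  have "bilinear ?T ?T ?T m"
    unfolding me by (rule bilinearI; rule be; simp)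
  then show "pre_algebra (tensor_alg A B)"
    unfolding pre_algebra_def
    by (simp add: m vect_tensor_alg
        bilinear_same_space[OF same_space_tensor_alg same_space_tensor_alg same_space_tensor_alg])
  show "tens A B a b \<otimes>\<^bsub>tensor_alg A B\<^esub> tens A B c d = tens A B (a \<otimes>\<^bsub>A\<^esub> c) (b \<otimes>\<^bsub>B\<^esub> d)"
    if "a \<in> carrier A" "b \<in> carrier B" "c \<in> carrier A" "d \<in> carrier B"
    unfolding m me tens_def[of A B a b] tens_def[of A B c d]
    using be(3)[of "(a, b)" "(c, d)"] that by simp
qed

lemma tensor_alg_mult_bilinear:
  assumes A: "pre_algebra A" and B: "pre_algebra B"
  shows "bilinear (tensor_space A B) (tensor_space A B) (tensor_space A B) (monoid.mult (tensor_alg A B))"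
  using pre_algebra_tensor_alg[OF assms]
    bilinear_same_space[OF same_space_tensor_alg same_space_tensor_alg same_space_tensor_alg, of A B A B A B]
  by (simp add: pre_algebra_def)

lemma tensor_map_mult:
  assumes "pre_algebra A" "pre_algebra B" "pre_algebra A'" "pre_algebra B'"
    and f: "linear_map A A' f" and g: "linear_map B B' g"
    and fm: "\<And>x y. \<lbrakk>x \<in> carrier A; y \<in> carrier A\<rbrakk> \<Longrightarrow> f (x \<otimes>\<^bsub>A\<^esub> y) = f x \<otimes>\<^bsub>A'\<^esub> f y"
    and gm: "\<And>x y. \<lbrakk>x \<in> carrier B; y \<in> carrier B\<rbrakk> \<Longrightarrow> g (x \<otimes>\<^bsub>B\<^esub> y) = g x \<otimes>\<^bsub>B'\<^esub> g y"
    and s: "s \<in> carrier (tensor_space A B)" and t: "t \<in> carrier (tensor_space A B)"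
  shows "tensor_map A' B' f g (s \<otimes>\<^bsub>tensor_alg A B\<^esub> t)
    = tensor_map A' B' f g s \<otimes>\<^bsub>tensor_alg A' B'\<^esub> tensor_map A' B' f g t"
proof -
  have v: "vect A" "vect B" "vect A'" "vect B'"
    and b: "bilinear A A A (monoid.mult A)" "bilinear B B B (monoid.mult B)"
    using assms(1-4) by (auto simp: pre_algebra_def)
  note F = linear_map_tensor_map[OF v f g]
  note m = tensor_alg_mult_bilinear[OF assms(1,2)] and m' = tensor_alg_mult_bilinear[OF assms(3,4)]
  note h1 = linear_bilinear_comp[OF F m] and h2 = bilinear_comp[OF m' F F]
  show ?thesis
  proof (rule tensor_linear_eq[OF vect_tensor_space bilinear_left[OF h1 t] bilinear_left[OF h2 t] _ s])
    fix x y assume xy: "x \<in> carrier A" "y \<in> carrier B"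
    then have xyt: "tens A B x y \<in> carrier (tensor_space A B)" by simp
    show "tensor_map A' B' f g (tens A B x y \<otimes>\<^bsub>tensor_alg A B\<^esub> t)
      = tensor_map A' B' f g (tens A B x y) \<otimes>\<^bsub>tensor_alg A' B'\<^esub> tensor_map A' B' f g t"
      by (rule tensor_linear_eq[OF vect_tensor_space bilinear_right[OF h1 xyt] bilinear_right[OF h2 xyt] _ t])
        (use xy v f g in \<open>simp add: tensor_map_tens tensor_alg_mult_tens assms(1-4) fm gm
            bilinear_closed[OF b(1)] bilinear_closed[OF b(2)] linear_map_closed\<close>)
  qed
qed

section \<open>Transfer of the weak bialgebra axioms along surjections\<close>

lemma pre_algebra_ring:
  assumes "pre_algebra A"
    and one: "one A \<in> carrier A"
    and assoc: "\<And>x y z. \<lbrakk>x \<in> carrier A; y \<in> carrier A; z \<in> carrier A\<rbrakk> \<Longrightarrow>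
      x \<otimes>\<^bsub>A\<^esub> y \<otimes>\<^bsub>A\<^esub> z = x \<otimes>\<^bsub>A\<^esub> (y \<otimes>\<^bsub>A\<^esub> z)"
    and unit: "\<And>x. x \<in> carrier A \<Longrightarrow> \<one>\<^bsub>A\<^esub> \<otimes>\<^bsub>A\<^esub> x = x" "\<And>x. x \<in> carrier A \<Longrightarrow> x \<otimes>\<^bsub>A\<^esub> \<one>\<^bsub>A\<^esub> = x"
  shows "ring A"
proof -
  have v: "vect A" and b: "bilinear A A A (monoid.mult A)"
    using assms(1) by (auto simp: pre_algebra_def)
  interpret vect A by fact
  show ?thesis
  proof (rule ringI)
    show "abelian_group A" by unfold_locales
    show "monoid A"
      by (rule monoidI) (simp_all add: bilinear_closed[OF b] one assoc unit)
  qed (simp_all add: linear_map_add[OF bilinear_left[OF b]] linear_map_add[OF bilinear_right[OF b]])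
qed

lemma (in weak_bialgebra) pre_algebra: "pre_algebra H"
proof -
  note rH = weak_bialgebra.axioms(1)[OF weak_bialgebra_axioms]
  have "vect H"
    using module_kfield_iff module_axioms by blast
  moreover have "bilinear H H H (monoid.mult H)"
    by (intro bilinearI linear_mapI)
      (simp_all add: ring.ring_simprules(13,23)[OF rH] smult_mult_left smult_mult_right)
  ultimately show ?thesis by (simp add: pre_algebra_def)
qed

lemma bilinear_mult_kfield: "bilinear kfield kfield kfield (*)"
  by (intro bilinearI linear_mapI) (auto simp: algebra_simps)

lemma bilinear_smult: "vect W \<Longrightarrow> bilinear kfield W W (smult W)"
proof -
  assume "vect W"
  then interpret vect W .
  show ?thesis
    by (intro bilinearI linear_mapI)
      (auto simp: smult_add_left smult_add_right smult_assoc[symmetric] mult.commute)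
qed

text \<open>Elements of \<open>B\<close> have the form \<open>f a\<close>, so both sides of each
  axiom of \<open>B\<close> are images of the two sides of the same axiom of \<open>A\<close>, under
  \<open>f\<close>, \<open>f \<otimes> f\<close> or \<open>f \<otimes> f \<otimes> f\<close>, or
  equal scalars for the axioms on the counit of a product. For \<open>B\<close> itself only
  bilinearity of the product and linearity of comultiplication and counit have to be
  supplied.\<close>

lemma weak_bialgebra_transfer:
  fixes A :: "('k::field, 'a) bialg" and B :: "('k, 'b) bialg"
  assumes "weak_bialgebra A" and pB: "pre_algebra B"
    and dB: "linear_map B (tensor_space B B) (comult B)" and eB: "linear_map B kfield (counit B)"
    and f: "linear_map A B f" and surj: "f ` carrier A = carrier B"
    and f_one: "f \<one>\<^bsub>A\<^esub> = \<one>\<^bsub>B\<^esub>"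
    and f_mult: "\<And>x y. \<lbrakk>x \<in> carrier A; y \<in> carrier A\<rbrakk> \<Longrightarrow> f (x \<otimes>\<^bsub>A\<^esub> y) = f x \<otimes>\<^bsub>B\<^esub> f y"
    and f_counit: "\<And>x. x \<in> carrier A \<Longrightarrow> counit B (f x) = counit A x"
    and f_comult: "\<And>x. x \<in> carrier A \<Longrightarrow> comult B (f x) = tensor_map B B f f (comult A x)"
  shows "wba_surjection A B f"
proof -
  interpret A: weak_bialgebra A by fact
  have rA: "ring A" by (rule weak_bialgebra.axioms(1)[OF assms(1)])
  have pA: "pre_algebra A" by (rule A.pre_algebra)
  have vA: "vect A" and mA: "bilinear A A A (monoid.mult A)"
    using pA by (auto simp: pre_algebra_def)
  have vB: "vect B" and mB: "bilinear B B B (monoid.mult B)"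
    using pB by (auto simp: pre_algebra_def)
  interpret B: vect B by fact
  note dA = A.comult_linear and eA = A.counit_linear
  note clA = linear_map_closed[OF dA]
  note fc = linear_map_closed[OF f]
  let ?T = "tensor_map B B f f"
  let ?T3 = "tensor_map B (tensor_space B B) f ?T"
  note T = linear_map_tensor_map[OF vA vA vB vB f f]
  note vT = vect_tensor_space
  have ex: "\<exists>a\<in>carrier A. x = f a" if "x \<in> carrier B" for x
    using that surj by blast

  have map_comult: "tensor_map (tensor_space B B) B (comult B) id (comult B (f a))
      = tensor_map (tensor_space B B) B ?T f (tensor_map (tensor_space A A) A (comult A) id (comult A a))"
    and map_comult': "tensor_map B (tensor_space B B) id (comult B) (comult B (f a))
      = ?T3 (tensor_map A (tensor_space A A) id (comult A) (comult A a))"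
    if a: "a \<in> carrier A" for a
  proof -
    note d = clA[OF a]
    have l: "linear_map A B (\<lambda>x. id (f x))" "linear_map A B (\<lambda>x. f (id x))"
      "linear_map A (tensor_space B B) (\<lambda>x. comult B (f x))"
      "linear_map A (tensor_space B B) (\<lambda>x. ?T (comult A x))"
      using f linear_map_comp[OF dB f] linear_map_comp[OF T dA] by simp_all
    show "tensor_map (tensor_space B B) B (comult B) id (comult B (f a))
      = tensor_map (tensor_space B B) B ?T f (tensor_map (tensor_space A A) A (comult A) id (comult A a))"
      unfolding f_comult[OF a] tensor_map_comp[OF vA vA vB vB vT vB f f dB linear_map_id(2) d]
        tensor_map_comp[OF vA vA vT vA vT vB dA linear_map_id(2) T f d]
      by (rule tensor_map_cong[OF vA vA vT vB l(3,1) _ _ d]) (simp_all add: f_comult)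
    show "tensor_map B (tensor_space B B) id (comult B) (comult B (f a))
      = ?T3 (tensor_map A (tensor_space A A) id (comult A) (comult A a))"
      unfolding f_comult[OF a] tensor_map_comp[OF vA vA vB vB vB vT f f linear_map_id(2) dB d]
        tensor_map_comp[OF vA vA vA vT vB vT linear_map_id(2) dA f T d]
      by (rule tensor_map_cong[OF vA vA vB vT l(1,3) _ _ d]) (simp_all add: f_comult)
  qed
  have tmA: "linear_map (tensor_space A A) (tensor_space (tensor_space A A) A)
      (tensor_map (tensor_space A A) A (comult A) id)"
    by (rule linear_map_tensor_map[OF vA vA vT vA dA linear_map_id(2)])
  have assoc_nat: "tensor_assoc B B B (tensor_map (tensor_space B B) B ?T f t) = ?T3 (tensor_assoc A A A t)"
    if "t \<in> carrier (tensor_space (tensor_space A A) A)" for t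
    by (rule tensor_assoc_natural[OF vA vA vA vB vB vB f f f that])
  have map_one: "tensor_assoc B B B (tensor_map (tensor_space B B) B (comult B) id (comult B (f a)))
      = ?T3 (tensor_assoc A A A (tensor_map (tensor_space A A) A (comult A) id (comult A a)))"
    if a: "a \<in> carrier A" for a
    unfolding map_comult[OF a] by (rule assoc_nat[OF linear_map_closed[OF tmA clA[OF a]]])
  have T_mult: "?T (s \<otimes>\<^bsub>tensor_alg A A\<^esub> t) = ?T s \<otimes>\<^bsub>tensor_alg B B\<^esub> ?T t"
    if "s \<in> carrier (tensor_space A A)" "t \<in> carrier (tensor_space A A)" for s t
    by (rule tensor_map_mult[OF pA pA pB pB f f f_mult f_mult that])
  have T3_mult: "?T3 (s \<otimes>\<^bsub>tensor_alg A (tensor_alg A A)\<^esub> t)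
      = ?T3 s \<otimes>\<^bsub>tensor_alg B (tensor_alg B B)\<^esub> ?T3 t"
    if "s \<in> carrier (tensor_space A (tensor_space A A))" "t \<in> carrier (tensor_space A (tensor_space A A))" for s t
  proof -
    \<comment> \<open>The product on the triple tensor power is that of
      \<open>tensor_alg A (tensor_alg A A)\<close>, while \<open>?T3\<close> is built over plain
      tensor spaces. The underlying spaces coincide, so \<open>tensor_map_mult\<close> can be
      applied and translated back.\<close>
    have ss: "same_space (tensor_alg A A) (tensor_space A A)" "same_space (tensor_alg B B) (tensor_space B B)"
      by (rule same_space_tensor_alg)+
    have T': "linear_map (tensor_alg A A) (tensor_alg B B) ?T"
      using T linear_map_same_space[OF ss] by blast
    have eq: "tensor_map B (tensor_alg B B) = tensor_map B (tensor_space B B)"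
      "tensor_space A (tensor_alg A A) = tensor_space A (tensor_space A A)"
      using tensor_map_same_space[OF same_space_refl ss(2)]
        tensor_same_space(1)[OF same_space_refl ss(1)] by auto
    have "tensor_map B (tensor_alg B B) f ?T (s \<otimes>\<^bsub>tensor_alg A (tensor_alg A A)\<^esub> t)
      = tensor_map B (tensor_alg B B) f ?T s \<otimes>\<^bsub>tensor_alg B (tensor_alg B B)\<^esub> tensor_map B (tensor_alg B B) f ?T t"
      by (rule tensor_map_mult[OF pA pre_algebra_tensor_alg[OF pA pA] pB pre_algebra_tensor_alg[OF pB pB] f T'])
        (simp_all only: f_mult T_mult eq tensor_alg_carrier that)
    then show ?thesis by (simp only: eq)
  qed
  have one: "\<one>\<^bsub>A\<^esub> \<in> carrier A" by simp
  have dA1: "comult A \<one>\<^bsub>A\<^esub> \<in> carrier (tensor_space A A)" by (rule clA[OF one])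
  let ?l = "tensor_assoc A A A (tens (tensor_space A A) A (comult A \<one>\<^bsub>A\<^esub>) \<one>\<^bsub>A\<^esub>)"
  let ?r = "tens A (tensor_space A A) \<one>\<^bsub>A\<^esub> (comult A \<one>\<^bsub>A\<^esub>)"
  have cl: "?l \<in> carrier (tensor_space A (tensor_space A A))" "?r \<in> carrier (tensor_space A (tensor_space A A))"
    using linear_map_closed[OF linear_map_tensor_assoc[OF vA vA vA]] dA1 one by auto
  have Tl: "?T3 ?l = tensor_assoc B B B (tens (tensor_space B B) B (comult B \<one>\<^bsub>B\<^esub>) \<one>\<^bsub>B\<^esub>)"
    using assoc_nat[symmetric, of "tens (tensor_space A A) A (comult A \<one>\<^bsub>A\<^esub>) \<one>\<^bsub>A\<^esub>"] dA1 one
    by (simp add: tensor_map_tens[OF vT vA vT vB T f dA1 one] f_one f_comult[OF one, symmetric])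
  have Tr: "?T3 ?r = tens B (tensor_space B B) \<one>\<^bsub>B\<^esub> (comult B \<one>\<^bsub>B\<^esub>)"
    by (simp add: tensor_map_tens[OF vA vT vB vT f T one dA1] f_one f_comult[OF one, symmetric])

  have "ring B"
  proof (rule pre_algebra_ring[OF pB])
    show "\<one>\<^bsub>B\<^esub> \<in> carrier B" using fc[OF one] by (simp add: f_one)
    fix x assume "x \<in> carrier B"
    then obtain a where a: "a \<in> carrier A" "x = f a" using ex by blast
    show "\<one>\<^bsub>B\<^esub> \<otimes>\<^bsub>B\<^esub> x = x" "x \<otimes>\<^bsub>B\<^esub> \<one>\<^bsub>B\<^esub> = x"
      unfolding a(2) f_one[symmetric] using a one by (simp_all flip: f_mult)
    fix y z assume "y \<in> carrier B" "z \<in> carrier B"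
    then obtain b c where bc: "b \<in> carrier A" "y = f b" "c \<in> carrier A" "z = f c" using ex by metis
    show "x \<otimes>\<^bsub>B\<^esub> y \<otimes>\<^bsub>B\<^esub> z = x \<otimes>\<^bsub>B\<^esub> (y \<otimes>\<^bsub>B\<^esub> z)"
      unfolding a(2) bc using a bc by (simp add: monoid.m_assoc[OF ring.is_monoid[OF rA]] flip: f_mult)
  qed
  moreover have "Module.module kfield B" using vB module_kfield_iff by blast
  moreover have "weak_bialgebra_axioms B"
  proof (unfold_locales; (rule dB eB)?)
    fix x y c assume "x \<in> carrier B" "y \<in> carrier B"
    then show "c \<odot>\<^bsub>B\<^esub> x \<otimes>\<^bsub>B\<^esub> y = c \<odot>\<^bsub>B\<^esub> (x \<otimes>\<^bsub>B\<^esub> y)" "x \<otimes>\<^bsub>B\<^esub> (c \<odot>\<^bsub>B\<^esub> y) = c \<odot>\<^bsub>B\<^esub> (x \<otimes>\<^bsub>B\<^esub> y)"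
      by (simp_all add: linear_map_smult[OF bilinear_left[OF mB]] linear_map_smult[OF bilinear_right[OF mB]])
  next
    fix x assume "x \<in> carrier B"
    then obtain a where a: "a \<in> carrier A" and x: "x = f a" using ex by blast
    note d = clA[OF a]
    show "tensor_assoc B B B (tensor_map (tensor_space B B) B (comult B) id (comult B x))
      = tensor_map B (tensor_space B B) id (comult B) (comult B x)"
      unfolding x map_one[OF a] A.coassoc[OF a] map_comult'[OF a] ..
    have b1: "bilinear A A A (\<lambda>x' x''. counit A x' \<odot>\<^bsub>A\<^esub> x'')"
      "bilinear A A A (\<lambda>x' x''. counit A x'' \<odot>\<^bsub>A\<^esub> x')"
      "bilinear B B B (\<lambda>x' x''. counit B x' \<odot>\<^bsub>B\<^esub> x'')"
      "bilinear B B B (\<lambda>x' x''. counit B x'' \<odot>\<^bsub>B\<^esub> x')"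
      using bilinear_comp[OF bilinear_smult[OF vA] eA linear_map_id(1)]
        bilinear_comp[OF bilinear_smult[OF vB] eB linear_map_id(1)] by (auto dest: bilinear_flip)
    \<comment> \<open>After pulling back along \<open>f \<otimes> f\<close>, the contracted
      expression is \<open>f\<close> applied to the one in the counit axiom of \<open>A\<close>;
      then \<open>f\<close> moves out of the contraction.\<close>
    have "ext B (\<lambda>(x', x''). counit B (f x') \<odot>\<^bsub>B\<^esub> f x'') (comult A a)
      = ext B (\<lambda>(x', x''). f (counit A x' \<odot>\<^bsub>A\<^esub> x'')) (comult A a)"
      using bilinear_comp[OF b1(3) f f]
      by (intro ext_tensor_cong[OF vA vA vB _ _ d]) (simp_all add: f_counit linear_map_smult[OF f])
    also have "\<dots> = f a"
      by (simp add: linear_map_ext_comp[OF vA vA vA vB b1(1) f d, symmetric] A.counit_left a)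
    finally show "ext B (\<lambda>(x', x''). counit B x' \<odot>\<^bsub>B\<^esub> x'') (comult B x) = x"
      by (simp add: x f_comult[OF a] ext_tensor_map[OF vA vA vB vB vB f f b1(3) d])
    have "ext B (\<lambda>(x', x''). counit B (f x'') \<odot>\<^bsub>B\<^esub> f x') (comult A a)
      = ext B (\<lambda>(x', x''). f (counit A x'' \<odot>\<^bsub>A\<^esub> x')) (comult A a)"
      using bilinear_comp[OF b1(4) f f]
      by (intro ext_tensor_cong[OF vA vA vB _ _ d]) (simp_all add: f_counit linear_map_smult[OF f])
    also have "\<dots> = f a"
      by (simp add: linear_map_ext_comp[OF vA vA vA vB b1(2) f d, symmetric] A.counit_right a)
    finally show "ext B (\<lambda>(x', x''). counit B x'' \<odot>\<^bsub>B\<^esub> x') (comult B x) = x"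
      by (simp add: x f_comult[OF a] ext_tensor_map[OF vA vA vB vB vB f f b1(4) d])
  next
    fix x y assume "x \<in> carrier B" "y \<in> carrier B"
    then obtain a b where ab: "a \<in> carrier A" "x = f a" "b \<in> carrier A" "y = f b" using ex by metis
    then show "comult B (x \<otimes>\<^bsub>B\<^esub> y) = comult B x \<otimes>\<^bsub>tensor_alg B B\<^esub> comult B y"
      by (simp add: f_comult T_mult[symmetric] clA A.comult_mult[symmetric] f_mult[symmetric])
  next
    fix x y z assume "x \<in> carrier B" "y \<in> carrier B" "z \<in> carrier B"
    then obtain a b c where abc: "a \<in> carrier A" "b \<in> carrier A" "c \<in> carrier A"
      and e: "x = f a" "y = f b" "z = f c" using ex by metis
    note d = clA[OF abc(2)] and m = bilinear_closed[OF mA]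
    have l: "linear_map A kfield (\<lambda>x. counit A (x \<otimes>\<^bsub>A\<^esub> c))" "linear_map A kfield (\<lambda>x. counit A (a \<otimes>\<^bsub>A\<^esub> x))"
      "linear_map B kfield (\<lambda>x. counit B (x \<otimes>\<^bsub>B\<^esub> f c))" "linear_map B kfield (\<lambda>x. counit B (f a \<otimes>\<^bsub>B\<^esub> x))"
      using abc fc by (auto intro: linear_map_comp[OF eA bilinear_left[OF mA]] linear_map_comp[OF eA bilinear_right[OF mA]]
          linear_map_comp[OF eB bilinear_left[OF mB]] linear_map_comp[OF eB bilinear_right[OF mB]])
    have bl: "bilinear A A kfield (\<lambda>y' y''. counit A (a \<otimes>\<^bsub>A\<^esub> y') * counit A (y'' \<otimes>\<^bsub>A\<^esub> c))"
      "bilinear A A kfield (\<lambda>y' y''. counit A (a \<otimes>\<^bsub>A\<^esub> y'') * counit A (y' \<otimes>\<^bsub>A\<^esub> c))"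
      "bilinear B B kfield (\<lambda>y' y''. counit B (f a \<otimes>\<^bsub>B\<^esub> y') * counit B (y'' \<otimes>\<^bsub>B\<^esub> f c))"
      "bilinear B B kfield (\<lambda>y' y''. counit B (f a \<otimes>\<^bsub>B\<^esub> y'') * counit B (y' \<otimes>\<^bsub>B\<^esub> f c))"
      using bilinear_comp[OF bilinear_mult_kfield l(2,1)] bilinear_comp[OF bilinear_mult_kfield l(4,3)]
        bilinear_flip[OF bilinear_comp[OF bilinear_mult_kfield l(2,1)]]
        bilinear_flip[OF bilinear_comp[OF bilinear_mult_kfield l(4,3)]] by simp_all
    have q: "counit B (f a \<otimes>\<^bsub>B\<^esub> f b \<otimes>\<^bsub>B\<^esub> f c) = counit A (a \<otimes>\<^bsub>A\<^esub> b \<otimes>\<^bsub>A\<^esub> c)"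
      using abc by (simp add: m f_counit flip: f_mult)
    show "counit B (x \<otimes>\<^bsub>B\<^esub> y \<otimes>\<^bsub>B\<^esub> z)
      = ext kfield (\<lambda>(y', y''). counit B (x \<otimes>\<^bsub>B\<^esub> y') * counit B (y'' \<otimes>\<^bsub>B\<^esub> z)) (comult B y)"
      unfolding e f_comult[OF abc(2)] ext_tensor_map[OF vA vA vB vB vect_kfield f f bl(3) d]
        q A.counit_mult[OF abc]
      using abc by (intro ext_tensor_cong[OF vA vA vect_kfield bl(1) _ d]) (simp add: m f_counit flip: f_mult)
    show "counit B (x \<otimes>\<^bsub>B\<^esub> y \<otimes>\<^bsub>B\<^esub> z)
      = ext kfield (\<lambda>(y', y''). counit B (x \<otimes>\<^bsub>B\<^esub> y'') * counit B (y' \<otimes>\<^bsub>B\<^esub> z)) (comult B y)"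
      unfolding e f_comult[OF abc(2)] ext_tensor_map[OF vA vA vB vB vect_kfield f f bl(4) d]
        q A.counit_mult'[OF abc]
      using abc by (intro ext_tensor_cong[OF vA vA vect_kfield bl(2) _ d]) (simp add: m f_counit flip: f_mult)
  next
    show "tensor_assoc B B B (tensor_map (tensor_space B B) B (comult B) id (comult B \<one>\<^bsub>B\<^esub>))
      = tensor_assoc B B B (tens (tensor_space B B) B (comult B \<one>\<^bsub>B\<^esub>) \<one>\<^bsub>B\<^esub>)
         \<otimes>\<^bsub>tensor_alg B (tensor_alg B B)\<^esub> tens B (tensor_space B B) \<one>\<^bsub>B\<^esub> (comult B \<one>\<^bsub>B\<^esub>)"
      using map_one[OF one] A.comult_one T3_mult[OF cl] Tl Tr by (simp add: f_one)
    show "tensor_assoc B B B (tensor_map (tensor_space B B) B (comult B) id (comult B \<one>\<^bsub>B\<^esub>))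
      = tens B (tensor_space B B) \<one>\<^bsub>B\<^esub> (comult B \<one>\<^bsub>B\<^esub>) \<otimes>\<^bsub>tensor_alg B (tensor_alg B B)\<^esub>
         tensor_assoc B B B (tens (tensor_space B B) B (comult B \<one>\<^bsub>B\<^esub>) \<one>\<^bsub>B\<^esub>)"
      using map_one[OF one] A.comult_one' T3_mult[OF cl(2,1)] Tl Tr by (simp add: f_one)
  qed
  ultimately have "weak_bialgebra B" by (simp add: weak_bialgebra_def)
  then show ?thesis
    unfolding wba_surjection_def wba_hom_def
    using assms(1) f f_one f_mult f_counit f_comult surj by blast
qed

section \<open>Paths in a finite directed graph\<close>

context fin_digraph
begin

lemma Vertex_in_paths [simp]: "Vertex v \<in> paths G n \<longleftrightarrow> n = 0 \<and> v \<in> verts G"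
  by (auto simp: paths_def)

lemma Edges_in_paths [simp]:
  "Edges es \<in> paths G n \<longleftrightarrow>
    n \<noteq> 0 \<and> length es = n \<and> set es \<subseteq> arcs G \<and> successively (\<lambda>a b. tail G a = head G b) es"
  by (auto simp: paths_def successively_conv_nth)

lemma paths_0: "paths G 0 = Vertex ` verts G"
  by (simp add: paths_def)

lemma plen_paths [simp]: "p \<in> paths G n \<Longrightarrow> plen p = n"
  by (cases p) auto

lemma finite_paths [simp, intro]: "finite (paths G n)"
proof -
  have "finite {es. set es \<subseteq> arcs G \<and> length es = n}"
    by (rule finite_lists_length_eq) simp
  then have "finite (Vertex ` verts G \<union> Edges ` {es. set es \<subseteq> arcs G \<and> length es = n})" by simp
  moreover have "paths G n \<subseteq> Vertex ` verts G \<union> Edges ` {es. set es \<subseteq> arcs G \<and> length es = n}"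
    by (auto simp: paths_def)
  ultimately show ?thesis by (rule finite_subset[rotated])
qed

lemma psrc_in_verts [simp]: "p \<in> paths G n \<Longrightarrow> psrc G p \<in> verts G"
  by (cases p) (use last_in_set in \<open>fastforce simp: subset_iff\<close>)+

lemma ptgt_in_verts [simp]: "p \<in> paths G n \<Longrightarrow> ptgt G p \<in> verts G"
  by (cases p) (use hd_in_set in \<open>fastforce simp: subset_iff\<close>)+

lemma
  assumes "p \<in> paths G n" "r \<in> paths G m" "psrc G p = ptgt G r"
  shows pcat_in_paths: "pcat p r \<in> paths G (n + m)"
    and psrc_pcat: "psrc G (pcat p r) = psrc G r"
    and ptgt_pcat: "ptgt G (pcat p r) = ptgt G p"
  using assms by (cases p; cases r; auto simp: successively_append_iff)+

lemma pcat_Vertex_right [simp]: "psrc G p = v \<Longrightarrow> pcat p (Vertex v) = p"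
  by (cases p) auto

lemma pcat_assoc: "pcat (pcat p q) r = pcat p (pcat q r)"
  by (cases p; cases q; cases r) auto

text \<open>With the lengths fixed, a list splits in one way only. If one factor is a vertex, it is
  determined by the other factor through composability.\<close>

lemma pcat_inject:
  assumes "p \<in> paths G n" "q \<in> paths G n" "r \<in> paths G m" "s \<in> paths G m"
    and "psrc G p = ptgt G r" "psrc G q = ptgt G s"
  shows "pcat p r = pcat q s \<longleftrightarrow> p = q \<and> r = s"
  using assms by (cases p; cases q; cases r; cases s) auto

text \<open>The list is cut after \<open>n\<close> entries. For \<open>n = 0\<close> or
  \<open>m = 0\<close> the missing factor is the vertex at the target or at the source of the whole
  path.\<close>

lemma pcat_cases:
  assumes "t \<in> paths G (n + m)"
  obtains p r where "p \<in> paths G n" "r \<in> paths G m" "psrc G p = ptgt G r" "t = pcat p r"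
proof (cases t)
  case (Vertex v)
  then show ?thesis using assms that[of "Vertex v" "Vertex v"] by auto
next
  case (Edges es)
  with assms have es: "length es = n + m" "set es \<subseteq> arcs G" "n + m \<noteq> 0"
    "successively (\<lambda>a b. tail G a = head G b) (take n es @ drop n es)" by auto
  have ne: "es \<noteq> []" using es by auto
  consider "n = 0" | "m = 0" | "n \<noteq> 0" "m \<noteq> 0" by auto
  then show ?thesis
  proof cases
    case 1
    then show ?thesis
      using that[of "Vertex (head G (hd es))" "Edges es"] assms Edges hd_in_set[OF ne] by auto
  next
    case 2
    then show ?thesis
      using that[of "Edges es" "Vertex (tail G (last es))"] assms Edges last_in_set[OF ne] by auto
  next
    case 3
    have "set (take n es) \<subseteq> arcs G" "set (drop n es) \<subseteq> arcs G"
      using es(2) set_take_subset[of n es] set_drop_subset[of n es] by auto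
    moreover have "tail G (last (take n es)) = head G (hd (drop n es))"
      using es(4)[unfolded successively_append_iff] es(1) 3 by auto
    ultimately show ?thesis
      using that[of "Edges (take n es)" "Edges (drop n es)"] es(1) es(4)[unfolded successively_append_iff] 3 Edges
      by auto
  qed
qed

text \<open>Unique factorisation makes concatenation a bijection from composable pairs onto
  \<open>paths G (n + m)\<close>. In this form it regroups the double sum in a product of two
  comultiplications.\<close>

lemma finsum_paths_add:
  assumes W: "vect W" and g: "\<And>w. w \<in> paths G (n + m) \<Longrightarrow> g w \<in> carrier W"
  shows "(\<Oplus>\<^bsub>W\<^esub>u\<in>paths G n. \<Oplus>\<^bsub>W\<^esub>v\<in>paths G m. if psrc G u = ptgt G v then g (pcat u v) else \<zero>\<^bsub>W\<^esub>)
    = (\<Oplus>\<^bsub>W\<^esub>w\<in>paths G (n + m). g w)"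
proof -
  interpret W: vect W by fact
  let ?A = "{(u, v) \<in> paths G n \<times> paths G m. psrc G u = ptgt G v}"
  let ?h = "\<lambda>(u, v). if psrc G u = ptgt G v then g (pcat u v) else \<zero>\<^bsub>W\<^esub>"
  have img: "(\<lambda>(u, v). pcat u v) ` ?A = paths G (n + m)"
    by (auto intro: pcat_in_paths elim!: pcat_cases)
  have "(\<Oplus>\<^bsub>W\<^esub>u\<in>paths G n. \<Oplus>\<^bsub>W\<^esub>v\<in>paths G m. if psrc G u = ptgt G v then g (pcat u v) else \<zero>\<^bsub>W\<^esub>)
    = (\<Oplus>\<^bsub>W\<^esub>x\<in>paths G n \<times> paths G m. ?h x)"
    by (subst W.finsum_Sigma) (auto intro!: g pcat_in_paths)
  also have "\<dots> = (\<Oplus>\<^bsub>W\<^esub>x\<in>?A. ?h x)"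
    by (rule W.finsum_mono_neutral[symmetric]) (auto intro!: g pcat_in_paths split: if_splits)
  also have "\<dots> = (\<Oplus>\<^bsub>W\<^esub>x\<in>?A. g ((\<lambda>(u, v). pcat u v) x))"
    by (rule W.finsum_cong') (auto intro!: g pcat_in_paths)
  also have "\<dots> = (\<Oplus>\<^bsub>W\<^esub>w\<in>(\<lambda>(u, v). pcat u v) ` ?A. g w)"
    by (rule W.finsum_reindex[symmetric]) (unfold img, use g in \<open>auto simp: inj_on_def pcat_inject\<close>)
  finally show ?thesis unfolding img .
qed

end

section \<open>The weak bialgebra of a finite directed graph\<close>

text \<open>The graph does not mention the ground field; the \<open>itself\<close> parameter ties
  the type \<open>'k\<close> to the locale.\<close>

locale graph_algebra = fin_digraph G for G :: "('v, 'e) pre_digraph" +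
  fixes field_type :: "'k::field itself"
begin

abbreviation H :: "('k, ('v, 'e) gpath \<times> ('v, 'e) gpath \<Rightarrow>\<^sub>0 'k) bialg" where
  "H \<equiv> graph_wba G"

abbreviation P :: "nat \<Rightarrow> ('v, 'e) gpath set" where
  "P \<equiv> paths G"

abbreviation composable :: "('v, 'e) gpath \<Rightarrow> ('v, 'e) gpath \<Rightarrow> bool" where
  "composable p r \<equiv> psrc G p = ptgt G r"

definition pairs :: "(('v, 'e) gpath \<times> ('v, 'e) gpath) set" where
  "pairs = (\<Union>n. P n \<times> P n)"

definition gmult :: "('v, 'e) gpath \<times> ('v, 'e) gpath \<Rightarrow> ('v, 'e) gpath \<times> ('v, 'e) gpath \<Rightarrow>
    (('v, 'e) gpath \<times> ('v, 'e) gpath) \<Rightarrow>\<^sub>0 'k" where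
  "gmult = (\<lambda>(p, q) (r, s).
    if composable p r \<and> composable q s then gen (pcat p r, pcat q s) else 0)"

lemma pairsI [simp, intro]: "p \<in> P n \<Longrightarrow> q \<in> P n \<Longrightarrow> (p, q) \<in> pairs"
  by (auto simp: pairs_def)

lemma pairsE:
  assumes "x \<in> pairs" obtains p q n where "x = (p, q)" "p \<in> P n" "q \<in> P n"
  using assms by (auto simp: pairs_def)

lemma graph_space_eq: "graph_space G = free_space pairs"
  by (simp add: graph_space_def pairs_def)

lemma same_space_H: "same_space H (free_space pairs)"
  by (simp add: same_space_def graph_wba_def graph_space_eq Let_def)

lemma H_simps:
  "carrier H = {x. Poly_Mapping.keys x \<subseteq> pairs}" "ring.zero H = 0" "add H = (+)" "smult H = pscale"
  by (simp_all add: graph_wba_def graph_space_eq Let_def)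

lemma vect_H: "vect H"
  by (rule vect_same_space[OF same_space_sym[OF same_space_H] vect_free_space])

sublocale H: vect H by (rule vect_H)

lemma gen_in_H [simp, intro]: "p \<in> P n \<Longrightarrow> q \<in> P n \<Longrightarrow> gen (p, q) \<in> carrier H"
  by (auto simp: H_simps)

lemma zero_in_H [simp, intro]: "0 \<in> carrier H"
  by (simp add: H_simps)

lemma H_linear_eq:
  assumes "vect W" "linear_map H W F" "linear_map H W F'"
    and "\<And>p q n. \<lbrakk>p \<in> P n; q \<in> P n\<rbrakk> \<Longrightarrow> F (gen (p, q)) = F' (gen (p, q))" and "x \<in> carrier H"
  shows "F x = F' x"
proof (rule free_space_linear_eq[OF assms(1)])
  show "linear_map (free_space pairs) W F" "linear_map (free_space pairs) W F'"
    using assms(2,3) linear_map_same_space[OF same_space_H same_space_refl] by blast+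
  show "F (gen s) = F' (gen s)" if "s \<in> pairs" for s
    using that assms(4) by (auto elim!: pairsE)
  show "x \<in> carrier (free_space pairs)" using assms(5) by (simp add: H_simps)
qed

lemma gmult_closed [simp]:
  "\<lbrakk>p \<in> P n; q \<in> P n; r \<in> P m; s \<in> P m\<rbrakk> \<Longrightarrow> gmult (p, q) (r, s) \<in> carrier H"
  by (auto simp: gmult_def intro!: pcat_in_paths gen_in_H)

lemma H_mult: "monoid.mult H = (\<lambda>x y. lin_ext H (\<lambda>s. lin_ext H (gmult s) y) x)"
proof -
  have "monoid.mult H = (\<lambda>x y. lin_ext (free_space pairs) (\<lambda>s. lin_ext (free_space pairs) (gmult s) y) x)"
    by (simp add: graph_wba_def graph_space_eq Let_def gmult_def case_prod_beta')
  then show ?thesis by (simp add: lin_ext_same_space[OF same_space_H])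
qed

lemma linear_gmult: "s \<in> pairs \<Longrightarrow> linear_map H H (lin_ext H (gmult s))"
proof (elim pairsE)
  fix p q n assume "s = (p, q)" "p \<in> P n" "q \<in> P n"
  then have "gmult s \<in> pairs \<rightarrow> carrier H" by (auto elim!: pairsE)
  from linear_map_lin_ext[OF vect_H this] show "linear_map H H (lin_ext H (gmult s))"
    using linear_map_same_space[OF same_space_H same_space_refl] by blast
qed

lemma bilinear_H_mult: "bilinear H H H (monoid.mult H)"
proof (rule bilinearI)
  fix x assume x: "x \<in> carrier H"
  then show "linear_map H H (monoid.mult H x)"
    unfolding H_mult using linear_gmult
    by (intro linear_map_lin_ext_param[OF vect_H vect_H]) (auto simp: H_simps)
next
  fix y assume y: "y \<in> carrier H"
  have "(\<lambda>s. lin_ext H (gmult s) y) \<in> pairs \<rightarrow> carrier H"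
    using linear_map_closed[OF linear_gmult y] by auto
  from linear_map_lin_ext[OF vect_H this] show "linear_map H H (\<lambda>x. x \<otimes>\<^bsub>H\<^esub> y)"
    unfolding H_mult using linear_map_same_space[OF same_space_H same_space_refl] by blast
qed

lemma H_mult_gen:
  assumes "p \<in> P n" "q \<in> P n" "r \<in> P m" "s \<in> P m"
  shows "gen (p, q) \<otimes>\<^bsub>H\<^esub> gen (r, s) = gmult (p, q) (r, s)"
proof -
  have 1: "lin_ext H (gmult (p, q)) (gen (r, s)) = gmult (p, q) (r, s)"
    by (rule lin_ext_gen[OF vect_H]) (use assms in simp)
  show ?thesis
    unfolding H_mult by (subst lin_ext_gen[OF vect_H]) (use assms 1 in simp_all)
qed

lemma pre_algebra_H: "pre_algebra H"
  by (simp add: pre_algebra_def vect_H bilinear_H_mult)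

lemma H_mult_zero [simp]:
  "x \<in> carrier H \<Longrightarrow> x \<otimes>\<^bsub>H\<^esub> 0 = 0" "x \<in> carrier H \<Longrightarrow> 0 \<otimes>\<^bsub>H\<^esub> x = 0"
  using linear_map_zero[OF vect_H vect_H bilinear_right[OF bilinear_H_mult]]
    linear_map_zero[OF vect_H vect_H bilinear_left[OF bilinear_H_mult]] by (simp_all add: H_simps)

lemma H_one: "\<one>\<^bsub>H\<^esub> = (\<Oplus>\<^bsub>H\<^esub>j\<in>P 0. \<Oplus>\<^bsub>H\<^esub>l\<in>P 0. gen (j, l))"
proof -
  have fs: "finsum H f A = sum f A" if "f \<in> A \<rightarrow> carrier H" for f :: "('v, 'e) gpath \<Rightarrow> _" and A
    by (rule finsum_eq_sum[OF vect_H _ _ that]) (simp_all add: H_simps)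
  have "(\<Oplus>\<^bsub>H\<^esub>l\<in>P 0. gen (j, l)) = (\<Sum>l\<in>P 0. gen (j, l))" if "j \<in> P 0" for j
    using that by (intro fs) auto
  moreover from this have "(\<Sum>l\<in>P 0. gen (j, l)) \<in> carrier H" if "j \<in> P 0" for j
    using that by (metis (no_types, lifting) H.finsum_closed Pi_I gen_in_H)
  ultimately have "(\<Oplus>\<^bsub>H\<^esub>j\<in>P 0. \<Oplus>\<^bsub>H\<^esub>l\<in>P 0. gen (j, l)) = (\<Sum>j\<in>P 0. \<Sum>l\<in>P 0. gen (j, l))"
    by (subst fs) auto
  then show ?thesis
    by (simp add: graph_wba_def Let_def paths_0 sum.reindex inj_on_def)
qed

lemma H_one_closed [simp, intro]: "\<one>\<^bsub>H\<^esub> \<in> carrier H"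
  unfolding H_one by (intro H.finsum_closed) (auto intro!: H.finsum_closed)

lemma gmult_Vertex:
  assumes "j \<in> P 0" "l \<in> P 0" "p \<in> P n" "q \<in> P n"
  shows "gmult (j, l) (p, q) = (if Vertex (ptgt G p) = j then if Vertex (ptgt G q) = l then gen (p, q) else 0 else 0)"
    and "gmult (p, q) (j, l) = (if Vertex (psrc G p) = j then if Vertex (psrc G q) = l then gen (p, q) else 0 else 0)"
  using assms by (auto simp: paths_0 gmult_def)

lemma finsum_delta2:
  assumes "vect W" "finite A" "finite B" "a \<in> A" "b \<in> B" "f a b \<in> carrier W"
  shows "(\<Oplus>\<^bsub>W\<^esub>j\<in>A. \<Oplus>\<^bsub>W\<^esub>l\<in>B. if a = j then if b = l then f j l else \<zero>\<^bsub>W\<^esub> else \<zero>\<^bsub>W\<^esub>) = f a b"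
proof -
  interpret W: vect W by fact
  have "(\<Oplus>\<^bsub>W\<^esub>j\<in>A. \<Oplus>\<^bsub>W\<^esub>l\<in>B. if a = j then if b = l then f j l else \<zero>\<^bsub>W\<^esub> else \<zero>\<^bsub>W\<^esub>)
    = (\<Oplus>\<^bsub>W\<^esub>j\<in>A. if a = j then f j b else \<zero>\<^bsub>W\<^esub>)"
  proof (rule W.finsum_cong'[OF refl])
    fix j assume "j \<in> A"
    show "(\<Oplus>\<^bsub>W\<^esub>l\<in>B. if a = j then if b = l then f j l else \<zero>\<^bsub>W\<^esub> else \<zero>\<^bsub>W\<^esub>) = (if a = j then f j b else \<zero>\<^bsub>W\<^esub>)"
      using W.finsum_delta[of B b "f a"] assms by auto
  qed (use assms in auto)
  then show ?thesis using W.finsum_delta[of A a "\<lambda>j. f j b"] assms by simp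
qed

text \<open>Of the double sum for the unit only one term acts on \<open>[p|q]\<close>: the pair of
  targets of \<open>p\<close> and \<open>q\<close> from the left, the pair of their sources from the
  right.\<close>

lemma H_one_mult:
  assumes "x \<in> carrier H"
  shows "\<one>\<^bsub>H\<^esub> \<otimes>\<^bsub>H\<^esub> x = x" "x \<otimes>\<^bsub>H\<^esub> \<one>\<^bsub>H\<^esub> = x"
proof -
  note m = bilinear_H_mult
  have Z: "\<zero>\<^bsub>H\<^esub> = 0" by (simp add: H_simps)
  have cl: "(\<lambda>l. gen (j, l)) \<in> P 0 \<rightarrow> carrier H" if "j \<in> P 0" for j using that by auto
  have cl': "(\<lambda>j. \<Oplus>\<^bsub>H\<^esub>l\<in>P 0. gen (j, l)) \<in> P 0 \<rightarrow> carrier H" using H.finsum_closed[OF cl] by auto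
  show "\<one>\<^bsub>H\<^esub> \<otimes>\<^bsub>H\<^esub> x = x"
  proof (rule H_linear_eq[OF vect_H bilinear_right[OF m H_one_closed] linear_map_id(1) _ assms])
    fix p q n assume pq: "p \<in> P n" "q \<in> P n"
    note l = bilinear_left[OF m gen_in_H[OF pq]]
    have "\<one>\<^bsub>H\<^esub> \<otimes>\<^bsub>H\<^esub> gen (p, q) = (\<Oplus>\<^bsub>H\<^esub>j\<in>P 0. \<Oplus>\<^bsub>H\<^esub>l\<in>P 0. gen (j, l) \<otimes>\<^bsub>H\<^esub> gen (p, q))"
      unfolding H_one linear_map_finsum[OF vect_H vect_H l cl']
      using linear_map_finsum[OF vect_H vect_H l cl] linear_map_closed[OF l]
      by (intro H.finsum_cong') (auto intro!: H.finsum_closed)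
    also have "\<dots> = (\<Oplus>\<^bsub>H\<^esub>j\<in>P 0. \<Oplus>\<^bsub>H\<^esub>l\<in>P 0. if Vertex (ptgt G p) = j then if Vertex (ptgt G q) = l then gen (p, q) else \<zero>\<^bsub>H\<^esub> else \<zero>\<^bsub>H\<^esub>)"
      using pq by (intro H.finsum_cong' refl) (auto simp: H_mult_gen gmult_Vertex Z intro!: H.finsum_closed)
    also have "\<dots> = gen (p, q)"
      using pq by (intro finsum_delta2[OF vect_H, where f = "\<lambda>_ _. gen (p, q)"]) (auto simp: paths_0)
    finally show "\<one>\<^bsub>H\<^esub> \<otimes>\<^bsub>H\<^esub> gen (p, q) = gen (p, q)" .
  qed
  show "x \<otimes>\<^bsub>H\<^esub> \<one>\<^bsub>H\<^esub> = x"
  proof (rule H_linear_eq[OF vect_H bilinear_left[OF m H_one_closed] linear_map_id(1) _ assms])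
    fix p q n assume pq: "p \<in> P n" "q \<in> P n"
    note l = bilinear_right[OF m gen_in_H[OF pq]]
    have "gen (p, q) \<otimes>\<^bsub>H\<^esub> \<one>\<^bsub>H\<^esub> = (\<Oplus>\<^bsub>H\<^esub>j\<in>P 0. \<Oplus>\<^bsub>H\<^esub>l\<in>P 0. gen (p, q) \<otimes>\<^bsub>H\<^esub> gen (j, l))"
      unfolding H_one linear_map_finsum[OF vect_H vect_H l cl']
      using linear_map_finsum[OF vect_H vect_H l cl] linear_map_closed[OF l]
      by (intro H.finsum_cong') (auto intro!: H.finsum_closed)
    also have "\<dots> = (\<Oplus>\<^bsub>H\<^esub>j\<in>P 0. \<Oplus>\<^bsub>H\<^esub>l\<in>P 0. if Vertex (psrc G p) = j then if Vertex (psrc G q) = l then gen (p, q) else \<zero>\<^bsub>H\<^esub> else \<zero>\<^bsub>H\<^esub>)"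
      using pq by (intro H.finsum_cong' refl) (auto simp: H_mult_gen gmult_Vertex Z intro!: H.finsum_closed)
    also have "\<dots> = gen (p, q)"
      using pq by (intro finsum_delta2[OF vect_H, where f = "\<lambda>_ _. gen (p, q)"]) (auto simp: paths_0)
    finally show "gen (p, q) \<otimes>\<^bsub>H\<^esub> \<one>\<^bsub>H\<^esub> = gen (p, q)" .
  qed
qed

text \<open>If the first two pairs are composable, both sides are the product of their concatenation
  with the third pair. Otherwise both vanish, because extending a path at its source leaves its
  target, which decides composability, unchanged.\<close>

lemma gmult_assoc_gen:
  assumes "p \<in> P n" "q \<in> P n" "r \<in> P m" "s \<in> P m" "t \<in> P l" "u \<in> P l"
  shows "gen (p, q) \<otimes>\<^bsub>H\<^esub> gen (r, s) \<otimes>\<^bsub>H\<^esub> gen (t, u) = gen (p, q) \<otimes>\<^bsub>H\<^esub> (gen (r, s) \<otimes>\<^bsub>H\<^esub> gen (t, u))"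
proof (cases "composable p r \<and> composable q s")
  case True
  then have "gen (p, q) \<otimes>\<^bsub>H\<^esub> gen (r, s) \<otimes>\<^bsub>H\<^esub> gen (t, u) = gmult (pcat p r, pcat q s) (t, u)"
    using assms H_mult_gen[OF pcat_in_paths pcat_in_paths] by (simp add: H_mult_gen gmult_def)
  moreover have "gen (p, q) \<otimes>\<^bsub>H\<^esub> (gen (r, s) \<otimes>\<^bsub>H\<^esub> gen (t, u)) = gmult (pcat p r, pcat q s) (t, u)"
    using assms True H_mult_gen[OF _ _ pcat_in_paths pcat_in_paths, of p n q r m t l s u]
    by (auto simp: H_mult_gen gmult_def psrc_pcat ptgt_pcat pcat_assoc)
  ultimately show ?thesis by simp
next
  case False
  then have "gen (p, q) \<otimes>\<^bsub>H\<^esub> (gen (r, s) \<otimes>\<^bsub>H\<^esub> gen (t, u)) = 0"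
    using assms H_mult_gen[OF _ _ pcat_in_paths pcat_in_paths, of p n q r m t l s u]
    by (auto simp: H_mult_gen gmult_def psrc_pcat ptgt_pcat pcat_assoc)
  moreover have "gen (p, q) \<otimes>\<^bsub>H\<^esub> gen (r, s) = 0"
    using False assms by (auto simp: H_mult_gen gmult_def)
  ultimately show ?thesis using assms by simp
qed

lemma H_trilinear_eq:
  assumes W: "vect W"
    and F: "\<And>y z. \<lbrakk>y \<in> carrier H; z \<in> carrier H\<rbrakk> \<Longrightarrow> linear_map H W (\<lambda>x. F x y z)"
      "\<And>x z. \<lbrakk>x \<in> carrier H; z \<in> carrier H\<rbrakk> \<Longrightarrow> linear_map H W (\<lambda>y. F x y z)"
      "\<And>x y. \<lbrakk>x \<in> carrier H; y \<in> carrier H\<rbrakk> \<Longrightarrow> linear_map H W (\<lambda>z. F x y z)"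
    and F': "\<And>y z. \<lbrakk>y \<in> carrier H; z \<in> carrier H\<rbrakk> \<Longrightarrow> linear_map H W (\<lambda>x. F' x y z)"
      "\<And>x z. \<lbrakk>x \<in> carrier H; z \<in> carrier H\<rbrakk> \<Longrightarrow> linear_map H W (\<lambda>y. F' x y z)"
      "\<And>x y. \<lbrakk>x \<in> carrier H; y \<in> carrier H\<rbrakk> \<Longrightarrow> linear_map H W (\<lambda>z. F' x y z)"
    and eq: "\<And>p q r s t u n m l. \<lbrakk>p \<in> P n; q \<in> P n; r \<in> P m; s \<in> P m; t \<in> P l; u \<in> P l\<rbrakk> \<Longrightarrow>
      F (gen (p, q)) (gen (r, s)) (gen (t, u)) = F' (gen (p, q)) (gen (r, s)) (gen (t, u))"
    and xyz: "x \<in> carrier H" "y \<in> carrier H" "z \<in> carrier H"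
  shows "F x y z = F' x y z"
proof -
  have 1: "F (gen (p, q)) (gen (r, s)) z = F' (gen (p, q)) (gen (r, s)) z"
    if "p \<in> P n" "q \<in> P n" "r \<in> P m" "s \<in> P m" for p q n r s m
    by (rule H_linear_eq[OF W F(3)[OF gen_in_H[OF that(1,2)] gen_in_H[OF that(3,4)]]
          F'(3)[OF gen_in_H[OF that(1,2)] gen_in_H[OF that(3,4)]] eq[OF that] xyz(3)])
  have 2: "F (gen (p, q)) y z = F' (gen (p, q)) y z" if "p \<in> P n" "q \<in> P n" for p q n
    by (rule H_linear_eq[OF W F(2)[OF gen_in_H[OF that(1,2)] xyz(3)]
          F'(2)[OF gen_in_H[OF that(1,2)] xyz(3)] 1[OF that] xyz(2)])
  show ?thesis
    by (rule H_linear_eq[OF W F(1)[OF xyz(2,3)] F'(1)[OF xyz(2,3)] 2 xyz(1)])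
qed

lemma H_mult_assoc:
  assumes "x \<in> carrier H" "y \<in> carrier H" "z \<in> carrier H"
  shows "x \<otimes>\<^bsub>H\<^esub> y \<otimes>\<^bsub>H\<^esub> z = x \<otimes>\<^bsub>H\<^esub> (y \<otimes>\<^bsub>H\<^esub> z)"
proof -
  note L = bilinear_left[OF bilinear_H_mult] and R = bilinear_right[OF bilinear_H_mult]
    and cl = bilinear_closed[OF bilinear_H_mult]
  show ?thesis
    by (rule H_trilinear_eq[where F = "\<lambda>x y z. x \<otimes>\<^bsub>H\<^esub> y \<otimes>\<^bsub>H\<^esub> z"
          and F' = "\<lambda>x y z. x \<otimes>\<^bsub>H\<^esub> (y \<otimes>\<^bsub>H\<^esub> z)", OF vect_H
          linear_map_comp[OF L L] linear_map_comp[OF L R] R[OF cl]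
          L[OF cl] linear_map_comp[OF R L] linear_map_comp[OF R R] gmult_assoc_gen assms])
qed

section \<open>The coalgebra structure of \<open>H[G]\<close> and its compatibility with the
  product\<close>

lemma H_comult_linear: "linear_map H (tensor_space H H) (comult H)"
  and H_comult_gen: "\<lbrakk>p \<in> P n; q \<in> P n\<rbrakk> \<Longrightarrow>
    comult H (gen (p, q)) = (\<Oplus>\<^bsub>tensor_space H H\<^esub>r\<in>P n. tens H H (gen (p, r)) (gen (r, q)))"
proof -
  let ?T = "tensor_space H H"
  interpret T: vect ?T by (rule vect_tensor_space)
  let ?d = "\<lambda>(p, q). \<Oplus>\<^bsub>?T\<^esub>r\<in>P (plen p). tens H H (gen (p, r)) (gen (r, q))"
  note ss = same_space_sym[OF same_space_H]
  have "comult H = lin_ext (tensor_space (free_space pairs) (free_space pairs))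
      (\<lambda>(p, q). \<Oplus>\<^bsub>tensor_space (free_space pairs) (free_space pairs)\<^esub>r\<in>P (plen p).
        tens (free_space pairs) (free_space pairs) (gen (p, r)) (gen (r, q)))"
    by (simp only: graph_wba_def graph_space_eq Let_def bialg.simps)
  then have eq: "comult H = lin_ext ?T ?d"
    by (simp only: tensor_same_space[OF ss ss])
  have d: "?d (p, q) \<in> carrier ?T" if "p \<in> P n" "q \<in> P n" for p q n
    using that by (auto intro!: T.finsum_closed)
  have "?d \<in> pairs \<rightarrow> carrier ?T"
    using d by (auto elim!: pairsE)
  from linear_map_lin_ext[OF vect_tensor_space this] show "linear_map H ?T (comult H)"
    unfolding eq using linear_map_same_space[OF same_space_H same_space_refl] by blast
  show "comult H (gen (p, q)) = (\<Oplus>\<^bsub>?T\<^esub>r\<in>P n. tens H H (gen (p, r)) (gen (r, q)))"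
    if "p \<in> P n" "q \<in> P n" for p q n
    unfolding eq using d[OF that] that by (subst lin_ext_gen[OF vect_tensor_space]) simp_all
qed

lemma H_counit_linear: "linear_map H kfield (counit H)"
  and H_counit_gen: "counit H (gen (p, q)) = (if p = q then 1 else 0)"
proof -
  have eq: "counit H = lin_ext kfield (\<lambda>(p, q). if p = q then 1 else 0)"
    by (simp add: graph_wba_def Let_def)
  have "(\<lambda>(p, q). if p = q then 1 else 0 :: 'k) \<in> pairs \<rightarrow> carrier kfield" by simp
  from linear_map_lin_ext[OF vect_kfield this] show "linear_map H kfield (counit H)"
    unfolding eq using linear_map_same_space[OF same_space_H same_space_refl] by blast
  show "counit H (gen (p, q)) = (if p = q then 1 else 0)"
    unfolding eq by (subst lin_ext_gen[OF vect_kfield]) simp_all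
qed

lemma H_comult_closed [simp]: "x \<in> carrier H \<Longrightarrow> comult H x \<in> carrier (tensor_space H H)"
  by (rule linear_map_closed[OF H_comult_linear])

lemma linear_map_comult_gen:
  assumes "vect W" "linear_map (tensor_space H H) W F" "p \<in> P n" "q \<in> P n"
  shows "F (comult H (gen (p, q))) = (\<Oplus>\<^bsub>W\<^esub>r\<in>P n. F (tens H H (gen (p, r)) (gen (r, q))))"
  unfolding H_comult_gen[OF assms(3,4)]
  by (rule linear_map_finsum[OF vect_tensor_space assms(1,2)]) (use assms(3,4) in auto)

text \<open>In each degree the elements \<open>[p|q]\<close> form a matrix coalgebra. Both sides are
  the double sum of \<open>[p|s] \<otimes> [s|r] \<otimes> [r|q]\<close> and differ only in the
  order of summation.\<close>

lemma H_coassoc: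
  assumes "x \<in> carrier H"
  shows "tensor_assoc H H H (tensor_map (tensor_space H H) H (comult H) id (comult H x))
    = tensor_map H (tensor_space H H) id (comult H) (comult H x)"
proof -
  let ?T = "tensor_space H H" and ?T3 = "tensor_space H (tensor_space H H)"
  interpret T3: vect ?T3 by (rule vect_tensor_space)
  note vT = vect_tensor_space and d = H_comult_linear
  note a = linear_map_tensor_assoc[OF vect_H vect_H vect_H]
  note l = linear_map_tensor_map[OF vect_H vect_H vT vect_H d linear_map_id(2)]
    and r = linear_map_tensor_map[OF vect_H vect_H vect_H vT linear_map_id(2) d]
  show ?thesis
  proof (rule H_linear_eq[OF vT linear_map_comp[OF a linear_map_comp[OF l d]] linear_map_comp[OF r d] _ assms])
    fix p q n assume pq: "p \<in> P n" "q \<in> P n"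
    let ?t = "\<lambda>s r. tens H ?T (gen (p, s)) (tens H H (gen (s, r)) (gen (r, q)))"
    have "tensor_assoc H H H (tensor_map ?T H (comult H) id (tens H H (gen (p, r)) (gen (r, q))))
      = (\<Oplus>\<^bsub>?T3\<^esub>s\<in>P n. ?t s r)" if r: "r \<in> P n" for r
    proof -
      note rq = gen_in_H[OF r pq(2)]
      have lin: "linear_map ?T ?T3 (\<lambda>t. tensor_assoc H H H (tens ?T H t (gen (r, q))))"
        by (rule linear_map_comp[OF a]) (rule bilinear_left[OF bilinear_tens[OF vT vect_H] rq])
      have "tensor_map ?T H (comult H) id (tens H H (gen (p, r)) (gen (r, q)))
        = tens ?T H (comult H (gen (p, r))) (gen (r, q))"
        using tensor_map_tens[OF vect_H vect_H vT vect_H d linear_map_id(2) gen_in_H[OF pq(1) r] rq] by simp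
      moreover have "tensor_assoc H H H (tens ?T H (comult H (gen (p, r))) (gen (r, q))) = (\<Oplus>\<^bsub>?T3\<^esub>s\<in>P n. tensor_assoc H H H (tens ?T H (tens H H (gen (p, s)) (gen (s, r))) (gen (r, q))))"
        by (rule linear_map_comult_gen[OF vT lin pq(1) r])
      moreover have "\<dots> = (\<Oplus>\<^bsub>?T3\<^esub>s\<in>P n. ?t s r)"
        using pq r by (intro T3.finsum_cong' refl)
          (auto simp: tensor_assoc_tens[OF vect_H vect_H vect_H] gen_in_H[where n = n])
      ultimately show ?thesis by simp
    qed
    then have "tensor_assoc H H H (tensor_map ?T H (comult H) id (comult H (gen (p, q))))
      = (\<Oplus>\<^bsub>?T3\<^esub>r\<in>P n. \<Oplus>\<^bsub>?T3\<^esub>s\<in>P n. ?t s r)"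
      unfolding linear_map_comult_gen[OF vT linear_map_comp[OF a l] pq]
      using pq by (intro T3.finsum_cong' refl) (auto intro!: T3.finsum_closed)
    also have "\<dots> = (\<Oplus>\<^bsub>?T3\<^esub>s\<in>P n. \<Oplus>\<^bsub>?T3\<^esub>r\<in>P n. ?t s r)"
      using pq by (intro T3.finsum_swap) auto
    also have "\<dots> = (\<Oplus>\<^bsub>?T3\<^esub>s\<in>P n. tensor_map H ?T id (comult H) (tens H H (gen (p, s)) (gen (s, q))))"
    proof (rule T3.finsum_cong'[OF refl])
      fix s assume s: "s \<in> P n"
      note ps = gen_in_H[OF pq(1) s] and sq = gen_in_H[OF s pq(2)]
      have "tensor_map H ?T id (comult H) (tens H H (gen (p, s)) (gen (s, q)))
        = tens H ?T (gen (p, s)) (comult H (gen (s, q)))"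
        using tensor_map_tens[OF vect_H vect_H vect_H vT linear_map_id(2) d ps sq] by simp
      also have "\<dots> = (\<Oplus>\<^bsub>?T3\<^esub>r\<in>P n. ?t s r)"
        by (rule linear_map_comult_gen[OF vT bilinear_right[OF bilinear_tens[OF vect_H vT] ps] s pq(2)])
      finally show "(\<Oplus>\<^bsub>?T3\<^esub>r\<in>P n. ?t s r) = tensor_map H ?T id (comult H) (tens H H (gen (p, s)) (gen (s, q)))" ..
    qed (use linear_map_closed[OF r] pq in auto)
    also have "\<dots> = tensor_map H ?T id (comult H) (comult H (gen (p, q)))"
      by (rule linear_map_comult_gen[OF vT r pq, symmetric])
    finally show "tensor_assoc H H H (tensor_map ?T H (comult H) id (comult H (gen (p, q))))
      = tensor_map H ?T id (comult H) (comult H (gen (p, q)))" .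
  qed
qed

lemma H_counit_left_right:
  assumes "x \<in> carrier H"
  shows "ext H (\<lambda>(x', x''). counit H x' \<odot>\<^bsub>H\<^esub> x'') (comult H x) = x"
    and "ext H (\<lambda>(x', x''). counit H x'' \<odot>\<^bsub>H\<^esub> x') (comult H x) = x"
proof -
  have b: "bilinear H H H (\<lambda>x' x''. counit H x' \<odot>\<^bsub>H\<^esub> x'')"
    by (rule bilinear_comp[OF bilinear_smult[OF vect_H] H_counit_linear linear_map_id(1)])
  have b': "bilinear H H H (\<lambda>x' x''. counit H x'' \<odot>\<^bsub>H\<^esub> x')"
    by (rule bilinear_flip[OF b])
  note e = linear_map_ext_tensor[OF vect_H vect_H vect_H b] and e' = linear_map_ext_tensor[OF vect_H vect_H vect_H b']
  show "ext H (\<lambda>(x', x''). counit H x' \<odot>\<^bsub>H\<^esub> x'') (comult H x) = x"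
  proof (rule H_linear_eq[OF vect_H linear_map_comp[OF e H_comult_linear] linear_map_id(1) _ assms])
    fix p q n assume pq: "p \<in> P n" "q \<in> P n"
    have "(\<Oplus>\<^bsub>H\<^esub>r\<in>P n. ext H (\<lambda>(x', x''). counit H x' \<odot>\<^bsub>H\<^esub> x'') (tens H H (gen (p, r)) (gen (r, q))))
      = (\<Oplus>\<^bsub>H\<^esub>r\<in>P n. if p = r then gen (r, q) else \<zero>\<^bsub>H\<^esub>)"
      using pq by (intro H.finsum_cong' refl)
        (auto simp: ext_tens[OF vect_H vect_H vect_H b] gen_in_H[where n = n] H_counit_gen)
    then show "ext H (\<lambda>(x', x''). counit H x' \<odot>\<^bsub>H\<^esub> x'') (comult H (gen (p, q))) = gen (p, q)"
      unfolding linear_map_comult_gen[OF vect_H e pq] using pq by (simp add: H.finsum_delta gen_in_H[where n = n])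
  qed
  show "ext H (\<lambda>(x', x''). counit H x'' \<odot>\<^bsub>H\<^esub> x') (comult H x) = x"
  proof (rule H_linear_eq[OF vect_H linear_map_comp[OF e' H_comult_linear] linear_map_id(1) _ assms])
    fix p q n assume pq: "p \<in> P n" "q \<in> P n"
    have "(\<Oplus>\<^bsub>H\<^esub>r\<in>P n. ext H (\<lambda>(x', x''). counit H x'' \<odot>\<^bsub>H\<^esub> x') (tens H H (gen (p, r)) (gen (r, q))))
      = (\<Oplus>\<^bsub>H\<^esub>r\<in>P n. if q = r then gen (p, r) else \<zero>\<^bsub>H\<^esub>)"
      using pq by (intro H.finsum_cong' refl)
        (auto simp: ext_tens[OF vect_H vect_H vect_H b'] gen_in_H[where n = n] H_counit_gen)
    then show "ext H (\<lambda>(x', x''). counit H x'' \<odot>\<^bsub>H\<^esub> x') (comult H (gen (p, q))) = gen (p, q)"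
      unfolding linear_map_comult_gen[OF vect_H e' pq] using pq by (simp add: H.finsum_delta gen_in_H[where n = n])
  qed
qed

lemma tens_zero [simp]:
  assumes "x \<in> carrier H"
  shows "tens H H 0 x = \<zero>\<^bsub>tensor_space H H\<^esub>" "tens H H x 0 = \<zero>\<^bsub>tensor_space H H\<^esub>"
  using linear_map_zero[OF vect_H vect_tensor_space bilinear_left[OF bilinear_tens[OF vect_H vect_H] assms]]
    linear_map_zero[OF vect_H vect_tensor_space bilinear_right[OF bilinear_tens[OF vect_H vect_H] assms]]
  by (simp_all add: H_simps)

text \<open>On basis elements the right side is a sum over pairs \<open>u\<close>, \<open>v\<close>,
  and only composable ones contribute; regrouped by \<open>w = pcat u v\<close> it is the
  comultiplication of \<open>[pr|qs]\<close>. If \<open>p\<close>, \<open>r\<close> or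
  \<open>q\<close>, \<open>s\<close> do not compose, each term has a vanishing tensor
  factor.\<close>

lemma H_comult_mult:
  assumes "x \<in> carrier H" "y \<in> carrier H"
  shows "comult H (x \<otimes>\<^bsub>H\<^esub> y) = comult H x \<otimes>\<^bsub>tensor_alg H H\<^esub> comult H y"
proof -
  let ?T = "tensor_space H H" and ?m = "monoid.mult (tensor_alg H H)"
  interpret T: vect ?T by (rule vect_tensor_space)
  note vT = vect_tensor_space and d = H_comult_linear
  note m = tensor_alg_mult_bilinear[OF pre_algebra_H pre_algebra_H]
  note b1 = linear_bilinear_comp[OF d bilinear_H_mult] and b2 = bilinear_comp[OF m d d]
  have 1: "comult H (gen (p, q) \<otimes>\<^bsub>H\<^esub> gen (r, s)) = ?m (comult H (gen (p, q))) (comult H (gen (r, s)))"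
    if pq: "p \<in> P n" "q \<in> P n" and rs: "r \<in> P l" "s \<in> P l" for p q r s n l
  proof -
    let ?g = "\<lambda>w. tens H H (gen (pcat p r, w)) (gen (w, pcat q s))"
    have t: "tens H H (gen (p, u)) (gen (u, q)) \<in> carrier ?T" if "u \<in> P n" for u using that pq by auto
    have "?m (comult H (gen (p, q))) (comult H (gen (r, s)))
      = (\<Oplus>\<^bsub>?T\<^esub>u\<in>P n. ?m (tens H H (gen (p, u)) (gen (u, q))) (comult H (gen (r, s))))"
      using rs by (intro linear_map_comult_gen[OF vT bilinear_left[OF m] pq]) auto
    also have "\<dots> = (\<Oplus>\<^bsub>?T\<^esub>u\<in>P n. \<Oplus>\<^bsub>?T\<^esub>v\<in>P l. ?m (tens H H (gen (p, u)) (gen (u, q))) (tens H H (gen (r, v)) (gen (v, s))))"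
      using t linear_map_comult_gen[OF vT bilinear_right[OF m t] rs] rs bilinear_closed[OF m]
      by (intro T.finsum_cong' refl) (auto intro!: T.finsum_closed)
    also have "\<dots> = (\<Oplus>\<^bsub>?T\<^esub>u\<in>P n. \<Oplus>\<^bsub>?T\<^esub>v\<in>P l. tens H H (gmult (p, u) (r, v)) (gmult (u, q) (v, s)))"
      using pq rs by (intro T.finsum_cong' refl)
        (auto simp: tensor_alg_mult_tens[OF pre_algebra_H pre_algebra_H] gen_in_H[where n = n]
          gen_in_H[where n = l] H_mult_gen gmult_closed[where n = n and m = l] intro!: T.finsum_closed tens_closed)
    also have "\<dots> = comult H (gen (p, q) \<otimes>\<^bsub>H\<^esub> gen (r, s))"
    proof (cases "composable p r \<and> composable q s")
      case True
      have pr: "pcat p r \<in> P (n + l)" "pcat q s \<in> P (n + l)" using True pq rs by (auto intro: pcat_in_paths)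
      have g: "?g w \<in> carrier ?T" if "w \<in> P (n + l)" for w using pr that by auto
      have "(\<Oplus>\<^bsub>?T\<^esub>u\<in>P n. \<Oplus>\<^bsub>?T\<^esub>v\<in>P l. tens H H (gmult (p, u) (r, v)) (gmult (u, q) (v, s)))
        = (\<Oplus>\<^bsub>?T\<^esub>u\<in>P n. \<Oplus>\<^bsub>?T\<^esub>v\<in>P l. if composable u v then ?g (pcat u v) else \<zero>\<^bsub>?T\<^esub>)"
        using True g by (intro T.finsum_cong' refl)
          (auto simp: gmult_def intro!: T.finsum_closed g pcat_in_paths)
      also have "\<dots> = (\<Oplus>\<^bsub>?T\<^esub>w\<in>P (n + l). ?g w)"
        by (rule finsum_paths_add[OF vT g])
      also have "\<dots> = comult H (gen (p, q) \<otimes>\<^bsub>H\<^esub> gen (r, s))"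
        using True pq rs by (simp add: H_mult_gen gmult_def H_comult_gen[OF pr])
      finally show ?thesis .
    next
      case False
      have z: "comult H 0 = \<zero>\<^bsub>?T\<^esub>"
        using linear_map_zero[OF vect_H vT d] by (simp add: H_simps)
      have "tens H H (gmult (p, u) (r, v)) (gmult (u, q) (v, s)) = \<zero>\<^bsub>?T\<^esub>"
        if uv: "u \<in> P n" "v \<in> P l" for u v
      proof -
        have "gmult (p, u) (r, v) \<in> carrier H" "gmult (u, q) (v, s) \<in> carrier H"
          using pq rs uv by (auto intro: gmult_closed)
        moreover have "gmult (p, u) (r, v) = 0 \<or> gmult (u, q) (v, s) = 0"
          using False by (auto simp: gmult_def)
        ultimately show ?thesis by auto
      qed
      then have "(\<Oplus>\<^bsub>?T\<^esub>u\<in>P n. \<Oplus>\<^bsub>?T\<^esub>v\<in>P l. tens H H (gmult (p, u) (r, v)) (gmult (u, q) (v, s)))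
        = (\<Oplus>\<^bsub>?T\<^esub>u\<in>P n. \<Oplus>\<^bsub>?T\<^esub>v\<in>P l. \<zero>\<^bsub>?T\<^esub>)"
        by (intro T.finsum_cong' refl) (auto intro!: T.finsum_closed)
      also have "\<dots> = comult H (gen (p, q) \<otimes>\<^bsub>H\<^esub> gen (r, s))"
        using False pq rs z by (auto simp: H_mult_gen gmult_def)
      finally show ?thesis .
    qed
    finally show ?thesis ..
  qed
  have 2: "comult H (gen (p, q) \<otimes>\<^bsub>H\<^esub> y) = ?m (comult H (gen (p, q))) (comult H y)"
    if pq: "p \<in> P n" "q \<in> P n" for p q n
    by (rule H_linear_eq[OF vT bilinear_right[OF b1 gen_in_H[OF pq]] bilinear_right[OF b2 gen_in_H[OF pq]] 1[OF pq] assms(2)])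
  show ?thesis
    by (rule H_linear_eq[OF vT bilinear_left[OF b1 assms(2)] bilinear_left[OF b2 assms(2)] 2 assms(1)])
qed

text \<open>The counit compares the concatenations, and by unique factorisation these agree only if
  the factors do; then the two composability conditions coincide.\<close>

lemma H_counit_gmult:
  assumes "p \<in> P n" "q \<in> P n" "r \<in> P m" "v \<in> P m"
  shows "counit H (gmult (p, q) (r, v)) = (if composable p r \<and> p = q \<and> r = v then 1 else 0)"
proof -
  have "counit H 0 = 0"
    using linear_map_zero[OF vect_H vect_kfield H_counit_linear] by (simp add: H_simps)
  then show ?thesis
    using pcat_inject[OF assms] by (auto simp: gmult_def H_counit_gen)
qed

lemma H_counit_gmult3:
  assumes "p \<in> P n" "q \<in> P n" "r \<in> P m" "s \<in> P m" "t \<in> P l" "u \<in> P l"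
  shows "counit H (gen (p, q) \<otimes>\<^bsub>H\<^esub> gen (r, s) \<otimes>\<^bsub>H\<^esub> gen (t, u))
    = (if composable p r \<and> p = q \<and> composable r t \<and> r = s \<and> t = u then 1 else 0)"
proof (cases "composable p r \<and> composable q s")
  case True
  then have pr: "pcat p r \<in> P (n + m)" "pcat q s \<in> P (n + m)" using assms by (auto intro: pcat_in_paths)
  moreover have "gmult (p, q) (r, s) = gen (pcat p r, pcat q s)" using True by (simp add: gmult_def)
  ultimately show ?thesis
    using True assms pcat_inject[OF assms(1-4)] H_counit_gmult[OF pr assms(5,6)]
    by (auto simp: H_mult_gen[OF assms(1-4)] H_mult_gen[OF pr assms(5,6)] psrc_pcat)
next
  case False
  moreover have "counit H 0 = 0"
    using linear_map_zero[OF vect_H vect_kfield H_counit_linear] by (simp add: H_simps)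
  ultimately show ?thesis
    using gen_in_H[OF assms(5,6)] by (auto simp: H_mult_gen[OF assms(1-4)] gmult_def)
qed

text \<open>On basis elements the sum over the middle path \<open>v\<close> collapses to
  \<open>v = r\<close>: one of the two factors carries the Kronecker delta of \<open>r\<close> and
  \<open>v\<close>, the first factor in one axiom and the second in the other. What remains is the
  same product of deltas as for the triple product.\<close>

lemma H_counit_mult:
  assumes "x \<in> carrier H" "y \<in> carrier H" "z \<in> carrier H"
  shows "counit H (x \<otimes>\<^bsub>H\<^esub> y \<otimes>\<^bsub>H\<^esub> z)
      = ext kfield (\<lambda>(y', y''). counit H (x \<otimes>\<^bsub>H\<^esub> y') * counit H (y'' \<otimes>\<^bsub>H\<^esub> z)) (comult H y)" (is "?l x y z = ?r x y z")
    and "counit H (x \<otimes>\<^bsub>H\<^esub> y \<otimes>\<^bsub>H\<^esub> z)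
      = ext kfield (\<lambda>(y', y''). counit H (x \<otimes>\<^bsub>H\<^esub> y'') * counit H (y' \<otimes>\<^bsub>H\<^esub> z)) (comult H y)" (is "_ = ?r' x y z")
proof -
  interpret K: vect "kfield :: ('k, 'k) module" by (rule vect_kfield)
  note m = bilinear_H_mult and e = H_counit_linear and vk = vect_kfield
  note mc = bilinear_closed[OF m]
  have eR: "linear_map H kfield (\<lambda>y. counit H (x \<otimes>\<^bsub>H\<^esub> y))" if "x \<in> carrier H" for x
    by (rule linear_map_comp[OF e bilinear_right[OF m that]])
  have eL: "linear_map H kfield (\<lambda>y. counit H (y \<otimes>\<^bsub>H\<^esub> x))" if "x \<in> carrier H" for x
    by (rule linear_map_comp[OF e bilinear_left[OF m that]])
  have b: "bilinear H H kfield (\<lambda>y' y''. counit H (x \<otimes>\<^bsub>H\<^esub> y') * counit H (y'' \<otimes>\<^bsub>H\<^esub> z))"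
    if "x \<in> carrier H" "z \<in> carrier H" for x z
    by (rule bilinear_comp[OF bilinear_mult_kfield eR[OF that(1)] eL[OF that(2)]])
  note b' = bilinear_flip[OF b]
  have ml: "linear_map kfield kfield (\<lambda>x. x * c)" "linear_map kfield kfield (\<lambda>x. c * x)" for c :: 'k
    by (rule bilinear_left[OF bilinear_mult_kfield] bilinear_right[OF bilinear_mult_kfield], simp)+
  have x: "linear_map H kfield (\<lambda>x. counit H (x \<otimes>\<^bsub>H\<^esub> a) * c)" if "a \<in> carrier H" for a c
    by (rule linear_map_comp[OF ml(1) eL[OF that]])
  have z: "linear_map H kfield (\<lambda>z. c * counit H (a \<otimes>\<^bsub>H\<^esub> z))" if "a \<in> carrier H" for a c
    by (rule linear_map_comp[OF ml(2) eR[OF that]])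
  have lin_r: "linear_map H kfield (\<lambda>x. ?r x y z)" "linear_map H kfield (\<lambda>x. ?r' x y z)"
    if "y \<in> carrier H" "z \<in> carrier H" for y z
    by (rule bilinear_left[OF bilinear_ext_param[OF vect_H vect_H vk vect_H b[OF _ that(2)] x] H_comult_closed[OF that(1)]],
        assumption+)
      (rule bilinear_left[OF bilinear_ext_param[OF vect_H vect_H vk vect_H b'[OF _ that(2)] x] H_comult_closed[OF that(1)]],
        assumption+)
  have lin_z: "linear_map H kfield (\<lambda>z. ?r x y z)" "linear_map H kfield (\<lambda>z. ?r' x y z)"
    if "x \<in> carrier H" "y \<in> carrier H" for x y
    by (rule bilinear_left[OF bilinear_ext_param[OF vect_H vect_H vk vect_H b[OF that(1)] z] H_comult_closed[OF that(2)]],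
        assumption+)
      (rule bilinear_left[OF bilinear_ext_param[OF vect_H vect_H vk vect_H b'[OF that(1)] z] H_comult_closed[OF that(2)]],
        assumption+)
  have lin_y: "linear_map H kfield (\<lambda>y. ?r x y z)" "linear_map H kfield (\<lambda>y. ?r' x y z)"
    if "x \<in> carrier H" "z \<in> carrier H" for x z
    by (rule linear_map_comp[OF linear_map_ext_tensor[OF vect_H vect_H vk b[OF that]] H_comult_linear])
      (rule linear_map_comp[OF linear_map_ext_tensor[OF vect_H vect_H vk b'[OF that]] H_comult_linear])
  have lin_l: "linear_map H kfield (\<lambda>x. ?l x y z)" "linear_map H kfield (\<lambda>y. ?l x y z)" "linear_map H kfield (\<lambda>z. ?l x y z)"
    if "x \<in> carrier H" "y \<in> carrier H" "z \<in> carrier H" for x y z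
    by (rule linear_map_comp[OF eL[OF that(3)] bilinear_left[OF m that(2)]])
      (rule linear_map_comp[OF eL[OF that(3)] bilinear_right[OF m that(1)]],
       rule eR[OF mc[OF that(1,2)]])
  have gens: "?l (gen (p, q)) (gen (r, s)) (gen (t, u)) = ?r (gen (p, q)) (gen (r, s)) (gen (t, u))"
    "?l (gen (p, q)) (gen (r, s)) (gen (t, u)) = ?r' (gen (p, q)) (gen (r, s)) (gen (t, u))"
    if g: "p \<in> P n" "q \<in> P n" "r \<in> P k" "s \<in> P k" "t \<in> P l" "u \<in> P l" for p q r s t u n k l
  proof -
    note pq = gen_in_H[OF g(1,2)] and rs = g(3,4) and tu = gen_in_H[OF g(5,6)]
    let ?c = "if composable p r \<and> p = q \<and> composable r t \<and> r = s \<and> t = u then 1 else 0 :: 'k"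
    have "?r (gen (p, q)) (gen (r, s)) (gen (t, u))
      = (\<Oplus>\<^bsub>kfield\<^esub>v\<in>P k. counit H (gmult (p, q) (r, v)) * counit H (gmult (v, s) (t, u)))"
      unfolding linear_map_comult_gen[OF vk linear_map_ext_tensor[OF vect_H vect_H vk b[OF pq tu]] rs]
      using g by (intro K.finsum_cong' refl)
        (auto simp: ext_tens[OF vect_H vect_H vk b[OF pq tu]] gen_in_H[where n = k] H_mult_gen)
    also have "\<dots> = (\<Oplus>\<^bsub>kfield\<^esub>v\<in>P k. if r = v then ?c else \<zero>\<^bsub>kfield\<^esub>)"
      using g by (intro K.finsum_cong' refl) (auto simp: H_counit_gmult[where n = n and m = k] H_counit_gmult[where n = k and m = l])
    also have "\<dots> = ?c"
      using g by (intro K.finsum_delta[where f = "\<lambda>_. ?c"]) auto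
    finally show "?l (gen (p, q)) (gen (r, s)) (gen (t, u)) = ?r (gen (p, q)) (gen (r, s)) (gen (t, u))"
      using H_counit_gmult3[OF g] by simp
    have "?r' (gen (p, q)) (gen (r, s)) (gen (t, u))
      = (\<Oplus>\<^bsub>kfield\<^esub>v\<in>P k. counit H (gmult (p, q) (v, s)) * counit H (gmult (r, v) (t, u)))"
      unfolding linear_map_comult_gen[OF vk linear_map_ext_tensor[OF vect_H vect_H vk b'[OF pq tu]] rs]
      using g by (intro K.finsum_cong' refl)
        (auto simp: ext_tens[OF vect_H vect_H vk b'[OF pq tu]] gen_in_H[where n = k] H_mult_gen)
    also have "\<dots> = (\<Oplus>\<^bsub>kfield\<^esub>v\<in>P k. if r = v then ?c else \<zero>\<^bsub>kfield\<^esub>)"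
      using g by (intro K.finsum_cong' refl) (auto simp: H_counit_gmult[where n = n and m = k] H_counit_gmult[where n = k and m = l])
    also have "\<dots> = ?c"
      using g by (intro K.finsum_delta[where f = "\<lambda>_. ?c"]) auto
    finally show "?l (gen (p, q)) (gen (r, s)) (gen (t, u)) = ?r' (gen (p, q)) (gen (r, s)) (gen (t, u))"
      using H_counit_gmult3[OF g] by simp
  qed
  show "?l x y z = ?r x y z"
    by (rule H_trilinear_eq[where F = ?l and F' = ?r, OF vk lin_l lin_r(1) lin_y(1) lin_z(1) gens(1) assms])
      (use assms in auto)
  show "?l x y z = ?r' x y z"
    by (rule H_trilinear_eq[where F = ?l and F' = ?r', OF vk lin_l lin_r(2) lin_y(2) lin_z(2) gens(2) assms])
      (use assms in auto)
qed

section \<open>The axioms on the comultiplication of the unit of \<open>H[G]\<close>\<close>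

lemma linear_map_H_one:
  assumes W: "vect W" and F: "linear_map H W F"
  shows "F \<one>\<^bsub>H\<^esub> = (\<Oplus>\<^bsub>W\<^esub>j\<in>P 0. \<Oplus>\<^bsub>W\<^esub>l\<in>P 0. F (gen (j, l)))"
proof -
  interpret W: vect W by fact
  have cl: "(\<lambda>l. gen (j, l)) \<in> P 0 \<rightarrow> carrier H" if "j \<in> P 0" for j using that by auto
  have cl': "(\<lambda>j. \<Oplus>\<^bsub>H\<^esub>l\<in>P 0. gen (j, l)) \<in> P 0 \<rightarrow> carrier H" using H.finsum_closed[OF cl] by auto
  show ?thesis
    unfolding H_one linear_map_finsum[OF vect_H W F cl']
    using linear_map_finsum[OF vect_H W F cl] linear_map_closed[OF F gen_in_H]
    by (intro W.finsum_cong' refl) (auto intro!: W.finsum_closed)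
qed

lemma linear_map_comult_one:
  assumes W: "vect W" and F: "linear_map (tensor_space H H) W F"
  shows "F (comult H \<one>\<^bsub>H\<^esub>)
    = (\<Oplus>\<^bsub>W\<^esub>j\<in>P 0. \<Oplus>\<^bsub>W\<^esub>l\<in>P 0. \<Oplus>\<^bsub>W\<^esub>k\<in>P 0. F (tens H H (gen (j, k)) (gen (k, l))))"
proof -
  interpret W: vect W by fact
  have c: "F (tens H H (gen (j, k)) (gen (k, l))) \<in> carrier W" if "j \<in> P 0" "k \<in> P 0" "l \<in> P 0" for j k l
    using that by (intro linear_map_closed[OF F]) auto
  show ?thesis
    unfolding linear_map_H_one[OF W linear_map_comp[OF F H_comult_linear]]
    using linear_map_comult_gen[OF W F] c by (intro W.finsum_cong' refl) (auto intro!: W.finsum_closed)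
qed

lemma gmult_Vertex2:
  assumes "k \<in> P 0" "l \<in> P 0" "x \<in> P 0" "y \<in> P 0"
  shows "gmult (k, l) (x, y) = (if k = x then if l = y then gen (k, l) else 0 else 0)"
    and "gmult (x, y) (k, l) = (if k = x then if l = y then gen (k, l) else 0 else 0)"
  using assms by (auto simp: paths_0 gmult_def)

text \<open>In the sum of \<open>[x|y] \<otimes> [y|z]\<close> for \<open>\<Delta>(1)\<close>, the
  factor \<open>[k|l] \<otimes> 1\<close> selects \<open>x = k\<close> and \<open>y = l\<close>.
  Degree-zero elements are orthogonal idempotents, so the side of multiplication does not
  matter.\<close>

lemma comult_one_mult:
  assumes kl: "k \<in> P 0" "l \<in> P 0"
  shows "tens H H (gen (k, l)) \<one>\<^bsub>H\<^esub> \<otimes>\<^bsub>tensor_alg H H\<^esub> comult H \<one>\<^bsub>H\<^esub>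
      = (\<Oplus>\<^bsub>tensor_space H H\<^esub>z\<in>P 0. tens H H (gen (k, l)) (gen (l, z)))"
    and "comult H \<one>\<^bsub>H\<^esub> \<otimes>\<^bsub>tensor_alg H H\<^esub> tens H H (gen (k, l)) \<one>\<^bsub>H\<^esub>
      = (\<Oplus>\<^bsub>tensor_space H H\<^esub>z\<in>P 0. tens H H (gen (k, l)) (gen (l, z)))"
proof -
  let ?T = "tensor_space H H" and ?m = "monoid.mult (tensor_alg H H)"
  interpret T: vect ?T by (rule vect_tensor_space)
  note m = tensor_alg_mult_bilinear[OF pre_algebra_H pre_algebra_H]
  have t: "tens H H (gen (k, l)) \<one>\<^bsub>H\<^esub> \<in> carrier ?T" using kl by auto
  let ?i = "\<lambda>x z y. if k = x then if l = y then tens H H (gen (k, l)) (gen (y, z)) else \<zero>\<^bsub>?T\<^esub> else \<zero>\<^bsub>?T\<^esub>"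
  have 1: "?m (tens H H (gen (k, l)) \<one>\<^bsub>H\<^esub>) (tens H H (gen (x, y)) (gen (y, z))) = ?i x z y"
    "?m (tens H H (gen (x, y)) (gen (y, z))) (tens H H (gen (k, l)) \<one>\<^bsub>H\<^esub>) = ?i x z y"
    if "x \<in> P 0" "y \<in> P 0" "z \<in> P 0" for x y z
    using kl that gen_in_H[OF that(2,3)] by (auto simp: tensor_alg_mult_tens[OF pre_algebra_H pre_algebra_H]
        gen_in_H[where n = 0] H_mult_gen[where n = 0 and m = 0] H_one_mult gmult_Vertex2)
  have 2: "(\<Oplus>\<^bsub>?T\<^esub>x\<in>P 0. \<Oplus>\<^bsub>?T\<^esub>z\<in>P 0. \<Oplus>\<^bsub>?T\<^esub>y\<in>P 0. ?i x z y)
    = (\<Oplus>\<^bsub>?T\<^esub>z\<in>P 0. tens H H (gen (k, l)) (gen (l, z)))"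
  proof -
    have i: "(\<Oplus>\<^bsub>?T\<^esub>y\<in>P 0. ?i x z y) = (if k = x then tens H H (gen (k, l)) (gen (l, z)) else \<zero>\<^bsub>?T\<^esub>)"
      if "z \<in> P 0" for x z
      using kl that T.finsum_delta[of "P 0" l "\<lambda>y. tens H H (gen (k, l)) (gen (y, z))"] by auto
    have "(\<Oplus>\<^bsub>?T\<^esub>x\<in>P 0. \<Oplus>\<^bsub>?T\<^esub>z\<in>P 0. \<Oplus>\<^bsub>?T\<^esub>y\<in>P 0. ?i x z y)
      = (\<Oplus>\<^bsub>?T\<^esub>x\<in>P 0. if k = x then \<Oplus>\<^bsub>?T\<^esub>z\<in>P 0. tens H H (gen (k, l)) (gen (l, z)) else \<zero>\<^bsub>?T\<^esub>)"
    proof (rule T.finsum_cong'[OF refl])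
      fix x assume "x \<in> P 0"
      have "(\<Oplus>\<^bsub>?T\<^esub>z\<in>P 0. \<Oplus>\<^bsub>?T\<^esub>y\<in>P 0. ?i x z y)
        = (\<Oplus>\<^bsub>?T\<^esub>z\<in>P 0. if k = x then tens H H (gen (k, l)) (gen (l, z)) else \<zero>\<^bsub>?T\<^esub>)"
        using i kl by (intro T.finsum_cong' refl) auto
      then show "(\<Oplus>\<^bsub>?T\<^esub>z\<in>P 0. \<Oplus>\<^bsub>?T\<^esub>y\<in>P 0. ?i x z y)
        = (if k = x then \<Oplus>\<^bsub>?T\<^esub>z\<in>P 0. tens H H (gen (k, l)) (gen (l, z)) else \<zero>\<^bsub>?T\<^esub>)" by simp
    qed (use kl in \<open>auto intro!: T.finsum_closed\<close>)
    also have "\<dots> = (\<Oplus>\<^bsub>?T\<^esub>z\<in>P 0. tens H H (gen (k, l)) (gen (l, z)))"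
      using kl by (intro T.finsum_delta[where f = "\<lambda>_. \<Oplus>\<^bsub>?T\<^esub>z\<in>P 0. tens H H (gen (k, l)) (gen (l, z))"])
        (auto intro!: T.finsum_closed)
    finally show ?thesis .
  qed
  have cl: "?i x z y \<in> carrier ?T" if "x \<in> P 0" "y \<in> P 0" "z \<in> P 0" for x y z
    using that kl by auto
  have "?m (tens H H (gen (k, l)) \<one>\<^bsub>H\<^esub>) (comult H \<one>\<^bsub>H\<^esub>) = (\<Oplus>\<^bsub>?T\<^esub>x\<in>P 0. \<Oplus>\<^bsub>?T\<^esub>z\<in>P 0. \<Oplus>\<^bsub>?T\<^esub>y\<in>P 0. ?i x z y)"
    unfolding linear_map_comult_one[OF vect_tensor_space bilinear_right[OF m t]]
    using 1(1) cl by (intro T.finsum_cong' refl) (auto intro!: T.finsum_closed)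
  then show "?m (tens H H (gen (k, l)) \<one>\<^bsub>H\<^esub>) (comult H \<one>\<^bsub>H\<^esub>) = (\<Oplus>\<^bsub>?T\<^esub>z\<in>P 0. tens H H (gen (k, l)) (gen (l, z)))"
    using 2 by simp
  have "?m (comult H \<one>\<^bsub>H\<^esub>) (tens H H (gen (k, l)) \<one>\<^bsub>H\<^esub>) = (\<Oplus>\<^bsub>?T\<^esub>x\<in>P 0. \<Oplus>\<^bsub>?T\<^esub>z\<in>P 0. \<Oplus>\<^bsub>?T\<^esub>y\<in>P 0. ?i x z y)"
    unfolding linear_map_comult_one[OF vect_tensor_space bilinear_left[OF m t]]
    using 1(2) cl by (intro T.finsum_cong' refl) (auto intro!: T.finsum_closed)
  then show "?m (comult H \<one>\<^bsub>H\<^esub>) (tens H H (gen (k, l)) \<one>\<^bsub>H\<^esub>) = (\<Oplus>\<^bsub>?T\<^esub>z\<in>P 0. tens H H (gen (k, l)) (gen (l, z)))"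
    using 2 by simp
qed

text \<open>All three elements equal the sum of \<open>[j|k] \<otimes> [k|l] \<otimes> [l|z]\<close>
  over quadruples of vertices. Multiplying \<open>\<Delta>(1) \<otimes> 1\<close> with
  \<open>1 \<otimes> \<Delta>(1)\<close> glues two such sums at the common middle factor
  \<open>[k|l]\<close>.\<close>

lemma H_comult_one:
  shows "tensor_assoc H H H (tensor_map (tensor_space H H) H (comult H) id (comult H \<one>\<^bsub>H\<^esub>))
       = tensor_assoc H H H (tens (tensor_space H H) H (comult H \<one>\<^bsub>H\<^esub>) \<one>\<^bsub>H\<^esub>)
           \<otimes>\<^bsub>tensor_alg H (tensor_alg H H)\<^esub> tens H (tensor_space H H) \<one>\<^bsub>H\<^esub> (comult H \<one>\<^bsub>H\<^esub>)" (is "?L = ?l \<otimes>\<^bsub>_\<^esub> ?r")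
    and "tensor_assoc H H H (tensor_map (tensor_space H H) H (comult H) id (comult H \<one>\<^bsub>H\<^esub>))
       = tens H (tensor_space H H) \<one>\<^bsub>H\<^esub> (comult H \<one>\<^bsub>H\<^esub>)
           \<otimes>\<^bsub>tensor_alg H (tensor_alg H H)\<^esub>
         tensor_assoc H H H (tens (tensor_space H H) H (comult H \<one>\<^bsub>H\<^esub>) \<one>\<^bsub>H\<^esub>)"
proof -
  let ?T = "tensor_space H H" and ?A = "tensor_alg H H"
  let ?T3 = "tensor_space H ?T"
  let ?m2 = "monoid.mult ?A" and ?m = "monoid.mult (tensor_alg H ?A)"
  interpret T: vect ?T by (rule vect_tensor_space)
  interpret T3: vect ?T3 by (rule vect_tensor_space)
  note vT = vect_tensor_space and d = H_comult_linear
  note pA = pre_algebra_tensor_alg[OF pre_algebra_H pre_algebra_H]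
  note ts = tensor_same_space[OF same_space_refl same_space_tensor_alg, of H H H]
  note bm = tensor_alg_mult_bilinear[OF pre_algebra_H pA, unfolded ts]
  note mt = tensor_alg_mult_tens[OF pre_algebra_H pA, unfolded ts tensor_alg_carrier]
  note b3 = bilinear_tens[OF vect_H vT[of H H]]
  have one: "\<one>\<^bsub>H\<^esub> \<in> carrier H" and d1: "comult H \<one>\<^bsub>H\<^esub> \<in> carrier ?T" by auto
  let ?N = "\<lambda>k l. \<Oplus>\<^bsub>?T\<^esub>z\<in>P 0. tens H H (gen (k, l)) (gen (l, z))"
  let ?S = "\<Oplus>\<^bsub>?T3\<^esub>j\<in>P 0. \<Oplus>\<^bsub>?T3\<^esub>l\<in>P 0. \<Oplus>\<^bsub>?T3\<^esub>k\<in>P 0. tens H ?T (gen (j, k)) (?N k l)"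
  have Ncl: "?N k l \<in> carrier ?T" if "k \<in> P 0" "l \<in> P 0" for k l
    using that by (auto intro!: T.finsum_closed)
  have r: "?r \<in> carrier ?T3" by auto
  note a = linear_map_tensor_assoc[OF vect_H vect_H vect_H]
  have al: "linear_map ?T ?T3 (\<lambda>t. tensor_assoc H H H (tens ?T H t x))" if "x \<in> carrier H" for x
    by (rule linear_map_comp[OF a]) (rule bilinear_left[OF bilinear_tens[OF vT vect_H] that])
  have at: "tensor_assoc H H H (tens ?T H (tens H H (gen (j, k)) (gen (k, l))) x) = tens H ?T (gen (j, k)) (tens H H (gen (k, l)) x)"
    if "j \<in> P 0" "k \<in> P 0" "l \<in> P 0" "x \<in> carrier H" for j k l x
    using that by (intro tensor_assoc_tens[OF vect_H vect_H vect_H]) auto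
  have "?m ?l ?r = (\<Oplus>\<^bsub>?T3\<^esub>j\<in>P 0. \<Oplus>\<^bsub>?T3\<^esub>l\<in>P 0. \<Oplus>\<^bsub>?T3\<^esub>k\<in>P 0.
      ?m (tensor_assoc H H H (tens ?T H (tens H H (gen (j, k)) (gen (k, l))) \<one>\<^bsub>H\<^esub>)) ?r)"
    by (rule linear_map_comult_one[OF vT]) (rule linear_map_comp[OF bilinear_left[OF bm r] al[OF one]])
  also have "\<dots> = ?S"
  proof -
    have "?m (tensor_assoc H H H (tens ?T H (tens H H (gen (j, k)) (gen (k, l))) \<one>\<^bsub>H\<^esub>)) ?r = tens H ?T (gen (j, k)) (?N k l)"
      if "j \<in> P 0" "k \<in> P 0" "l \<in> P 0" for j k l
      unfolding at[OF that one] using that gen_in_H[OF that(1,2)] gen_in_H[OF that(2,3)]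
      by (simp add: mt comult_one_mult H_one_mult)
    then show ?thesis
      using Ncl by (intro T3.finsum_cong' refl) (auto intro!: T3.finsum_closed)
  qed
  finally have l: "?m ?l ?r = ?S" .
  have "?m ?r ?l = (\<Oplus>\<^bsub>?T3\<^esub>j\<in>P 0. \<Oplus>\<^bsub>?T3\<^esub>l\<in>P 0. \<Oplus>\<^bsub>?T3\<^esub>k\<in>P 0.
      ?m ?r (tensor_assoc H H H (tens ?T H (tens H H (gen (j, k)) (gen (k, l))) \<one>\<^bsub>H\<^esub>)))"
    by (rule linear_map_comult_one[OF vT]) (rule linear_map_comp[OF bilinear_right[OF bm r] al[OF one]])
  also have "\<dots> = ?S"
  proof -
    have "?m ?r (tensor_assoc H H H (tens ?T H (tens H H (gen (j, k)) (gen (k, l))) \<one>\<^bsub>H\<^esub>)) = tens H ?T (gen (j, k)) (?N k l)"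
      if "j \<in> P 0" "k \<in> P 0" "l \<in> P 0" for j k l
      unfolding at[OF that one] using that gen_in_H[OF that(1,2)] gen_in_H[OF that(2,3)]
      by (simp add: mt comult_one_mult H_one_mult)
    then show ?thesis
      using Ncl by (intro T3.finsum_cong' refl) (auto intro!: T3.finsum_closed)
  qed
  finally have r': "?m ?r ?l = ?S" .
  let ?t = "\<lambda>j k l z. tens H ?T (gen (j, k)) (tens H H (gen (k, l)) (gen (l, z)))"
  have tcl: "?t j k l z \<in> carrier ?T3" if "j \<in> P 0" "k \<in> P 0" "l \<in> P 0" "z \<in> P 0" for j k l z
    using that by auto
  have "?S = (\<Oplus>\<^bsub>?T3\<^esub>j\<in>P 0. \<Oplus>\<^bsub>?T3\<^esub>l\<in>P 0. \<Oplus>\<^bsub>?T3\<^esub>k\<in>P 0. \<Oplus>\<^bsub>?T3\<^esub>z\<in>P 0. ?t j k l z)"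
  proof -
    have "tens H ?T (gen (j, k)) (?N k l) = (\<Oplus>\<^bsub>?T3\<^esub>z\<in>P 0. ?t j k l z)"
      if "j \<in> P 0" "k \<in> P 0" "l \<in> P 0" for j k l
      using that by (intro linear_map_finsum[OF vT vT bilinear_right[OF b3]]) auto
    then show ?thesis
      using tcl by (intro T3.finsum_cong' refl) (auto intro!: T3.finsum_closed)
  qed
  \<comment> \<open>From here on the four sums are only permuted, into the order produced by
    \<open>\<Delta>(1)\<close> followed by \<open>\<Delta>\<close> on its first factor: the outer
    vertices \<open>j\<close> and \<open>z\<close>, then \<open>l\<close>, then
    \<open>k\<close>.\<close>
  also have "\<dots> = (\<Oplus>\<^bsub>?T3\<^esub>j\<in>P 0. \<Oplus>\<^bsub>?T3\<^esub>l\<in>P 0. \<Oplus>\<^bsub>?T3\<^esub>z\<in>P 0. \<Oplus>\<^bsub>?T3\<^esub>k\<in>P 0. ?t j k l z)"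
  proof -
    have "(\<Oplus>\<^bsub>?T3\<^esub>k\<in>P 0. \<Oplus>\<^bsub>?T3\<^esub>z\<in>P 0. ?t j k l z) = (\<Oplus>\<^bsub>?T3\<^esub>z\<in>P 0. \<Oplus>\<^bsub>?T3\<^esub>k\<in>P 0. ?t j k l z)"
      if "j \<in> P 0" "l \<in> P 0" for j l
      using that tcl by (intro T3.finsum_swap) auto
    then show ?thesis
      using tcl by (subst T3.finsum_cong'[OF refl _ T3.finsum_cong'[OF refl]])
        (auto intro!: T3.finsum_closed)
  qed
  also have "\<dots> = (\<Oplus>\<^bsub>?T3\<^esub>j\<in>P 0. \<Oplus>\<^bsub>?T3\<^esub>z\<in>P 0. \<Oplus>\<^bsub>?T3\<^esub>l\<in>P 0. \<Oplus>\<^bsub>?T3\<^esub>k\<in>P 0. ?t j k l z)"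
  proof (rule T3.finsum_cong'[OF refl])
    fix j assume "j \<in> P 0"
    then show "(\<Oplus>\<^bsub>?T3\<^esub>l\<in>P 0. \<Oplus>\<^bsub>?T3\<^esub>z\<in>P 0. \<Oplus>\<^bsub>?T3\<^esub>k\<in>P 0. ?t j k l z)
      = (\<Oplus>\<^bsub>?T3\<^esub>z\<in>P 0. \<Oplus>\<^bsub>?T3\<^esub>l\<in>P 0. \<Oplus>\<^bsub>?T3\<^esub>k\<in>P 0. ?t j k l z)"
      using tcl by (intro T3.finsum_swap) (auto intro!: T3.finsum_closed)
  qed (use tcl in \<open>auto intro!: T3.finsum_closed\<close>)
  also have "\<dots> = ?L"
  proof -
    let ?M = "tensor_map ?T H (comult H) id"
    have M: "linear_map ?T ?T3 (\<lambda>t. tensor_assoc H H H (?M t))"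
      by (rule linear_map_comp[OF a]) (rule linear_map_tensor_map[OF vect_H vect_H vT vect_H d linear_map_id(2)])
    have "tensor_assoc H H H (?M (tens H H (gen (j, l)) (gen (l, z)))) = (\<Oplus>\<^bsub>?T3\<^esub>k\<in>P 0. ?t j k l z)"
      if g: "j \<in> P 0" "l \<in> P 0" "z \<in> P 0" for j l z
    proof -
      note jl = gen_in_H[OF g(1,2)] and lz = gen_in_H[OF g(2,3)]
      have "tensor_assoc H H H (?M (tens H H (gen (j, l)) (gen (l, z))))
        = tensor_assoc H H H (tens ?T H (comult H (gen (j, l))) (gen (l, z)))"
        using tensor_map_tens[OF vect_H vect_H vT vect_H d linear_map_id(2) jl lz] by simp
      moreover have "\<dots> = (\<Oplus>\<^bsub>?T3\<^esub>k\<in>P 0. tensor_assoc H H H (tens ?T H (tens H H (gen (j, k)) (gen (k, l))) (gen (l, z))))"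
        by (rule linear_map_comult_gen[OF vT al[OF lz] g(1,2)])
      moreover have "\<dots> = (\<Oplus>\<^bsub>?T3\<^esub>k\<in>P 0. ?t j k l z)"
        using g tcl at lz by (intro T3.finsum_cong' refl) auto
      ultimately show ?thesis by simp
    qed
    then show ?thesis
      unfolding linear_map_comult_one[OF vT M] using tcl
      by (intro T3.finsum_cong' refl) (auto intro!: T3.finsum_closed)
  qed
  finally have "?S = ?L" .
  then show "?L = ?m ?l ?r" "?L = ?m ?r ?l" using l r' by simp_all
qed

theorem weak_bialgebra_H: "weak_bialgebra H"
proof -
  have "ring H"
    by (rule pre_algebra_ring[OF pre_algebra_H H_one_closed H_mult_assoc H_one_mult])
  moreover have "Module.module kfield H" using vect_H module_kfield_iff by blast
  moreover have "weak_bialgebra_axioms H"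
    by (unfold_locales;
        (rule H_comult_linear H_counit_linear H_coassoc H_counit_left_right H_comult_mult H_counit_mult
          H_comult_one linear_map_smult[OF bilinear_left[OF bilinear_H_mult]]
          linear_map_smult[OF bilinear_right[OF bilinear_H_mult]]; assumption)?)
  ultimately show ?thesis by (simp add: weak_bialgebra_def)
qed

end

section \<open>Linear monoidal categories\<close>

text \<open>Morphisms carry no source and target. Tagging them with both turns the axioms into
  conditional equations whose side conditions the simplifier can decide.\<close>

datatype ('o, 'm) arrow = Arrow (adom: 'o) (acod: 'o) (amor: 'm)

lemma arrow_eqI: "\<lbrakk>adom a = adom b; acod a = acod b; amor a = amor b\<rbrakk> \<Longrightarrow> a = b"
  by (cases a; cases b) simp

context linear_category
begin

lemma inv_mor_eq:
  assumes "X \<in> Obj C" "Y \<in> Obj C" "f \<in> Hom C X Y" "is_inverse C X Y f g"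
  shows "inv_mor C X Y f = g"
  unfolding inv_mor_def
proof (rule the_equality)
  fix h assume h: "is_inverse C X Y f h"
  have "h = h \<cdot> (f \<cdot> g)"
    using assms h cmp_ident_right[of Y X h] by (simp add: is_inverse_def)
  also have "\<dots> = (h \<cdot> f) \<cdot> g"
    using assms h cmp_assoc[of Y X Y X g f h] by (simp add: is_inverse_def)
  also have "\<dots> = g"
    using assms h cmp_ident_left[of Y X g] by (simp add: is_inverse_def)
  finally show "h = g" .
qed fact

lemma inv_mor:
  assumes "X \<in> Obj C" "Y \<in> Obj C" "iso_mor C X Y f"
  shows "inv_mor C X Y f \<in> Hom C Y X" "inv_mor C X Y f \<cdot> f = ident C X" "f \<cdot> inv_mor C X Y f = ident C Y"
proof -
  obtain g where "f \<in> Hom C X Y" "is_inverse C X Y f g"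
    using assms(3) by (auto simp: iso_mor_def)
  then show "inv_mor C X Y f \<in> Hom C Y X" "inv_mor C X Y f \<cdot> f = ident C X" "f \<cdot> inv_mor C X Y f = ident C Y"
    using inv_mor_eq[OF assms(1,2), of f g] by (auto simp: is_inverse_def)
qed

lemma zero_in_Hom [simp]: "X \<in> Obj C \<Longrightarrow> Y \<in> Obj C \<Longrightarrow> 0 \<in> Hom C X Y"
  and add_in_Hom: "\<lbrakk>X \<in> Obj C; Y \<in> Obj C; f \<in> Hom C X Y; g \<in> Hom C X Y\<rbrakk> \<Longrightarrow> f + g \<in> Hom C X Y"
  and scl_in_Hom: "\<lbrakk>X \<in> Obj C; Y \<in> Obj C; f \<in> Hom C X Y\<rbrakk> \<Longrightarrow> scl C c f \<in> Hom C X Y"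
  and sum_in_Hom: "\<lbrakk>X \<in> Obj C; Y \<in> Obj C; \<And>a. a \<in> A \<Longrightarrow> h a \<in> Hom C X Y\<rbrakk> \<Longrightarrow> sum h A \<in> Hom C X Y"
  using Hom_subspace subspace_0 subspace_add subspace_scale subspace_sum by metis+

lemma cmp_zero_left: "\<lbrakk>X \<in> Obj C; Y \<in> Obj C; Z \<in> Obj C; f \<in> Hom C X Y\<rbrakk> \<Longrightarrow> 0 \<cdot> f = 0"
  using cmp_scl_left[of X Y Z f 0 0] by simp

lemma cmp_zero_right: "\<lbrakk>X \<in> Obj C; Y \<in> Obj C; Z \<in> Obj C; g \<in> Hom C Y Z\<rbrakk> \<Longrightarrow> g \<cdot> 0 = 0"
  using cmp_scl_right[of X Y Z 0 g 0] by simp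

lemma cmp_sum_left:
  assumes "X \<in> Obj C" "Y \<in> Obj C" "Z \<in> Obj C" "f \<in> Hom C X Y" "\<And>a. a \<in> A \<Longrightarrow> g a \<in> Hom C Y Z"
  shows "(\<Sum>a\<in>A. g a) \<cdot> f = (\<Sum>a\<in>A. g a \<cdot> f)"
  using assms(5)
proof (induction A rule: infinite_finite_induct)
  case (insert a A)
  then show ?case
    using assms(1-4) cmp_add_left[of X Y Z f "g a" "sum g A"] sum_in_Hom[of Y Z A g] by simp
qed (use assms cmp_zero_left in auto)

lemma cmp_sum_right:
  assumes "X \<in> Obj C" "Y \<in> Obj C" "Z \<in> Obj C" "g \<in> Hom C Y Z" "\<And>a. a \<in> A \<Longrightarrow> f a \<in> Hom C X Y"
  shows "g \<cdot> (\<Sum>a\<in>A. f a) = (\<Sum>a\<in>A. g \<cdot> f a)"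
  using assms(5)
proof (induction A rule: infinite_finite_induct)
  case (insert a A)
  then show ?case
    using assms(1-4) cmp_add_right[of X Y Z "f a" "sum f A" g] sum_in_Hom[of X Y A f] by simp
qed (use assms cmp_zero_right in auto)

end

context linear_monoidal_category
begin

section \<open>Tagged arrows and coherence in a monoidal category\<close>

definition arr :: "('o, 'm) arrow \<Rightarrow> bool" where
  "arr a \<longleftrightarrow> adom a \<in> Obj C \<and> acod a \<in> Obj C \<and> amor a \<in> Hom C (adom a) (acod a)"

definition acmp :: "('o, 'm) arrow \<Rightarrow> ('o, 'm) arrow \<Rightarrow> ('o, 'm) arrow" (infixr \<open>\<bullet>\<close> 70) where
  "b \<bullet> a = Arrow (adom a) (acod b) (amor b \<cdot> amor a)"

definition aten :: "('o, 'm) arrow \<Rightarrow> ('o, 'm) arrow \<Rightarrow> ('o, 'm) arrow" (infixr \<open>\<circledast>\<close> 75) where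
  "a \<circledast> b = Arrow (adom a \<boxtimes> adom b) (acod a \<boxtimes> acod b) (amor a \<star> amor b)"

definition aid :: "'o \<Rightarrow> ('o, 'm) arrow" where
  "aid X = Arrow X X (ident C X)"

definition aassoc :: "'o \<Rightarrow> 'o \<Rightarrow> 'o \<Rightarrow> ('o, 'm) arrow" where
  "aassoc X Y Z = Arrow ((X \<boxtimes> Y) \<boxtimes> Z) (X \<boxtimes> (Y \<boxtimes> Z)) (assoc C X Y Z)"

definition aassoc' :: "'o \<Rightarrow> 'o \<Rightarrow> 'o \<Rightarrow> ('o, 'm) arrow" where
  "aassoc' X Y Z = Arrow (X \<boxtimes> (Y \<boxtimes> Z)) ((X \<boxtimes> Y) \<boxtimes> Z)
     (inv_mor C ((X \<boxtimes> Y) \<boxtimes> Z) (X \<boxtimes> (Y \<boxtimes> Z)) (assoc C X Y Z))"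

definition alunit :: "'o \<Rightarrow> ('o, 'm) arrow" where
  "alunit X = Arrow (unit_obj C \<boxtimes> X) X (lunit C X)"

definition arunit :: "'o \<Rightarrow> ('o, 'm) arrow" where
  "arunit X = Arrow (X \<boxtimes> unit_obj C) X (runit C X)"

definition arunit' :: "'o \<Rightarrow> ('o, 'm) arrow" where
  "arunit' X = Arrow X (X \<boxtimes> unit_obj C) (runit_inv C X)"

lemmas arrow_defs = acmp_def aten_def aid_def aassoc_def aassoc'_def alunit_def arunit_def arunit'_def

lemma adom_simps [simp]:
  "adom (b \<bullet> a) = adom a" "adom (a \<circledast> b) = adom a \<boxtimes> adom b" "adom (aid X) = X"
  "adom (aassoc X Y Z) = (X \<boxtimes> Y) \<boxtimes> Z" "adom (aassoc' X Y Z) = X \<boxtimes> (Y \<boxtimes> Z)"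
  "adom (alunit X) = unit_obj C \<boxtimes> X" "adom (arunit X) = X \<boxtimes> unit_obj C" "adom (arunit' X) = X"
  by (simp_all add: arrow_defs)

lemma acod_simps [simp]:
  "acod (b \<bullet> a) = acod b" "acod (a \<circledast> b) = acod a \<boxtimes> acod b" "acod (aid X) = X"
  "acod (aassoc X Y Z) = X \<boxtimes> (Y \<boxtimes> Z)" "acod (aassoc' X Y Z) = (X \<boxtimes> Y) \<boxtimes> Z"
  "acod (alunit X) = X" "acod (arunit X) = X" "acod (arunit' X) = X \<boxtimes> unit_obj C"
  by (simp_all add: arrow_defs)

lemma amor_simps:
  "amor (b \<bullet> a) = amor b \<cdot> amor a" "amor (a \<circledast> b) = amor a \<star> amor b" "amor (aid X) = ident C X"
  "amor (aassoc X Y Z) = assoc C X Y Z"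
  "amor (aassoc' X Y Z) = inv_mor C ((X \<boxtimes> Y) \<boxtimes> Z) (X \<boxtimes> (Y \<boxtimes> Z)) (assoc C X Y Z)"
  "amor (alunit X) = lunit C X" "amor (arunit X) = runit C X" "amor (arunit' X) = runit_inv C X"
  by (simp_all add: arrow_defs)

lemma arr_dom [simp]: "arr a \<Longrightarrow> adom a \<in> Obj C"
  and arr_cod [simp]: "arr a \<Longrightarrow> acod a \<in> Obj C"
  and arr_Hom: "arr a \<Longrightarrow> amor a \<in> Hom C (adom a) (acod a)"
  by (simp_all add: arr_def)

declare unit_Obj [simp] tobj_Obj [simp]

lemma arr_simps [simp]:
  "\<lbrakk>arr b; arr a; adom b = acod a\<rbrakk> \<Longrightarrow> arr (b \<bullet> a)"
  "\<lbrakk>arr a; arr b\<rbrakk> \<Longrightarrow> arr (a \<circledast> b)"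
  "X \<in> Obj C \<Longrightarrow> arr (aid X)"
  "\<lbrakk>X \<in> Obj C; Y \<in> Obj C; Z \<in> Obj C\<rbrakk> \<Longrightarrow> arr (aassoc X Y Z)"
  "\<lbrakk>X \<in> Obj C; Y \<in> Obj C; Z \<in> Obj C\<rbrakk> \<Longrightarrow> arr (aassoc' X Y Z)"
  "X \<in> Obj C \<Longrightarrow> arr (alunit X)" "X \<in> Obj C \<Longrightarrow> arr (arunit X)" "X \<in> Obj C \<Longrightarrow> arr (arunit' X)"
  unfolding arr_def
  using cmp_Hom[of "adom a" "acod a" "acod b" "amor a" "amor b"]
    tmor_Hom[of "adom a" "acod a" "adom b" "acod b" "amor a" "amor b"]
    ident_Hom assoc_iso[of X Y Z] lunit_iso[of X] runit_iso[of X]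
    inv_mor(1)[of "(X \<boxtimes> Y) \<boxtimes> Z" "X \<boxtimes> (Y \<boxtimes> Z)" "assoc C X Y Z"]
    inv_mor(1)[of "X \<boxtimes> unit_obj C" X "runit C X"]
  by (simp_all add: amor_simps iso_mor_def runit_inv_def)

lemma acmp_assoc [simp]:
  "\<lbrakk>arr a; arr b; arr c; adom c = acod b; adom b = acod a\<rbrakk> \<Longrightarrow> (c \<bullet> b) \<bullet> a = c \<bullet> (b \<bullet> a)"
  using cmp_assoc[of "adom a" "acod a" "acod b" "acod c" "amor a" "amor b" "amor c"]
  by (intro arrow_eqI) (auto simp: amor_simps arr_def simp del: arr_dom arr_cod)

lemma acmp_aid [simp]:
  "\<lbrakk>arr f; acod f = Y\<rbrakk> \<Longrightarrow> aid Y \<bullet> f = f" "\<lbrakk>arr f; adom f = X\<rbrakk> \<Longrightarrow> f \<bullet> aid X = f"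
  using cmp_ident_left[of "adom f" "acod f" "amor f"] cmp_ident_right[of "adom f" "acod f" "amor f"]
  by (auto intro!: arrow_eqI simp: amor_simps arr_def simp del: arr_dom arr_cod)

lemma aten_aid [simp]: "\<lbrakk>X \<in> Obj C; Y \<in> Obj C\<rbrakk> \<Longrightarrow> aid X \<circledast> aid Y = aid (X \<boxtimes> Y)"
  by (auto intro!: arrow_eqI simp: amor_simps tmor_ident)

lemma aten_acmp:
  "\<lbrakk>arr f; arr f'; arr g; arr g'; adom f' = acod f; adom g' = acod g\<rbrakk> \<Longrightarrow>
    (f' \<bullet> f) \<circledast> (g' \<bullet> g) = (f' \<circledast> g') \<bullet> (f \<circledast> g)"
  using tmor_cmp[of "adom f" "acod f" "acod f'" "adom g" "acod g" "acod g'" "amor f" "amor f'" "amor g" "amor g'"]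
  by (auto intro!: arrow_eqI simp: amor_simps arr_def simp del: arr_dom arr_cod)

lemma whisker:
  "\<lbrakk>arr f; arr f'; adom f' = acod f; X \<in> Obj C\<rbrakk> \<Longrightarrow> (f' \<bullet> f) \<circledast> aid X = (f' \<circledast> aid X) \<bullet> (f \<circledast> aid X)"
  "\<lbrakk>arr f; arr f'; adom f' = acod f; X \<in> Obj C\<rbrakk> \<Longrightarrow> aid X \<circledast> (f' \<bullet> f) = (aid X \<circledast> f') \<bullet> (aid X \<circledast> f)"
  using aten_acmp[of f f' "aid X" "aid X"] aten_acmp[of "aid X" "aid X" f f'] by simp_all

lemma interchange:
  assumes "arr f" "arr g" "adom f = X" "acod f = X'" "adom g = Y" "acod g = Y'"
  shows "(f \<circledast> aid Y') \<bullet> (aid X \<circledast> g) = (aid X' \<circledast> g) \<bullet> (f \<circledast> aid Y)"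
  using assms aten_acmp[of "aid X" f g "aid Y'"] aten_acmp[of f "aid X'" "aid Y" g] by auto

text \<open>Composites are normalised by bracketing to the right, so an equation between two-fold
  composites does not match inside a longer one. This adds an arbitrary tail \<open>x\<close> to
  such an equation; the variants with suffix \<open>_cmp\<close> for interchange and naturality
  arise in this way.\<close>

lemma acmp_cong_right:
  assumes "b \<bullet> a = c \<bullet> d" "arr a" "arr b" "arr c" "arr d" "arr x"
    "adom b = acod a" "adom c = acod d" "adom a = acod x" "adom d = acod x"
  shows "b \<bullet> (a \<bullet> x) = c \<bullet> (d \<bullet> x)"
  using acmp_assoc[of x a b] acmp_assoc[of x d c] assms by simp

lemma interchange_cmp:
  assumes "arr f" "arr g" "adom f = X" "acod f = X'" "adom g = Y" "acod g = Y'" "arr x" "acod x = X \<boxtimes> Y"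
  shows "(f \<circledast> aid Y') \<bullet> ((aid X \<circledast> g) \<bullet> x) = (aid X' \<circledast> g) \<bullet> ((f \<circledast> aid Y) \<bullet> x)"
  using assms by (intro acmp_cong_right interchange) auto

lemma aassoc_natural:
  assumes "arr f" "arr g" "arr h" "adom f = X" "acod f = X'" "adom g = Y" "acod g = Y'" "adom h = Z" "acod h = Z'"
  shows "aassoc X' Y' Z' \<bullet> ((f \<circledast> g) \<circledast> h) = (f \<circledast> (g \<circledast> h)) \<bullet> aassoc X Y Z"
  using assoc_natural[of X X' Y Y' Z Z' "amor f" "amor g" "amor h"] assms
  by (auto intro!: arrow_eqI simp: amor_simps arr_def simp del: arr_dom arr_cod)

lemma aassoc_natural_cmp:
  assumes "arr f" "arr g" "arr h" "adom f = X" "acod f = X'" "adom g = Y" "acod g = Y'" "adom h = Z" "acod h = Z'"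
    "arr x" "acod x = (X \<boxtimes> Y) \<boxtimes> Z"
  shows "aassoc X' Y' Z' \<bullet> (((f \<circledast> g) \<circledast> h) \<bullet> x) = (f \<circledast> (g \<circledast> h)) \<bullet> (aassoc X Y Z \<bullet> x)"
  using assms by (intro acmp_cong_right aassoc_natural) auto

lemma aassoc_inv [simp]:
  assumes "X \<in> Obj C" "Y \<in> Obj C" "Z \<in> Obj C"
  shows "aassoc X Y Z \<bullet> aassoc' X Y Z = aid (X \<boxtimes> (Y \<boxtimes> Z))"
    "aassoc' X Y Z \<bullet> aassoc X Y Z = aid ((X \<boxtimes> Y) \<boxtimes> Z)"
  using inv_mor(2,3)[of "(X \<boxtimes> Y) \<boxtimes> Z" "X \<boxtimes> (Y \<boxtimes> Z)" "assoc C X Y Z"] assoc_iso[of X Y Z] assms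
  by (auto intro!: arrow_eqI simp: amor_simps)

lemma aassoc_inv_cmp [simp]:
  assumes "X \<in> Obj C" "Y \<in> Obj C" "Z \<in> Obj C" "arr x"
  shows "acod x = X \<boxtimes> (Y \<boxtimes> Z) \<Longrightarrow> aassoc X Y Z \<bullet> (aassoc' X Y Z \<bullet> x) = x"
    "acod x = (X \<boxtimes> Y) \<boxtimes> Z \<Longrightarrow> aassoc' X Y Z \<bullet> (aassoc X Y Z \<bullet> x) = x"
  using assms acmp_assoc[of x "aassoc' X Y Z" "aassoc X Y Z"] acmp_assoc[of x "aassoc X Y Z" "aassoc' X Y Z"]
  by simp_all

lemma aassoc'_natural:
  assumes "arr f" "arr g" "arr h" "adom f = X" "acod f = X'" "adom g = Y" "acod g = Y'" "adom h = Z" "acod h = Z'"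
  shows "aassoc' X' Y' Z' \<bullet> (f \<circledast> (g \<circledast> h)) = ((f \<circledast> g) \<circledast> h) \<bullet> aassoc' X Y Z"
proof -
  have "aassoc' X' Y' Z' \<bullet> (f \<circledast> (g \<circledast> h)) = aassoc' X' Y' Z' \<bullet> (((f \<circledast> (g \<circledast> h)) \<bullet> aassoc X Y Z) \<bullet> aassoc' X Y Z)"
    using assms by auto
  also have "\<dots> = aassoc' X' Y' Z' \<bullet> ((aassoc X' Y' Z' \<bullet> ((f \<circledast> g) \<circledast> h)) \<bullet> aassoc' X Y Z)"
    using aassoc_natural[OF assms] by simp
  also have "\<dots> = ((f \<circledast> g) \<circledast> h) \<bullet> aassoc' X Y Z"
    using assms by auto
  finally show ?thesis .
qed

lemma arunit_inv [simp]:
  assumes "X \<in> Obj C"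
  shows "arunit X \<bullet> arunit' X = aid X" "arunit' X \<bullet> arunit X = aid (X \<boxtimes> unit_obj C)"
  using inv_mor(2,3)[of "X \<boxtimes> unit_obj C" X "runit C X"] runit_iso[of X] assms
  by (auto intro!: arrow_eqI simp: amor_simps runit_inv_def)

lemma arunit_inv_cmp [simp]:
  assumes "X \<in> Obj C" "arr x"
  shows "acod x = X \<Longrightarrow> arunit X \<bullet> (arunit' X \<bullet> x) = x"
  using assms acmp_assoc[of x "arunit' X" "arunit X"] by simp

lemma arunit_natural:
  "\<lbrakk>arr f; adom f = X; acod f = Y\<rbrakk> \<Longrightarrow> arunit Y \<bullet> (f \<circledast> aid (unit_obj C)) = f \<bullet> arunit X"
  using runit_natural[of X Y "amor f"] by (auto intro!: arrow_eqI simp: amor_simps arr_def simp del: arr_dom arr_cod)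

lemma arunit_natural_cmp:
  "\<lbrakk>arr f; adom f = X; acod f = Y; arr x; acod x = X \<boxtimes> unit_obj C\<rbrakk> \<Longrightarrow>
    arunit Y \<bullet> ((f \<circledast> aid (unit_obj C)) \<bullet> x) = f \<bullet> (arunit X \<bullet> x)"
  by (intro acmp_cong_right arunit_natural) auto

lemma atriangle:
  "\<lbrakk>X \<in> Obj C; Y \<in> Obj C\<rbrakk> \<Longrightarrow> (aid X \<circledast> alunit Y) \<bullet> aassoc X (unit_obj C) Y = arunit X \<circledast> aid Y"
  using triangle[of X Y] by (auto intro!: arrow_eqI simp: amor_simps)

lemma apentagon:
  assumes "W \<in> Obj C" "X \<in> Obj C" "Y \<in> Obj C" "Z \<in> Obj C"
  shows "aassoc W X (Y \<boxtimes> Z) \<bullet> aassoc (W \<boxtimes> X) Y Z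
    = (aid W \<circledast> aassoc X Y Z) \<bullet> aassoc W (X \<boxtimes> Y) Z \<bullet> (aassoc W X Y \<circledast> aid Z)"
  using pentagon[OF assms] assms by (auto intro!: arrow_eqI simp: amor_simps)

text \<open>The right unitor is a natural isomorphism, so \<open>f\<close> is recovered from its
  tensor product with the identity of the unit object by conjugation.\<close>

lemma aten_unit_cancel:
  assumes "arr f" "arr g" "adom f = adom g" "acod f = acod g"
    and eq: "f \<circledast> aid (unit_obj C) = g \<circledast> aid (unit_obj C)"
  shows "f = g"
proof -
  have "f = arunit (acod f) \<bullet> (f \<circledast> aid (unit_obj C)) \<bullet> arunit' (adom f)"
    using assms arunit_natural_cmp[of f "adom f" "acod f" "arunit' (adom f)"] by simp
  moreover have "g = arunit (acod g) \<bullet> (g \<circledast> aid (unit_obj C)) \<bullet> arunit' (adom g)"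
    using assms arunit_natural_cmp[of g "adom g" "acod g" "arunit' (adom g)"] by simp
  ultimately show ?thesis using assms by metis
qed

text \<open>Kelly's argument: both sides agree after tensoring with the unit object, by the pentagon
  for \<open>X, Y, 1, 1\<close> and the triangle axiom.\<close>

lemma arunit_tensor:
  assumes X: "X \<in> Obj C" and Y: "Y \<in> Obj C"
  shows "(aid X \<circledast> arunit Y) \<bullet> aassoc X Y (unit_obj C) = arunit (X \<boxtimes> Y)"
proof -
  let ?U = "unit_obj C"
  have "aassoc X Y ?U \<bullet> (arunit (X \<boxtimes> Y) \<circledast> aid ?U)
    = aassoc X Y ?U \<bullet> ((aid (X \<boxtimes> Y) \<circledast> alunit ?U) \<bullet> aassoc (X \<boxtimes> Y) ?U ?U)"
    using X Y by (simp add: atriangle)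
  also have "\<dots> = (aid X \<circledast> (aid Y \<circledast> alunit ?U)) \<bullet> (aassoc X Y (?U \<boxtimes> ?U) \<bullet> aassoc (X \<boxtimes> Y) ?U ?U)"
    using X Y aassoc_natural_cmp[of "aid X" "aid Y" "alunit ?U" X X Y Y "?U \<boxtimes> ?U" ?U "aassoc (X \<boxtimes> Y) ?U ?U"]
    by simp
  also have "\<dots> = (aid X \<circledast> ((aid Y \<circledast> alunit ?U) \<bullet> aassoc Y ?U ?U)) \<bullet> aassoc X (Y \<boxtimes> ?U) ?U \<bullet> (aassoc X Y ?U \<circledast> aid ?U)"
    using X Y by (simp add: apentagon whisker)
  also have "\<dots> = (aid X \<circledast> (arunit Y \<circledast> aid ?U)) \<bullet> (aassoc X (Y \<boxtimes> ?U) ?U \<bullet> (aassoc X Y ?U \<circledast> aid ?U))"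
    using X Y by (simp add: atriangle)
  also have "\<dots> = aassoc X Y ?U \<bullet> (((aid X \<circledast> arunit Y) \<bullet> aassoc X Y ?U) \<circledast> aid ?U)"
    using X Y aassoc_natural_cmp[of "aid X" "arunit Y" "aid ?U" X X "Y \<boxtimes> ?U" Y ?U ?U "aassoc X Y ?U \<circledast> aid ?U"]
    by (simp add: whisker)
  finally have "aassoc' X Y ?U \<bullet> (aassoc X Y ?U \<bullet> (arunit (X \<boxtimes> Y) \<circledast> aid ?U))
    = aassoc' X Y ?U \<bullet> (aassoc X Y ?U \<bullet> (((aid X \<circledast> arunit Y) \<bullet> aassoc X Y ?U) \<circledast> aid ?U))"
    by simp
  then have "arunit (X \<boxtimes> Y) \<circledast> aid ?U = ((aid X \<circledast> arunit Y) \<bullet> aassoc X Y ?U) \<circledast> aid ?U"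
    using X Y by simp
  then have "arunit (X \<boxtimes> Y) = (aid X \<circledast> arunit Y) \<bullet> aassoc X Y ?U"
    by (rule aten_unit_cancel[rotated -1]) (use X Y in simp_all)
  then show ?thesis ..
qed

section \<open>The products of vectors and of covectors\<close>

text \<open>\<open>vprod\<close> and \<open>cprod\<close> are the two entries in the product of the
  symbols \<open>[\<theta>|v]\<close> and \<open>[\<zeta>|w]\<close>, for a general object
  \<open>A\<close> in the place of \<open>Vh\<close>. Identities about them are proved for tagged
  arrows and then read off from the underlying morphisms.\<close>

definition vprod :: "'o \<Rightarrow> 'o \<Rightarrow> 'o \<Rightarrow> 'm \<Rightarrow> 'm \<Rightarrow> 'm" where
  "vprod A X Y v w = assoc C A X Y \<cdot> (v \<star> ident C Y) \<cdot> w"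

definition cprod :: "'o \<Rightarrow> 'o \<Rightarrow> 'o \<Rightarrow> 'm \<Rightarrow> 'm \<Rightarrow> 'm" where
  "cprod A X Y \<theta> \<zeta> = \<zeta> \<cdot> (\<theta> \<star> ident C Y) \<cdot> inv_mor C ((A \<boxtimes> X) \<boxtimes> Y) (A \<boxtimes> (X \<boxtimes> Y)) (assoc C A X Y)"

lemma arr_Arrow [simp]: "arr (Arrow X Y f) \<longleftrightarrow> X \<in> Obj C \<and> Y \<in> Obj C \<and> f \<in> Hom C X Y"
  by (simp add: arr_def)

context
  fixes A X Y :: 'o
  assumes Obj: "A \<in> Obj C" "X \<in> Obj C" "Y \<in> Obj C"
begin

lemma vprod_Hom:
  assumes "v \<in> Hom C A (A \<boxtimes> X)" "w \<in> Hom C A (A \<boxtimes> Y)"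
  shows "vprod A X Y v w \<in> Hom C A (A \<boxtimes> (X \<boxtimes> Y))"
  using arr_Hom[of "aassoc A X Y \<bullet> (Arrow A (A \<boxtimes> X) v \<circledast> aid Y) \<bullet> Arrow A (A \<boxtimes> Y) w"] assms Obj
  by (simp add: vprod_def amor_simps)

lemma cprod_Hom:
  assumes "\<theta> \<in> Hom C (A \<boxtimes> X) A" "\<zeta> \<in> Hom C (A \<boxtimes> Y) A"
  shows "cprod A X Y \<theta> \<zeta> \<in> Hom C (A \<boxtimes> (X \<boxtimes> Y)) A"
  using arr_Hom[of "Arrow (A \<boxtimes> Y) A \<zeta> \<bullet> (Arrow (A \<boxtimes> X) A \<theta> \<circledast> aid Y) \<bullet> aassoc' A X Y"] assms Obj
  by (simp add: cprod_def amor_simps)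

text \<open>Naturality of the associator moves \<open>f\<close> out of the product. With the three
  lemmas that follow, this makes the product of symbols compatible with the dinaturality relation of
  the coend in either argument.\<close>

lemma vprod_natural_left:
  assumes "v \<in> Hom C A (A \<boxtimes> X)" "w \<in> Hom C A (A \<boxtimes> Y)" "X' \<in> Obj C" "f \<in> Hom C X X'"
  shows "vprod A X' Y ((ident C A \<star> f) \<cdot> v) w = (ident C A \<star> (f \<star> ident C Y)) \<cdot> vprod A X Y v w"
proof -
  let ?v = "Arrow A (A \<boxtimes> X) v" and ?w = "Arrow A (A \<boxtimes> Y) w" and ?f = "Arrow X X' f"
  have "aassoc A X' Y \<bullet> (((aid A \<circledast> ?f) \<bullet> ?v) \<circledast> aid Y) \<bullet> ?w
    = (aid A \<circledast> (?f \<circledast> aid Y)) \<bullet> aassoc A X Y \<bullet> (?v \<circledast> aid Y) \<bullet> ?w"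
    using assms Obj by (simp add: whisker aassoc_natural_cmp)
  from arg_cong[OF this, of amor] show ?thesis by (simp add: amor_simps vprod_def)
qed

lemma vprod_natural_right:
  assumes "v \<in> Hom C A (A \<boxtimes> X)" "w \<in> Hom C A (A \<boxtimes> Y)" "Y' \<in> Obj C" "g \<in> Hom C Y Y'"
  shows "vprod A X Y' v ((ident C A \<star> g) \<cdot> w) = (ident C A \<star> (ident C X \<star> g)) \<cdot> vprod A X Y v w"
proof -
  let ?v = "Arrow A (A \<boxtimes> X) v" and ?w = "Arrow A (A \<boxtimes> Y) w" and ?g = "Arrow Y Y' g"
  have "aassoc A X Y' \<bullet> (?v \<circledast> aid Y') \<bullet> (aid A \<circledast> ?g) \<bullet> ?w
    = aassoc A X Y' \<bullet> ((aid A \<circledast> aid X) \<circledast> ?g) \<bullet> (?v \<circledast> aid Y) \<bullet> ?w"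
    using assms Obj interchange_cmp[of ?v ?g A "A \<boxtimes> X" Y Y' ?w] by simp
  also have "\<dots> = (aid A \<circledast> (aid X \<circledast> ?g)) \<bullet> aassoc A X Y \<bullet> (?v \<circledast> aid Y) \<bullet> ?w"
    using assms Obj by (simp del: aten_aid add: aassoc_natural_cmp)
  finally show ?thesis by (simp only: vprod_def arrow_defs arrow.sel arrow.inject simp_thms)
qed

lemma cprod_natural_left:
  assumes "X' \<in> Obj C" "f \<in> Hom C X X'" "\<theta> \<in> Hom C (A \<boxtimes> X') A" "\<zeta> \<in> Hom C (A \<boxtimes> Y) A"
  shows "cprod A X Y (\<theta> \<cdot> (ident C A \<star> f)) \<zeta> = cprod A X' Y \<theta> \<zeta> \<cdot> (ident C A \<star> (f \<star> ident C Y))"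
proof -
  let ?t = "Arrow (A \<boxtimes> X') A \<theta>" and ?z = "Arrow (A \<boxtimes> Y) A \<zeta>" and ?f = "Arrow X X' f"
  have "?z \<bullet> ((?t \<bullet> (aid A \<circledast> ?f)) \<circledast> aid Y) \<bullet> aassoc' A X Y
    = (?z \<bullet> (?t \<circledast> aid Y) \<bullet> aassoc' A X' Y) \<bullet> (aid A \<circledast> (?f \<circledast> aid Y))"
    using assms Obj by (simp add: whisker aassoc'_natural)
  from arg_cong[OF this, of amor] show ?thesis by (simp add: amor_simps cprod_def)
qed

lemma cprod_natural_right:
  assumes "Y' \<in> Obj C" "g \<in> Hom C Y Y'" "\<theta> \<in> Hom C (A \<boxtimes> X) A" "\<zeta> \<in> Hom C (A \<boxtimes> Y') A"
  shows "cprod A X Y \<theta> (\<zeta> \<cdot> (ident C A \<star> g)) = cprod A X Y' \<theta> \<zeta> \<cdot> (ident C A \<star> (ident C X \<star> g))"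
proof -
  let ?t = "Arrow (A \<boxtimes> X) A \<theta>" and ?z = "Arrow (A \<boxtimes> Y') A \<zeta>" and ?g = "Arrow Y Y' g"
  have "(?z \<bullet> (?t \<circledast> aid Y') \<bullet> aassoc' A X Y') \<bullet> (aid A \<circledast> (aid X \<circledast> ?g))
    = ?z \<bullet> (?t \<circledast> aid Y') \<bullet> ((aid A \<circledast> aid X) \<circledast> ?g) \<bullet> aassoc' A X Y"
    using assms Obj by (simp del: aten_aid add: aassoc'_natural)
  also have "\<dots> = (?z \<bullet> (aid A \<circledast> ?g)) \<bullet> (?t \<circledast> aid Y) \<bullet> aassoc' A X Y"
    using assms Obj interchange_cmp[of ?t ?g "A \<boxtimes> X" A Y Y' "aassoc' A X Y"] by simp
  finally show ?thesis by (simp only: cprod_def arrow_defs arrow.sel arrow.inject simp_thms)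
qed

text \<open>The associator cancels against its inverse. In this form the orthogonality of
  \<open>\<theta>\<close> and \<open>v\<close> can be used first, in the middle, and that of
  \<open>\<zeta>\<close> and \<open>w\<close> afterwards.\<close>

lemma cprod_vprod:
  assumes "\<theta> \<in> Hom C (A \<boxtimes> X) A" "\<zeta> \<in> Hom C (A \<boxtimes> Y) A" "v \<in> Hom C A (A \<boxtimes> X)" "w \<in> Hom C A (A \<boxtimes> Y)"
  shows "cprod A X Y \<theta> \<zeta> \<cdot> vprod A X Y v w = \<zeta> \<cdot> ((\<theta> \<cdot> v) \<star> ident C Y) \<cdot> w"
proof -
  let ?t = "Arrow (A \<boxtimes> X) A \<theta>" and ?z = "Arrow (A \<boxtimes> Y) A \<zeta>"
    and ?v = "Arrow A (A \<boxtimes> X) v" and ?w = "Arrow A (A \<boxtimes> Y) w"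
  have "(?z \<bullet> (?t \<circledast> aid Y) \<bullet> aassoc' A X Y) \<bullet> aassoc A X Y \<bullet> (?v \<circledast> aid Y) \<bullet> ?w
    = ?z \<bullet> ((?t \<bullet> ?v) \<circledast> aid Y) \<bullet> ?w"
    using assms Obj by (simp add: whisker)
  from arg_cong[OF this, of amor] show ?thesis by (simp add: amor_simps cprod_def vprod_def)
qed

text \<open>The composite is bracketed with \<open>w \<cdot> \<zeta>\<close> in the middle, ready
  for summing over the second factor before the first.\<close>

lemma vprod_cprod:
  assumes "\<theta> \<in> Hom C (A \<boxtimes> X) A" "\<zeta> \<in> Hom C (A \<boxtimes> Y) A" "v \<in> Hom C A (A \<boxtimes> X)" "w \<in> Hom C A (A \<boxtimes> Y)"
  shows "vprod A X Y v w \<cdot> cprod A X Y \<theta> \<zeta>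
    = assoc C A X Y \<cdot> (v \<star> ident C Y) \<cdot> (w \<cdot> \<zeta>) \<cdot> (\<theta> \<star> ident C Y)
        \<cdot> inv_mor C ((A \<boxtimes> X) \<boxtimes> Y) (A \<boxtimes> (X \<boxtimes> Y)) (assoc C A X Y)"
proof -
  let ?t = "Arrow (A \<boxtimes> X) A \<theta>" and ?z = "Arrow (A \<boxtimes> Y) A \<zeta>"
    and ?v = "Arrow A (A \<boxtimes> X) v" and ?w = "Arrow A (A \<boxtimes> Y) w"
  have "(aassoc A X Y \<bullet> (?v \<circledast> aid Y) \<bullet> ?w) \<bullet> (?z \<bullet> (?t \<circledast> aid Y) \<bullet> aassoc' A X Y)
    = aassoc A X Y \<bullet> (?v \<circledast> aid Y) \<bullet> (?w \<bullet> ?z) \<bullet> (?t \<circledast> aid Y) \<bullet> aassoc' A X Y"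
    using assms Obj by simp
  from arg_cong[OF this, of amor] show ?thesis by (simp add: amor_simps cprod_def vprod_def)
qed

text \<open>The pentagon axiom at \<open>A, X, Y, Z\<close>, after the associator has been moved
  past \<open>v\<close> by naturality.\<close>

lemma vprod_assoc:
  assumes "Z \<in> Obj C" "v \<in> Hom C A (A \<boxtimes> X)" "w \<in> Hom C A (A \<boxtimes> Y)" "u \<in> Hom C A (A \<boxtimes> Z)"
  shows "(ident C A \<star> assoc C X Y Z) \<cdot> vprod A (X \<boxtimes> Y) Z (vprod A X Y v w) u
    = vprod A X (Y \<boxtimes> Z) v (vprod A Y Z w u)"
proof -
  let ?v = "Arrow A (A \<boxtimes> X) v" and ?w = "Arrow A (A \<boxtimes> Y) w" and ?u = "Arrow A (A \<boxtimes> Z) u"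
  have "aassoc A X (Y \<boxtimes> Z) \<bullet> (?v \<circledast> aid (Y \<boxtimes> Z)) \<bullet> aassoc A Y Z \<bullet> (?w \<circledast> aid Z) \<bullet> ?u
    = aassoc A X (Y \<boxtimes> Z) \<bullet> aassoc (A \<boxtimes> X) Y Z \<bullet> ((?v \<circledast> aid Y) \<circledast> aid Z) \<bullet> (?w \<circledast> aid Z) \<bullet> ?u"
    using assms Obj aassoc_natural_cmp[of ?v "aid Y" "aid Z" A "A \<boxtimes> X" Y Y Z Z "(?w \<circledast> aid Z) \<bullet> ?u"] by simp
  also have "\<dots> = (aassoc A X (Y \<boxtimes> Z) \<bullet> aassoc (A \<boxtimes> X) Y Z) \<bullet> ((?v \<circledast> aid Y) \<circledast> aid Z) \<bullet> (?w \<circledast> aid Z) \<bullet> ?u"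
    using assms Obj by simp
  also have "\<dots> = (aid A \<circledast> aassoc X Y Z) \<bullet> aassoc A (X \<boxtimes> Y) Z \<bullet> ((aassoc A X Y \<bullet> (?v \<circledast> aid Y) \<bullet> ?w) \<circledast> aid Z) \<bullet> ?u"
    unfolding apentagon[OF Obj assms(1)] using assms Obj by (simp add: whisker)
  finally show ?thesis by (simp only: vprod_def arrow_defs arrow.sel arrow.inject simp_thms)
qed

text \<open>Dual to \<open>vprod_assoc\<close>, and based on the pentagon for inverse associators,
  which first has to be derived.\<close>

lemma cprod_assoc:
  assumes "Z \<in> Obj C" "\<theta> \<in> Hom C (A \<boxtimes> X) A" "\<zeta> \<in> Hom C (A \<boxtimes> Y) A" "\<xi> \<in> Hom C (A \<boxtimes> Z) A"
  shows "cprod A X (Y \<boxtimes> Z) \<theta> (cprod A Y Z \<zeta> \<xi>) \<cdot> (ident C A \<star> assoc C X Y Z)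
    = cprod A (X \<boxtimes> Y) Z (cprod A X Y \<theta> \<zeta>) \<xi>"
proof -
  let ?t = "Arrow (A \<boxtimes> X) A \<theta>" and ?z = "Arrow (A \<boxtimes> Y) A \<zeta>" and ?x = "Arrow (A \<boxtimes> Z) A \<xi>"
  let ?r = "aassoc' (A \<boxtimes> X) Y Z \<bullet> aassoc' A X (Y \<boxtimes> Z) \<bullet> (aid A \<circledast> aassoc X Y Z)"
  let ?l = "(aassoc' A X Y \<circledast> aid Z) \<bullet> aassoc' A (X \<boxtimes> Y) Z"
  let ?p = "aassoc A (X \<boxtimes> Y) Z \<bullet> (aassoc A X Y \<circledast> aid Z)"
  have p: "?r \<bullet> ?p = aid (((A \<boxtimes> X) \<boxtimes> Y) \<boxtimes> Z)"
  proof -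
    have "?r \<bullet> ?p = aassoc' (A \<boxtimes> X) Y Z \<bullet> aassoc' A X (Y \<boxtimes> Z) \<bullet>
        ((aid A \<circledast> aassoc X Y Z) \<bullet> aassoc A (X \<boxtimes> Y) Z \<bullet> (aassoc A X Y \<circledast> aid Z))"
      using assms Obj by simp
    also have "\<dots> = aid (((A \<boxtimes> X) \<boxtimes> Y) \<boxtimes> Z)"
      unfolding apentagon[OF Obj assms(1), symmetric] using assms Obj by simp
    finally show ?thesis .
  qed
  have q: "?p \<bullet> ?l = aid (A \<boxtimes> ((X \<boxtimes> Y) \<boxtimes> Z))"
  proof -
    have "(aassoc A X Y \<circledast> aid Z) \<bullet> ((aassoc' A X Y \<circledast> aid Z) \<bullet> aassoc' A (X \<boxtimes> Y) Z)
      = ((aassoc A X Y \<bullet> aassoc' A X Y) \<circledast> aid Z) \<bullet> aassoc' A (X \<boxtimes> Y) Z"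
      unfolding whisker(1)[of "aassoc' A X Y" "aassoc A X Y" Z] using assms Obj by (subst whisker) simp_all
    then show ?thesis using assms Obj by simp
  qed
  \<comment> \<open>One composite \<open>?p\<close> of associators has \<open>?r\<close> as a left
    inverse and \<open>?l\<close> as a right inverse, so these are equal. This is the inverted
    pentagon, with one associator kept on the left side.\<close>
  have rl: "?r = ?l"
  proof -
    have "?r = ?r \<bullet> (?p \<bullet> ?l)" unfolding q using assms Obj by simp
    also have "\<dots> = (?r \<bullet> ?p) \<bullet> ?l" using assms Obj by simp
    also have "\<dots> = ?l" unfolding p using assms Obj by simp
    finally show ?thesis .
  qed
  have "((?x \<bullet> (?z \<circledast> aid Z) \<bullet> aassoc' A Y Z) \<bullet> (?t \<circledast> aid (Y \<boxtimes> Z)) \<bullet> aassoc' A X (Y \<boxtimes> Z)) \<bullet> (aid A \<circledast> aassoc X Y Z)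
    = ?x \<bullet> (?z \<circledast> aid Z) \<bullet> (aassoc' A Y Z \<bullet> (?t \<circledast> (aid Y \<circledast> aid Z))) \<bullet> aassoc' A X (Y \<boxtimes> Z) \<bullet> (aid A \<circledast> aassoc X Y Z)"
    using assms Obj by simp
  also have "\<dots> = ?x \<bullet> (?z \<circledast> aid Z) \<bullet> ((?t \<circledast> aid Y) \<circledast> aid Z) \<bullet> ?r"
    using assms Obj aassoc'_natural[of ?t "aid Y" "aid Z" "A \<boxtimes> X" A Y Y Z Z] by simp
  also have "\<dots> = ?x \<bullet> ((?z \<bullet> (?t \<circledast> aid Y) \<bullet> aassoc' A X Y) \<circledast> aid Z) \<bullet> aassoc' A (X \<boxtimes> Y) Z"
    unfolding rl using assms Obj by (simp add: whisker)
  finally show ?thesis by (simp only: cprod_def arrow_defs arrow.sel arrow.inject simp_thms)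
qed

text \<open>This is the triangle axiom. The degree-zero vector given by \<open>l\<close> turns into
  the action of \<open>l\<close> on the target side of \<open>w\<close>.\<close>

lemma vprod_unit_left:
  assumes "l \<in> Hom C A A" "w \<in> Hom C A (A \<boxtimes> Y)"
  shows "(ident C A \<star> lunit C Y) \<cdot> vprod A (unit_obj C) Y (runit_inv C A \<cdot> l) w = (l \<star> ident C Y) \<cdot> w"
proof -
  let ?l = "Arrow A A l" and ?w = "Arrow A (A \<boxtimes> Y) w"
  have "(aid A \<circledast> alunit Y) \<bullet> aassoc A (unit_obj C) Y \<bullet> ((arunit' A \<bullet> ?l) \<circledast> aid Y) \<bullet> ?w
    = ((aid A \<circledast> alunit Y) \<bullet> aassoc A (unit_obj C) Y) \<bullet> ((arunit' A \<bullet> ?l) \<circledast> aid Y) \<bullet> ?w"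
    using assms Obj by simp
  also have "\<dots> = ((arunit A \<bullet> arunit' A \<bullet> ?l) \<circledast> aid Y) \<bullet> ?w"
    unfolding atriangle[OF Obj(1,3)] using assms Obj by (simp del: arunit_inv_cmp add: whisker)
  also have "\<dots> = (?l \<circledast> aid Y) \<bullet> ?w"
    using assms Obj by simp
  finally show ?thesis by (simp only: vprod_def arrow_defs arrow.sel arrow.inject simp_thms)
qed

lemma cprod_unit_left:
  assumes "l \<in> Hom C A A" "\<zeta> \<in> Hom C (A \<boxtimes> Y) A"
  shows "cprod A (unit_obj C) Y (l \<cdot> runit C A) \<zeta> = (\<zeta> \<cdot> (l \<star> ident C Y)) \<cdot> (ident C A \<star> lunit C Y)"
proof -
  let ?l = "Arrow A A l" and ?z = "Arrow (A \<boxtimes> Y) A \<zeta>"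
  have "?z \<bullet> ((?l \<bullet> arunit A) \<circledast> aid Y) \<bullet> aassoc' A (unit_obj C) Y
    = ?z \<bullet> (?l \<circledast> aid Y) \<bullet> (arunit A \<circledast> aid Y) \<bullet> aassoc' A (unit_obj C) Y"
    using assms Obj by (simp add: whisker)
  also have "\<dots> = (?z \<bullet> (?l \<circledast> aid Y)) \<bullet> (aid A \<circledast> alunit Y)"
    unfolding atriangle[OF Obj(1,3), symmetric] using assms Obj by simp
  finally show ?thesis by (simp only: cprod_def arrow_defs arrow.sel arrow.inject simp_thms)
qed

text \<open>Here the unit object stands on the right, so the derived coherence
  \<open>arunit_tensor\<close> replaces the triangle axiom; \<open>l\<close> now acts on the source
  side of \<open>v\<close>.\<close>

lemma vprod_unit_right:
  assumes "l \<in> Hom C A A" "v \<in> Hom C A (A \<boxtimes> X)"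
  shows "(ident C A \<star> runit C X) \<cdot> vprod A X (unit_obj C) v (runit_inv C A \<cdot> l) = v \<cdot> l"
proof -
  let ?l = "Arrow A A l" and ?v = "Arrow A (A \<boxtimes> X) v"
  have "(aid A \<circledast> arunit X) \<bullet> aassoc A X (unit_obj C) \<bullet> (?v \<circledast> aid (unit_obj C)) \<bullet> arunit' A \<bullet> ?l
    = ((aid A \<circledast> arunit X) \<bullet> aassoc A X (unit_obj C)) \<bullet> (?v \<circledast> aid (unit_obj C)) \<bullet> arunit' A \<bullet> ?l"
    using assms Obj by simp
  also have "\<dots> = ?v \<bullet> ?l"
    unfolding arunit_tensor[OF Obj(1,2)] using assms Obj by (simp add: arunit_natural_cmp)
  finally show ?thesis by (simp only: vprod_def arrow_defs arrow.sel arrow.inject simp_thms)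
qed

lemma cprod_unit_right:
  assumes "l \<in> Hom C A A" "\<theta> \<in> Hom C (A \<boxtimes> X) A"
  shows "cprod A X (unit_obj C) \<theta> (l \<cdot> runit C A) = (l \<cdot> \<theta>) \<cdot> (ident C A \<star> runit C X)"
proof -
  let ?l = "Arrow A A l" and ?t = "Arrow (A \<boxtimes> X) A \<theta>"
  have "(?l \<bullet> arunit A) \<bullet> (?t \<circledast> aid (unit_obj C)) \<bullet> aassoc' A X (unit_obj C)
    = ?l \<bullet> ?t \<bullet> arunit (A \<boxtimes> X) \<bullet> aassoc' A X (unit_obj C)"
    using assms Obj by (simp add: arunit_natural_cmp)
  also have "\<dots> = (?l \<bullet> ?t) \<bullet> (aid A \<circledast> arunit X)"
    unfolding arunit_tensor[OF Obj(1,2), symmetric] using assms Obj by simp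
  finally show ?thesis by (simp only: cprod_def arrow_defs arrow.sel arrow.inject simp_thms)
qed

end

end

section \<open>The long canonical functor\<close>

definition hom_space ::
    "('k, 'o, 'm::ab_group_add, 'z) lin_cat_scheme \<Rightarrow> 'o \<Rightarrow> 'o \<Rightarrow> ('k, 'm) module" where
  "hom_space C X Y =
     \<lparr>carrier = Hom C X Y, monoid.mult = undefined, one = undefined,
      ring.zero = 0, add = (+), smult = scl C\<rparr>"

lemma hom_space_simps [simp]:
  "carrier (hom_space C X Y) = Hom C X Y" "ring.zero (hom_space C X Y) = 0"
  "add (hom_space C X Y) = (+)" "smult (hom_space C X Y) = scl C"
  by (simp_all add: hom_space_def)

context linear_category
begin

lemma vect_hom_space:
  assumes "X \<in> Obj C" "Y \<in> Obj C"
  shows "vect (hom_space C X Y)"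
proof -
  note sub = Hom_subspace[OF assms]
  have "x \<in> Units (add_monoid (hom_space C X Y))" if "x \<in> Hom C X Y" for x
    using that subspace_neg[OF sub that] by (auto simp: Units_def intro!: bexI[of _ "- x"])
  then show ?thesis
    by unfold_locales
      (auto simp: add.assoc add.commute scale_right_distrib scale_left_distrib
        intro: subspace_0[OF sub] subspace_add[OF sub] subspace_scale[OF sub])
qed

lemma linear_map_hom_sum_one:
  assumes "X \<in> Obj C" "Y \<in> Obj C" "vect W" "linear_map (hom_space C X Y) W P"
    and "\<And>a. a \<in> A \<Longrightarrow> v a \<in> Hom C X Y"
  shows "P (\<Sum>a\<in>A. v a) = (\<Oplus>\<^bsub>W\<^esub>a\<in>A. P (v a))"
proof -
  have m: "v \<in> A \<rightarrow> carrier (hom_space C X Y)" using assms(5) by auto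
  show ?thesis
    using linear_map_finsum[OF vect_hom_space[OF assms(1,2)] assms(3,4) m]
      finsum_eq_sum[OF vect_hom_space[OF assms(1,2)] _ _ m] by simp
qed

lemma linear_map_hom_sum:
  assumes "X \<in> Obj C" "Y \<in> Obj C" "vect W" "linear_map (hom_space C X Y) W P"
    and "\<And>a. a \<in> A \<Longrightarrow> v a \<in> Hom C X Y"
  shows "P (\<Sum>a\<in>A. scl C (c a) (v a)) = (\<Oplus>\<^bsub>W\<^esub>a\<in>A. c a \<odot>\<^bsub>W\<^esub> P (v a))"
proof -
  interpret W: vect W by fact
  have "P (\<Sum>a\<in>A. scl C (c a) (v a)) = (\<Oplus>\<^bsub>W\<^esub>a\<in>A. P (scl C (c a) (v a)))"
    by (rule linear_map_hom_sum_one[OF assms(1-4)]) (rule scl_in_Hom[OF assms(1,2,5)])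
  also have "\<dots> = (\<Oplus>\<^bsub>W\<^esub>a\<in>A. c a \<odot>\<^bsub>W\<^esub> P (v a))"
    using assms(5) linear_map_smult[OF assms(4)] linear_map_closed[OF assms(4)]
    by (intro W.finsum_cong') auto
  finally show ?thesis .
qed

lemma linear_map_hom_hom_sum:
  assumes "X \<in> Obj C" "Y \<in> Obj C" "X' \<in> Obj C" "Y' \<in> Obj C"
    and P: "linear_map (hom_space C X Y) (hom_space C X' Y') P"
    and v: "\<And>a. a \<in> A \<Longrightarrow> v a \<in> Hom C X Y"
  shows "P (\<Sum>a\<in>A. v a) = (\<Sum>a\<in>A. P (v a))"
proof -
  have "(\<lambda>a. P (v a)) \<in> A \<rightarrow> carrier (hom_space C X' Y')" using linear_map_closed[OF P] v by auto
  from finsum_eq_sum[OF vect_hom_space[OF assms(3,4)] _ _ this]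
  have "(\<Oplus>\<^bsub>hom_space C X' Y'\<^esub>a\<in>A. P (v a)) = (\<Sum>a\<in>A. P (v a))" by simp
  moreover have "P (\<Sum>a\<in>A. v a) = (\<Oplus>\<^bsub>hom_space C X' Y'\<^esub>a\<in>A. P (v a))"
    by (rule linear_map_hom_sum_one[OF assms(1,2) vect_hom_space[OF assms(3,4)] P]) (rule v)
  ultimately show ?thesis by simp
qed

lemma linear_map_cmp_left:
  "\<lbrakk>X \<in> Obj C; Y \<in> Obj C; Z \<in> Obj C; f \<in> Hom C X Y\<rbrakk> \<Longrightarrow>
    linear_map (hom_space C Y Z) (hom_space C X Z) (\<lambda>g. g \<cdot> f)"
  by (intro linear_mapI) (simp_all add: cmp_Hom[of X Y Z] cmp_add_left[of X Y Z] cmp_scl_left[of X Y Z])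

lemma linear_map_cmp_right:
  "\<lbrakk>X \<in> Obj C; Y \<in> Obj C; Z \<in> Obj C; g \<in> Hom C Y Z\<rbrakk> \<Longrightarrow>
    linear_map (hom_space C X Y) (hom_space C X Z) (\<lambda>f. g \<cdot> f)"
  by (intro linear_mapI) (simp_all add: cmp_Hom[of X Y Z] cmp_add_right[of X Y Z] cmp_scl_right[of X Y Z])

end

locale long_functor = linear_monoidal_category C
  for C :: "('k::field, 'o, 'm::ab_group_add, 'z) mon_cat_scheme" (structure) +
  fixes I :: "'i set" and V :: "'i \<Rightarrow> 'o" and Vh :: 'o and inc prj :: "'i \<Rightarrow> 'm"
  assumes semisimple: "finitely_split_semisimple C I V"
    and sum_Vh: "direct_sum C I V Vh inc prj"
begin

abbreviation lam :: "'i \<Rightarrow> 'm" where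
  "lam \<equiv> \<lambda>j. inc j \<cdot> prj j"

abbreviation omega :: "'o \<Rightarrow> 'm set" where
  "omega X \<equiv> Hom C Vh (Vh \<boxtimes> X)"

abbreviation coomega :: "'o \<Rightarrow> 'm set" where
  "coomega X \<equiv> Hom C (Vh \<boxtimes> X) Vh"

abbreviation g :: "'m \<Rightarrow> 'm \<Rightarrow> 'k" where
  "g \<equiv> pairing C I lam"

section \<open>The endomorphism algebra of \<open>Vh\<close> and its linear form\<close>

lemma finite_I [simp]: "finite I"
  and Vh_Obj [simp]: "Vh \<in> Obj C"
  and V_Obj [simp]: "j \<in> I \<Longrightarrow> V j \<in> Obj C"
  and inc_Hom: "j \<in> I \<Longrightarrow> inc j \<in> Hom C (V j) Vh"
  and prj_Hom: "j \<in> I \<Longrightarrow> prj j \<in> Hom C Vh (V j)"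
  and prj_inc: "\<lbrakk>j \<in> I; l \<in> I\<rbrakk> \<Longrightarrow> prj j \<cdot> inc l = (if j = l then ident C (V j) else 0)"
  and sum_lam: "(\<Sum>j\<in>I. lam j) = ident C Vh"
  using sum_Vh by (auto simp: direct_sum_def)

lemma lam_Hom [simp]: "j \<in> I \<Longrightarrow> lam j \<in> Hom C Vh Vh"
  using cmp_Hom[of Vh "V j" Vh "prj j" "inc j"] by (simp add: inc_Hom prj_Hom)

lemma lam_inc: "\<lbrakk>j \<in> I; l \<in> I\<rbrakk> \<Longrightarrow> lam j \<cdot> inc l = (if j = l then inc l else 0)"
  using cmp_assoc[of "V l" Vh "V j" Vh "inc l" "prj j" "inc j"]
  by (auto simp: inc_Hom prj_Hom prj_inc cmp_ident_right[of "V l" Vh] cmp_zero_right[of "V l" "V j" Vh])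

lemma lam_lam: "\<lbrakk>j \<in> I; l \<in> I\<rbrakk> \<Longrightarrow> lam j \<cdot> lam l = (if j = l then lam j else 0)"
  using cmp_assoc[of Vh "V l" Vh Vh "prj l" "inc l" "lam j"]
  by (auto simp: inc_Hom prj_Hom lam_inc cmp_zero_left[of Vh "V l" Vh])

lemma schur_zero: "\<lbrakk>j \<in> I; l \<in> I; j \<noteq> l; f \<in> Hom C (V j) (V l)\<rbrakk> \<Longrightarrow> f = 0"
  using semisimple by (auto simp: finitely_split_semisimple_def)

text \<open>The isomorphism \<open>\<phi>\<close> sends the identity to 1 and is injective, so
  \<open>f\<close> equals \<open>\<phi> f\<close> times the identity because both have the same
  image.\<close>

lemma schur_scalar:
  assumes "j \<in> I"
  shows "ident C (V j) \<noteq> 0" and "f \<in> Hom C (V j) (V j) \<Longrightarrow> \<exists>c. f = scl C c (ident C (V j))"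
proof -
  from semisimple assms have "simple_obj C (V j)" by (simp add: finitely_split_semisimple_def)
  then obtain \<phi> :: "'m \<Rightarrow> 'k" where
    bij: "bij_betw \<phi> (Hom C (V j) (V j)) UNIV" and one: "\<phi> (ident C (V j)) = 1"
    and scl: "\<And>c f. f \<in> Hom C (V j) (V j) \<Longrightarrow> \<phi> (scl C c f) = c * \<phi> f"
    unfolding simple_obj_def by auto
  have "\<phi> 0 = 0" using scl[of "ident C (V j)" 0] ident_Hom assms by simp
  then show "ident C (V j) \<noteq> 0" using one by auto
  assume f: "f \<in> Hom C (V j) (V j)"
  have id: "ident C (V j) \<in> Hom C (V j) (V j)" using ident_Hom assms by simp
  have "\<phi> f = \<phi> (scl C (\<phi> f) (ident C (V j)))" using scl[OF id] one by simp
  then have "f = scl C (\<phi> f) (ident C (V j))"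
    using bij f id scl_in_Hom[of "V j" "V j"] assms by (auto simp: bij_betw_def inj_on_def)
  then show "\<exists>c. f = scl C c (ident C (V j))" by blast
qed

lemma lam_nonzero: "j \<in> I \<Longrightarrow> lam j \<noteq> 0"
proof
  assume j: "j \<in> I" and 0: "lam j = 0"
  have "prj j \<cdot> (lam j \<cdot> inc j) = ident C (V j)"
    using j by (simp add: lam_inc prj_inc)
  then show False
    using j 0 schur_scalar(1)[OF j]
    by (simp add: cmp_zero_left[of "V j" Vh Vh] cmp_zero_right[of "V j" Vh "V j"] inc_Hom prj_Hom)
qed

lemma inj_lam: "inj_on lam I"
  using lam_lam lam_nonzero by (intro inj_onI) metis

text \<open>The block of \<open>r\<close> between two idempotents factors through a morphism from
  \<open>V l\<close> to \<open>V j\<close>, which is zero or a scalar by Schur's lemma.\<close>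

lemma lam_mid:
  assumes "j \<in> I" "l \<in> I" "r \<in> Hom C Vh Vh"
  shows "\<exists>c. lam j \<cdot> (r \<cdot> lam l) = (if j = l then scl C c (lam j) else 0)"
proof -
  let ?i = "\<lambda>j. Arrow (V j) Vh (inc j)" and ?p = "\<lambda>j. Arrow Vh (V j) (prj j)" and ?r = "Arrow Vh Vh r"
  have a: "arr (?i j)" "arr (?p j)" "arr (?i l)" "arr (?p l)" "arr ?r"
    using assms inc_Hom prj_Hom by simp_all
  have m: "prj j \<cdot> (r \<cdot> inc l) \<in> Hom C (V l) (V j)"
    using arr_Hom[of "?p j \<bullet> (?r \<bullet> ?i l)"] a by (simp add: amor_simps)
  have "(?i j \<bullet> ?p j) \<bullet> (?r \<bullet> (?i l \<bullet> ?p l)) = ?i j \<bullet> ((?p j \<bullet> (?r \<bullet> ?i l)) \<bullet> ?p l)"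
    using a by simp
  then have eq: "lam j \<cdot> (r \<cdot> lam l) = inc j \<cdot> ((prj j \<cdot> (r \<cdot> inc l)) \<cdot> prj l)"
    by (simp only: arrow_defs arrow.sel arrow.inject simp_thms)
  show ?thesis
  proof (cases "j = l")
    case True
    with schur_scalar(2)[OF assms(1), of "prj j \<cdot> (r \<cdot> inc l)"] m
    obtain c where c: "prj j \<cdot> (r \<cdot> inc l) = scl C c (ident C (V j))" by auto
    have "lam j \<cdot> (r \<cdot> lam l) = scl C c (lam j)"
      unfolding eq c using assms True
      by (simp add: cmp_scl_left[of Vh "V l" "V l"] cmp_scl_right[of Vh "V l" Vh] cmp_ident_left[of Vh "V l"]
          ident_Hom prj_Hom inc_Hom)
    then show ?thesis using True by auto
  next
    case False
    then have "prj j \<cdot> (r \<cdot> inc l) = 0" using schur_zero[OF assms(2,1) _ m] by auto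
    then show ?thesis
      unfolding eq using assms False
      by (simp add: cmp_zero_left[of Vh "V l" "V j"] cmp_zero_right[of Vh "V j" Vh] prj_Hom inc_Hom)
  qed
qed

text \<open>Inserting the sum of the idempotents on both sides cuts \<open>r\<close> into blocks, of
  which only the diagonal ones survive.\<close>

lemma End_expand:
  assumes r: "r \<in> Hom C Vh Vh"
  obtains c where "r = (\<Sum>j\<in>I. scl C (c j) (lam j))"
proof -
  have "\<forall>j\<in>I. \<exists>c. lam j \<cdot> (r \<cdot> lam j) = scl C c (lam j)"
    using lam_mid[OF _ _ r] by fastforce
  then obtain c where c: "\<And>j. j \<in> I \<Longrightarrow> lam j \<cdot> (r \<cdot> lam j) = scl C (c j) (lam j)" by metis
  have rl: "r \<cdot> lam l \<in> Hom C Vh Vh" if "l \<in> I" for l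
    by (rule cmp_Hom[of Vh Vh Vh]) (use that r in simp_all)
  have "r = r \<cdot> (\<Sum>l\<in>I. lam l)" using r by (simp add: sum_lam cmp_ident_right[of Vh Vh])
  also have "\<dots> = (\<Sum>l\<in>I. r \<cdot> lam l)" using r by (intro cmp_sum_right[of Vh Vh Vh]) auto
  also have "\<dots> = (\<Sum>l\<in>I. scl C (c l) (lam l))"
  proof (rule sum.cong[OF refl])
    fix l assume l: "l \<in> I"
    have "r \<cdot> lam l = (\<Sum>j\<in>I. lam j) \<cdot> (r \<cdot> lam l)"
      using rl[OF l] by (simp add: sum_lam cmp_ident_left[of Vh Vh])
    also have "\<dots> = (\<Sum>j\<in>I. lam j \<cdot> (r \<cdot> lam l))" using rl[OF l] by (intro cmp_sum_left[of Vh Vh Vh]) auto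
    also have "\<dots> = (\<Sum>j\<in>I. if j = l then scl C (c l) (lam l) else 0)"
    proof (rule sum.cong[OF refl])
      fix j assume "j \<in> I"
      from lam_mid[OF this l r] c[OF l]
      show "lam j \<cdot> (r \<cdot> lam l) = (if j = l then scl C (c l) (lam l) else 0)" by (cases "j = l") auto
    qed
    also have "\<dots> = scl C (c l) (lam l)" using l by simp
    finally show "r \<cdot> lam l = scl C (c l) (lam l)" .
  qed
  finally show ?thesis using that by blast
qed

lemma sum_lam_lam:
  assumes "l \<in> I"
  shows "lam l \<cdot> (\<Sum>j\<in>I. scl C (c j) (lam j)) = scl C (c l) (lam l)"
    and "(\<Sum>j\<in>I. scl C (c j) (lam j)) \<cdot> lam l = scl C (c l) (lam l)"
proof -
  have "lam l \<cdot> (\<Sum>j\<in>I. scl C (c j) (lam j)) = (\<Sum>j\<in>I. scl C (c j) (lam l \<cdot> lam j))"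
    using assms scl_in_Hom[of Vh Vh]
    by (subst cmp_sum_right[of Vh Vh Vh]) (auto intro!: sum.cong cmp_scl_right[of Vh Vh Vh])
  also have "\<dots> = (\<Sum>j\<in>I. if j = l then scl C (c l) (lam l) else 0)"
    using assms by (intro sum.cong) (auto simp: lam_lam)
  finally show "lam l \<cdot> (\<Sum>j\<in>I. scl C (c j) (lam j)) = scl C (c l) (lam l)" using assms by simp
  have "(\<Sum>j\<in>I. scl C (c j) (lam j)) \<cdot> lam l = (\<Sum>j\<in>I. scl C (c j) (lam j \<cdot> lam l))"
    using assms scl_in_Hom[of Vh Vh]
    by (subst cmp_sum_left[of Vh Vh Vh]) (auto intro!: sum.cong cmp_scl_left[of Vh Vh Vh])
  also have "\<dots> = (\<Sum>j\<in>I. if j = l then scl C (c l) (lam l) else 0)"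
    using assms by (intro sum.cong) (auto simp: lam_lam)
  finally show "(\<Sum>j\<in>I. scl C (c j) (lam j)) \<cdot> lam l = scl C (c l) (lam l)" using assms by simp
qed

lemma sum_scl_lam_eq_zero:
  assumes "(\<Sum>j\<in>I. scl C (c j) (lam j)) = 0" "l \<in> I"
  shows "c l = 0"
proof -
  have "scl C (c l) (lam l) = lam l \<cdot> 0"
    using sum_lam_lam(1)[OF assms(2), of c] unfolding assms(1) by simp
  also have "\<dots> = 0" using assms(2) by (intro cmp_zero_right[of Vh Vh Vh]) simp_all
  finally show ?thesis using lam_nonzero[OF assms(2)] by simp
qed

lemma independent_lam: "independent (lam ` I)"
proof (rule independent_if_scalars_zero)
  fix f x assume *: "(\<Sum>x\<in>lam ` I. scl C (f x) x) = 0" "x \<in> lam ` I"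
  then obtain j where j: "j \<in> I" "x = lam j" by auto
  have "(\<Sum>j\<in>I. scl C (f (lam j)) (lam j)) = 0"
    using *(1) by (simp add: sum.reindex[OF inj_lam])
  from sum_scl_lam_eq_zero[OF this j(1)] show "f x = 0" by (simp add: j)
qed simp

lemma eps_sum: "eps_R C I lam (\<Sum>j\<in>I. scl C (c j) (lam j)) = (\<Sum>j\<in>I. c j)"
proof -
  have "representation (lam ` I) (\<Sum>l\<in>I. scl C (c l) (lam l)) (lam j) = c j" if j: "j \<in> I" for j
  proof -
    have sp: "lam l \<in> span (lam ` I)" if "l \<in> I" for l using that by (intro span_base) auto
    have "representation (lam ` I) (\<Sum>l\<in>I. scl C (c l) (lam l)) (lam j)
      = (\<Sum>l\<in>I. representation (lam ` I) (scl C (c l) (lam l)) (lam j))"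
      by (subst representation_sum[OF independent_lam]) (simp_all add: sp span_scale)
    also have "\<dots> = (\<Sum>l\<in>I. c l * (if lam l = lam j then 1 else 0))"
    proof (rule sum.cong[OF refl])
      fix l assume l: "l \<in> I"
      then have "lam l \<in> lam ` I" by (rule imageI)
      then show "representation (lam ` I) (scl C (c l) (lam l)) (lam j) = c l * (if lam l = lam j then 1 else 0)"
        by (simp add: representation_scale[OF independent_lam sp[OF l]] representation_basis[OF independent_lam] eq_commute)
    qed
    also have "\<dots> = (\<Sum>l\<in>I. if l = j then c j else 0)"
      using j inj_onD[OF inj_lam] by (intro sum.cong) auto
    finally show ?thesis using j by simp
  qed
  then show ?thesis by (simp add: eps_R_def)
qed

lemma linear_map_eps: "linear_map (hom_space C Vh Vh) kfield (eps_R C I lam)"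
proof (rule linear_mapI; simp)
  fix r r' assume "r \<in> Hom C Vh Vh" "r' \<in> Hom C Vh Vh"
  then obtain c c' where r: "r = (\<Sum>j\<in>I. scl C (c j) (lam j))" "r' = (\<Sum>j\<in>I. scl C (c' j) (lam j))"
    by (metis End_expand)
  have "r + r' = (\<Sum>j\<in>I. scl C (c j + c' j) (lam j))"
    by (simp add: r sum.distrib scale_left_distrib)
  then show "eps_R C I lam (r + r') = eps_R C I lam r + eps_R C I lam r'"
    by (simp only: eps_sum r sum.distrib)
next
  fix r a assume "r \<in> Hom C Vh Vh"
  then obtain c where r: "r = (\<Sum>j\<in>I. scl C (c j) (lam j))" by (metis End_expand)
  have "scl C a r = (\<Sum>j\<in>I. scl C (a * c j) (lam j))"
    by (simp add: r scale_sum_right)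
  then show "eps_R C I lam (scl C a r) = a * eps_R C I lam r"
    by (simp only: eps_sum r sum_distrib_left)
qed

lemma eps_lam: "j \<in> I \<Longrightarrow> eps_R C I lam (lam j) = 1"
  using eps_sum[of "\<lambda>l. if l = j then 1 else 0"]
  by (simp add: if_distrib[of "\<lambda>x. scl C x _"] cong: if_cong)

text \<open>This is the passage from numbers back to morphisms: an endomorphism supported at one
  idempotent is a multiple of it, and \<open>eps_R\<close> reads off the factor. It lets a composite
  of covector and vector be recovered from its pairing.\<close>

lemma eps_scalar:
  assumes "r \<in> Hom C Vh Vh" "j \<in> I" "lam j \<cdot> r = r \<or> r \<cdot> lam j = r"
  shows "r = scl C (eps_R C I lam r) (lam j)"
proof -
  obtain c where r: "r = (\<Sum>j\<in>I. scl C (c j) (lam j))" using assms(1) by (metis End_expand)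
  have "r = scl C (c j) (lam j)"
    using assms(3) sum_lam_lam[OF assms(2), of c] unfolding r by auto
  moreover from this have "eps_R C I lam r = c j"
    using linear_map_smult[OF linear_map_eps, of "lam j" "c j"] assms(2) by (simp add: eps_lam)
  ultimately show ?thesis by simp
qed

lemma bilinear_pairing:
  assumes "X \<in> Obj C"
  shows "bilinear (hom_space C (Vh \<boxtimes> X) Vh) (hom_space C Vh (Vh \<boxtimes> X)) kfield g"
proof (rule bilinearI)
  show "linear_map (hom_space C Vh (Vh \<boxtimes> X)) kfield (g \<theta>)"
    if "\<theta> \<in> carrier (hom_space C (Vh \<boxtimes> X) Vh)" for \<theta>
    unfolding pairing_def
    by (rule linear_map_comp[OF linear_map_eps], rule linear_map_cmp_right) (use assms that in simp_all)
  show "linear_map (hom_space C (Vh \<boxtimes> X) Vh) kfield (\<lambda>\<theta>. g \<theta> v)"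
    if "v \<in> carrier (hom_space C Vh (Vh \<boxtimes> X))" for v
    unfolding pairing_def
    by (rule linear_map_comp[OF linear_map_eps], rule linear_map_cmp_left) (use assms that in simp_all)
qed

lemma pairing_natural:
  assumes "X \<in> Obj C" "Y \<in> Obj C" "f \<in> Hom C X Y" "\<zeta> \<in> coomega Y" "v \<in> omega X"
  shows "g \<zeta> ((ident C Vh \<star> f) \<cdot> v) = g (\<zeta> \<cdot> (ident C Vh \<star> f)) v"
  using assms cmp_assoc[of Vh "Vh \<boxtimes> X" "Vh \<boxtimes> Y" Vh v "ident C Vh \<star> f" \<zeta>]
  by (simp add: pairing_def tmor_Hom ident_Hom)

lemma omega_map: "\<lbrakk>X \<in> Obj C; Y \<in> Obj C; f \<in> Hom C X Y; v \<in> omega X\<rbrakk> \<Longrightarrow> (ident C Vh \<star> f) \<cdot> v \<in> omega Y"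
  and coomega_map: "\<lbrakk>X \<in> Obj C; Y \<in> Obj C; f \<in> Hom C X Y; \<zeta> \<in> coomega Y\<rbrakk> \<Longrightarrow> \<zeta> \<cdot> (ident C Vh \<star> f) \<in> coomega X"
  by (intro cmp_Hom[of Vh "Vh \<boxtimes> X" "Vh \<boxtimes> Y"] cmp_Hom[of "Vh \<boxtimes> X" "Vh \<boxtimes> Y" Vh];
      simp add: tmor_Hom ident_Hom)+

subsection \<open>Dual systems\<close>

text \<open>A pair of dual bases of \<open>\<omega> X\<close> and its dual, characterised by the two expansion formulas.\<close>

definition dual_system :: "'o \<Rightarrow> 'q set \<Rightarrow> ('q \<Rightarrow> 'm) \<Rightarrow> ('q \<Rightarrow> 'm) \<Rightarrow> bool" where
  "dual_system X Q b b' \<longleftrightarrow>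
     X \<in> Obj C \<and> finite Q \<and> (\<forall>q\<in>Q. b q \<in> omega X \<and> b' q \<in> coomega X) \<and>
     (\<forall>v\<in>omega X. v = (\<Sum>q\<in>Q. scl C (g (b' q) v) (b q))) \<and>
     (\<forall>\<theta>\<in>coomega X. \<theta> = (\<Sum>q\<in>Q. scl C (g \<theta> (b q)) (b' q)))"

text \<open>The canonical element is dinatural. Expanding the shifted covectors in \<open>b'\<close>
  on one side and the shifted vectors in \<open>c\<close> on the other gives double sums with the
  same coefficients, since the pairing is natural.\<close>

lemma dual_system_change:
  assumes X: "dual_system X Q b b'" and Y: "dual_system Y P c c'" and f: "f \<in> Hom C X Y"
    and T: "vect T" and F: "bilinear (hom_space C Vh (Vh \<boxtimes> Y)) (hom_space C (Vh \<boxtimes> X) Vh) T F"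
  shows "(\<Oplus>\<^bsub>T\<^esub>p\<in>P. F (c p) (c' p \<cdot> (ident C Vh \<star> f))) = (\<Oplus>\<^bsub>T\<^esub>q\<in>Q. F ((ident C Vh \<star> f) \<cdot> b q) (b' q))"
proof -
  interpret T: vect T by fact
  let ?f = "ident C Vh \<star> f"
  have Obj: "X \<in> Obj C" "Y \<in> Obj C" and fin: "finite Q" "finite P"
    and b: "\<And>q. q \<in> Q \<Longrightarrow> b q \<in> omega X" "\<And>q. q \<in> Q \<Longrightarrow> b' q \<in> coomega X"
    and c: "\<And>p. p \<in> P \<Longrightarrow> c p \<in> omega Y" "\<And>p. p \<in> P \<Longrightarrow> c' p \<in> coomega Y"
    using X Y by (auto simp: dual_system_def)
  have Fcl: "F v \<theta> \<in> carrier T" if "v \<in> omega Y" "\<theta> \<in> coomega X" for v \<theta>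
    using bilinear_closed[OF F] that by simp
  have "(\<Oplus>\<^bsub>T\<^esub>p\<in>P. F (c p) (c' p \<cdot> ?f)) = (\<Oplus>\<^bsub>T\<^esub>p\<in>P. \<Oplus>\<^bsub>T\<^esub>q\<in>Q. g (c' p \<cdot> ?f) (b q) \<odot>\<^bsub>T\<^esub> F (c p) (b' q))"
  proof (rule T.finsum_cong'[OF refl])
    fix p assume p: "p \<in> P"
    have "c' p \<cdot> ?f \<in> coomega X" by (rule coomega_map[OF Obj f c(2)[OF p]])
    then have "F (c p) (c' p \<cdot> ?f) = F (c p) (\<Sum>q\<in>Q. scl C (g (c' p \<cdot> ?f) (b q)) (b' q))"
      using X by (auto simp: dual_system_def)
    also have "\<dots> = (\<Oplus>\<^bsub>T\<^esub>q\<in>Q. g (c' p \<cdot> ?f) (b q) \<odot>\<^bsub>T\<^esub> F (c p) (b' q))"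
      using Obj b c(1)[OF p] by (intro linear_map_hom_sum[OF _ _ T bilinear_right[OF F]]) auto
    finally show "F (c p) (c' p \<cdot> ?f) = (\<Oplus>\<^bsub>T\<^esub>q\<in>Q. g (c' p \<cdot> ?f) (b q) \<odot>\<^bsub>T\<^esub> F (c p) (b' q))" .
  qed (use Fcl b c in \<open>auto intro!: T.finsum_closed\<close>)
  also have "\<dots> = (\<Oplus>\<^bsub>T\<^esub>q\<in>Q. \<Oplus>\<^bsub>T\<^esub>p\<in>P. g (c' p \<cdot> ?f) (b q) \<odot>\<^bsub>T\<^esub> F (c p) (b' q))"
    using Fcl b c fin by (intro T.finsum_swap) auto
  also have "\<dots> = (\<Oplus>\<^bsub>T\<^esub>q\<in>Q. F (?f \<cdot> b q) (b' q))"
  proof (rule T.finsum_cong'[OF refl])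
    fix q assume q: "q \<in> Q"
    have "?f \<cdot> b q \<in> omega Y" by (rule omega_map[OF Obj f b(1)[OF q]])
    then have "F (?f \<cdot> b q) (b' q) = F (\<Sum>p\<in>P. scl C (g (c' p) (?f \<cdot> b q)) (c p)) (b' q)"
      using Y by (auto simp: dual_system_def)
    also have "\<dots> = (\<Oplus>\<^bsub>T\<^esub>p\<in>P. g (c' p) (?f \<cdot> b q) \<odot>\<^bsub>T\<^esub> F (c p) (b' q))"
      using Obj c b(2)[OF q] by (intro linear_map_hom_sum[OF _ _ T bilinear_left[OF F]]) auto
    also have "\<dots> = (\<Oplus>\<^bsub>T\<^esub>p\<in>P. g (c' p \<cdot> ?f) (b q) \<odot>\<^bsub>T\<^esub> F (c p) (b' q))"
      using Fcl b c q Obj f by (intro T.finsum_cong') (auto simp: pairing_natural)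
    finally show "(\<Oplus>\<^bsub>T\<^esub>p\<in>P. g (c' p \<cdot> ?f) (b q) \<odot>\<^bsub>T\<^esub> F (c p) (b' q)) = F (?f \<cdot> b q) (b' q)" ..
  qed (use Fcl b omega_map[OF Obj f] in auto)
  finally show ?thesis .
qed

text \<open>This is the case of an identity morphism in \<open>dual_system_change\<close>. It
  removes the choice of \<open>omega_basis\<close> from the comultiplication and from the
  coaction.\<close>

lemma dual_system_independent:
  assumes X: "dual_system X Q b b'" and Y: "dual_system X P c c'"
    and T: "vect T" and F: "bilinear (hom_space C Vh (Vh \<boxtimes> X)) (hom_space C (Vh \<boxtimes> X) Vh) T F"
  shows "(\<Oplus>\<^bsub>T\<^esub>p\<in>P. F (c p) (c' p)) = (\<Oplus>\<^bsub>T\<^esub>q\<in>Q. F (b q) (b' q))"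
proof -
  interpret T: vect T by fact
  have Obj: "X \<in> Obj C"
    and b: "\<And>q. q \<in> Q \<Longrightarrow> b q \<in> omega X" "\<And>q. q \<in> Q \<Longrightarrow> b' q \<in> coomega X"
    and c: "\<And>p. p \<in> P \<Longrightarrow> c p \<in> omega X" "\<And>p. p \<in> P \<Longrightarrow> c' p \<in> coomega X"
    using X Y by (auto simp: dual_system_def)
  have id: "v \<in> omega X \<Longrightarrow> (ident C Vh \<star> ident C X) \<cdot> v = v"
    "\<theta> \<in> coomega X \<Longrightarrow> \<theta> \<cdot> (ident C Vh \<star> ident C X) = \<theta>" for v \<theta>
    using Obj by (simp_all add: tmor_ident cmp_ident_left[of Vh "Vh \<boxtimes> X"] cmp_ident_right[of "Vh \<boxtimes> X" Vh])
  have Fcl: "F v \<theta> \<in> carrier T" if "v \<in> omega X" "\<theta> \<in> coomega X" for v \<theta>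
    using bilinear_closed[OF F] that by simp
  have "(\<Oplus>\<^bsub>T\<^esub>p\<in>P. F (c p) (c' p)) = (\<Oplus>\<^bsub>T\<^esub>p\<in>P. F (c p) (c' p \<cdot> (ident C Vh \<star> ident C X)))"
    using Fcl c id by (intro T.finsum_cong') auto
  also have "\<dots> = (\<Oplus>\<^bsub>T\<^esub>q\<in>Q. F ((ident C Vh \<star> ident C X) \<cdot> b q) (b' q))"
    by (rule dual_system_change[OF X Y ident_Hom[OF Obj] T F])
  also have "\<dots> = (\<Oplus>\<^bsub>T\<^esub>q\<in>Q. F (b q) (b' q))"
    using Fcl b id by (intro T.finsum_cong') auto
  finally show ?thesis .
qed

subsection \<open>Resolutions\<close>

text \<open>A decomposition of \<open>Vh \<otimes> X\<close> into simple objects \<open>V (s q)\<close>.\<close>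

definition resolution :: "'o \<Rightarrow> 'q set \<Rightarrow> ('q \<Rightarrow> 'm) \<Rightarrow> ('q \<Rightarrow> 'm) \<Rightarrow> ('q \<Rightarrow> 'i) \<Rightarrow> bool" where
  "resolution X Q b b' s \<longleftrightarrow>
     X \<in> Obj C \<and> finite Q \<and>
     (\<forall>q\<in>Q. b q \<in> omega X \<and> b' q \<in> coomega X \<and> s q \<in> I \<and> b q \<cdot> lam (s q) = b q \<and> lam (s q) \<cdot> b' q = b' q) \<and>
     (\<forall>q\<in>Q. \<forall>r\<in>Q. b' q \<cdot> b r = (if q = r then lam (s q) else 0)) \<and>
     (\<Sum>q\<in>Q. b q \<cdot> b' q) = ident C (Vh \<boxtimes> X)"

text \<open>\<open>b' \<cdot> v\<close> lives at the idempotent \<open>lam j\<close>, hence is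
  \<open>g b' v\<close> times it by \<open>eps_scalar\<close>, and \<open>b\<close> absorbs
  \<open>lam j\<close>.\<close>

lemma rank_one_apply:
  assumes X: "X \<in> Obj C" and b: "b \<in> omega X" "b' \<in> coomega X"
    and j: "j \<in> I" "b \<cdot> lam j = b" "lam j \<cdot> b' = b'" and v: "v \<in> omega X"
  shows "(b \<cdot> b') \<cdot> v = scl C (g b' v) b"
proof -
  have VX: "Vh \<boxtimes> X \<in> Obj C" using X by simp
  have m: "b' \<cdot> v \<in> Hom C Vh Vh" using cmp_Hom[OF Vh_Obj VX Vh_Obj v b(2)] .
  have "lam j \<cdot> (b' \<cdot> v) = b' \<cdot> v"
    using cmp_assoc[OF Vh_Obj VX Vh_Obj Vh_Obj v b(2) lam_Hom[OF j(1)]] j by simp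
  then have e: "b' \<cdot> v = scl C (g b' v) (lam j)"
    using eps_scalar[OF m j(1)] by (simp add: pairing_def)
  have "(b \<cdot> b') \<cdot> v = b \<cdot> (b' \<cdot> v)"
    by (rule cmp_assoc[OF Vh_Obj VX Vh_Obj VX v b(2,1)])
  also have "\<dots> = scl C (g b' v) b"
    unfolding e using cmp_scl_right[OF Vh_Obj Vh_Obj VX lam_Hom[OF j(1)] b(1)] j by simp
  finally show ?thesis .
qed

text \<open>Both expansions come from the decomposition of the identity of
  \<open>Vh \<otimes> X\<close>: composed with \<open>v\<close> on the right it expands vectors,
  composed with \<open>\<theta>\<close> on the left it expands covectors.\<close>

lemma resolution_dual_system:
  assumes "resolution X Q b b' s"
  shows "dual_system X Q b b'"
proof -
  have Obj: "X \<in> Obj C" and fin: "finite Q"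
    and b: "\<And>q. q \<in> Q \<Longrightarrow> b q \<in> omega X" "\<And>q. q \<in> Q \<Longrightarrow> b' q \<in> coomega X"
    and s: "\<And>q. q \<in> Q \<Longrightarrow> s q \<in> I" "\<And>q. q \<in> Q \<Longrightarrow> b q \<cdot> lam (s q) = b q" "\<And>q. q \<in> Q \<Longrightarrow> lam (s q) \<cdot> b' q = b' q"
    and one: "(\<Sum>q\<in>Q. b q \<cdot> b' q) = ident C (Vh \<boxtimes> X)"
    using assms unfolding resolution_def by blast+
  have VX: "Vh \<boxtimes> X \<in> Obj C" using Obj by simp
  have bb: "b q \<cdot> b' q \<in> Hom C (Vh \<boxtimes> X) (Vh \<boxtimes> X)" if "q \<in> Q" for q
    using b[OF that] VX by (intro cmp_Hom[of "Vh \<boxtimes> X" Vh "Vh \<boxtimes> X"]) auto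
  have "v = (\<Sum>q\<in>Q. scl C (g (b' q) v) (b q))" if v: "v \<in> omega X" for v
  proof -
    have "v = (\<Sum>q\<in>Q. b q \<cdot> b' q) \<cdot> v" unfolding one using v VX cmp_ident_left[of Vh "Vh \<boxtimes> X" v] by simp
    also have "\<dots> = (\<Sum>q\<in>Q. (b q \<cdot> b' q) \<cdot> v)" using v VX bb by (intro cmp_sum_left[of Vh "Vh \<boxtimes> X" "Vh \<boxtimes> X"]) auto
    also have "\<dots> = (\<Sum>q\<in>Q. scl C (g (b' q) v) (b q))"
    proof (rule sum.cong[OF refl])
      fix q assume q: "q \<in> Q"
      show "(b q \<cdot> b' q) \<cdot> v = scl C (g (b' q) v) (b q)"
        by (rule rank_one_apply[OF Obj b(1)[OF q] b(2)[OF q] s(1)[OF q] s(2)[OF q] s(3)[OF q] v])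
    qed
    finally show ?thesis .
  qed
  moreover have "\<theta> = (\<Sum>q\<in>Q. scl C (g \<theta> (b q)) (b' q))" if v: "\<theta> \<in> coomega X" for \<theta>
  proof -
    have "\<theta> = \<theta> \<cdot> (\<Sum>q\<in>Q. b q \<cdot> b' q)" unfolding one using v VX cmp_ident_right[of "Vh \<boxtimes> X" Vh \<theta>] by simp
    also have "\<dots> = (\<Sum>q\<in>Q. \<theta> \<cdot> (b q \<cdot> b' q))" using v VX bb by (intro cmp_sum_right[of "Vh \<boxtimes> X" "Vh \<boxtimes> X" Vh]) auto
    also have "\<dots> = (\<Sum>q\<in>Q. scl C (g \<theta> (b q)) (b' q))"
    proof (rule sum.cong[OF refl])
      fix q assume q: "q \<in> Q"
      have m: "\<theta> \<cdot> b q \<in> Hom C Vh Vh" using v VX b(1)[OF q] by (intro cmp_Hom[of Vh "Vh \<boxtimes> X" Vh]) auto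
      have "(\<theta> \<cdot> b q) \<cdot> lam (s q) = \<theta> \<cdot> b q"
        using cmp_assoc[of Vh Vh "Vh \<boxtimes> X" Vh "lam (s q)" "b q" \<theta>] v VX b(1)[OF q] s(1,2)[OF q] by simp
      then have e: "\<theta> \<cdot> b q = scl C (g \<theta> (b q)) (lam (s q))"
        using eps_scalar[OF m s(1)[OF q]] by (simp add: pairing_def)
      have "\<theta> \<cdot> (b q \<cdot> b' q) = (\<theta> \<cdot> b q) \<cdot> b' q"
        using cmp_assoc[of "Vh \<boxtimes> X" Vh "Vh \<boxtimes> X" Vh "b' q" "b q" \<theta>] v VX b[OF q] by simp
      also have "\<dots> = scl C (g \<theta> (b q)) (b' q)"
        unfolding e using cmp_scl_left[of "Vh \<boxtimes> X" Vh Vh "b' q" "lam (s q)"] VX b[OF q] s(1,3)[OF q] by simp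
      finally show "\<theta> \<cdot> (b q \<cdot> b' q) = scl C (g \<theta> (b q)) (b' q)" .
    qed
    finally show ?thesis .
  qed
  ultimately show ?thesis using Obj fin b by (auto simp: dual_system_def)
qed

text \<open>Semisimplicity writes \<open>Vh \<otimes> X\<close> as a direct sum of simple objects
  \<open>V (s n)\<close>. Composing its inclusions with \<open>prj (s n)\<close> and its projections
  with \<open>inc (s n)\<close> extends them to morphisms from and to \<open>Vh\<close>.\<close>

lemma resolution_exists:
  assumes X: "X \<in> Obj C"
  obtains Q :: "nat set" and b b' s where "resolution X Q b b' s"
proof -
  let ?W = "Vh \<boxtimes> X"
  have W: "?W \<in> Obj C" using X by simp
  then obtain Xs where Xs: "set Xs \<subseteq> V ` I" and "is_sum C Xs ?W"
    using semisimple unfolding finitely_split_semisimple_def by blast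
  then obtain i p where ds: "direct_sum C {..<length Xs} ((!) Xs) ?W i p"
    by (auto simp: is_sum_def)
  have "\<forall>n<length Xs. \<exists>j\<in>I. Xs ! n = V j" using Xs by (metis image_iff nth_mem subset_iff)
  then obtain s where s: "\<And>n. n < length Xs \<Longrightarrow> s n \<in> I \<and> Xs ! n = V (s n)" by metis
  have ip: "i n \<in> Hom C (V (s n)) ?W" "p n \<in> Hom C ?W (V (s n))" if "n < length Xs" for n
  proof -
    have "i n \<in> Hom C (Xs ! n) ?W \<and> p n \<in> Hom C ?W (Xs ! n)" using ds that by (simp add: direct_sum_def)
    then show "i n \<in> Hom C (V (s n)) ?W" "p n \<in> Hom C ?W (V (s n))" using s[OF that] by simp_all
  qed
  have pi: "p n \<cdot> i m = (if n = m then ident C (V (s n)) else 0)" if "n < length Xs" "m < length Xs" for n m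
  proof -
    have "p n \<cdot> i m = (if n = m then ident C (Xs ! n) else 0)" using ds that by (simp add: direct_sum_def)
    then show ?thesis using s[OF that(1)] by (simp only: simp_thms)
  qed
  have one: "(\<Sum>n<length Xs. i n \<cdot> p n) = ident C ?W" using ds by (auto simp: direct_sum_def)
  define b where "b = (\<lambda>n. i n \<cdot> prj (s n))"
  define b' where "b' = (\<lambda>n. inc (s n) \<cdot> p n)"
  let ?i = "\<lambda>n. Arrow (V (s n)) ?W (i n)" and ?p = "\<lambda>n. Arrow ?W (V (s n)) (p n)"
  let ?I = "\<lambda>n. Arrow (V (s n)) Vh (inc (s n))" and ?P = "\<lambda>n. Arrow Vh (V (s n)) (prj (s n))"
  have a: "arr (?i n)" "arr (?p n)" "arr (?I n)" "arr (?P n)" if "n < length Xs" for n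
    using ip[OF that] s[OF that] W inc_Hom prj_Hom by simp_all
  have PI: "?P n \<bullet> ?I n = aid (V (s n))" if "n < length Xs" for n
    using s[OF that] prj_inc by (simp add: arrow_defs)
  have PIc: "?P n \<bullet> (?I n \<bullet> x) = x" if "n < length Xs" "arr x" "acod x = V (s n)" for n x
    using a[OF that(1)] that acmp_assoc[of x "?I n" "?P n"] PI[OF that(1)] by simp
  have "resolution X {..<length Xs} b b' s"
    unfolding resolution_def
  proof (intro conjI ballI X)
    fix n assume "n \<in> {..<length Xs}"
    then have n: "n < length Xs" by simp
    show "s n \<in> I" using s[OF n] by simp
    show "b n \<in> omega X" using arr_Hom[of "?i n \<bullet> ?P n"] a[OF n] by (simp add: amor_simps b_def)
    show "b' n \<in> coomega X" using arr_Hom[of "?I n \<bullet> ?p n"] a[OF n] by (simp add: amor_simps b'_def)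
    have "(?i n \<bullet> ?P n) \<bullet> (?I n \<bullet> ?P n) = ?i n \<bullet> ?P n" using a[OF n] by (simp add: PIc[OF n])
    then show "b n \<cdot> lam (s n) = b n" by (simp only: b_def arrow_defs arrow.sel arrow.inject simp_thms)
    have "(?I n \<bullet> ?P n) \<bullet> (?I n \<bullet> ?p n) = ?I n \<bullet> ?p n" using a[OF n] by (simp add: PIc[OF n])
    then show "lam (s n) \<cdot> b' n = b' n" by (simp only: b'_def arrow_defs arrow.sel arrow.inject simp_thms)
    fix m assume "m \<in> {..<length Xs}"
    then have m: "m < length Xs" by simp
    have sm: "s m \<in> I" "s n \<in> I" using s n m by auto
    have "(?I n \<bullet> ?p n) \<bullet> (?i m \<bullet> ?P m) = ?I n \<bullet> ((?p n \<bullet> ?i m) \<bullet> ?P m)"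
      using a[OF n] a[OF m] by simp
    then have "b' n \<cdot> b m = inc (s n) \<cdot> ((p n \<cdot> i m) \<cdot> prj (s m))"
      by (simp only: b_def b'_def arrow_defs arrow.sel arrow.inject simp_thms)
    then show "b' n \<cdot> b m = (if n = m then lam (s n) else 0)"
      using sm prj_Hom inc_Hom cmp_ident_left[of Vh "V (s m)"] cmp_zero_left[of Vh "V (s m)" "V (s n)"]
        cmp_zero_right[of Vh "V (s n)" Vh] by (simp add: pi[OF n m])
  next
    have "b n \<cdot> b' n = i n \<cdot> p n" if n: "n < length Xs" for n
    proof -
      have "(?i n \<bullet> ?P n) \<bullet> (?I n \<bullet> ?p n) = ?i n \<bullet> ?p n" using a[OF n] by (simp add: PIc[OF n])
      then show ?thesis by (simp only: b_def b'_def arrow_defs arrow.sel arrow.inject simp_thms)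
    qed
    then show "(\<Sum>n<length Xs. b n \<cdot> b' n) = ident C ?W" using one by simp
  qed simp
  then show ?thesis using that by blast
qed

text \<open>This shows that the definite description in \<open>dual_basis\<close> denotes. A basis
  enters through its coordinate functionals \<open>\<kappa> q\<close>; a resolution represents each
  of them by the pairing, and uniqueness holds because every covector expands in the representing
  elements with its values on \<open>b\<close> as coefficients.\<close>

lemma dual_basis_system:
  assumes X: "X \<in> Obj C" and Q: "finite Q" and b: "\<And>q. q \<in> Q \<Longrightarrow> b q \<in> omega X"
    and \<kappa>: "\<And>q. q \<in> Q \<Longrightarrow> linear_map (hom_space C Vh (Vh \<boxtimes> X)) kfield (\<kappa> q)"
    and expand: "\<And>v. v \<in> omega X \<Longrightarrow> v = (\<Sum>q\<in>Q. scl C (\<kappa> q v) (b q))"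
    and delta: "\<And>q r. \<lbrakk>q \<in> Q; r \<in> Q\<rbrakk> \<Longrightarrow> \<kappa> q (b r) = (if r = q then 1 else 0)"
  defines "b' \<equiv> dual_basis C I Vh lam X Q b"
  shows "dual_system X Q b b'" and "\<lbrakk>q \<in> Q; v \<in> omega X\<rbrakk> \<Longrightarrow> g (b' q) v = \<kappa> q v"
proof -
  obtain N :: "nat set" and c c' s where res: "resolution X N c c' s"
    using resolution_exists[OF X] .
  have ds: "dual_system X N c c'" by (rule resolution_dual_system[OF res])
  then have N: "finite N" and c: "\<And>n. n \<in> N \<Longrightarrow> c n \<in> omega X" "\<And>n. n \<in> N \<Longrightarrow> c' n \<in> coomega X"
    and cv: "\<And>v. v \<in> omega X \<Longrightarrow> v = (\<Sum>n\<in>N. scl C (g (c' n) v) (c n))"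
    and ct: "\<And>\<theta>. \<theta> \<in> coomega X \<Longrightarrow> \<theta> = (\<Sum>n\<in>N. scl C (g \<theta> (c n)) (c' n))"
    by (auto simp: dual_system_def)
  have VX: "Vh \<boxtimes> X \<in> Obj C" using X by simp
  \<comment> \<open>The covector that represents \<open>\<kappa> q\<close>: its coefficients in
    \<open>c'\<close> are the values of \<open>\<kappa> q\<close> on the dual family
    \<open>c\<close>.\<close>
  define d where "d q = (\<Sum>n\<in>N. scl C (\<kappa> q (c n)) (c' n))" for q
  have d: "d q \<in> coomega X" for q
    unfolding d_def using c VX by (intro sum_in_Hom scl_in_Hom) auto
  have gd: "g (d q) v = \<kappa> q v" if q: "q \<in> Q" and v: "v \<in> omega X" for q v
  proof -
    have "g (d q) v = (\<Oplus>\<^bsub>kfield\<^esub>n\<in>N. \<kappa> q (c n) \<odot>\<^bsub>kfield\<^esub> g (c' n) v)"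
      unfolding d_def using v c VX
      by (intro linear_map_hom_sum[OF _ _ vect_kfield bilinear_left[OF bilinear_pairing[OF X]]]) auto
    also have "\<dots> = (\<Oplus>\<^bsub>kfield\<^esub>n\<in>N. g (c' n) v \<odot>\<^bsub>kfield\<^esub> \<kappa> q (c n))" by (simp add: mult.commute)
    also have "\<dots> = \<kappa> q (\<Sum>n\<in>N. scl C (g (c' n) v) (c n))"
      using c VX by (intro linear_map_hom_sum[OF _ _ vect_kfield \<kappa>[OF q], symmetric]) auto
    finally show ?thesis using cv[OF v] by simp
  qed
  have dexp: "\<theta> = (\<Sum>q\<in>Q. scl C (g \<theta> (b q)) (d q))" if t: "\<theta> \<in> coomega X" for \<theta>
  proof -
    have eq: "g \<theta> (c n) = (\<Sum>q\<in>Q. g \<theta> (b q) * \<kappa> q (c n))" if n: "n \<in> N" for n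
    proof -
      have "g \<theta> (c n) = g \<theta> (\<Sum>q\<in>Q. scl C (\<kappa> q (c n)) (b q))" using expand[OF c(1)[OF n]] by simp
      also have "\<dots> = (\<Oplus>\<^bsub>kfield\<^esub>q\<in>Q. \<kappa> q (c n) \<odot>\<^bsub>kfield\<^esub> g \<theta> (b q))"
        using t b VX by (intro linear_map_hom_sum[OF _ _ vect_kfield bilinear_right[OF bilinear_pairing[OF X]]]) auto
      also have "\<dots> = (\<Sum>q\<in>Q. g \<theta> (b q) * \<kappa> q (c n))"
        by (subst finsum_eq_sum[OF vect_kfield]) (auto simp: mult.commute)
      finally show ?thesis .
    qed
    have "\<theta> = (\<Sum>n\<in>N. scl C (g \<theta> (c n)) (c' n))" by (rule ct[OF t])
    also have "\<dots> = (\<Sum>n\<in>N. \<Sum>q\<in>Q. scl C (g \<theta> (b q)) (scl C (\<kappa> q (c n)) (c' n)))"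
      by (intro sum.cong refl) (simp add: eq scale_sum_left)
    also have "\<dots> = (\<Sum>q\<in>Q. \<Sum>n\<in>N. scl C (g \<theta> (b q)) (scl C (\<kappa> q (c n)) (c' n)))"
      by (rule sum.swap)
    also have "\<dots> = (\<Sum>q\<in>Q. scl C (g \<theta> (b q)) (d q))"
      by (simp only: d_def scale_sum_right)
    finally show ?thesis .
  qed
  have bd: "b' q = d q" if q: "q \<in> Q" for q
    unfolding b'_def dual_basis_def
  proof (rule the_equality)
    show "d q \<in> coomega X \<and> (\<forall>r\<in>Q. g (d q) (b r) = (if r = q then 1 else 0))"
      using d gd[OF q b] delta[OF q] by simp
    fix \<theta> assume t: "\<theta> \<in> coomega X \<and> (\<forall>r\<in>Q. g \<theta> (b r) = (if r = q then 1 else 0))"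
    then have "\<theta> = (\<Sum>r\<in>Q. scl C (if r = q then 1 else 0) (d r))"
      using dexp[of \<theta>] by (simp cong: sum.cong)
    also have "\<dots> = d q"
      using q Q by (simp add: if_distrib[of "\<lambda>x. scl C x _"] cong: if_cong)
    finally show "\<theta> = d q" .
  qed
  show "dual_system X Q b b'"
    unfolding dual_system_def
    using X Q b d bd gd expand dexp by (auto cong: sum.cong)
  show "q \<in> Q \<Longrightarrow> v \<in> omega X \<Longrightarrow> g (b' q) v = \<kappa> q v" using bd gd by simp
qed

text \<open>A resolution provides a finite spanning set of \<open>\<omega> X\<close>, so a maximal
  independent subset is a finite basis and the choice in \<open>omega_basis\<close> is legitimate.
  The coordinate functionals are those of \<open>representation\<close>.\<close>

lemma omega_basis_dual_system:
  assumes X: "X \<in> Obj C"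
  shows "dual_system X (omega_basis C Vh X) id (dual_basis C I Vh lam X (omega_basis C Vh X) id)"
proof -
  let ?W = "omega X"
  have VX: "Vh \<boxtimes> X \<in> Obj C" using X by simp
  note sub = Hom_subspace[OF Vh_Obj VX]
  obtain N :: "nat set" and c c' s where "resolution X N c c' s"
    using resolution_exists[OF X] .
  then have ds: "dual_system X N c c'" by (rule resolution_dual_system)
  obtain B where B: "B \<subseteq> ?W" "independent B" "?W \<subseteq> span B"
    using maximal_independent_subset[of ?W] by blast
  have "?W \<subseteq> span (c ` N)"
  proof
    fix v assume "v \<in> ?W"
    then have "v = (\<Sum>n\<in>N. scl C (g (c' n) v) (c n))" using ds by (auto simp: dual_system_def)
    also have "\<dots> \<in> span (c ` N)" by (intro span_sum span_scale span_base) auto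
    finally show "v \<in> span (c ` N)" .
  qed
  moreover have "finite (c ` N)" using ds by (simp add: dual_system_def)
  ultimately have "finite B" using independent_span_bound[of "c ` N" B] B by blast
  moreover have "span B = ?W" using B sub by (metis span_minimal subset_antisym)
  ultimately have "\<exists>B. finite B \<and> independent B \<and> span B = ?W" using B by blast
  then have *: "finite (omega_basis C Vh X)" "independent (omega_basis C Vh X)" "span (omega_basis C Vh X) = ?W"
    unfolding omega_basis_def by (metis (mono_tags, lifting) someI_ex)+
  define B' where "B' = omega_basis C Vh X"
  note B = *[folded B'_def]
  have "dual_system X B' id (dual_basis C I Vh lam X B' id)"
  proof (rule dual_basis_system[where \<kappa> = "\<lambda>q v. representation B' v q", OF X B(1)])
    show "id q \<in> ?W" if "q \<in> B'" for q using that B(3) span_base by auto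
    show "linear_map (hom_space C Vh (Vh \<boxtimes> X)) kfield (\<lambda>v. representation B' v q)" for q
      by (rule linear_mapI)
        (use B in \<open>simp_all add: representation_add representation_scale\<close>)
    show "v = (\<Sum>q\<in>B'. scl C (representation B' v q) (id q))" if "v \<in> ?W" for v
      using sum_representation_eq[OF B(2), of v B'] that B by simp
    show "representation B' (id r) q = (if r = q then 1 else 0)" if "q \<in> B'" "r \<in> B'" for q r
      using representation_basis[OF B(2) that(2)] by simp
  qed
  then show ?thesis by (simp add: B'_def)
qed

end

context linear_monoidal_category
begin

lemma linear_map_tmor:
  assumes "X \<in> Obj C" "X' \<in> Obj C" "Y \<in> Obj C" "Y' \<in> Obj C"
  shows "h \<in> Hom C Y Y' \<Longrightarrow> linear_map (hom_space C X X') (hom_space C (X \<boxtimes> Y) (X' \<boxtimes> Y')) (\<lambda>f. f \<star> h)"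
    and "f \<in> Hom C X X' \<Longrightarrow> linear_map (hom_space C Y Y') (hom_space C (X \<boxtimes> Y) (X' \<boxtimes> Y')) (\<lambda>h. f \<star> h)"
  using assms
  by (auto intro!: linear_mapI simp: tmor_Hom[of X X' Y Y'] tmor_add_left[of X X' Y Y'] tmor_scl_left[of X X' Y Y']
      tmor_add_right[of X X' Y Y'] tmor_scl_right[of X X' Y Y'])

lemma bilinear_vprod:
  assumes Obj: "A \<in> Obj C" "X \<in> Obj C" "Y \<in> Obj C"
  shows "bilinear (hom_space C A (A \<boxtimes> X)) (hom_space C A (A \<boxtimes> Y)) (hom_space C A (A \<boxtimes> (X \<boxtimes> Y))) (vprod A X Y)"
proof (rule bilinearI; simp)
  have a: "assoc C A X Y \<in> Hom C ((A \<boxtimes> X) \<boxtimes> Y) (A \<boxtimes> (X \<boxtimes> Y))"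
    using assoc_iso[OF Obj] by (simp add: iso_mor_def)
  have la: "linear_map (hom_space C A ((A \<boxtimes> X) \<boxtimes> Y)) (hom_space C A (A \<boxtimes> (X \<boxtimes> Y))) (\<lambda>x. assoc C A X Y \<cdot> x)"
    by (rule linear_map_cmp_right) (use Obj a in simp_all)
  show "linear_map (hom_space C A (A \<boxtimes> Y)) (hom_space C A (A \<boxtimes> (X \<boxtimes> Y))) (vprod A X Y v)"
    if "v \<in> Hom C A (A \<boxtimes> X)" for v
    unfolding vprod_def
    by (rule linear_map_comp[OF la], rule linear_map_cmp_right) (use Obj that in \<open>simp_all add: tmor_Hom ident_Hom\<close>)
  show "linear_map (hom_space C A (A \<boxtimes> X)) (hom_space C A (A \<boxtimes> (X \<boxtimes> Y))) (\<lambda>v. vprod A X Y v w)"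
    if "w \<in> Hom C A (A \<boxtimes> Y)" for w
  proof -
    have 1: "linear_map (hom_space C (A \<boxtimes> Y) ((A \<boxtimes> X) \<boxtimes> Y)) (hom_space C A ((A \<boxtimes> X) \<boxtimes> Y)) (\<lambda>x. x \<cdot> w)"
      by (rule linear_map_cmp_left) (use Obj that in simp_all)
    have 2: "linear_map (hom_space C A (A \<boxtimes> X)) (hom_space C (A \<boxtimes> Y) ((A \<boxtimes> X) \<boxtimes> Y)) (\<lambda>v. v \<star> ident C Y)"
      by (rule linear_map_tmor) (use Obj ident_Hom in simp_all)
    show ?thesis
      unfolding vprod_def by (rule linear_map_comp[OF la linear_map_comp[OF 1 2]])
  qed
qed

lemma bilinear_cprod:
  assumes Obj: "A \<in> Obj C" "X \<in> Obj C" "Y \<in> Obj C"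
  shows "bilinear (hom_space C (A \<boxtimes> X) A) (hom_space C (A \<boxtimes> Y) A) (hom_space C (A \<boxtimes> (X \<boxtimes> Y)) A) (cprod A X Y)"
proof (rule bilinearI; simp)
  let ?a = "inv_mor C ((A \<boxtimes> X) \<boxtimes> Y) (A \<boxtimes> (X \<boxtimes> Y)) (assoc C A X Y)"
  have a: "?a \<in> Hom C (A \<boxtimes> (X \<boxtimes> Y)) ((A \<boxtimes> X) \<boxtimes> Y)"
    using inv_mor(1)[OF _ _ assoc_iso[OF Obj]] Obj by simp
  have t: "\<theta> \<star> ident C Y \<in> Hom C ((A \<boxtimes> X) \<boxtimes> Y) (A \<boxtimes> Y)" if "\<theta> \<in> Hom C (A \<boxtimes> X) A" for \<theta>
    using Obj that by (simp add: tmor_Hom ident_Hom)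
  show "linear_map (hom_space C (A \<boxtimes> Y) A) (hom_space C (A \<boxtimes> (X \<boxtimes> Y)) A) (cprod A X Y \<theta>)"
    if "\<theta> \<in> Hom C (A \<boxtimes> X) A" for \<theta>
    unfolding cprod_def
    by (rule linear_map_cmp_left)
      (use Obj cmp_Hom[OF _ _ _ a t[OF that]] in simp_all)
  show "linear_map (hom_space C (A \<boxtimes> X) A) (hom_space C (A \<boxtimes> (X \<boxtimes> Y)) A) (\<lambda>\<theta>. cprod A X Y \<theta> \<zeta>)"
    if "\<zeta> \<in> Hom C (A \<boxtimes> Y) A" for \<zeta>
  proof -
    have 0: "linear_map (hom_space C (A \<boxtimes> (X \<boxtimes> Y)) (A \<boxtimes> Y)) (hom_space C (A \<boxtimes> (X \<boxtimes> Y)) A) (\<lambda>x. \<zeta> \<cdot> x)"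
      by (rule linear_map_cmp_right) (use Obj that in simp_all)
    have 1: "linear_map (hom_space C ((A \<boxtimes> X) \<boxtimes> Y) (A \<boxtimes> Y)) (hom_space C (A \<boxtimes> (X \<boxtimes> Y)) (A \<boxtimes> Y)) (\<lambda>x. x \<cdot> ?a)"
      by (rule linear_map_cmp_left) (use Obj a in simp_all)
    have 2: "linear_map (hom_space C (A \<boxtimes> X) A) (hom_space C ((A \<boxtimes> X) \<boxtimes> Y) (A \<boxtimes> Y)) (\<lambda>v. v \<star> ident C Y)"
      by (rule linear_map_tmor) (use Obj ident_Hom in simp_all)
    show ?thesis
      unfolding cprod_def by (rule linear_map_comp[OF 0 linear_map_comp[OF 1 2]])
  qed
qed

end

section \<open>The universal coend\<close>

context long_functor
begin

abbreviation S :: "('k, ('o \<times> 'm \<times> 'm \<Rightarrow>\<^sub>0 'k) set) module" where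
  "S \<equiv> coend_space C Vh"

abbreviation K :: "('k, ('o \<times> 'm \<times> 'm \<Rightarrow>\<^sub>0 'k) set) bialg" where
  "K \<equiv> coend C I Vh lam"

abbreviation sym :: "'o \<Rightarrow> 'm \<Rightarrow> 'm \<Rightarrow> ('o \<times> 'm \<times> 'm \<Rightarrow>\<^sub>0 'k) set" where
  "sym \<equiv> coend_sym C Vh"

abbreviation coW :: "'o \<Rightarrow> ('k, 'm) module" where
  "coW X \<equiv> hom_space C (Vh \<boxtimes> X) Vh"

abbreviation W :: "'o \<Rightarrow> ('k, 'm) module" where
  "W X \<equiv> hom_space C Vh (Vh \<boxtimes> X)"

lemma vect_W [simp]: "X \<in> Obj C \<Longrightarrow> vect (W X)"
  and vect_coW [simp]: "X \<in> Obj C \<Longrightarrow> vect (coW X)"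
  by (simp_all add: vect_hom_space)

lemma coend_gens_iff [simp]:
  "(X, \<theta>, v) \<in> coend_gens C Vh \<longleftrightarrow> X \<in> Obj C \<and> \<theta> \<in> coomega X \<and> v \<in> omega X"
  by (simp add: coend_gens_def)

lemma coend_gens_closed:
  "\<lbrakk>X \<in> Obj C; \<theta> \<in> coomega X; \<theta>' \<in> coomega X\<rbrakk> \<Longrightarrow> \<theta> + \<theta>' \<in> coomega X"
  "\<lbrakk>X \<in> Obj C; \<theta> \<in> coomega X\<rbrakk> \<Longrightarrow> scl C c \<theta> \<in> coomega X"
  "\<lbrakk>X \<in> Obj C; v \<in> omega X; v' \<in> omega X\<rbrakk> \<Longrightarrow> v + v' \<in> omega X"
  "\<lbrakk>X \<in> Obj C; v \<in> omega X\<rbrakk> \<Longrightarrow> scl C c v \<in> omega X"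
  using add_in_Hom[of "Vh \<boxtimes> X" Vh] scl_in_Hom[of "Vh \<boxtimes> X" Vh]
    add_in_Hom[of Vh "Vh \<boxtimes> X"] scl_in_Hom[of Vh "Vh \<boxtimes> X"] by simp_all

lemma presentation_coend: "presentation (coend_gens C Vh) (coend_rel C Vh)"
proof
  fix r :: "'o \<times> 'm \<times> 'm \<Rightarrow>\<^sub>0 'k" assume "r \<in> coend_rel C Vh"
  then show "Poly_Mapping.keys r \<subseteq> coend_gens C Vh"
    unfolding coend_rel_def
    by (elim UnE CollectE exE conjE) (simp_all add: coend_gens_closed omega_map coomega_map)
qed

lemma vect_S: "vect S"
  unfolding coend_space_def by (rule vect_presented_space)

lemma S_eq: "presented_space (coend_gens C Vh) (coend_rel C Vh) = S"
  by (simp add: coend_space_def)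

lemma sym_closed [simp, intro]:
  "\<lbrakk>X \<in> Obj C; \<theta> \<in> coomega X; v \<in> omega X\<rbrakk> \<Longrightarrow> sym X \<theta> v \<in> carrier S"
  by (simp add: coend_space_def coend_sym_def)

lemma bilinear_sym:
  assumes X: "X \<in> Obj C"
  shows "bilinear (coW X) (W X) S (sym X)"
proof -
  let ?R = "coend_rel C Vh :: ('o \<times> 'm \<times> 'm \<Rightarrow>\<^sub>0 'k) set" and ?S = "coend_gens C Vh"
  have "cls ?R (gen (X, \<theta> + \<theta>', v)) = cls ?R (gen (X, \<theta>, v) + gen (X, \<theta>', v))"
    if "(X, \<theta>, v) \<in> ?S" "(X, \<theta>', v) \<in> ?S" for \<theta> \<theta>' v
    by (rule cls_eqI) (unfold coend_rel_def diff_diff_eq, rule UnI1, rule UnI1, rule UnI1, rule UnI1, use that in blast)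
  moreover have "cls ?R (gen (X, \<theta>, v + v')) = cls ?R (gen (X, \<theta>, v) + gen (X, \<theta>, v'))"
    if "(X, \<theta>, v) \<in> ?S" "(X, \<theta>, v') \<in> ?S" for \<theta> v v'
    by (rule cls_eqI) (unfold coend_rel_def diff_diff_eq, rule UnI1, rule UnI1, rule UnI1, rule UnI2, use that in blast)
  moreover have "cls ?R (gen (X, scl C c \<theta>, v)) = cls ?R (pscale c (gen (X, \<theta>, v)))"
    if "(X, \<theta>, v) \<in> ?S" for c \<theta> v
    by (rule cls_eqI) (unfold coend_rel_def diff_diff_eq, rule UnI1, rule UnI1, rule UnI2, use that in blast)
  moreover have "cls ?R (gen (X, \<theta>, scl C c v)) = cls ?R (pscale c (gen (X, \<theta>, v)))"
    if "(X, \<theta>, v) \<in> ?S" for c \<theta> v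
    by (rule cls_eqI) (unfold coend_rel_def diff_diff_eq, rule UnI1, rule UnI2, use that in blast)
  ultimately show ?thesis
    using X by (intro bilinearI linear_mapI; simp add: coend_sym_def coend_space_def)
qed

lemma sym_natural:
  assumes "X \<in> Obj C" "Y \<in> Obj C" "f \<in> Hom C X Y" "\<zeta> \<in> coomega Y" "v \<in> omega X"
  shows "sym Y \<zeta> ((ident C Vh \<star> f) \<cdot> v) = sym X (\<zeta> \<cdot> (ident C Vh \<star> f)) v"
  unfolding coend_sym_def
  by (rule cls_eqI) (unfold coend_rel_def, rule UnI2, use assms in blast)

text \<open>This is the universal property of the coend. Four of the five families of relations
  express bilinearity in the covector and the vector, the fifth one dinaturality.\<close>

lemma compat_coend:
  assumes U: "vect U" and F: "\<And>X. X \<in> Obj C \<Longrightarrow> bilinear (coW X) (W X) U (F X)"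
    and nat: "\<And>X Y f \<zeta> v. \<lbrakk>X \<in> Obj C; Y \<in> Obj C; f \<in> Hom C X Y; \<zeta> \<in> coomega Y; v \<in> omega X\<rbrakk> \<Longrightarrow>
      F Y \<zeta> ((ident C Vh \<star> f) \<cdot> v) = F X (\<zeta> \<cdot> (ident C Vh \<star> f)) v"
  shows "compat U (coend_gens C Vh) (coend_rel C Vh) (\<lambda>(X, \<theta>, v). F X \<theta> v)"
proof -
  interpret U: vect U by fact
  let ?S = "coend_gens C Vh" and ?f = "\<lambda>(X, \<theta>, v). F X \<theta> v"
  have fS: "?f \<in> ?S \<rightarrow> carrier U"
    using bilinear_closed[OF F] by auto
  note lin = linear_map_lin_ext[OF U fS]
  note b = linear_map_add[OF lin, simplified] linear_map_smult[OF lin, simplified] U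
    bilinear_closed[OF F, simplified] linear_mapD[OF bilinear_right[OF F], simplified]
    linear_mapD[OF bilinear_left[OF F], simplified]
  have 1: "lin_ext U ?f (gen (X, \<theta> + \<theta>', v) - (gen (X, \<theta>, v) + gen (X, \<theta>', v))) = \<zero>\<^bsub>U\<^esub>"
    if "(X, \<theta>, v) \<in> ?S" "(X, \<theta>', v) \<in> ?S" for X \<theta> \<theta>' v
    by (rule lin_ext_diff[OF U fS]) (use that in \<open>simp_all add: b coend_gens_closed\<close>)
  have 2: "lin_ext U ?f (gen (X, \<theta>, v + v') - (gen (X, \<theta>, v) + gen (X, \<theta>, v'))) = \<zero>\<^bsub>U\<^esub>"
    if "(X, \<theta>, v) \<in> ?S" "(X, \<theta>, v') \<in> ?S" for X \<theta> v v'
    by (rule lin_ext_diff[OF U fS]) (use that in \<open>simp_all add: b coend_gens_closed\<close>)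
  have 3: "lin_ext U ?f (gen (X, scl C c \<theta>, v) - pscale c (gen (X, \<theta>, v))) = \<zero>\<^bsub>U\<^esub>"
    if "(X, \<theta>, v) \<in> ?S" for X c \<theta> v
    by (rule lin_ext_diff[OF U fS]) (use that in \<open>simp_all add: b coend_gens_closed\<close>)
  have 4: "lin_ext U ?f (gen (X, \<theta>, scl C c v) - pscale c (gen (X, \<theta>, v))) = \<zero>\<^bsub>U\<^esub>"
    if "(X, \<theta>, v) \<in> ?S" for X c \<theta> v
    by (rule lin_ext_diff[OF U fS]) (use that in \<open>simp_all add: b coend_gens_closed\<close>)
  have 5: "lin_ext U ?f (gen (Y, \<zeta>, (ident C Vh \<star> f) \<cdot> v) - gen (X, \<zeta> \<cdot> (ident C Vh \<star> f), v)) = \<zero>\<^bsub>U\<^esub>"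
    if "X \<in> Obj C" "Y \<in> Obj C" "f \<in> Hom C X Y" "\<zeta> \<in> coomega Y" "v \<in> omega X" for X Y f \<zeta> v
    by (rule lin_ext_diff[OF U fS])
      (use that in \<open>simp_all add: U bilinear_closed[OF F] nat omega_map[of X Y] coomega_map[of X Y]\<close>)
  show ?thesis
    unfolding compat_def
  proof (intro conjI fS ballI)
    fix r :: "'o \<times> 'm \<times> 'm \<Rightarrow>\<^sub>0 'k" assume "r \<in> coend_rel C Vh"
    then show "lin_ext U ?f r = \<zero>\<^bsub>U\<^esub>"
      unfolding coend_rel_def diff_diff_eq
      by (elim UnE CollectE exE conjE) (simp_all only: 1 2 3 4 5)
  qed
qed

lemma same_space_K: "same_space K S"
  by (simp add: same_space_def coend_def Let_def)

lemma vect_K: "vect K"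
  by (rule vect_same_space[OF same_space_sym[OF same_space_K] vect_S])

lemma K_carrier: "carrier K = carrier S"
  using same_space_K by (simp add: same_space_def)

lemma sym_closed_K [simp, intro]:
  "\<lbrakk>X \<in> Obj C; \<theta> \<in> coomega X; v \<in> omega X\<rbrakk> \<Longrightarrow> sym X \<theta> v \<in> carrier K"
  by (simp add: K_carrier sym_closed)

lemma bilinear_sym_K: "X \<in> Obj C \<Longrightarrow> bilinear (coW X) (W X) K (sym X)"
  using bilinear_sym bilinear_same_space[OF same_space_refl same_space_refl same_space_K] by blast

lemma coend_ops:
  "monoid.mult K = coend_mult C Vh"
  "one K = sym (unit_obj C) (runit C Vh) (runit_inv C Vh)"
  "counit K = ext kfield (\<lambda>(X, \<theta>, v). g \<theta> v)"
  by (simp_all add: coend_def Let_def)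

text \<open>In each argument the product of symbols is a dinatural family: by naturality of
  \<open>vprod\<close> and \<open>cprod\<close>, a morphism \<open>f\<close> becomes
  \<open>f \<star> ident C Y\<close> or \<open>ident C X \<star> f\<close> on the tensor product,
  and a relation of the coend moves it from the vector to the covector.\<close>

lemma
  shows bilinear_K_mult: "bilinear K K K (monoid.mult K)"
    and sym_mult: "\<lbrakk>X \<in> Obj C; \<theta> \<in> coomega X; v \<in> omega X; Y \<in> Obj C; \<zeta> \<in> coomega Y; w \<in> omega Y\<rbrakk> \<Longrightarrow>
      sym X \<theta> v \<otimes>\<^bsub>K\<^esub> sym Y \<zeta> w = sym (X \<boxtimes> Y) (cprod Vh X Y \<theta> \<zeta>) (vprod Vh X Y v w)"
proof -
  let ?G = "coend_gens C Vh" and ?R = "coend_rel C Vh :: ('o \<times> 'm \<times> 'm \<Rightarrow>\<^sub>0 'k) set"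
  define F where "F = (\<lambda>(X, \<theta>, v) (Y, \<zeta>, w). sym (X \<boxtimes> Y) (cprod Vh X Y \<theta> \<zeta>) (vprod Vh X Y v w))"
  have l: "compat S ?G ?R (\<lambda>s. F s t)" if t: "t \<in> ?G" for t
  proof -
    obtain Y \<zeta> w where [simp]: "t = (Y, \<zeta>, w)" by (cases t)
    have Y: "Y \<in> Obj C" and zw: "\<zeta> \<in> coomega Y" "w \<in> omega Y" using t by auto
    have "compat S ?G ?R (\<lambda>(X, \<theta>, v). sym (X \<boxtimes> Y) (cprod Vh X Y \<theta> \<zeta>) (vprod Vh X Y v w))"
    proof (rule compat_coend[OF vect_S])
      show "bilinear (coW X) (W X) S (\<lambda>\<theta> v. sym (X \<boxtimes> Y) (cprod Vh X Y \<theta> \<zeta>) (vprod Vh X Y v w))"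
        if X: "X \<in> Obj C" for X
        by (rule bilinear_comp[OF bilinear_sym bilinear_left[OF bilinear_cprod] bilinear_left[OF bilinear_vprod]])
          (use X Y zw in simp_all)
      show "sym (X' \<boxtimes> Y) (cprod Vh X' Y \<theta> \<zeta>) (vprod Vh X' Y ((ident C Vh \<star> f) \<cdot> v) w)
        = sym (X \<boxtimes> Y) (cprod Vh X Y (\<theta> \<cdot> (ident C Vh \<star> f)) \<zeta>) (vprod Vh X Y v w)"
        if "X \<in> Obj C" "X' \<in> Obj C" "f \<in> Hom C X X'" "\<theta> \<in> coomega X'" "v \<in> omega X" for X X' f \<theta> v
        using that Y zw
        by (simp add: vprod_natural_left cprod_natural_left[where X' = X'] sym_natural[of "X \<boxtimes> Y" "X' \<boxtimes> Y"]
            tmor_Hom ident_Hom cprod_Hom vprod_Hom)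
    qed
    then show ?thesis by (simp add: F_def case_prod_beta')
  qed
  have r: "compat S ?G ?R (F s)" if s: "s \<in> ?G" for s
  proof -
    obtain X \<theta> v where [simp]: "s = (X, \<theta>, v)" by (cases s)
    have X: "X \<in> Obj C" and tv: "\<theta> \<in> coomega X" "v \<in> omega X" using s by auto
    have "compat S ?G ?R (\<lambda>(Y, \<zeta>, w). sym (X \<boxtimes> Y) (cprod Vh X Y \<theta> \<zeta>) (vprod Vh X Y v w))"
    proof (rule compat_coend[OF vect_S])
      show "bilinear (coW Y) (W Y) S (\<lambda>\<zeta> w. sym (X \<boxtimes> Y) (cprod Vh X Y \<theta> \<zeta>) (vprod Vh X Y v w))"
        if Y: "Y \<in> Obj C" for Y
        by (rule bilinear_comp[OF bilinear_sym bilinear_right[OF bilinear_cprod] bilinear_right[OF bilinear_vprod]])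
          (use X Y tv in simp_all)
      show "sym (X \<boxtimes> Y') (cprod Vh X Y' \<theta> \<zeta>) (vprod Vh X Y' v ((ident C Vh \<star> f) \<cdot> w))
        = sym (X \<boxtimes> Y) (cprod Vh X Y \<theta> (\<zeta> \<cdot> (ident C Vh \<star> f))) (vprod Vh X Y v w)"
        if "Y \<in> Obj C" "Y' \<in> Obj C" "f \<in> Hom C Y Y'" "\<zeta> \<in> coomega Y'" "w \<in> omega Y" for Y Y' f \<zeta> w
        using that X tv
        by (simp add: vprod_natural_right cprod_natural_right[where Y' = Y'] sym_natural[of "X \<boxtimes> Y" "X \<boxtimes> Y'"]
            tmor_Hom ident_Hom cprod_Hom vprod_Hom)
    qed
    then show ?thesis by (simp add: F_def case_prod_beta')
  qed
  have eq: "coend_mult C Vh = (\<lambda>A B. ext S (\<lambda>s. ext S (F s) B) A)"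
    by (simp add: fun_eq_iff coend_mult_def F_def case_prod_beta' cprod_def vprod_def)
  note be = bilinear_ext[OF vect_S presentation_coend presentation_coend l r, unfolded S_eq]
  have "bilinear S S S (monoid.mult K)"
    unfolding coend_ops eq by (rule bilinearI; rule be; simp)
  then show "bilinear K K K (monoid.mult K)"
    using bilinear_same_space[OF same_space_K same_space_K same_space_K] by blast
  show "sym X \<theta> v \<otimes>\<^bsub>K\<^esub> sym Y \<zeta> w = sym (X \<boxtimes> Y) (cprod Vh X Y \<theta> \<zeta>) (vprod Vh X Y v w)"
    if "X \<in> Obj C" "\<theta> \<in> coomega X" "v \<in> omega X" "Y \<in> Obj C" "\<zeta> \<in> coomega Y" "w \<in> omega Y"
    unfolding coend_ops eq coend_sym_def[of C Vh X] coend_sym_def[of C Vh Y]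
    using be(3)[of "(X, \<theta>, v)" "(Y, \<zeta>, w)"] that by (simp add: F_def)
qed

lemma pre_algebra_K: "pre_algebra K"
  by (simp add: pre_algebra_def vect_K bilinear_K_mult)

lemma
  shows linear_map_K_counit: "linear_map K kfield (counit K)"
    and counit_sym: "\<lbrakk>X \<in> Obj C; \<theta> \<in> coomega X; v \<in> omega X\<rbrakk> \<Longrightarrow> counit K (sym X \<theta> v) = g \<theta> v"
proof -
  have c: "compat kfield (coend_gens C Vh) (coend_rel C Vh) (\<lambda>(X, \<theta>, v). g \<theta> v)"
    by (rule compat_coend[where F = "\<lambda>X. g", OF vect_kfield bilinear_pairing pairing_natural])
  show "linear_map K kfield (counit K)"
    using presentation.linear_map_ext[OF presentation_coend vect_kfield c]
      linear_map_same_space[OF same_space_K same_space_refl, of kfield] by (simp add: coend_ops S_eq)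
  show "counit K (sym X \<theta> v) = g \<theta> v" if "X \<in> Obj C" "\<theta> \<in> coomega X" "v \<in> omega X"
    using presentation.ext_gen[OF presentation_coend vect_kfield c, of "(X, \<theta>, v)"] that
    by (simp add: coend_ops coend_sym_def)
qed

text \<open>Well-definedness rests on \<open>dual_system_change\<close>. The second claim permits
  any dual system in place of \<open>omega_basis\<close>; the path bases will be inserted
  there.\<close>

lemma
  shows linear_map_K_comult: "linear_map K (tensor_space K K) (comult K)"
    and comult_sym: "\<lbrakk>dual_system X Q b b'; \<theta> \<in> coomega X; v \<in> omega X\<rbrakk> \<Longrightarrow>
      comult K (sym X \<theta> v) = (\<Oplus>\<^bsub>tensor_space K K\<^esub>q\<in>Q. tens K K (sym X \<theta> (b q)) (sym X (b' q) v))"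
proof -
  let ?T = "tensor_space K K" and ?G = "coend_gens C Vh" and ?R = "coend_rel C Vh :: ('o \<times> 'm \<times> 'm \<Rightarrow>\<^sub>0 'k) set"
  interpret T: vect ?T by (rule vect_tensor_space)
  let ?B = "omega_basis C Vh" and ?B' = "\<lambda>X. dual_basis C I Vh lam X (omega_basis C Vh X) id"
  define F where "F X \<theta> v = (\<Oplus>\<^bsub>?T\<^esub>b\<in>?B X. tens K K (sym X \<theta> b) (sym X (?B' X b) v))" for X \<theta> v
  note ss = same_space_sym[OF same_space_K]
  have "comult K = ext (tensor_space S S) (\<lambda>(X, \<theta>, v).
      \<Oplus>\<^bsub>tensor_space S S\<^esub>b\<in>?B X. tens S S (sym X \<theta> b) (sym X (?B' X b) v))"
    by (simp only: coend_def Let_def bialg.simps)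
  then have eq: "comult K = ext ?T (\<lambda>(X, \<theta>, v). F X \<theta> v)"
    unfolding F_def by (simp only: tensor_same_space[OF ss ss])
  note bt = bilinear_tens[OF vect_K vect_K]
  have B: "b \<in> omega X" "?B' X b \<in> coomega X" if "X \<in> Obj C" "b \<in> ?B X" for X b
    using omega_basis_dual_system[OF that(1)] that by (auto simp: dual_system_def)
  have bl: "bilinear (W Y) (coW X) ?T (\<lambda>x \<xi>. tens K K (sym Y \<theta> x) (sym X \<xi> v))"
    if "X \<in> Obj C" "\<theta> \<in> coomega Y" "v \<in> omega X" "Y \<in> Obj C" for X Y \<theta> v
    by (rule bilinear_comp[OF bt bilinear_right[OF bilinear_sym_K] bilinear_left[OF bilinear_sym_K]])
      (use that in simp_all)
  have indep: "(\<Oplus>\<^bsub>?T\<^esub>q\<in>Q. tens K K (sym X \<theta> (b q)) (sym X (b' q) v)) = F X \<theta> v"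
    if d: "dual_system X Q b b'" and tv: "\<theta> \<in> coomega X" "v \<in> omega X"
    for X \<theta> v and Q :: "'r set" and b b'
  proof -
    have X: "X \<in> Obj C" using d by (simp add: dual_system_def)
    show ?thesis
      using dual_system_independent[OF omega_basis_dual_system[OF X] d vect_tensor_space bl[OF X tv X]]
      by (simp add: F_def)
  qed
  have c: "compat ?T ?G ?R (\<lambda>(X, \<theta>, v). F X \<theta> v)"
  proof (rule compat_coend[OF vect_tensor_space])
    show "bilinear (coW X) (W X) ?T (F X)" if X: "X \<in> Obj C" for X
    proof (rule bilinearI)
      have b: "bilinear (coW X) (W X) ?T (\<lambda>\<theta> v. tens K K (sym X \<theta> b) (sym X (?B' X b) v))" if "b \<in> ?B X" for b
        by (rule bilinear_comp[OF bt bilinear_left[OF bilinear_sym_K] bilinear_right[OF bilinear_sym_K]])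
          (use B[OF X that] X in simp_all)
      show "linear_map (W X) ?T (F X \<theta>)" if "\<theta> \<in> carrier (coW X)" for \<theta>
        unfolding F_def by (rule linear_map_finsum_fun[OF vect_W[OF X] vect_tensor_space bilinear_right[OF b that]])
      show "linear_map (coW X) ?T (\<lambda>\<theta>. F X \<theta> v)" if "v \<in> carrier (W X)" for v
        unfolding F_def by (rule linear_map_finsum_fun[OF vect_coW[OF X] vect_tensor_space bilinear_left[OF b that]])
    qed
    fix X Y f \<zeta> v assume a: "X \<in> Obj C" "Y \<in> Obj C" "f \<in> Hom C X Y" "\<zeta> \<in> coomega Y" "v \<in> omega X"
    let ?f = "ident C Vh \<star> f"
    \<comment> \<open>The morphism \<open>f\<close> makes three moves: from the vector to the
      covector inside the right tensor factor, across the canonical element, and from the vector to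
      the covector inside the left tensor factor.\<close>
    have "F Y \<zeta> (?f \<cdot> v) = (\<Oplus>\<^bsub>?T\<^esub>b\<in>?B Y. tens K K (sym Y \<zeta> (id b)) (sym X (?B' Y b \<cdot> ?f) v))"
      unfolding F_def using a B omega_map[OF a(1-3)] coomega_map[OF a(1-3)]
      by (intro T.finsum_cong' refl) (auto simp: sym_natural intro!: tens_closed)
    also have "\<dots> = (\<Oplus>\<^bsub>?T\<^esub>b\<in>?B X. tens K K (sym Y \<zeta> (?f \<cdot> id b)) (sym X (?B' X b) v))"
      by (rule dual_system_change[OF omega_basis_dual_system[OF a(1)] omega_basis_dual_system[OF a(2)] a(3)
          vect_tensor_space bl[OF a(1,4,5,2)]])
    also have "\<dots> = F X (\<zeta> \<cdot> ?f) v"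
      unfolding F_def using a B omega_map[OF a(1-3)] coomega_map[OF a(1-3)]
      by (intro T.finsum_cong' refl) (auto simp: sym_natural intro!: tens_closed)
    finally show "F Y \<zeta> (?f \<cdot> v) = F X (\<zeta> \<cdot> ?f) v" .
  qed
  show "linear_map K ?T (comult K)"
    using presentation.linear_map_ext[OF presentation_coend vect_tensor_space c]
      linear_map_same_space[OF same_space_K same_space_refl, of ?T] by (simp add: eq S_eq)
  show "comult K (sym X \<theta> v) = (\<Oplus>\<^bsub>?T\<^esub>q\<in>Q. tens K K (sym X \<theta> (b q)) (sym X (b' q) v))"
    if d: "dual_system X Q b b'" and tv: "\<theta> \<in> coomega X" "v \<in> omega X"
  proof -
    have X: "X \<in> Obj C" using d by (simp add: dual_system_def)
    show ?thesis
      unfolding indep[OF d tv] eq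
      using presentation.ext_gen[OF presentation_coend vect_tensor_space c, of "(X, \<theta>, v)"] X tv
      by (simp add: coend_sym_def)
  qed
qed

text \<open>The two products are symbols over \<open>(X \<boxtimes> Y) \<boxtimes> Z\<close> and
  over \<open>X \<boxtimes> (Y \<boxtimes> Z)\<close>. They agree because the associator is a
  morphism between these objects and may be moved by dinaturality.\<close>

lemma sym_mult_assoc:
  assumes X: "X \<in> Obj C" "\<theta> \<in> coomega X" "v \<in> omega X"
    and Y: "Y \<in> Obj C" "\<zeta> \<in> coomega Y" "w \<in> omega Y"
    and Z: "Z \<in> Obj C" "\<xi> \<in> coomega Z" "u \<in> omega Z"
  shows "sym X \<theta> v \<otimes>\<^bsub>K\<^esub> sym Y \<zeta> w \<otimes>\<^bsub>K\<^esub> sym Z \<xi> u = sym X \<theta> v \<otimes>\<^bsub>K\<^esub> (sym Y \<zeta> w \<otimes>\<^bsub>K\<^esub> sym Z \<xi> u)"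
proof -
  have a: "assoc C X Y Z \<in> Hom C ((X \<boxtimes> Y) \<boxtimes> Z) (X \<boxtimes> (Y \<boxtimes> Z))"
    using assoc_iso X Y Z by (simp add: iso_mor_def)
  show ?thesis
    using X Y Z a
    by (simp add: sym_mult cprod_Hom vprod_Hom flip: vprod_assoc cprod_assoc[of Vh X Y Z])
      (simp add: sym_natural[of "(X \<boxtimes> Y) \<boxtimes> Z" "X \<boxtimes> (Y \<boxtimes> Z)"] cprod_Hom vprod_Hom)
qed

text \<open>Symbols over the unit object act through endomorphisms of \<open>Vh\<close>: on the
  target side when multiplied from the left, on the source side from the right. A unitor, moved by
  dinaturality, brings the result back from \<open>unit_obj C \<boxtimes> X\<close> or
  \<open>X \<boxtimes> unit_obj C\<close> to \<open>X\<close>.\<close>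

lemma sym_unit_mult:
  assumes "l \<in> Hom C Vh Vh" "l' \<in> Hom C Vh Vh" "X \<in> Obj C" "\<theta> \<in> coomega X" "v \<in> omega X"
  shows "sym (unit_obj C) (l \<cdot> runit C Vh) (runit_inv C Vh \<cdot> l') \<otimes>\<^bsub>K\<^esub> sym X \<theta> v
      = sym X (\<theta> \<cdot> (l \<star> ident C X)) ((l' \<star> ident C X) \<cdot> v)" (is "?L")
    and "sym X \<theta> v \<otimes>\<^bsub>K\<^esub> sym (unit_obj C) (l \<cdot> runit C Vh) (runit_inv C Vh \<cdot> l')
      = sym X (l \<cdot> \<theta>) (v \<cdot> l')" (is "?R")
proof -
  let ?U = "unit_obj C"
  have r: "runit C Vh \<in> coomega ?U" "runit_inv C Vh \<in> omega ?U"
    using runit_iso[of Vh] inv_mor(1)[of "Vh \<boxtimes> ?U" Vh "runit C Vh"] by (simp_all add: iso_mor_def runit_inv_def)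
  have ll: "l \<cdot> runit C Vh \<in> coomega ?U" "runit_inv C Vh \<cdot> l' \<in> omega ?U"
    using assms r by (auto intro: cmp_Hom[of "Vh \<boxtimes> ?U" Vh Vh] cmp_Hom[of Vh Vh "Vh \<boxtimes> ?U"])
  have un: "lunit C X \<in> Hom C (?U \<boxtimes> X) X" "runit C X \<in> Hom C (X \<boxtimes> ?U) X"
    using lunit_iso runit_iso assms by (simp_all add: iso_mor_def)
  have tl: "\<theta> \<cdot> (l \<star> ident C X) \<in> coomega X" "l \<cdot> \<theta> \<in> coomega X"
    using assms by (auto intro: cmp_Hom[of "Vh \<boxtimes> X" "Vh \<boxtimes> X" Vh] cmp_Hom[of "Vh \<boxtimes> X" Vh Vh] simp: tmor_Hom ident_Hom)
  show ?L
    using assms ll un tl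
    by (simp add: sym_mult cprod_unit_left vprod_Hom vprod_unit_left flip: sym_natural[of "?U \<boxtimes> X" X])
  show ?R
    using assms ll un tl
    by (simp add: sym_mult cprod_unit_right vprod_Hom vprod_unit_right flip: sym_natural[of "X \<boxtimes> ?U" X])
qed

end

context linear_monoidal_category
begin

context
  fixes A X Y :: 'o
  assumes Obj: "A \<in> Obj C" "X \<in> Obj C" "Y \<in> Obj C"
begin

lemma vprod_zero: "w \<in> Hom C A (A \<boxtimes> Y) \<Longrightarrow> vprod A X Y 0 w = 0"
  using linear_map_zero[OF vect_hom_space vect_hom_space bilinear_left[OF bilinear_vprod[OF Obj]]] Obj by simp

lemma cprod_zero: "\<zeta> \<in> Hom C (A \<boxtimes> Y) A \<Longrightarrow> cprod A X Y 0 \<zeta> = 0"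
  using linear_map_zero[OF vect_hom_space vect_hom_space bilinear_left[OF bilinear_cprod[OF Obj]]] Obj by simp

text \<open>In a product the source idempotent belongs to the second factor and the target
  idempotent to the first, as for concatenated paths. \<open>cprod_End\<close> says the same for
  covectors.\<close>

lemma vprod_End:
  assumes "v \<in> Hom C A (A \<boxtimes> X)" "w \<in> Hom C A (A \<boxtimes> Y)" "l \<in> Hom C A A"
  shows "vprod A X Y v w \<cdot> l = vprod A X Y v (w \<cdot> l)"
    and "(l \<star> ident C (X \<boxtimes> Y)) \<cdot> vprod A X Y v w = vprod A X Y ((l \<star> ident C X) \<cdot> v) w"
proof -
  let ?v = "Arrow A (A \<boxtimes> X) v" and ?w = "Arrow A (A \<boxtimes> Y) w" and ?l = "Arrow A A l"
  have "(aassoc A X Y \<bullet> (?v \<circledast> aid Y) \<bullet> ?w) \<bullet> ?l = aassoc A X Y \<bullet> (?v \<circledast> aid Y) \<bullet> ?w \<bullet> ?l"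
    using assms Obj by simp
  then show "vprod A X Y v w \<cdot> l = vprod A X Y v (w \<cdot> l)"
    by (simp only: vprod_def arrow_defs arrow.sel arrow.inject simp_thms)
  have "(?l \<circledast> aid (X \<boxtimes> Y)) \<bullet> aassoc A X Y \<bullet> (?v \<circledast> aid Y) \<bullet> ?w
    = (?l \<circledast> (aid X \<circledast> aid Y)) \<bullet> aassoc A X Y \<bullet> (?v \<circledast> aid Y) \<bullet> ?w"
    using assms Obj by simp
  also have "\<dots> = aassoc A X Y \<bullet> ((?l \<circledast> aid X) \<circledast> aid Y) \<bullet> (?v \<circledast> aid Y) \<bullet> ?w"
    using assms Obj by (subst aassoc_natural_cmp[symmetric, where X = A and Y = X and Z = Y]) simp_all
  also have "\<dots> = aassoc A X Y \<bullet> (((?l \<circledast> aid X) \<bullet> ?v) \<circledast> aid Y) \<bullet> ?w"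
    using assms Obj by (simp add: whisker)
  finally show "(l \<star> ident C (X \<boxtimes> Y)) \<cdot> vprod A X Y v w = vprod A X Y ((l \<star> ident C X) \<cdot> v) w"
    by (simp only: vprod_def arrow_defs arrow.sel arrow.inject simp_thms)
qed

lemma cprod_End:
  assumes "\<theta> \<in> Hom C (A \<boxtimes> X) A" "\<zeta> \<in> Hom C (A \<boxtimes> Y) A" "l \<in> Hom C A A"
  shows "l \<cdot> cprod A X Y \<theta> \<zeta> = cprod A X Y \<theta> (l \<cdot> \<zeta>)"
    and "cprod A X Y \<theta> \<zeta> \<cdot> (l \<star> ident C (X \<boxtimes> Y)) = cprod A X Y (\<theta> \<cdot> (l \<star> ident C X)) \<zeta>"
proof -
  let ?t = "Arrow (A \<boxtimes> X) A \<theta>" and ?z = "Arrow (A \<boxtimes> Y) A \<zeta>" and ?l = "Arrow A A l"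
  have "?l \<bullet> (?z \<bullet> (?t \<circledast> aid Y) \<bullet> aassoc' A X Y) = (?l \<bullet> ?z) \<bullet> (?t \<circledast> aid Y) \<bullet> aassoc' A X Y"
    using assms Obj by simp
  then show "l \<cdot> cprod A X Y \<theta> \<zeta> = cprod A X Y \<theta> (l \<cdot> \<zeta>)"
    by (simp only: cprod_def arrow_defs arrow.sel arrow.inject simp_thms)
  have "(?z \<bullet> (?t \<circledast> aid Y) \<bullet> aassoc' A X Y) \<bullet> (?l \<circledast> aid (X \<boxtimes> Y))
    = ?z \<bullet> (?t \<circledast> aid Y) \<bullet> aassoc' A X Y \<bullet> (?l \<circledast> (aid X \<circledast> aid Y))"
    using assms Obj by simp
  also have "\<dots> = ?z \<bullet> (?t \<circledast> aid Y) \<bullet> ((?l \<circledast> aid X) \<circledast> aid Y) \<bullet> aassoc' A X Y"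
    using assms Obj by (subst aassoc'_natural[where X = A and Y = X and Z = Y]) simp_all
  also have "\<dots> = ?z \<bullet> ((?t \<bullet> (?l \<circledast> aid X)) \<circledast> aid Y) \<bullet> aassoc' A X Y"
    using assms Obj by (simp add: whisker)
  finally show "cprod A X Y \<theta> \<zeta> \<cdot> (l \<star> ident C (X \<boxtimes> Y)) = cprod A X Y (\<theta> \<cdot> (l \<star> ident C X)) \<zeta>"
    by (simp only: cprod_def arrow_defs arrow.sel arrow.inject simp_thms)
qed

end

end

subsection \<open>Graded resolutions\<close>

context long_functor
begin

text \<open>The summand with index \<open>q\<close> lies in \<open>V (t q) \<otimes> X\<close>.\<close>

definition graded :: "'o \<Rightarrow> 'q set \<Rightarrow> ('q \<Rightarrow> 'm) \<Rightarrow> ('q \<Rightarrow> 'm) \<Rightarrow> ('q \<Rightarrow> 'i) \<Rightarrow> bool" where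
  "graded X Q b b' t \<longleftrightarrow>
     (\<forall>q\<in>Q. t q \<in> I \<and> (\<forall>j\<in>I. (lam j \<star> ident C X) \<cdot> b q = (if j = t q then b q else 0) \<and>
        b' q \<cdot> (lam j \<star> ident C X) = (if j = t q then b' q else 0)))"

lemma resolutionD:
  assumes "resolution X Q b b' s"
  shows "X \<in> Obj C" "finite Q"
    "\<And>q. q \<in> Q \<Longrightarrow> b q \<in> omega X" "\<And>q. q \<in> Q \<Longrightarrow> b' q \<in> coomega X" "\<And>q. q \<in> Q \<Longrightarrow> s q \<in> I"
    "\<And>q. q \<in> Q \<Longrightarrow> b q \<cdot> lam (s q) = b q" "\<And>q. q \<in> Q \<Longrightarrow> lam (s q) \<cdot> b' q = b' q"
    "\<And>q r. \<lbrakk>q \<in> Q; r \<in> Q\<rbrakk> \<Longrightarrow> b' q \<cdot> b r = (if q = r then lam (s q) else 0)"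
    "(\<Sum>q\<in>Q. b q \<cdot> b' q) = ident C (Vh \<boxtimes> X)"
  using assms unfolding resolution_def by blast+

lemma gradedD:
  assumes "graded X Q b b' t" "q \<in> Q"
  shows "t q \<in> I" "j \<in> I \<Longrightarrow> (lam j \<star> ident C X) \<cdot> b q = (if j = t q then b q else 0)"
    "j \<in> I \<Longrightarrow> b' q \<cdot> (lam j \<star> ident C X) = (if j = t q then b' q else 0)"
  using assms unfolding graded_def by blast+

lemma resolution_reindex:
  assumes "resolution X Q b b' s" "inj_on h Q"
    and "\<And>q. q \<in> Q \<Longrightarrow> c (h q) = b q" "\<And>q. q \<in> Q \<Longrightarrow> c' (h q) = b' q" "\<And>q. q \<in> Q \<Longrightarrow> s' (h q) = s q"
  shows "resolution X (h ` Q) c c' s'"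
proof -
  note r = resolutionD[OF assms(1)]
  have "(\<Sum>q\<in>h ` Q. c q \<cdot> c' q) = (\<Sum>q\<in>Q. b q \<cdot> b' q)"
    using assms by (subst sum.reindex) auto
  then show ?thesis
    unfolding resolution_def using r assms(2-5) by (auto simp: inj_on_eq_iff)
qed

lemma graded_reindex:
  assumes "graded X Q b b' t"
    and "\<And>q. q \<in> Q \<Longrightarrow> c (h q) = b q" "\<And>q. q \<in> Q \<Longrightarrow> c' (h q) = b' q" "\<And>q. q \<in> Q \<Longrightarrow> t' (h q) = t q"
  shows "graded X (h ` Q) c c' t'"
  using assms by (auto simp: graded_def)

lemma dual_system_eqI:
  assumes "dual_system X Q b b'" "\<theta> \<in> coomega X" "\<theta>' \<in> coomega X" "\<And>q. q \<in> Q \<Longrightarrow> g \<theta> (b q) = g \<theta>' (b q)"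
  shows "\<theta> = \<theta>'"
proof -
  have "\<theta> = (\<Sum>q\<in>Q. scl C (g \<theta> (b q)) (b' q))" "\<theta>' = (\<Sum>q\<in>Q. scl C (g \<theta>' (b q)) (b' q))"
    using assms(1-3) by (auto simp: dual_system_def)
  then show ?thesis using assms(4) by (simp cong: sum.cong)
qed

text \<open>A dual basis of vectors that are homogeneous at the source is already a resolution: by
  \<open>eps_scalar\<close> each composite \<open>b' q \<cdot> b r\<close> is determined by its
  pairing. Homogeneity at the target passes from the vectors to the covectors because a covector is
  determined by its values on the basis.\<close>

lemma
  assumes ds: "dual_system X Q b b'"
    and delta: "\<And>q r. \<lbrakk>q \<in> Q; r \<in> Q\<rbrakk> \<Longrightarrow> g (b' q) (b r) = (if r = q then 1 else 0)"
    and s: "\<And>q. q \<in> Q \<Longrightarrow> s q \<in> I" "\<And>q. q \<in> Q \<Longrightarrow> b q \<cdot> lam (s q) = b q"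
  shows dual_system_resolution: "resolution X Q b b' s"
    and dual_system_graded: "\<lbrakk>\<And>q. q \<in> Q \<Longrightarrow> t q \<in> I;
      \<And>q j. \<lbrakk>q \<in> Q; j \<in> I\<rbrakk> \<Longrightarrow> (lam j \<star> ident C X) \<cdot> b q = (if j = t q then b q else 0)\<rbrakk> \<Longrightarrow> graded X Q b b' t"
proof -
  have X: "X \<in> Obj C" and Q: "finite Q" and b: "\<And>q. q \<in> Q \<Longrightarrow> b q \<in> omega X" "\<And>q. q \<in> Q \<Longrightarrow> b' q \<in> coomega X"
    and exp: "\<And>v. v \<in> omega X \<Longrightarrow> v = (\<Sum>q\<in>Q. scl C (g (b' q) v) (b q))"
    using ds by (auto simp: dual_system_def)
  have VX: "Vh \<boxtimes> X \<in> Obj C" using X by simp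
  have bb: "b' q \<cdot> v \<in> Hom C Vh Vh" if "q \<in> Q" "v \<in> omega X" for q v
    using cmp_Hom[of Vh "Vh \<boxtimes> X" Vh v "b' q"] b that VX by simp
  have orth: "b' q \<cdot> b r = (if q = r then lam (s q) else 0)" if q: "q \<in> Q" and r: "r \<in> Q" for q r
  proof -
    have "(b' q \<cdot> b r) \<cdot> lam (s r) = b' q \<cdot> b r"
      using cmp_assoc[of Vh Vh "Vh \<boxtimes> X" Vh "lam (s r)" "b r" "b' q"] q r b s VX by simp
    then have "b' q \<cdot> b r = scl C (g (b' q) (b r)) (lam (s r))"
      using eps_scalar[OF bb[OF q b(1)[OF r]] s(1)[OF r]] by (simp add: pairing_def)
    then show ?thesis using delta[OF q r] by auto
  qed
  have ls: "lam (s q) \<cdot> b' q = b' q" if q: "q \<in> Q" for q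
  proof (rule dual_system_eqI[OF ds _ b(2)[OF q]])
    show "lam (s q) \<cdot> b' q \<in> coomega X"
      using cmp_Hom[of "Vh \<boxtimes> X" Vh Vh "b' q" "lam (s q)"] b(2)[OF q] s(1)[OF q] VX by simp
    show "g (lam (s q) \<cdot> b' q) (b r) = g (b' q) (b r)" if r: "r \<in> Q" for r
    proof -
      have "(lam (s q) \<cdot> b' q) \<cdot> b r = lam (s q) \<cdot> (b' q \<cdot> b r)"
        using cmp_assoc[of Vh "Vh \<boxtimes> X" Vh Vh "b r" "b' q" "lam (s q)"] b q r s VX by simp
      also have "\<dots> = b' q \<cdot> b r"
        using orth[OF q r] s(1)[OF q] s(1)[OF r] by (simp add: lam_lam cmp_zero_right[of Vh Vh Vh])
      finally show ?thesis by (simp add: pairing_def)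
    qed
  qed
  obtain N :: "nat set" and c c' s' where res: "resolution X N c c' s'"
    using resolution_exists[OF X] .
  note c = resolutionD[OF res]
  let ?e = "\<Sum>q\<in>Q. b q \<cdot> b' q"
  have bq: "b q \<cdot> b' q \<in> Hom C (Vh \<boxtimes> X) (Vh \<boxtimes> X)" if "q \<in> Q" for q
    using cmp_Hom[of "Vh \<boxtimes> X" Vh "Vh \<boxtimes> X" "b' q" "b q"] b[OF that] VX by simp
  have e: "?e \<in> Hom C (Vh \<boxtimes> X) (Vh \<boxtimes> X)" using bq VX by (intro sum_in_Hom) auto
  have ev: "?e \<cdot> v = v" if v: "v \<in> omega X" for v
  proof -
    have "?e \<cdot> v = (\<Sum>q\<in>Q. (b q \<cdot> b' q) \<cdot> v)" using v VX bq by (intro cmp_sum_left[of Vh "Vh \<boxtimes> X" "Vh \<boxtimes> X"]) auto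
    also have "\<dots> = (\<Sum>q\<in>Q. scl C (g (b' q) v) (b q))"
    proof (rule sum.cong[OF refl])
      fix q assume q: "q \<in> Q"
      show "(b q \<cdot> b' q) \<cdot> v = scl C (g (b' q) v) (b q)"
        by (rule rank_one_apply[OF X b(1)[OF q] b(2)[OF q] s(1)[OF q] s(2)[OF q] ls[OF q] v])
    qed
    finally show ?thesis using exp[OF v] by simp
  qed
  \<comment> \<open>\<open>?e\<close> is known to fix every vector of \<open>\<omega> X\<close>. A
    resolution writes the identity of \<open>Vh \<otimes> X\<close> as a sum of morphisms factoring
    through such vectors, and so \<open>?e\<close> is the identity.\<close>
  have "?e = ?e \<cdot> (\<Sum>n\<in>N. c n \<cdot> c' n)" unfolding c(9) using cmp_ident_right[of "Vh \<boxtimes> X" "Vh \<boxtimes> X" ?e] e VX by simp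
  also have "\<dots> = (\<Sum>n\<in>N. ?e \<cdot> (c n \<cdot> c' n))"
    using e VX cmp_Hom[of "Vh \<boxtimes> X" Vh "Vh \<boxtimes> X"] c(3,4) by (intro cmp_sum_right[of "Vh \<boxtimes> X" "Vh \<boxtimes> X" "Vh \<boxtimes> X"]) auto
  also have "\<dots> = (\<Sum>n\<in>N. c n \<cdot> c' n)"
  proof (rule sum.cong[OF refl])
    fix n assume n: "n \<in> N"
    have "?e \<cdot> (c n \<cdot> c' n) = (?e \<cdot> c n) \<cdot> c' n"
      using cmp_assoc[of "Vh \<boxtimes> X" Vh "Vh \<boxtimes> X" "Vh \<boxtimes> X" "c' n" "c n" ?e] e VX c(3,4)[OF n] by simp
    then show "?e \<cdot> (c n \<cdot> c' n) = c n \<cdot> c' n" using ev[OF c(3)[OF n]] by simp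
  qed
  finally have "?e = ident C (Vh \<boxtimes> X)" unfolding c(9) .
  then show "resolution X Q b b' s"
    unfolding resolution_def using X Q b s ls orth by blast
  assume t: "\<And>q. q \<in> Q \<Longrightarrow> t q \<in> I"
    "\<And>q j. \<lbrakk>q \<in> Q; j \<in> I\<rbrakk> \<Longrightarrow> (lam j \<star> ident C X) \<cdot> b q = (if j = t q then b q else 0)"
  have "b' q \<cdot> (lam j \<star> ident C X) = (if j = t q then b' q else 0)" if q: "q \<in> Q" and j: "j \<in> I" for q j
  proof (rule dual_system_eqI[OF ds])
    have l: "lam j \<star> ident C X \<in> Hom C (Vh \<boxtimes> X) (Vh \<boxtimes> X)" using j X by (simp add: tmor_Hom ident_Hom)
    show "b' q \<cdot> (lam j \<star> ident C X) \<in> coomega X"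
      using cmp_Hom[of "Vh \<boxtimes> X" "Vh \<boxtimes> X" Vh] l b(2)[OF q] VX by simp
    show "(if j = t q then b' q else 0) \<in> coomega X" using b(2)[OF q] VX by simp
    fix r assume r: "r \<in> Q"
    have g0: "g 0 (b r) = 0" "g (b' q) 0 = 0"
      using linear_map_zero[OF vect_coW[OF X] vect_kfield bilinear_left[OF bilinear_pairing[OF X]]]
        linear_map_zero[OF vect_W[OF X] vect_kfield bilinear_right[OF bilinear_pairing[OF X]]] b q r by simp_all
    have "g (b' q \<cdot> (lam j \<star> ident C X)) (b r) = g (b' q) ((lam j \<star> ident C X) \<cdot> b r)"
      using cmp_assoc[of Vh "Vh \<boxtimes> X" "Vh \<boxtimes> X" Vh "b r" "lam j \<star> ident C X" "b' q"] l b q r VX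
      by (simp add: pairing_def)
    also have "\<dots> = g (if j = t q then b' q else 0) (b r)"
    proof (cases "r = q")
      case True
      then show ?thesis using t(2)[OF q j] g0 by (cases "j = t q") simp_all
    next
      case False
      then show ?thesis unfolding t(2)[OF r j] using delta[OF q r] g0 by (cases "j = t q"; cases "j = t r") simp_all
    qed
    finally show "g (b' q \<cdot> (lam j \<star> ident C X)) (b r) = g (if j = t q then b' q else 0) (b r)" .
  qed
  then show "graded X Q b b' t" using t by (simp add: graded_def)
qed

context
  fixes X Y :: 'o and Q :: "'q set" and P :: "'p set" and b b' c c' s s' t t'
  assumes rX: "resolution X Q b b' s" and gX: "graded X Q b b' t"
    and rY: "resolution Y P c c' s'" and gY: "graded Y P c c' t'"
begin

lemma graded_vprod:
  "graded (X \<boxtimes> Y) {(q, r) \<in> Q \<times> P. s q = t' r}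
     (\<lambda>(q, r). vprod Vh X Y (b q) (c r)) (\<lambda>(q, r). cprod Vh X Y (b' q) (c' r)) (\<lambda>(q, r). t q)"
proof -
  note x = resolutionD[OF rX] and y = resolutionD[OF rY] and gx = gradedD[OF gX]
  have "(lam j \<star> ident C (X \<boxtimes> Y)) \<cdot> vprod Vh X Y (b q) (c r) = (if j = t q then vprod Vh X Y (b q) (c r) else 0)"
    "cprod Vh X Y (b' q) (c' r) \<cdot> (lam j \<star> ident C (X \<boxtimes> Y)) = (if j = t q then cprod Vh X Y (b' q) (c' r) else 0)"
    if "q \<in> Q" "r \<in> P" "j \<in> I" for q r j
    using that x(1,3,4) y(1,3,4) gx(2,3)
    by (simp_all add: vprod_End(2) cprod_End(2) vprod_zero cprod_zero)
  then show ?thesis using gx(1) by (auto simp: graded_def)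
qed

text \<open>Composing the decomposition of the identity with the projection to target
  \<open>j\<close> keeps the terms of grade \<open>j\<close> and kills the others.\<close>

lemma sum_graded_component:
  assumes "j \<in> I"
  shows "(\<Sum>r | r \<in> P \<and> j = t' r. c r \<cdot> c' r) = lam j \<star> ident C Y"
proof -
  note y = resolutionD[OF rY] and gy = gradedD[OF gY]
  have VY: "Vh \<boxtimes> Y \<in> Obj C" using y(1) by simp
  have l: "lam j \<star> ident C Y \<in> Hom C (Vh \<boxtimes> Y) (Vh \<boxtimes> Y)" using assms y(1) by (simp add: tmor_Hom ident_Hom)
  have cc: "c r \<cdot> c' r \<in> Hom C (Vh \<boxtimes> Y) (Vh \<boxtimes> Y)" if "r \<in> P" for r
    using cmp_Hom[of "Vh \<boxtimes> Y" Vh "Vh \<boxtimes> Y" "c' r" "c r"] y(3,4)[OF that] VY by simp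
  have "lam j \<star> ident C Y = (lam j \<star> ident C Y) \<cdot> (\<Sum>r\<in>P. c r \<cdot> c' r)"
    unfolding y(9) using cmp_ident_right[OF VY VY l] by simp
  also have "\<dots> = (\<Sum>r\<in>P. (lam j \<star> ident C Y) \<cdot> (c r \<cdot> c' r))"
    by (rule cmp_sum_right[OF VY VY VY l cc])
  also have "\<dots> = (\<Sum>r\<in>P. if j = t' r then c r \<cdot> c' r else 0)"
  proof (rule sum.cong[OF refl])
    fix r assume r: "r \<in> P"
    have "(lam j \<star> ident C Y) \<cdot> (c r \<cdot> c' r) = ((lam j \<star> ident C Y) \<cdot> c r) \<cdot> c' r"
      using cmp_assoc[of "Vh \<boxtimes> Y" Vh "Vh \<boxtimes> Y" "Vh \<boxtimes> Y" "c' r" "c r" "lam j \<star> ident C Y"] VY l y(3,4)[OF r] by simp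
    then show "(lam j \<star> ident C Y) \<cdot> (c r \<cdot> c' r) = (if j = t' r then c r \<cdot> c' r else 0)"
      using gy(2)[OF r assms] cmp_zero_left[of "Vh \<boxtimes> Y" Vh "Vh \<boxtimes> Y" "c' r"] VY y(4)[OF r] by simp
  qed
  also have "\<dots> = (\<Sum>r | r \<in> P \<and> j = t' r. c r \<cdot> c' r)"
    using y(2) by (rule sum.inter_filter[symmetric])
  finally show ?thesis ..
qed

text \<open>Orthogonality: \<open>b' q \<cdot> b q\<close> leaves \<open>lam (s q)\<close> on the
  target side of \<open>c r\<close>, where it acts as the identity since \<open>s q = t' r\<close>.
  Completeness: the sum over all \<open>r\<close> that fit a given \<open>q\<close> is a projection
  which \<open>b q\<close> and \<open>b' q\<close> absorb, and the sum over \<open>q\<close> then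
  gives the identity.\<close>

lemma resolution_vprod:
  "resolution (X \<boxtimes> Y) {(q, r) \<in> Q \<times> P. s q = t' r}
     (\<lambda>(q, r). vprod Vh X Y (b q) (c r)) (\<lambda>(q, r). cprod Vh X Y (b' q) (c' r)) (\<lambda>(q, r). s' r)"
proof -
  note x = resolutionD[OF rX] and y = resolutionD[OF rY] and gy = gradedD[OF gY]
  let ?QP = "{(q, r) \<in> Q \<times> P. s q = t' r}"
  let ?V = "Vh \<boxtimes> (X \<boxtimes> Y)" and ?VXY = "(Vh \<boxtimes> X) \<boxtimes> Y"
  let ?a' = "inv_mor C ?VXY ?V (assoc C Vh X Y)"
  have Obj: "?V \<in> Obj C" "?VXY \<in> Obj C" "Vh \<boxtimes> X \<in> Obj C" "Vh \<boxtimes> Y \<in> Obj C" "X \<in> Obj C" "Y \<in> Obj C"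
    using x(1) y(1) by simp_all
  have vb: "vprod Vh X Y (b q) (c r) \<in> omega (X \<boxtimes> Y)" "cprod Vh X Y (b' q) (c' r) \<in> coomega (X \<boxtimes> Y)"
    "vprod Vh X Y (b q) (c r) \<cdot> lam (s' r) = vprod Vh X Y (b q) (c r)"
    "lam (s' r) \<cdot> cprod Vh X Y (b' q) (c' r) = cprod Vh X Y (b' q) (c' r)"
    if "q \<in> Q" "r \<in> P" for q r
    using that x y by (simp_all add: vprod_Hom cprod_Hom vprod_End(1) cprod_End(1))
  have orth: "cprod Vh X Y (b' q) (c' r) \<cdot> vprod Vh X Y (b q') (c r') = (if (q, r) = (q', r') then lam (s' r) else 0)"
    if q: "q \<in> Q" "q' \<in> Q" and r: "r \<in> P" "r' \<in> P" and st: "s q = t' r" "s q' = t' r'" for q r q' r'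
  proof -
    have eq: "cprod Vh X Y (b' q) (c' r) \<cdot> vprod Vh X Y (b q') (c r') = c' r \<cdot> ((b' q \<cdot> b q') \<star> ident C Y) \<cdot> c r'"
      using x y q r by (intro cprod_vprod) simp_all
    show ?thesis
    proof (cases "q = q'")
      case True
      then have "cprod Vh X Y (b' q) (c' r) \<cdot> vprod Vh X Y (b q') (c r') = c' r \<cdot> c r'"
        unfolding eq using x(8)[OF q] gy(2)[OF r(2) x(5)[OF q(1)]] st by simp
      then show ?thesis using y(8)[OF r] True by simp
    next
      case False
      have "0 \<star> ident C Y = 0"
        using linear_map_zero[OF vect_hom_space vect_hom_space linear_map_tmor(1)[of Vh Vh Y Y "ident C Y"]] Obj ident_Hom by simp
      then have "cprod Vh X Y (b' q) (c' r) \<cdot> vprod Vh X Y (b q') (c r') = 0"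
        unfolding eq using x(8)[OF q] False Obj y(3)[OF r(2)] y(4)[OF r(1)]
          cmp_zero_left[of Vh "Vh \<boxtimes> Y" "Vh \<boxtimes> Y" "c r'"] cmp_zero_right[of Vh "Vh \<boxtimes> Y" Vh "c' r"] by simp
      then show ?thesis using False by simp
    qed
  qed
  have a: "assoc C Vh X Y \<in> Hom C ?VXY ?V" "?a' \<in> Hom C ?V ?VXY" "assoc C Vh X Y \<cdot> ?a' = ident C ?V"
    using assoc_iso[of Vh X Y] inv_mor(1,3)[of ?VXY ?V "assoc C Vh X Y"] Obj by (simp_all add: iso_mor_def)
  have la: "linear_map (hom_space C ?V ?VXY) (hom_space C ?V ?V) (\<lambda>x. assoc C Vh X Y \<cdot> x)"
    by (rule linear_map_cmp_right) (use Obj a in simp_all)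
  have la': "linear_map (hom_space C ?VXY ?VXY) (hom_space C ?V ?VXY) (\<lambda>x. x \<cdot> ?a')"
    by (rule linear_map_cmp_left) (use Obj a in simp_all)
  have lt: "linear_map (hom_space C (Vh \<boxtimes> X) (Vh \<boxtimes> X)) (hom_space C ?VXY ?VXY) (\<lambda>x. x \<star> ident C Y)"
    by (rule linear_map_tmor(1)) (use Obj ident_Hom in simp_all)
  note L = linear_map_comp[OF la linear_map_comp[OF la' lt]]
  have bt: "b q \<star> ident C Y \<in> Hom C (Vh \<boxtimes> Y) ?VXY" "b' q \<star> ident C Y \<in> Hom C ?VXY (Vh \<boxtimes> Y)" if "q \<in> Q" for q
    using x(3,4)[OF that] Obj by (simp_all add: tmor_Hom ident_Hom)
  have bta: "(b' q \<star> ident C Y) \<cdot> ?a' \<in> Hom C ?V (Vh \<boxtimes> Y)" if "q \<in> Q" for q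
    using cmp_Hom[OF Obj(1,2,4) a(2) bt(2)[OF that]] .
  have bb: "b q \<cdot> b' q \<in> Hom C (Vh \<boxtimes> X) (Vh \<boxtimes> X)" if "q \<in> Q" for q
    using cmp_Hom[of "Vh \<boxtimes> X" Vh "Vh \<boxtimes> X" "b' q" "b q"] x(3,4)[OF that] Obj by simp
  have inner: "(\<Sum>r | r \<in> P \<and> s q = t' r. vprod Vh X Y (b q) (c r) \<cdot> cprod Vh X Y (b' q) (c' r))
    = assoc C Vh X Y \<cdot> ((b q \<cdot> b' q) \<star> ident C Y) \<cdot> ?a'" if q: "q \<in> Q" for q
  proof -
    let ?f = "\<lambda>z. assoc C Vh X Y \<cdot> (b q \<star> ident C Y) \<cdot> z \<cdot> (b' q \<star> ident C Y) \<cdot> ?a'"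
    have 1: "linear_map (hom_space C (Vh \<boxtimes> Y) (Vh \<boxtimes> Y)) (hom_space C ?V (Vh \<boxtimes> Y)) (\<lambda>z. z \<cdot> (b' q \<star> ident C Y) \<cdot> ?a')"
      by (rule linear_map_cmp_left) (use Obj bta[OF q] in simp_all)
    have 2: "linear_map (hom_space C ?V (Vh \<boxtimes> Y)) (hom_space C ?V ?VXY) (\<lambda>z. (b q \<star> ident C Y) \<cdot> z)"
      by (rule linear_map_cmp_right) (use Obj bt[OF q] in simp_all)
    have f: "linear_map (hom_space C (Vh \<boxtimes> Y) (Vh \<boxtimes> Y)) (hom_space C ?V ?V) ?f"
      by (rule linear_map_comp[OF la linear_map_comp[OF 2 1]])
    have cc: "c r \<cdot> c' r \<in> Hom C (Vh \<boxtimes> Y) (Vh \<boxtimes> Y)" if "r \<in> P" for r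
      using cmp_Hom[of "Vh \<boxtimes> Y" Vh "Vh \<boxtimes> Y" "c' r" "c r"] y(3,4)[OF that] Obj by simp
    have "(\<Sum>r | r \<in> P \<and> s q = t' r. vprod Vh X Y (b q) (c r) \<cdot> cprod Vh X Y (b' q) (c' r))
      = (\<Sum>r | r \<in> P \<and> s q = t' r. ?f (c r \<cdot> c' r))"
      using x(3,4)[OF q] y(3,4) Obj by (intro sum.cong refl vprod_cprod) auto
    also have "\<dots> = ?f (\<Sum>r | r \<in> P \<and> s q = t' r. c r \<cdot> c' r)"
      using cc Obj by (intro linear_map_hom_hom_sum[OF _ _ _ _ f, symmetric]) auto
    \<comment> \<open>Only the \<open>r\<close> with grade \<open>s q\<close> occur, so the inner
      sum is the projection to that target and not the full identity; the next step lets it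
      disappear into \<open>b' q\<close>.\<close>
    also have "\<dots> = ?f (lam (s q) \<star> ident C Y)" by (simp only: sum_graded_component[OF x(5)[OF q]])
    also have "\<dots> = assoc C Vh X Y \<cdot> ((b q \<cdot> b' q) \<star> ident C Y) \<cdot> ?a'"
    proof -
      let ?b = "Arrow Vh (Vh \<boxtimes> X) (b q)" and ?b' = "Arrow (Vh \<boxtimes> X) Vh (b' q)" and ?l = "Arrow Vh Vh (lam (s q))"
      have arrs: "arr ?b" "arr ?b'" "arr ?l" using x(3-5)[OF q] Obj by simp_all
      have "?l \<bullet> ?b' = ?b'" using x(7)[OF q] by (simp add: arrow_defs)
      moreover have "aassoc Vh X Y \<bullet> (?b \<circledast> aid Y) \<bullet> (?l \<circledast> aid Y) \<bullet> (?b' \<circledast> aid Y) \<bullet> aassoc' Vh X Y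
        = aassoc Vh X Y \<bullet> ((?b \<bullet> (?l \<bullet> ?b')) \<circledast> aid Y) \<bullet> aassoc' Vh X Y"
        using arrs Obj by (simp add: whisker)
      ultimately have "aassoc Vh X Y \<bullet> (?b \<circledast> aid Y) \<bullet> (?l \<circledast> aid Y) \<bullet> (?b' \<circledast> aid Y) \<bullet> aassoc' Vh X Y
        = aassoc Vh X Y \<bullet> ((?b \<bullet> ?b') \<circledast> aid Y) \<bullet> aassoc' Vh X Y" by simp
      then show ?thesis by (simp only: arrow_defs arrow.sel arrow.inject simp_thms)
    qed
    finally show ?thesis .
  qed
  have "(\<Sum>z\<in>?QP. (case z of (q, r) \<Rightarrow> vprod Vh X Y (b q) (c r)) \<cdot> (case z of (q, r) \<Rightarrow> cprod Vh X Y (b' q) (c' r)))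
    = (\<Sum>(q, r)\<in>Sigma Q (\<lambda>q. {r. r \<in> P \<and> s q = t' r}). vprod Vh X Y (b q) (c r) \<cdot> cprod Vh X Y (b' q) (c' r))"
    by (rule sum.cong) auto
  also have "\<dots> = (\<Sum>q\<in>Q. \<Sum>r | r \<in> P \<and> s q = t' r. vprod Vh X Y (b q) (c r) \<cdot> cprod Vh X Y (b' q) (c' r))"
    using x(2) y(2) by (subst sum.Sigma) auto
  also have "\<dots> = (\<Sum>q\<in>Q. assoc C Vh X Y \<cdot> ((b q \<cdot> b' q) \<star> ident C Y) \<cdot> ?a')"
    by (rule sum.cong[OF refl inner])
  also have "\<dots> = assoc C Vh X Y \<cdot> ((\<Sum>q\<in>Q. b q \<cdot> b' q) \<star> ident C Y) \<cdot> ?a'"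
    using bb Obj by (intro linear_map_hom_hom_sum[OF _ _ _ _ L, symmetric]) auto
  also have "\<dots> = ident C ?V"
    unfolding x(9) using Obj a by (simp add: tmor_ident cmp_ident_left[of ?V ?VXY])
  finally have sum: "(\<Sum>z\<in>?QP. (case z of (q, r) \<Rightarrow> vprod Vh X Y (b q) (c r)) \<cdot> (case z of (q, r) \<Rightarrow> cprod Vh X Y (b' q) (c' r)))
    = ident C ?V" .
  have fin: "finite ?QP" using x(2) y(2) by (intro finite_subset[of ?QP "Q \<times> P"]) auto
  show ?thesis
    unfolding resolution_def
    using fin sum Obj vb orth y(5) by (intro conjI ballI) (auto split: prod.splits)
qed

end

lemma runit_Vh: "runit C Vh \<in> coomega (unit_obj C)" "runit_inv C Vh \<in> omega (unit_obj C)"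
  "runit C Vh \<cdot> runit_inv C Vh = ident C Vh" "runit_inv C Vh \<cdot> runit C Vh = ident C (Vh \<boxtimes> unit_obj C)"
  using runit_iso[of Vh] inv_mor[of "Vh \<boxtimes> unit_obj C" Vh "runit C Vh"] by (simp_all add: iso_mor_def runit_inv_def)

lemma unit_vec_Hom [simp]: "j \<in> I \<Longrightarrow> unit_vec C Vh lam j \<in> omega (unit_obj C)"
  and unit_covec_Hom [simp]: "j \<in> I \<Longrightarrow> unit_covec C Vh lam j \<in> coomega (unit_obj C)"
  using cmp_Hom[of Vh Vh "Vh \<boxtimes> unit_obj C" "lam j" "runit_inv C Vh"]
    cmp_Hom[of "Vh \<boxtimes> unit_obj C" Vh Vh "runit C Vh" "lam j"] runit_Vh
  by (simp_all add: unit_vec_def unit_covec_def)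

text \<open>The unitor identifies \<open>Vh \<otimes> 1\<close> with \<open>Vh\<close> itself, the
  direct sum of the \<open>V j\<close>. Source and target of the summand \<open>j\<close> are both
  \<open>j\<close>, as for a path of length zero.\<close>

lemma
  shows resolution_unit: "resolution (unit_obj C) I (unit_vec C Vh lam) (unit_covec C Vh lam) (\<lambda>j. j)"
    and graded_unit: "graded (unit_obj C) I (unit_vec C Vh lam) (unit_covec C Vh lam) (\<lambda>j. j)"
proof -
  let ?U = "unit_obj C" and ?b = "unit_vec C Vh lam" and ?b' = "unit_covec C Vh lam"
  let ?l = "\<lambda>j. Arrow Vh Vh (lam j)"
  have arrs: "arr (?l j)" if "j \<in> I" for j using that by simp
  have ll: "?l i \<bullet> ?l j = (if i = j then ?l j else Arrow Vh Vh 0)" if "i \<in> I" "j \<in> I" for i j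
    using lam_lam[OF that] by (auto simp: arrow_defs)
  have z: "arunit' Vh \<bullet> Arrow Vh Vh 0 = Arrow Vh (Vh \<boxtimes> ?U) 0" "Arrow Vh Vh 0 \<bullet> arunit Vh = Arrow (Vh \<boxtimes> ?U) Vh 0"
    using cmp_zero_right[of Vh Vh "Vh \<boxtimes> ?U"] cmp_zero_left[of "Vh \<boxtimes> ?U" Vh Vh] runit_Vh by (simp_all add: arrow_defs)
  have U: "?U \<in> Obj C" by simp
  have 1: "?b j \<cdot> lam j = ?b j" "lam j \<cdot> ?b' j = ?b' j" if j: "j \<in> I" for j
  proof -
    have "(arunit' Vh \<bullet> ?l j) \<bullet> ?l j = arunit' Vh \<bullet> ?l j" "?l j \<bullet> (?l j \<bullet> arunit Vh) = ?l j \<bullet> arunit Vh"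
      using arrs[OF j] ll[OF j j] acmp_assoc[of "arunit Vh" "?l j" "?l j"] by simp_all
    then show "?b j \<cdot> lam j = ?b j" "lam j \<cdot> ?b' j = ?b' j"
      by (simp_all only: unit_vec_def unit_covec_def arrow_defs arrow.sel arrow.inject simp_thms)
  qed
  have 2: "?b' i \<cdot> ?b j = (if i = j then lam i else 0)" if ij: "i \<in> I" "j \<in> I" for i j
  proof -
    have "(?l i \<bullet> arunit Vh) \<bullet> (arunit' Vh \<bullet> ?l j) = ?l i \<bullet> ?l j" using arrs ij by simp
    then have "?b' i \<cdot> ?b j = lam i \<cdot> lam j"
      by (simp only: unit_vec_def unit_covec_def arrow_defs arrow.sel arrow.inject simp_thms)
    then show ?thesis using lam_lam[OF ij] by simp
  qed
  have 3: "(lam i \<star> ident C ?U) \<cdot> ?b j = (if i = j then ?b j else 0)"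
    "?b' j \<cdot> (lam i \<star> ident C ?U) = (if i = j then ?b' j else 0)" if ij: "i \<in> I" "j \<in> I" for i j
  proof -
    have "(?l i \<circledast> aid ?U) \<bullet> (arunit' Vh \<bullet> ?l j)
      = arunit' Vh \<bullet> (arunit Vh \<bullet> ((?l i \<circledast> aid ?U) \<bullet> (arunit' Vh \<bullet> ?l j)))"
      using arrs ij acmp_assoc[of "(?l i \<circledast> aid ?U) \<bullet> (arunit' Vh \<bullet> ?l j)" "arunit Vh" "arunit' Vh"] by simp
    also have "\<dots> = arunit' Vh \<bullet> (?l i \<bullet> ?l j)"
      using arrs ij by (simp add: arunit_natural_cmp)
    also have "\<dots> = (if i = j then arunit' Vh \<bullet> ?l j else Arrow Vh (Vh \<boxtimes> ?U) 0)"
      using ll[OF ij] z by simp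
    finally have "amor ((?l i \<circledast> aid ?U) \<bullet> (arunit' Vh \<bullet> ?l j)) = amor (if i = j then arunit' Vh \<bullet> ?l j else Arrow Vh (Vh \<boxtimes> ?U) 0)"
      by simp
    then show "(lam i \<star> ident C ?U) \<cdot> ?b j = (if i = j then ?b j else 0)"
      by (cases "i = j") (simp_all add: unit_vec_def arrow_defs)
    have "(?l j \<bullet> arunit Vh) \<bullet> (?l i \<circledast> aid ?U) = (?l j \<bullet> ?l i) \<bullet> arunit Vh"
      using arrs ij arunit_natural[of "?l i" Vh Vh] by simp
    also have "\<dots> = (if i = j then ?l j \<bullet> arunit Vh else Arrow (Vh \<boxtimes> ?U) Vh 0)"
      using ll[of j i] ij z by simp
    finally have "amor ((?l j \<bullet> arunit Vh) \<bullet> (?l i \<circledast> aid ?U)) = amor (if i = j then ?l j \<bullet> arunit Vh else Arrow (Vh \<boxtimes> ?U) Vh 0)"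
      by simp
    then show "?b' j \<cdot> (lam i \<star> ident C ?U) = (if i = j then ?b' j else 0)"
      by (cases "i = j") (simp_all add: unit_covec_def arrow_defs)
  qed
  have VU: "Vh \<boxtimes> ?U \<in> Obj C" by simp
  have "(\<Sum>j\<in>I. ?b j \<cdot> ?b' j) = (\<Sum>j\<in>I. runit_inv C Vh \<cdot> (lam j \<cdot> runit C Vh))"
  proof (rule sum.cong[OF refl])
    fix j assume j: "j \<in> I"
    have "(arunit' Vh \<bullet> ?l j) \<bullet> (?l j \<bullet> arunit Vh) = arunit' Vh \<bullet> ((?l j \<bullet> ?l j) \<bullet> arunit Vh)"
      using arrs[OF j] by simp
    then have "(arunit' Vh \<bullet> ?l j) \<bullet> (?l j \<bullet> arunit Vh) = arunit' Vh \<bullet> (?l j \<bullet> arunit Vh)"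
      using ll[OF j j] by simp
    then show "?b j \<cdot> ?b' j = runit_inv C Vh \<cdot> (lam j \<cdot> runit C Vh)"
      by (simp only: unit_vec_def unit_covec_def arrow_defs arrow.sel arrow.inject simp_thms)
  qed
  also have "\<dots> = runit_inv C Vh \<cdot> (\<Sum>j\<in>I. lam j \<cdot> runit C Vh)"
    using cmp_sum_right[of "Vh \<boxtimes> ?U" Vh "Vh \<boxtimes> ?U" "runit_inv C Vh" I "\<lambda>j. lam j \<cdot> runit C Vh"]
      unit_covec_Hom runit_Vh by (simp add: unit_covec_def)
  also have "(\<Sum>j\<in>I. lam j \<cdot> runit C Vh) = runit C Vh"
    using cmp_sum_left[of "Vh \<boxtimes> ?U" Vh Vh "runit C Vh" I lam] cmp_ident_left[of "Vh \<boxtimes> ?U" Vh] runit_Vh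
    by (simp add: sum_lam)
  finally have "(\<Sum>j\<in>I. ?b j \<cdot> ?b' j) = ident C (Vh \<boxtimes> ?U)" using runit_Vh(4) by simp
  then show "resolution ?U I ?b ?b' (\<lambda>j. j)"
    unfolding resolution_def using 1 2 by simp
  show "graded ?U I ?b ?b' (\<lambda>j. j)"
    unfolding graded_def using 3 by simp
qed

end

section \<open>The dimension graph\<close>

locale fusion_graph = long_functor C I V Vh inc prj
  for C :: "('k::field, 'o, 'm::ab_group_add, 'z) mon_cat_scheme" (structure)
    and I :: "'i set" and V :: "'i \<Rightarrow> 'o" and Vh :: 'o and inc prj :: "'i \<Rightarrow> 'm" +
  fixes M :: 'o and G :: "('i, 'e) pre_digraph" and e :: "'e \<Rightarrow> 'm"
  assumes generates: "generates_fusion C I V M"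
    and dim_graph: "dimension_graph C I V M G e"
begin

lemma fin_digraph_G: "fin_digraph G"
  and verts_G [simp]: "verts G = I"
  using dim_graph by (auto simp: dimension_graph_def)

sublocale fin_digraph G by (rule fin_digraph_G)

sublocale graph_algebra G "TYPE('k)" ..

lemma M_Obj [simp]: "M \<in> Obj C"
  using generates by (simp add: generates_fusion_def)

abbreviation E :: "'i \<Rightarrow> 'i \<Rightarrow> 'e set" where
  "E j l \<equiv> {p \<in> arcs G. tail G p = j \<and> head G p = l}"

abbreviation eM :: "'e \<Rightarrow> 'm" where
  "eM \<equiv> edge_vec C inc prj M G e"

abbreviation eM' :: "'e \<Rightarrow> 'm" where
  "eM' \<equiv> dual_basis C I Vh lam M (arcs G) eM"

lemma E_basis:
  assumes "j \<in> I" "l \<in> I"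
  shows "inj_on e (E j l)" "independent (e ` E j l)" "span (e ` E j l) = Hom C (V j) (V l \<boxtimes> M)"
  using dim_graph assms by (auto simp: dimension_graph_def Let_def)

lemma tail_head_I [simp]: "p \<in> arcs G \<Longrightarrow> tail G p \<in> I" "p \<in> arcs G \<Longrightarrow> head G p \<in> I"
  using tail_in_verts head_in_verts by simp_all

lemma e_Hom [simp]: "p \<in> arcs G \<Longrightarrow> e p \<in> Hom C (V (tail G p)) (V (head G p) \<boxtimes> M)"
  using E_basis(3)[of "tail G p" "head G p"] span_base[of "e p" "e ` E (tail G p) (head G p)"] by auto

lemma tmor_zero_left:
  assumes "X \<in> Obj C" "X' \<in> Obj C" "Y \<in> Obj C" "Y' \<in> Obj C" "h \<in> Hom C Y Y'"
  shows "0 \<star> h = 0"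
  using tmor_scl_left[OF assms(1-4) zero_in_Hom[OF assms(1,2)] assms(5), of 0] by simp

definition component :: "'i \<Rightarrow> 'i \<Rightarrow> 'm \<Rightarrow> 'm" where
  "component j l v = (prj l \<star> ident C M) \<cdot> (v \<cdot> inc j)"

text \<open>The edges are bases block by block, of the spaces
  \<open>Hom C (V j) (V l \<boxtimes> M)\<close>. A vector of \<open>\<omega> M\<close> is therefore
  cut down to the block of \<open>p\<close> before its coefficient is read.\<close>

definition coord :: "'e \<Rightarrow> 'm \<Rightarrow> 'k" where
  "coord p v = representation (e ` E (tail G p) (head G p)) (component (tail G p) (head G p) v) (e p)"

lemma linear_map_component:
  assumes "j \<in> I" "l \<in> I"
  shows "linear_map (W M) (hom_space C (V j) (V l \<boxtimes> M)) (component j l)"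
proof -
  have p: "prj l \<star> ident C M \<in> Hom C (Vh \<boxtimes> M) (V l \<boxtimes> M)"
    using assms by (simp add: tmor_Hom prj_Hom ident_Hom)
  have 1: "linear_map (W M) (hom_space C (V j) (Vh \<boxtimes> M)) (\<lambda>v. v \<cdot> inc j)"
    by (rule linear_map_cmp_left) (use assms inc_Hom in simp_all)
  have 2: "linear_map (hom_space C (V j) (Vh \<boxtimes> M)) (hom_space C (V j) (V l \<boxtimes> M)) (\<lambda>v. (prj l \<star> ident C M) \<cdot> v)"
    by (rule linear_map_cmp_right) (use assms p in simp_all)
  show ?thesis
    unfolding component_def by (rule linear_map_comp[OF 2 1])
qed

lemma component_Hom: "\<lbrakk>j \<in> I; l \<in> I; v \<in> omega M\<rbrakk> \<Longrightarrow> component j l v \<in> Hom C (V j) (V l \<boxtimes> M)"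
  using linear_map_closed[OF linear_map_component] by simp

lemma linear_map_coord:
  assumes "p \<in> arcs G"
  shows "linear_map (W M) kfield (coord p)"
proof -
  let ?B = "e ` E (tail G p) (head G p)"
  note B = E_basis[OF tail_head_I[OF assms]]
  have "linear_map (hom_space C (V (tail G p)) (V (head G p) \<boxtimes> M)) kfield (\<lambda>m. representation ?B m (e p))"
    by (rule linear_mapI) (use B in \<open>simp_all add: representation_add representation_scale\<close>)
  from linear_map_comp[OF this linear_map_component[OF tail_head_I[OF assms]]]
  show ?thesis unfolding coord_def .
qed

lemma component_expand:
  assumes "j \<in> I" "l \<in> I" "v \<in> omega M"
  shows "component j l v = (\<Sum>p\<in>E j l. scl C (coord p v) (e p))"
proof -
  note B = E_basis[OF assms(1,2)]
  have "component j l v = (\<Sum>b\<in>e ` E j l. scl C (representation (e ` E j l) (component j l v) b) b)"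
    using sum_representation_eq[OF B(2), of "component j l v" "e ` E j l"] component_Hom[OF assms] B(3) by simp
  also have "\<dots> = (\<Sum>p\<in>E j l. scl C (representation (e ` E j l) (component j l v) (e p)) (e p))"
    by (rule sum.reindex_cong[OF B(1) refl refl])
  also have "\<dots> = (\<Sum>p\<in>E j l. scl C (coord p v) (e p))"
    by (rule sum.cong) (auto simp: coord_def)
  finally show ?thesis .
qed

lemma linear_map_embed:
  assumes "j \<in> I" "l \<in> I"
  shows "linear_map (hom_space C (V j) (V l \<boxtimes> M)) (W M) (\<lambda>m. (inc l \<star> ident C M) \<cdot> m \<cdot> prj j)"
proof -
  have i: "inc l \<star> ident C M \<in> Hom C (V l \<boxtimes> M) (Vh \<boxtimes> M)"
    using assms by (simp add: tmor_Hom inc_Hom ident_Hom)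
  have 1: "linear_map (hom_space C (V j) (V l \<boxtimes> M)) (hom_space C Vh (V l \<boxtimes> M)) (\<lambda>m. m \<cdot> prj j)"
    by (rule linear_map_cmp_left) (use assms prj_Hom in simp_all)
  have 2: "linear_map (hom_space C Vh (V l \<boxtimes> M)) (W M) (\<lambda>m. (inc l \<star> ident C M) \<cdot> m)"
    by (rule linear_map_cmp_right) (use assms i in simp_all)
  show ?thesis by (rule linear_map_comp[OF 2 1])
qed

lemma eM_Hom [simp]: "p \<in> arcs G \<Longrightarrow> eM p \<in> omega M"
  using linear_map_closed[OF linear_map_embed[of "tail G p" "head G p"], of "e p"] by (simp add: edge_vec_def)

lemma lam_embed:
  assumes "j \<in> I" "l \<in> I" "v \<in> omega M"
  shows "(lam l \<star> ident C M) \<cdot> v \<cdot> lam j = (inc l \<star> ident C M) \<cdot> component j l v \<cdot> prj j"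
proof -
  let ?i = "\<lambda>j. Arrow (V j) Vh (inc j)" and ?p = "\<lambda>j. Arrow Vh (V j) (prj j)" and ?v = "Arrow Vh (Vh \<boxtimes> M) v"
  have a: "arr (?i j)" "arr (?p j)" "arr (?i l)" "arr (?p l)" "arr ?v"
    using assms inc_Hom prj_Hom by simp_all
  have "((?i l \<bullet> ?p l) \<circledast> aid M) \<bullet> ?v \<bullet> (?i j \<bullet> ?p j)
    = (?i l \<circledast> aid M) \<bullet> ((?p l \<circledast> aid M) \<bullet> (?v \<bullet> ?i j)) \<bullet> ?p j"
    using a by (simp add: whisker)
  then show ?thesis
    by (simp only: component_def arrow_defs arrow.sel arrow.inject simp_thms)
qed

text \<open>Idempotents on both sides cut \<open>v\<close> into blocks, each block is expanded in
  its own edges, and every edge belongs to exactly one block, that of its tail and head.\<close>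

lemma omega_M_expand:
  assumes v: "v \<in> omega M"
  shows "v = (\<Sum>p\<in>arcs G. scl C (coord p v) (eM p))"
proof -
  have VM: "Vh \<boxtimes> M \<in> Obj C" by simp
  have tl: "lam l \<star> ident C M \<in> Hom C (Vh \<boxtimes> M) (Vh \<boxtimes> M)" if "l \<in> I" for l
    using that by (simp add: tmor_Hom ident_Hom)
  have vl: "v \<cdot> lam j \<in> omega M" if "j \<in> I" for j
    using that v cmp_Hom[of Vh Vh "Vh \<boxtimes> M" "lam j" v] by simp
  have sum1: "(\<Sum>l\<in>I. lam l \<star> ident C M) = ident C (Vh \<boxtimes> M)"
    using linear_map_hom_hom_sum[OF _ _ _ _ linear_map_tmor(1)[of Vh Vh M M "ident C M"], of I lam]
    by (simp add: ident_Hom sum_lam tmor_ident)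
  have "v = (\<Sum>l\<in>I. (lam l \<star> ident C M) \<cdot> v)"
    using cmp_sum_left[of Vh "Vh \<boxtimes> M" "Vh \<boxtimes> M" v I "\<lambda>l. lam l \<star> ident C M"] tl v
      cmp_ident_left[of Vh "Vh \<boxtimes> M" v] by (simp add: sum1)
  also have "\<dots> = (\<Sum>l\<in>I. \<Sum>j\<in>I. (lam l \<star> ident C M) \<cdot> v \<cdot> lam j)"
  proof (rule sum.cong[OF refl])
    fix l assume l: "l \<in> I"
    have "v = (\<Sum>j\<in>I. v \<cdot> lam j)"
      using cmp_sum_right[of Vh Vh "Vh \<boxtimes> M" v I lam] v cmp_ident_right[of Vh "Vh \<boxtimes> M" v] by (simp add: sum_lam)
    then have "(lam l \<star> ident C M) \<cdot> v = (lam l \<star> ident C M) \<cdot> (\<Sum>j\<in>I. v \<cdot> lam j)" by simp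
    also have "\<dots> = (\<Sum>j\<in>I. (lam l \<star> ident C M) \<cdot> v \<cdot> lam j)"
      by (rule cmp_sum_right[OF Vh_Obj VM VM tl[OF l] vl])
    finally show "(lam l \<star> ident C M) \<cdot> v = (\<Sum>j\<in>I. (lam l \<star> ident C M) \<cdot> v \<cdot> lam j)" .
  qed
  also have "\<dots> = (\<Sum>l\<in>I. \<Sum>j\<in>I. \<Sum>p\<in>E j l. scl C (coord p v) (eM p))"
  proof (intro sum.cong refl)
    fix l j assume lj: "l \<in> I" "j \<in> I"
    note L = linear_map_embed[OF lj(2,1)]
    have "(lam l \<star> ident C M) \<cdot> v \<cdot> lam j = (inc l \<star> ident C M) \<cdot> (\<Sum>p\<in>E j l. scl C (coord p v) (e p)) \<cdot> prj j"
      using lj v by (simp add: lam_embed component_expand)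
    also have "\<dots> = (\<Sum>p\<in>E j l. (inc l \<star> ident C M) \<cdot> scl C (coord p v) (e p) \<cdot> prj j)"
    proof (rule linear_map_hom_hom_sum[OF _ _ _ _ L])
      show "scl C (coord p v) (e p) \<in> Hom C (V j) (V l \<boxtimes> M)" if "p \<in> E j l" for p
        using that e_Hom[of p] lj scl_in_Hom[of "V j" "V l \<boxtimes> M"] by auto
    qed (use lj in simp_all)
    also have "\<dots> = (\<Sum>p\<in>E j l. scl C (coord p v) (eM p))"
      using e_Hom linear_map_smult[OF L] by (intro sum.cong refl) (auto simp: edge_vec_def)
    finally show "(lam l \<star> ident C M) \<cdot> v \<cdot> lam j = (\<Sum>p\<in>E j l. scl C (coord p v) (eM p))" .
  qed
  also have "\<dots> = (\<Sum>x\<in>I \<times> I. \<Sum>p\<in>E (snd x) (fst x). scl C (coord p v) (eM p))"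
    by (simp add: sum.cartesian_product case_prod_beta)
  also have "\<dots> = (\<Sum>x\<in>I \<times> I. \<Sum>p\<in>{p \<in> arcs G. (head G p, tail G p) = x}. scl C (coord p v) (eM p))"
    by (intro sum.cong) auto
  also have "\<dots> = (\<Sum>p\<in>arcs G. scl C (coord p v) (eM p))"
    by (rule sum.group) auto
  finally show ?thesis .
qed

lemma component_eM:
  assumes "j \<in> I" "l \<in> I" "p \<in> arcs G"
  shows "component j l (eM p) = (if j = tail G p \<and> l = head G p then e p else 0)"
proof -
  let ?i = "\<lambda>j. Arrow (V j) Vh (inc j)" and ?p = "\<lambda>j. Arrow Vh (V j) (prj j)"
    and ?e = "Arrow (V (tail G p)) (V (head G p) \<boxtimes> M) (e p)"
  have a: "arr (?i j)" "arr (?p l)" "arr (?i (head G p))" "arr (?p (tail G p))" "arr ?e"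
    using assms inc_Hom prj_Hom by simp_all
  have "(?p l \<circledast> aid M) \<bullet> (((?i (head G p) \<circledast> aid M) \<bullet> ?e \<bullet> ?p (tail G p)) \<bullet> ?i j)
    = ((?p l \<bullet> ?i (head G p)) \<circledast> aid M) \<bullet> (?e \<bullet> (?p (tail G p) \<bullet> ?i j))"
    using a by (simp add: whisker)
  then have "component j l (eM p) = ((prj l \<cdot> inc (head G p)) \<star> ident C M) \<cdot> (e p \<cdot> (prj (tail G p) \<cdot> inc j))"
    by (simp only: component_def edge_vec_def arrow_defs arrow.sel arrow.inject simp_thms)
  also have "\<dots> = (if j = tail G p \<and> l = head G p then e p else 0)"
  proof -
    let ?t = "tail G p" and ?h = "head G p"
    have 1: "e p \<cdot> (prj ?t \<cdot> inc j) = (if j = ?t then e p else 0)"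
      using assms cmp_ident_right[of "V ?t" "V ?h \<boxtimes> M" "e p"] cmp_zero_right[of "V j" "V ?t" "V ?h \<boxtimes> M" "e p"]
      by (simp add: prj_inc)
    have 2: "(prj l \<cdot> inc ?h) \<star> ident C M = (if l = ?h then ident C (V ?h \<boxtimes> M) else 0)"
      using assms tmor_zero_left[of "V ?h" "V l" M M] by (auto simp: prj_inc tmor_ident ident_Hom)
    show ?thesis
      unfolding 1 2 using assms cmp_ident_left[of "V ?t" "V ?h \<boxtimes> M" "e p"]
        cmp_zero_left[of "V ?t" "V ?h \<boxtimes> M" "V l \<boxtimes> M" "e p"] cmp_zero_left[of "V j" "V ?h \<boxtimes> M" "V l \<boxtimes> M" 0]
        cmp_zero_right[of "V j" "V ?h \<boxtimes> M" "V ?h \<boxtimes> M" "ident C (V ?h \<boxtimes> M)"] by (auto simp: ident_Hom)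
  qed
  finally show ?thesis .
qed

lemma coord_eM:
  assumes "p \<in> arcs G" "q \<in> arcs G"
  shows "coord p (eM q) = (if q = p then 1 else 0)"
proof (cases "tail G p = tail G q \<and> head G p = head G q")
  case True
  let ?E = "E (tail G p) (head G p)"
  note B = E_basis[OF tail_head_I[OF assms(1)]]
  have "p \<in> ?E" "q \<in> ?E" using assms True by auto
  then have "e p = e q \<longleftrightarrow> p = q" "e q \<in> e ` ?E" using B(1) by (auto simp: inj_on_eq_iff)
  then show ?thesis
    using assms True representation_basis[OF B(2), of "e q"] by (auto simp: coord_def component_eM)
next
  case False
  then have "component (tail G p) (head G p) (eM q) = 0" using assms by (auto simp: component_eM)
  then show ?thesis using False by (auto simp: coord_def representation_zero)
qed

text \<open>The functionals \<open>coord p\<close> play the part of \<open>\<kappa>\<close> in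
  \<open>dual_basis_system\<close>, which ties the dual basis in the theorem to the blockwise
  coordinates.\<close>

lemma eM_dual_system: "dual_system M (arcs G) eM eM'"
  and pairing_eM: "\<lbrakk>p \<in> arcs G; v \<in> omega M\<rbrakk> \<Longrightarrow> g (eM' p) v = coord p v"
  by (rule dual_basis_system[OF M_Obj finite_arcs eM_Hom linear_map_coord omega_M_expand coord_eM]; assumption)+

lemma eM_lam:
  assumes "p \<in> arcs G"
  shows "eM p \<cdot> lam (tail G p) = eM p"
    and "j \<in> I \<Longrightarrow> (lam j \<star> ident C M) \<cdot> eM p = (if j = head G p then eM p else 0)"
proof -
  let ?t = "tail G p" and ?h = "head G p"
  let ?i = "\<lambda>j. Arrow (V j) Vh (inc j)" and ?p = "\<lambda>j. Arrow Vh (V j) (prj j)"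
    and ?e = "Arrow (V ?t) (V ?h \<boxtimes> M) (e p)"
  have a: "arr (?i j)" "arr (?p j)" if "j \<in> I" for j
    using that inc_Hom prj_Hom by simp_all
  have th: "?t \<in> I" "?h \<in> I" and ae: "arr ?e" using assms by simp_all
  have "?p ?t \<bullet> ?i ?t = aid (V ?t)" using th prj_inc by (simp add: arrow_defs)
  moreover have "((?i ?h \<circledast> aid M) \<bullet> ?e \<bullet> ?p ?t) \<bullet> (?i ?t \<bullet> ?p ?t)
    = (?i ?h \<circledast> aid M) \<bullet> ?e \<bullet> (?p ?t \<bullet> ?i ?t) \<bullet> ?p ?t" using a th ae by simp
  ultimately have "((?i ?h \<circledast> aid M) \<bullet> ?e \<bullet> ?p ?t) \<bullet> (?i ?t \<bullet> ?p ?t) = (?i ?h \<circledast> aid M) \<bullet> ?e \<bullet> ?p ?t"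
    using a th ae by simp
  then show "eM p \<cdot> lam ?t = eM p"
    by (simp only: edge_vec_def arrow_defs arrow.sel arrow.inject simp_thms)
  assume j: "j \<in> I"
  have "((?i j \<bullet> ?p j) \<circledast> aid M) \<bullet> ((?i ?h \<circledast> aid M) \<bullet> ?e \<bullet> ?p ?t)
    = (((?i j \<bullet> ?p j) \<bullet> ?i ?h) \<circledast> aid M) \<bullet> (?e \<bullet> ?p ?t)"
    using a[OF j] a[OF th(1)] a[OF th(2)] ae by (simp add: whisker)
  then have "(lam j \<star> ident C M) \<cdot> eM p = ((lam j \<cdot> inc ?h) \<star> ident C M) \<cdot> (e p \<cdot> prj ?t)"
    by (simp only: edge_vec_def arrow_defs arrow.sel arrow.inject simp_thms)
  also have "\<dots> = (if j = ?h then eM p else 0)"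
  proof (cases "j = ?h")
    case True
    then show ?thesis using th by (simp add: lam_inc edge_vec_def)
  next
    case False
    have "e p \<cdot> prj ?t \<in> Hom C Vh (V ?h \<boxtimes> M)"
      using cmp_Hom[of Vh "V ?t" "V ?h \<boxtimes> M" "prj ?t" "e p"] th assms prj_Hom by simp
    then show ?thesis
      using False th j tmor_zero_left[of "V ?h" Vh M M] cmp_zero_left[of Vh "V ?h \<boxtimes> M" "Vh \<boxtimes> M"]
      by (simp add: lam_inc ident_Hom)
  qed
  finally show "(lam j \<star> ident C M) \<cdot> eM p = (if j = ?h then eM p else 0)" .
qed

text \<open>An edge is a morphism from \<open>V (tail G p)\<close> to
  \<open>V (head G p) \<boxtimes> M\<close>, so it starts at its tail and is graded by its head.
  Composability of indices thus becomes composability of edges.\<close>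

lemma resolution_edge: "resolution M (arcs G) eM eM' (tail G)"
  and graded_edge: "graded M (arcs G) eM eM' (head G)"
proof -
  have delta: "g (eM' q) (eM r) = (if r = q then 1 else 0)" if "q \<in> arcs G" "r \<in> arcs G" for q r
    using that by (simp add: pairing_eM coord_eM)
  show "resolution M (arcs G) eM eM' (tail G)"
    by (rule dual_system_resolution[OF eM_dual_system delta]) (simp_all add: eM_lam)
  show "graded M (arcs G) eM eM' (head G)"
    by (rule dual_system_graded[where s = "tail G", OF eM_dual_system delta]) (simp_all add: eM_lam)
qed

section \<open>Paths in the dimension graph\<close>

text \<open>The recursion ends in the unit object, so length one gives
  \<open>M \<boxtimes> unit_obj C\<close> and not \<open>M\<close>. In return the resolution of the
  unit object starts the induction; \<open>\<pi>_edge\<close> repairs the difference.\<close>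

primrec path_obj :: "nat \<Rightarrow> 'o" where
  "path_obj 0 = unit_obj C"
| "path_obj (Suc n) = M \<boxtimes> path_obj n"

text \<open>The index \<open>j\<close> is the source vertex of the whole path, at the end of the
  list. It is passed down unchanged because only the innermost factor, over the unit object, uses
  it.\<close>

primrec edges_vec :: "'i \<Rightarrow> 'e list \<Rightarrow> 'm" where
  "edges_vec j [] = unit_vec C Vh lam j"
| "edges_vec j (a # es) = vprod Vh M (path_obj (length es)) (eM a) (edges_vec j es)"

primrec edges_covec :: "'i \<Rightarrow> 'e list \<Rightarrow> 'm" where
  "edges_covec j [] = unit_covec C Vh lam j"
| "edges_covec j (a # es) = cprod Vh M (path_obj (length es)) (eM' a) (edges_covec j es)"

primrec path_vec :: "('i, 'e) gpath \<Rightarrow> 'm" where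
  "path_vec (Vertex j) = edges_vec j []"
| "path_vec (Edges es) = edges_vec (tail G (last es)) es"

primrec path_covec :: "('i, 'e) gpath \<Rightarrow> 'm" where
  "path_covec (Vertex j) = edges_covec j []"
| "path_covec (Edges es) = edges_covec (tail G (last es)) es"

lemma path_obj_Obj [simp]: "path_obj n \<in> Obj C"
  by (induction n) simp_all

lemma path_vec_step:
  assumes "r \<in> P n" "tail G a = ptgt G r"
  shows "path_vec (pcat (Edges [a]) r) = vprod Vh M (path_obj n) (eM a) (path_vec r)"
    and "path_covec (pcat (Edges [a]) r) = cprod Vh M (path_obj n) (eM' a) (path_covec r)"
  using assms by (cases r; auto)+

lemma edge_path [simp]: "Edges [a] \<in> P n \<longleftrightarrow> n = 1 \<and> a \<in> arcs G"
  by auto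

lemma path_step_cases:
  assumes "p \<in> P (Suc n)"
  obtains a r where "a \<in> arcs G" "r \<in> P n" "tail G a = ptgt G r" "p = pcat (Edges [a]) r"
proof -
  from assms have "p \<in> P (1 + n)" by simp
  then obtain p1 r where p1: "p1 \<in> P 1" "r \<in> P n" "psrc G p1 = ptgt G r" "p = pcat p1 r"
    by (rule pcat_cases)
  from p1(1) obtain es where "p1 = Edges es" "length es = 1" "set es \<subseteq> arcs G" by (cases p1) auto
  then obtain a where "p1 = Edges [a]" "a \<in> arcs G" by (cases es) auto
  then show ?thesis using that p1 by auto
qed

text \<open>Each step multiplies the resolution of \<open>M\<close> by edges with that of the
  shorter paths. Unique factorisation lets the composable pairs of an edge and a path be renamed as
  paths of length \<open>Suc n\<close>.\<close>

lemma
  shows resolution_paths: "resolution (path_obj n) (P n) path_vec path_covec (psrc G)"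
    and graded_paths: "graded (path_obj n) (P n) path_vec path_covec (ptgt G)"
proof (induction n)
  case 0
  have inj: "inj_on Vertex I" by (simp add: inj_on_def)
  case 1
  show ?case
    using resolution_reindex[OF resolution_unit inj, of path_vec path_covec "psrc G"] by (simp add: paths_0)
  case 2
  show ?case
    using graded_reindex[OF graded_unit, of path_vec Vertex path_covec "ptgt G"] by (simp add: paths_0)
next
  case (Suc n)
  let ?Q = "{(a, r) \<in> arcs G \<times> P n. tail G a = ptgt G r}" and ?h = "\<lambda>(a, r). pcat (Edges [a]) r"
  have inj: "inj_on ?h ?Q"
    using pcat_inject[of "Edges [_]" 1 "Edges [_]"] by (fastforce simp: inj_on_def)
  have img: "?h ` ?Q = P (Suc n)"
  proof
    show "?h ` ?Q \<subseteq> P (Suc n)"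
      using pcat_in_paths[of "Edges [_]" 1 _ n] by auto
    show "P (Suc n) \<subseteq> ?h ` ?Q"
      by (auto elim!: path_step_cases)
  qed
  have s: "psrc G (?h x) = psrc G (snd x)" "ptgt G (?h x) = head G (fst x)" if "x \<in> ?Q" for x
    using that psrc_pcat[of "Edges [_]" 1] ptgt_pcat[of "Edges [_]" 1] by auto
  note res = resolution_vprod[OF resolution_edge graded_edge Suc.IH] and gr = graded_vprod[OF resolution_edge graded_edge Suc.IH]
  case 1
  have "resolution (M \<boxtimes> path_obj n) (?h ` ?Q) path_vec path_covec (psrc G)"
    by (rule resolution_reindex[OF res inj]) (use s path_vec_step in auto)
  then show ?case unfolding img by simp
  case 2
  have "graded (M \<boxtimes> path_obj n) (?h ` ?Q) path_vec path_covec (ptgt G)"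
    by (rule graded_reindex[OF gr]) (use s path_vec_step in auto)
  then show ?case unfolding img by simp
qed

lemma path_vec_Hom [simp]: "p \<in> P n \<Longrightarrow> path_vec p \<in> omega (path_obj n)"
  and path_covec_Hom [simp]: "p \<in> P n \<Longrightarrow> path_covec p \<in> coomega (path_obj n)"
  using resolutionD(3,4)[OF resolution_paths] by auto

end

context fusion_graph
begin

section \<open>The surjection\<close>

definition \<pi> :: "(('i, 'e) gpath \<times> ('i, 'e) gpath \<Rightarrow>\<^sub>0 'k) \<Rightarrow> ('o \<times> 'm \<times> 'm \<Rightarrow>\<^sub>0 'k) set" where
  "\<pi> = lin_ext K (\<lambda>(p, q). sym (path_obj (plen p)) (path_covec p) (path_vec q))"

lemma linear_map_\<pi>: "linear_map H K \<pi>"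
proof -
  have "(\<lambda>(p, q). sym (path_obj (plen p)) (path_covec p) (path_vec q)) \<in> pairs \<rightarrow> carrier K"
    by (auto elim!: pairsE)
  from linear_map_lin_ext[OF vect_K this] show ?thesis
    unfolding \<pi>_def using linear_map_same_space[OF same_space_H same_space_refl] by blast
qed

lemma \<pi>_gen: "\<lbrakk>p \<in> P n; q \<in> P n\<rbrakk> \<Longrightarrow> \<pi> (gen (p, q)) = sym (path_obj n) (path_covec p) (path_vec q)"
  unfolding \<pi>_def by (subst lin_ext_gen[OF vect_K]) auto

lemma \<pi>_zero: "\<pi> 0 = \<zero>\<^bsub>K\<^esub>"
  using linear_map_zero[OF vect_H vect_K linear_map_\<pi>] by (simp add: H_simps)

lemma \<pi>_closed: "x \<in> carrier H \<Longrightarrow> \<pi> x \<in> carrier K"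
  by (rule linear_map_closed[OF linear_map_\<pi>])

lemma \<pi>_vertex:
  "\<lbrakk>j \<in> I; l \<in> I\<rbrakk> \<Longrightarrow> \<pi> (gen (Vertex j, Vertex l)) = sym (unit_obj C) (unit_covec C Vh lam j) (unit_vec C Vh lam l)"
  using \<pi>_gen[of "Vertex j" 0 "Vertex l"] by simp

lemma eM'_Hom [simp]: "p \<in> arcs G \<Longrightarrow> eM' p \<in> coomega M"
  using resolutionD(4)[OF resolution_edge] .

lemma \<pi>_step:
  assumes "a \<in> arcs G" "b \<in> arcs G" "p \<in> P n" "q \<in> P n" "tail G a = ptgt G p" "tail G b = ptgt G q"
  shows "\<pi> (gen (pcat (Edges [a]) p, pcat (Edges [b]) q)) = sym M (eM' a) (eM b) \<otimes>\<^bsub>K\<^esub> \<pi> (gen (p, q))"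
proof -
  have "pcat (Edges [a]) p \<in> P (Suc n)" "pcat (Edges [b]) q \<in> P (Suc n)"
    using pcat_in_paths[of "Edges [a]" 1 p n] pcat_in_paths[of "Edges [b]" 1 q n] assms by simp_all
  then show ?thesis
    using assms by (simp add: \<pi>_gen[where n = n] \<pi>_gen[where n = "Suc n"] path_vec_step[where n = n] sym_mult)
qed

text \<open>\<open>\<pi>\<close> gives a symbol over \<open>M \<boxtimes> unit_obj C\<close>, the
  product of the symbol over \<open>M\<close> with the degree-zero symbol of the tails. The latter
  acts by the source idempotents, which the edge vector and covector absorb.\<close>

lemma \<pi>_edge:
  assumes "a \<in> arcs G" "b \<in> arcs G"
  shows "\<pi> (gen (Edges [a], Edges [b])) = sym M (eM' a) (eM b)"
proof -
  have "\<pi> (gen (Edges [a], Edges [b])) = sym M (eM' a) (eM b) \<otimes>\<^bsub>K\<^esub> \<pi> (gen (Vertex (tail G a), Vertex (tail G b)))"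
    using \<pi>_step[OF assms, of "Vertex (tail G a)" 0 "Vertex (tail G b)"] assms by simp
  also have "\<dots> = sym M (lam (tail G a) \<cdot> eM' a) (eM b \<cdot> lam (tail G b))"
    using assms by (simp add: \<pi>_vertex unit_vec_def unit_covec_def sym_unit_mult(2))
  also have "\<dots> = sym M (eM' a) (eM b)"
    using assms resolutionD(6,7)[OF resolution_edge] by simp
  finally show ?thesis .
qed

lemma sym_zero:
  assumes "X \<in> Obj C"
  shows "\<theta> \<in> coomega X \<Longrightarrow> sym X \<theta> 0 = \<zero>\<^bsub>K\<^esub>" "v \<in> omega X \<Longrightarrow> sym X 0 v = \<zero>\<^bsub>K\<^esub>"
  using linear_map_zero[OF vect_W[OF assms] vect_K bilinear_right[OF bilinear_sym_K[OF assms]]]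
    linear_map_zero[OF vect_coW[OF assms] vect_K bilinear_left[OF bilinear_sym_K[OF assms]]] by simp_all

text \<open>Induction on the length of the left factor. In length zero, multiplication by a vertex
  pair projects to a target grade and so yields the two composability conditions; in the step, the
  first edge is split off by \<open>\<pi>_step\<close> and associativity on symbols applies.\<close>

lemma \<pi>_mult_gen:
  assumes "p \<in> P n" "q \<in> P n" "r \<in> P m" "s \<in> P m"
  shows "\<pi> (gen (p, q)) \<otimes>\<^bsub>K\<^esub> \<pi> (gen (r, s)) = \<pi> (gmult (p, q) (r, s))"
  using assms(1,2)
proof (induction n arbitrary: p q)
  case 0
  then obtain j l where p: "p = Vertex j" "q = Vertex l" and jl: "j \<in> I" "l \<in> I" by (auto simp: paths_0)
  have "\<pi> (gen (p, q)) \<otimes>\<^bsub>K\<^esub> \<pi> (gen (r, s)) =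
      sym (path_obj m) (path_covec r \<cdot> (lam j \<star> ident C (path_obj m))) ((lam l \<star> ident C (path_obj m)) \<cdot> path_vec s)"
    using assms(3,4) jl
    by (simp add: p \<pi>_vertex \<pi>_gen[OF assms(3,4)] unit_vec_def unit_covec_def sym_unit_mult(1))
  also have "\<dots> = sym (path_obj m) (if j = ptgt G r then path_covec r else 0) (if l = ptgt G s then path_vec s else 0)"
    using gradedD(3)[OF graded_paths assms(3) jl(1)] gradedD(2)[OF graded_paths assms(4) jl(2)] by simp
  also have "\<dots> = \<pi> (gmult (p, q) (r, s))"
    using assms(3,4) by (auto simp: p gmult_def \<pi>_gen[OF assms(3,4)] sym_zero \<pi>_zero)
  finally show ?case .
next
  case (Suc n)
  from Suc.prems obtain a p' b q' where
    a: "a \<in> arcs G" "p' \<in> P n" "tail G a = ptgt G p'" "p = pcat (Edges [a]) p'" and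
    b: "b \<in> arcs G" "q' \<in> P n" "tail G b = ptgt G q'" "q = pcat (Edges [b]) q'"
    by (metis path_step_cases)
  have src: "psrc G p = psrc G p'" "psrc G q = psrc G q'"
    using psrc_pcat[of "Edges [a]" 1 p' n] psrc_pcat[of "Edges [b]" 1 q' n] a b by simp_all
  have M: "sym M (eM' a) (eM b) \<in> carrier K" using a b by auto
  have "\<pi> (gen (p, q)) \<otimes>\<^bsub>K\<^esub> \<pi> (gen (r, s)) = sym M (eM' a) (eM b) \<otimes>\<^bsub>K\<^esub> \<pi> (gen (p', q')) \<otimes>\<^bsub>K\<^esub> \<pi> (gen (r, s))"
    using \<pi>_step[OF a(1) b(1) a(2) b(2) a(3) b(3)] by (simp add: a b)
  also have "\<dots> = sym M (eM' a) (eM b) \<otimes>\<^bsub>K\<^esub> (\<pi> (gen (p', q')) \<otimes>\<^bsub>K\<^esub> \<pi> (gen (r, s)))"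
    using a b assms(3,4) by (simp add: \<pi>_gen[OF a(2) b(2)] \<pi>_gen[OF assms(3,4)] sym_mult_assoc)
  also have "\<dots> = sym M (eM' a) (eM b) \<otimes>\<^bsub>K\<^esub> \<pi> (gmult (p', q') (r, s))"
    using Suc.IH[OF a(2) b(2)] by simp
  also have "\<dots> = \<pi> (gmult (p, q) (r, s))"
  proof (cases "composable p' r \<and> composable q' s")
    case True
    have c: "pcat p' r \<in> P (n + m)" "pcat q' s \<in> P (n + m)"
      "tail G a = ptgt G (pcat p' r)" "tail G b = ptgt G (pcat q' s)"
      using True a b assms(3,4) by (simp_all add: pcat_in_paths ptgt_pcat[of _ n _ m])
    show ?thesis
      using True src \<pi>_step[OF a(1) b(1) c] by (simp add: gmult_def a(4) b(4) pcat_assoc)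
  next
    case False
    then show ?thesis
      using src linear_map_zero[OF vect_K vect_K bilinear_right[OF bilinear_K_mult M]]
      by (auto simp: gmult_def \<pi>_zero)
  qed
  finally show ?case .
qed

lemma \<pi>_mult:
  assumes "x \<in> carrier H" "y \<in> carrier H"
  shows "\<pi> (x \<otimes>\<^bsub>H\<^esub> y) = \<pi> x \<otimes>\<^bsub>K\<^esub> \<pi> y"
proof -
  note b1 = linear_bilinear_comp[OF linear_map_\<pi> bilinear_H_mult]
    and b2 = bilinear_comp[OF bilinear_K_mult linear_map_\<pi> linear_map_\<pi>]
  have 1: "\<pi> (gen (p, q) \<otimes>\<^bsub>H\<^esub> y) = \<pi> (gen (p, q)) \<otimes>\<^bsub>K\<^esub> \<pi> y" if pq: "p \<in> P n" "q \<in> P n" for p q n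
    by (rule H_linear_eq[OF vect_K bilinear_right[OF b1 gen_in_H[OF pq]] bilinear_right[OF b2 gen_in_H[OF pq]] _ assms(2)])
      (simp add: H_mult_gen[OF pq] \<pi>_mult_gen[OF pq])
  show ?thesis
    by (rule H_linear_eq[OF vect_K bilinear_left[OF b1 assms(2)] bilinear_left[OF b2 assms(2)] 1 assms(1)])
qed

text \<open>Summing over all vertices removes the idempotents: the covectors add up to the right
  unitor of \<open>Vh\<close> and the vectors to its inverse.\<close>

lemma \<pi>_one: "\<pi> \<one>\<^bsub>H\<^esub> = \<one>\<^bsub>K\<^esub>"
proof -
  interpret K: vect K by (rule vect_K)
  let ?U = "unit_obj C" and ?b = "unit_vec C Vh lam" and ?b' = "unit_covec C Vh lam"
  have U: "?U \<in> Obj C" "Vh \<boxtimes> ?U \<in> Obj C" by simp_all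
  note bs = bilinear_sym_K[OF U(1)]
  have r: "(\<Sum>j\<in>I. ?b' j) = runit C Vh"
    using cmp_sum_left[of "Vh \<boxtimes> ?U" Vh Vh "runit C Vh" I lam] cmp_ident_left[of "Vh \<boxtimes> ?U" Vh] runit_Vh
    by (simp add: sum_lam unit_covec_def)
  have l: "(\<Sum>j\<in>I. ?b j) = runit_inv C Vh"
    using cmp_sum_right[of Vh Vh "Vh \<boxtimes> ?U" "runit_inv C Vh" I lam] cmp_ident_right[of Vh "Vh \<boxtimes> ?U"] runit_Vh
    by (simp add: sum_lam unit_vec_def)
  have "\<pi> \<one>\<^bsub>H\<^esub> = (\<Oplus>\<^bsub>K\<^esub>j\<in>P 0. \<Oplus>\<^bsub>K\<^esub>l\<in>P 0. \<pi> (gen (j, l)))"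
    by (rule linear_map_H_one[OF vect_K linear_map_\<pi>])
  also have "\<dots> = (\<Oplus>\<^bsub>K\<^esub>j\<in>I. \<Oplus>\<^bsub>K\<^esub>l\<in>P 0. \<pi> (gen (Vertex j, l)))"
    unfolding paths_0 verts_G
    by (rule K.finsum_reindex) (auto intro!: K.finsum_closed \<pi>_closed simp: inj_on_def)
  also have "\<dots> = (\<Oplus>\<^bsub>K\<^esub>j\<in>I. sym ?U (?b' j) (runit_inv C Vh))"
  proof (rule K.finsum_cong'[OF refl])
    fix j assume j: "j \<in> I"
    have "(\<Oplus>\<^bsub>K\<^esub>l\<in>P 0. \<pi> (gen (Vertex j, l))) = (\<Oplus>\<^bsub>K\<^esub>l\<in>I. \<pi> (gen (Vertex j, Vertex l)))"
      unfolding paths_0 verts_G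
      by (rule K.finsum_reindex) (use j in \<open>auto intro!: \<pi>_closed simp: inj_on_def\<close>)
    also have "\<dots> = (\<Oplus>\<^bsub>K\<^esub>l\<in>I. sym ?U (?b' j) (?b l))"
      using j by (intro K.finsum_cong') (auto simp: \<pi>_vertex intro!: sym_closed_K)
    also have "\<dots> = sym ?U (?b' j) (\<Sum>l\<in>I. ?b l)"
      using j by (intro linear_map_hom_sum_one[OF _ _ vect_K bilinear_right[OF bs], symmetric]) simp_all
    finally show "(\<Oplus>\<^bsub>K\<^esub>l\<in>P 0. \<pi> (gen (Vertex j, l))) = sym ?U (?b' j) (runit_inv C Vh)" by (simp add: l)
  qed (auto intro!: sym_closed_K runit_Vh)
  also have "\<dots> = sym ?U (\<Sum>j\<in>I. ?b' j) (runit_inv C Vh)"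
    using runit_Vh by (intro linear_map_hom_sum_one[OF _ _ vect_K bilinear_left[OF bs], symmetric]) simp_all
  finally show ?thesis by (simp add: r coend_ops)
qed

text \<open>By orthogonality of the path resolution the composite is \<open>lam (psrc G p)\<close>
  if \<open>p = q\<close> and zero otherwise, and \<open>eps_R\<close> takes the value 1 on each
  idempotent.\<close>

lemma \<pi>_counit:
  assumes "x \<in> carrier H"
  shows "counit K (\<pi> x) = counit H x"
proof (rule H_linear_eq[OF vect_kfield linear_map_comp[OF linear_map_K_counit linear_map_\<pi>] H_counit_linear _ assms])
  fix p q n assume pq: "p \<in> P n" "q \<in> P n"
  have "counit K (\<pi> (gen (p, q))) = eps_R C I lam (path_covec p \<cdot> path_vec q)"
    using pq by (simp add: \<pi>_gen[OF pq] counit_sym pairing_def)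
  also have "\<dots> = counit H (gen (p, q))"
    using resolutionD(8)[OF resolution_paths pq] psrc_in_verts[OF pq(1)]
      linear_map_zero[OF vect_hom_space[OF Vh_Obj Vh_Obj] vect_kfield linear_map_eps]
    by (cases "p = q") (simp_all add: H_counit_gen eps_lam)
  finally show "counit K (\<pi> (gen (p, q))) = counit H (gen (p, q))" .
qed

text \<open>Computed with the dual system of paths, the comultiplication of the coend is the matrix
  coproduct indexed by paths.\<close>

lemma \<pi>_comult:
  assumes "x \<in> carrier H"
  shows "comult K (\<pi> x) = tensor_map K K \<pi> \<pi> (comult H x)"
proof -
  let ?T = "tensor_space K K"
  interpret T: vect ?T by (rule vect_tensor_space)
  note L = linear_map_tensor_map[OF vect_H vect_H vect_K vect_K linear_map_\<pi> linear_map_\<pi>]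
  show ?thesis
  proof (rule H_linear_eq[OF vect_tensor_space linear_map_comp[OF linear_map_K_comult linear_map_\<pi>]
        linear_map_comp[OF L H_comult_linear] _ assms])
    fix p q n assume pq: "p \<in> P n" "q \<in> P n"
    have "tensor_map K K \<pi> \<pi> (comult H (gen (p, q)))
      = (\<Oplus>\<^bsub>?T\<^esub>r\<in>P n. tensor_map K K \<pi> \<pi> (tens H H (gen (p, r)) (gen (r, q))))"
      by (rule linear_map_comult_gen[OF vect_tensor_space L pq])
    also have "\<dots> = (\<Oplus>\<^bsub>?T\<^esub>r\<in>P n. tens K K (sym (path_obj n) (path_covec p) (path_vec r)) (sym (path_obj n) (path_covec r) (path_vec q)))"
      using pq by (intro T.finsum_cong' refl)
        (auto simp: tensor_map_tens[OF vect_H vect_H vect_K vect_K linear_map_\<pi> linear_map_\<pi>]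
          gen_in_H[where n = n] \<pi>_gen[where n = n] intro!: tens_closed sym_closed_K)
    also have "\<dots> = comult K (\<pi> (gen (p, q)))"
      using comult_sym[OF resolution_dual_system[OF resolution_paths]] pq by (simp add: \<pi>_gen[OF pq])
    finally show "comult K (\<pi> (gen (p, q))) = tensor_map K K \<pi> \<pi> (comult H (gen (p, q)))" ..
  qed
qed

section \<open>Surjectivity of \<open>\<pi>\<close>\<close>

definition in_image :: "'o \<Rightarrow> bool" where
  "in_image X \<longleftrightarrow> X \<in> Obj C \<and> (\<forall>\<theta>\<in>coomega X. \<forall>v\<in>omega X. sym X \<theta> v \<in> \<pi> ` carrier H)"

lemma image_smult: "y \<in> \<pi> ` carrier H \<Longrightarrow> c \<odot>\<^bsub>K\<^esub> y \<in> \<pi> ` carrier H"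
proof (elim imageE)
  fix x assume x: "y = \<pi> x" "x \<in> carrier H"
  have "c \<odot>\<^bsub>K\<^esub> y = \<pi> (c \<odot>\<^bsub>H\<^esub> x)" using linear_map_smult[OF linear_map_\<pi> x(2)] x(1) by simp
  then show "c \<odot>\<^bsub>K\<^esub> y \<in> \<pi> ` carrier H" using H.smult_closed[OF x(2)] by (rule image_eqI)
qed

lemma image_mult: "\<lbrakk>x \<in> \<pi> ` carrier H; y \<in> \<pi> ` carrier H\<rbrakk> \<Longrightarrow> x \<otimes>\<^bsub>K\<^esub> y \<in> \<pi> ` carrier H"
proof (elim imageE)
  fix a b assume a: "x = \<pi> a" "a \<in> carrier H" and b: "y = \<pi> b" "b \<in> carrier H"
  have "x \<otimes>\<^bsub>K\<^esub> y = \<pi> (a \<otimes>\<^bsub>H\<^esub> b)" using \<pi>_mult[OF a(2) b(2)] a(1) b(1) by simp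
  then show "x \<otimes>\<^bsub>K\<^esub> y \<in> \<pi> ` carrier H"
    using bilinear_closed[OF bilinear_H_mult a(2) b(2)] by (rule image_eqI)
qed

text \<open>Any symbol over \<open>X\<close> is a linear combination of the matrix coefficients of a
  dual system, first in the vector and then in the covector, and the image of \<open>\<pi>\<close>
  is a subspace.\<close>

lemma in_image_dual_system:
  assumes ds: "dual_system X Q b b'" and im: "\<And>q r. \<lbrakk>q \<in> Q; r \<in> Q\<rbrakk> \<Longrightarrow> sym X (b' q) (b r) \<in> \<pi> ` carrier H"
  shows "in_image X"
proof -
  have X: "X \<in> Obj C" "Vh \<boxtimes> X \<in> Obj C" and b: "\<And>q. q \<in> Q \<Longrightarrow> b q \<in> omega X" "\<And>q. q \<in> Q \<Longrightarrow> b' q \<in> coomega X"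
    using ds by (auto simp: dual_system_def)
  note bs = bilinear_sym_K[OF X(1)]
  have 1: "sym X (b' q) v \<in> \<pi> ` carrier H" if q: "q \<in> Q" and v: "v \<in> omega X" for q v
  proof -
    have "sym X (b' q) v = sym X (b' q) (\<Sum>r\<in>Q. scl C (g (b' r) v) (b r))"
      using ds v by (auto simp: dual_system_def)
    also have "\<dots> = (\<Oplus>\<^bsub>K\<^esub>r\<in>Q. g (b' r) v \<odot>\<^bsub>K\<^esub> sym X (b' q) (b r))"
      using X b q by (intro linear_map_hom_sum[OF _ _ vect_K bilinear_right[OF bs]]) auto
    also have "\<dots> \<in> \<pi> ` carrier H"
      by (rule linear_image_finsum[OF vect_H vect_K linear_map_\<pi> image_smult[OF im[OF q]]])
    finally show ?thesis .
  qed
  have "sym X \<theta> v \<in> \<pi> ` carrier H" if \<theta>: "\<theta> \<in> coomega X" and v: "v \<in> omega X" for \<theta> v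
  proof -
    have "sym X \<theta> v = sym X (\<Sum>r\<in>Q. scl C (g \<theta> (b r)) (b' r)) v"
      using ds \<theta> by (auto simp: dual_system_def)
    also have "\<dots> = (\<Oplus>\<^bsub>K\<^esub>r\<in>Q. g \<theta> (b r) \<odot>\<^bsub>K\<^esub> sym X (b' r) v)"
      using X b v by (intro linear_map_hom_sum[OF _ _ vect_K bilinear_left[OF bs]]) auto
    also have "\<dots> \<in> \<pi> ` carrier H"
      by (rule linear_image_finsum[OF vect_H vect_K linear_map_\<pi> image_smult[OF 1[OF _ v]]])
    finally show ?thesis .
  qed
  then show ?thesis using X(1) by (simp add: in_image_def)
qed

lemma in_image_unit: "in_image (unit_obj C)"
proof (rule in_image_dual_system[OF resolution_dual_system[OF resolution_unit]])
  fix j l assume jl: "j \<in> I" "l \<in> I"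
  then have "gen (Vertex j, Vertex l) \<in> carrier H" by (intro gen_in_H[where n = 0]) simp_all
  then show "sym (unit_obj C) (unit_covec C Vh lam j) (unit_vec C Vh lam l) \<in> \<pi> ` carrier H"
    unfolding \<pi>_vertex[OF jl, symmetric] by (rule imageI)
qed

lemma in_image_M: "in_image M"
proof (rule in_image_dual_system[OF eM_dual_system])
  fix a b assume ab: "a \<in> arcs G" "b \<in> arcs G"
  then have "gen (Edges [a], Edges [b]) \<in> carrier H" by (intro gen_in_H[where n = 1]) simp_all
  then show "sym M (eM' a) (eM b) \<in> \<pi> ` carrier H"
    unfolding \<pi>_edge[OF ab, symmetric] by (rule imageI)
qed

text \<open>Each product enlarges the index set to a set of pairs, so its type would change along
  the induction. Injecting the finite index set into \<open>nat\<close> after each step keeps a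
  single type.\<close>

lemma tpow_resolution:
  "\<exists>(Q :: nat set) b b' s t. resolution (tpow C M n) Q b b' s \<and> graded (tpow C M n) Q b b' t"
proof -
  have nat: "\<exists>(Q' :: nat set) c c' s' t'. resolution X Q' c c' s' \<and> graded X Q' c c' t'"
    if res: "resolution X Q b b' s" "graded X Q b b' t" for X and Q :: "'x set" and b b' s t
  proof -
    have "finite Q" using resolutionD(2)[OF res(1)] .
    then obtain h :: "'x \<Rightarrow> nat" where h: "inj_on h Q"
      using ex_bij_betw_finite_nat[of Q] by (auto simp: bij_betw_def)
    let ?i = "inv_into Q h"
    have "resolution X (h ` Q) (\<lambda>n. b (?i n)) (\<lambda>n. b' (?i n)) (\<lambda>n. s (?i n))"
      by (rule resolution_reindex[OF res(1) h]) (simp_all add: inv_into_f_f[OF h])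
    moreover have "graded X (h ` Q) (\<lambda>n. b (?i n)) (\<lambda>n. b' (?i n)) (\<lambda>n. t (?i n))"
      by (rule graded_reindex[OF res(2)]) (simp_all add: inv_into_f_f[OF h])
    ultimately show ?thesis by blast
  qed
  show ?thesis
  proof (induction n)
    case 0
    then show ?case using nat[OF resolution_unit graded_unit] by simp
  next
    case (Suc n)
    then obtain Q :: "nat set" and b b' s t where
      "resolution (tpow C M n) Q b b' s" "graded (tpow C M n) Q b b' t" by blast
    from nat[OF resolution_vprod[OF this resolution_edge graded_edge] graded_vprod[OF this resolution_edge graded_edge]]
    show ?case by simp
  qed
qed

text \<open>The matrix coefficients of a product resolution are products of matrix coefficients over
  \<open>tpow C M n\<close> and over \<open>M\<close>, and the image of \<open>\<pi>\<close> is
  closed under multiplication.\<close>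

lemma in_image_tpow: "in_image (tpow C M n)"
proof (induction n)
  case 0
  then show ?case using in_image_unit by simp
next
  case (Suc n)
  obtain Q :: "nat set" and b b' s t where
    res: "resolution (tpow C M n) Q b b' s" "graded (tpow C M n) Q b b' t" using tpow_resolution by blast
  note x = resolutionD[OF res(1)]
  have "in_image (tpow C M n \<boxtimes> M)"
  proof (rule in_image_dual_system[OF resolution_dual_system[OF resolution_vprod[OF res resolution_edge graded_edge]]])
    fix z z' assume "z \<in> {(q, r) \<in> Q \<times> arcs G. s q = head G r}" "z' \<in> {(q, r) \<in> Q \<times> arcs G. s q = head G r}"
    then obtain q r q' r' where z: "z = (q, r)" "z' = (q', r')" and qr: "q \<in> Q" "q' \<in> Q" "r \<in> arcs G" "r' \<in> arcs G" by auto
    have "sym (tpow C M n) (b' q) (b q') \<otimes>\<^bsub>K\<^esub> sym M (eM' r) (eM r') \<in> \<pi> ` carrier H"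
      using Suc.IH in_image_M x(3,4) qr by (intro image_mult) (simp_all add: in_image_def)
    then show "sym (tpow C M n \<boxtimes> M) (case z of (q, r) \<Rightarrow> cprod Vh (tpow C M n) M (b' q) (eM' r))
        (case z' of (q, r) \<Rightarrow> vprod Vh (tpow C M n) M (b q) (eM r)) \<in> \<pi> ` carrier H"
      using x(1,3,4) qr by (simp add: z sym_mult)
  qed
  then show ?case by simp
qed

text \<open>With inclusion \<open>i 0\<close> and projection \<open>p 0\<close> of the summand,
  \<open>p 0 \<cdot> i 0\<close> can be inserted after \<open>v\<close>. Dinaturality then moves
  \<open>p 0\<close> to the covector and leaves a symbol over \<open>tpow C M n\<close>.\<close>

lemma in_image_V:
  assumes j: "j \<in> I"
  shows "in_image (V j)"
proof -
  obtain n where "summand C (V j) (tpow C M n)" using generates j by (auto simp: generates_fusion_def)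
  then obtain B where "is_sum C [V j, B] (tpow C M n)" by (auto simp: summand_def)
  then obtain i p where ds: "direct_sum C {..<2} ((!) [V j, B]) (tpow C M n) i p"
    by (auto simp: is_sum_def numeral_2_eq_2)
  let ?T = "tpow C M n"
  have T: "?T \<in> Obj C" using in_image_tpow by (simp add: in_image_def)
  have ip: "i 0 \<in> Hom C (V j) ?T" "p 0 \<in> Hom C ?T (V j)" "p 0 \<cdot> i 0 = ident C (V j)"
    using ds by (auto simp: direct_sum_def dest!: bspec[of "{..<2}" _ "0::nat"])
  have "sym (V j) \<theta> v \<in> \<pi> ` carrier H" if \<theta>: "\<theta> \<in> coomega (V j)" and v: "v \<in> omega (V j)" for \<theta> v
  proof -
    have iv: "(ident C Vh \<star> i 0) \<cdot> v \<in> omega ?T" by (rule omega_map[OF V_Obj[OF j] T ip(1) v])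
    have "(ident C Vh \<star> p 0) \<cdot> ((ident C Vh \<star> i 0) \<cdot> v) = ((ident C Vh \<star> p 0) \<cdot> (ident C Vh \<star> i 0)) \<cdot> v"
      using cmp_assoc[of Vh "Vh \<boxtimes> V j" "Vh \<boxtimes> ?T" "Vh \<boxtimes> V j" v "ident C Vh \<star> i 0" "ident C Vh \<star> p 0"] j T ip v
      by (simp add: tmor_Hom ident_Hom)
    also have "(ident C Vh \<star> p 0) \<cdot> (ident C Vh \<star> i 0) = ident C (Vh \<boxtimes> V j)"
      using tmor_cmp[of Vh Vh Vh "V j" ?T "V j" "ident C Vh" "ident C Vh" "i 0" "p 0"] j T ip
      by (simp add: ident_Hom cmp_ident_left[of Vh Vh] tmor_ident)
    also have "ident C (Vh \<boxtimes> V j) \<cdot> v = v" using cmp_ident_left[of Vh "Vh \<boxtimes> V j" v] v j by simp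
    finally have "sym (V j) \<theta> v = sym (V j) \<theta> ((ident C Vh \<star> p 0) \<cdot> ((ident C Vh \<star> i 0) \<cdot> v))" by simp
    also have "\<dots> = sym ?T (\<theta> \<cdot> (ident C Vh \<star> p 0)) ((ident C Vh \<star> i 0) \<cdot> v)"
      by (rule sym_natural[OF T V_Obj[OF j] ip(2) \<theta> iv])
    also have "\<dots> \<in> \<pi> ` carrier H"
      using in_image_tpow[of n] iv coomega_map[OF T V_Obj[OF j] ip(2) \<theta>] by (simp add: in_image_def)
    finally show ?thesis .
  qed
  then show ?thesis using j by (simp add: in_image_def)
qed

text \<open>The identity of \<open>X\<close> is a sum of composites through simple objects. Inserted
  next to \<open>v\<close>, each term becomes a symbol over a simple object once the inclusion has
  been moved to the covector.\<close>

lemma in_image_all: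
  assumes X: "X \<in> Obj C"
  shows "in_image X"
proof -
  obtain Xs where Xs: "set Xs \<subseteq> V ` I" "is_sum C Xs X"
    using semisimple X unfolding finitely_split_semisimple_def by blast
  then obtain i p where ds: "direct_sum C {..<length Xs} ((!) Xs) X i p" by (auto simp: is_sum_def)
  have Y: "in_image (Xs ! n)" "Xs ! n \<in> Obj C" if "n < length Xs" for n
  proof -
    have "Xs ! n \<in> V ` I" using Xs(1) nth_mem[OF that] by blast
    then show "in_image (Xs ! n)" "Xs ! n \<in> Obj C" using in_image_V by auto
  qed
  have ip: "i n \<in> Hom C (Xs ! n) X" "p n \<in> Hom C X (Xs ! n)" if "n < length Xs" for n
    using ds that by (auto simp: direct_sum_def)
  have one: "(\<Sum>n<length Xs. i n \<cdot> p n) = ident C X" using ds by (simp add: direct_sum_def)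
  have VX: "Vh \<boxtimes> X \<in> Obj C" using X by simp
  have "sym X \<theta> v \<in> \<pi> ` carrier H" if \<theta>: "\<theta> \<in> coomega X" and v: "v \<in> omega X" for \<theta> v
  proof -
    let ?i = "\<lambda>n. ident C Vh \<star> i n" and ?p = "\<lambda>n. ident C Vh \<star> p n"
    have pv: "?p n \<cdot> v \<in> omega (Xs ! n)" if "n < length Xs" for n
      using omega_map[OF X Y(2)[OF that] ip(2)[OF that] v] .
    have ipv: "?i n \<cdot> (?p n \<cdot> v) \<in> omega X" if "n < length Xs" for n
      using omega_map[OF Y(2)[OF that] X ip(1)[OF that] pv[OF that]] .
    have tm: "linear_map (hom_space C X X) (hom_space C (Vh \<boxtimes> X) (Vh \<boxtimes> X)) (\<lambda>f. ident C Vh \<star> f)"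
      by (rule linear_map_tmor(2)) (use X ident_Hom in simp_all)
    have cv: "linear_map (hom_space C (Vh \<boxtimes> X) (Vh \<boxtimes> X)) (W X) (\<lambda>f. f \<cdot> v)"
      by (rule linear_map_cmp_left) (use VX v in simp_all)
    note L = linear_map_comp[OF cv tm]
    have "v = (ident C Vh \<star> (\<Sum>n<length Xs. i n \<cdot> p n)) \<cdot> v"
      unfolding one using X v cmp_ident_left[of Vh "Vh \<boxtimes> X" v] by (simp add: tmor_ident)
    also have "\<dots> = (\<Sum>n<length Xs. (ident C Vh \<star> (i n \<cdot> p n)) \<cdot> v)"
    proof (rule linear_map_hom_hom_sum[OF X X Vh_Obj VX L])
      show "i n \<cdot> p n \<in> Hom C X X" if "n \<in> {..<length Xs}" for n
        using cmp_Hom[of X "Xs ! n" X "p n" "i n"] X Y(2) ip that by simp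
    qed
    also have "\<dots> = (\<Sum>n<length Xs. ?i n \<cdot> (?p n \<cdot> v))"
    proof (rule sum.cong[OF refl])
      fix n assume "n \<in> {..<length Xs}"
      then have n: "n < length Xs" by simp
      have "ident C Vh \<star> (i n \<cdot> p n) = ?i n \<cdot> ?p n"
        using tmor_cmp[of Vh Vh Vh X "Xs ! n" X "ident C Vh" "ident C Vh" "p n" "i n"] X Y(2)[OF n] ip[OF n]
        by (simp add: ident_Hom cmp_ident_left[of Vh Vh])
      then show "(ident C Vh \<star> (i n \<cdot> p n)) \<cdot> v = ?i n \<cdot> (?p n \<cdot> v)"
        using cmp_assoc[of Vh "Vh \<boxtimes> X" "Vh \<boxtimes> Xs ! n" "Vh \<boxtimes> X" v "?p n" "?i n"] X Y(2)[OF n] ip[OF n] v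
        by (simp add: tmor_Hom ident_Hom)
    qed
    finally have "sym X \<theta> v = sym X \<theta> (\<Sum>n<length Xs. ?i n \<cdot> (?p n \<cdot> v))" by simp
    also have "\<dots> = (\<Oplus>\<^bsub>K\<^esub>n\<in>{..<length Xs}. sym X \<theta> (?i n \<cdot> (?p n \<cdot> v)))"
      using X VX \<theta> ipv by (intro linear_map_hom_sum_one[OF _ _ vect_K bilinear_right[OF bilinear_sym_K[OF X]]]) simp_all
    also have "\<dots> \<in> \<pi> ` carrier H"
    proof (rule linear_image_finsum[OF vect_H vect_K linear_map_\<pi>])
      fix n assume "n \<in> {..<length Xs}"
      then have n: "n < length Xs" by simp
      have "sym X \<theta> (?i n \<cdot> (?p n \<cdot> v)) = sym (Xs ! n) (\<theta> \<cdot> ?i n) (?p n \<cdot> v)"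
        by (rule sym_natural[OF Y(2)[OF n] X ip(1)[OF n] \<theta> pv[OF n]])
      then show "sym X \<theta> (?i n \<cdot> (?p n \<cdot> v)) \<in> \<pi> ` carrier H"
        using Y(1)[OF n] pv[OF n] coomega_map[OF Y(2)[OF n] X ip(1)[OF n] \<theta>] by (simp add: in_image_def)
    qed
    finally show ?thesis .
  qed
  then show ?thesis using X by (simp add: in_image_def)
qed

text \<open>The coend is spanned by its symbols, so \<open>in_image_all\<close> suffices. The sum
  over the support of a representative is taken in the free space, where it is the element itself,
  and then pushed to the quotient.\<close>

lemma \<pi>_surj: "\<pi> ` carrier H = carrier K"
proof
  show "\<pi> ` carrier H \<subseteq> carrier K" using \<pi>_closed by blast
  show "carrier K \<subseteq> \<pi> ` carrier H"
  proof
    fix y assume "y \<in> carrier K"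
    then obtain x where y: "y = cls (coend_rel C Vh) x" and x: "Poly_Mapping.keys x \<subseteq> coend_gens C Vh"
      by (auto simp: K_carrier coend_space_def)
    let ?G = "coend_gens C Vh" and ?S = "presented_space (coend_gens C Vh) (coend_rel C Vh) :: ('k, _) module"
    let ?t = "\<lambda>s. pscale (Poly_Mapping.lookup x s) (gen s)"
    have t: "?t \<in> Poly_Mapping.keys x \<rightarrow> carrier (free_space ?G)"
    proof
      fix s assume "s \<in> Poly_Mapping.keys x"
      then have "s \<in> ?G" using x by auto
      then show "?t s \<in> carrier (free_space ?G)" by simp
    qed
    have "y = cls (coend_rel C Vh) (finsum (free_space ?G) ?t (Poly_Mapping.keys x))"
      using poly_mapping_eq_sum_gen[of x] finsum_free_space[OF t] by (simp add: y)
    also have "\<dots> = finsum ?S (\<lambda>s. cls (coend_rel C Vh) (?t s)) (Poly_Mapping.keys x)"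
      by (rule linear_map_finsum[OF vect_free_space vect_presented_space linear_map_cls t])
    also have "\<dots> = finsum K (\<lambda>s. cls (coend_rel C Vh) (?t s)) (Poly_Mapping.keys x)"
      by (simp only: S_eq finsum_same_space[OF same_space_K])
    also have "\<dots> \<in> \<pi> ` carrier H"
    proof (rule linear_image_finsum[OF vect_H vect_K linear_map_\<pi>])
      fix s assume "s \<in> Poly_Mapping.keys x"
      then have s: "s \<in> ?G" using x by auto
      obtain X \<theta> v where [simp]: "s = (X, \<theta>, v)" by (cases s)
      have "cls (coend_rel C Vh) (?t s) = Poly_Mapping.lookup x s \<odot>\<^bsub>K\<^esub> sym X \<theta> v"
        using same_space_K by (simp add: same_space_def coend_space_def coend_sym_def)
      then show "cls (coend_rel C Vh) (?t s) \<in> \<pi> ` carrier H"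
        using in_image_all s image_smult by (simp add: in_image_def)
    qed
    finally show "y \<in> \<pi> ` carrier H" .
  qed
qed

lemma wba_surjection_\<pi>: "wba_surjection H K \<pi>"
  by (rule weak_bialgebra_transfer[OF weak_bialgebra_H pre_algebra_K linear_map_K_comult linear_map_K_counit
        linear_map_\<pi> \<pi>_surj \<pi>_one \<pi>_mult \<pi>_counit \<pi>_comult])

section \<open>The pushforward of the comodules\<close>

text \<open>On a basis path both sides are the canonical element of \<open>\<omega> X\<close> with
  \<open>[_|b p]\<close> applied to its second factor, once in the basis of paths and once in the
  chosen \<open>omega_basis\<close>. They agree by \<open>dual_system_independent\<close>.\<close>

lemma coaction_pushforward:
  assumes ds: "dual_system X (P n) b b'"
    and \<iota>: "linear_map (path_space G n) (W X) \<iota>" "\<And>p. p \<in> P n \<Longrightarrow> \<iota> (gen p) = b p"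
    and \<pi>b: "\<And>p q. \<lbrakk>p \<in> P n; q \<in> P n\<rbrakk> \<Longrightarrow> \<pi> (gen (q, p)) = sym X (b' q) (b p)"
    and x: "x \<in> carrier (path_space G n)"
  shows "tensor_map (W X) K \<iota> id (pushforward_coaction (path_space G n) K \<pi> (path_coaction G n) x)
    = omega_coaction C I Vh lam X (\<iota> x)"
proof -
  let ?PS = "path_space G n :: ('k, ('i, 'e) gpath \<Rightarrow>\<^sub>0 'k) module"
  let ?T = "tensor_space (W X) K" and ?B = "omega_basis C Vh X"
  let ?B' = "dual_basis C I Vh lam X ?B id"
  interpret T: vect ?T by (rule vect_tensor_space)
  have X: "X \<in> Obj C" and b: "\<And>q. q \<in> P n \<Longrightarrow> b q \<in> omega X" "\<And>q. q \<in> P n \<Longrightarrow> b' q \<in> coomega X"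
    using ds by (auto simp: dual_system_def)
  have PS: "?PS = free_space (P n)" by (simp add: path_space_def)
  have vPS: "vect ?PS" unfolding PS by (rule vect_free_space)
  have genPS: "gen p \<in> carrier ?PS" if "p \<in> P n" for p using that by (simp add: PS)
  note vT = vect_tensor_space
  let ?c = "\<lambda>p. \<Oplus>\<^bsub>tensor_space ?PS H\<^esub>q\<in>P n. tens ?PS H (gen q) (gen (q, p))"
  interpret TP: vect "tensor_space ?PS H" by (rule vect_tensor_space)
  have c: "?c \<in> P n \<rightarrow> carrier (tensor_space ?PS H)"
    using genPS by (auto intro!: TP.finsum_closed tens_closed gen_in_H)
  have co: "path_coaction G n = lin_ext (tensor_space ?PS H) ?c" by (simp add: path_coaction_def Let_def)
  have co_lin: "linear_map ?PS (tensor_space ?PS H) (path_coaction G n)"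
    unfolding co using linear_map_lin_ext[OF vT c] by (simp only: PS)
  note i\<pi> = linear_map_tensor_map[OF vPS vect_H vPS vect_K linear_map_id(2) linear_map_\<pi>]
  note \<iota>i = linear_map_tensor_map[OF vPS vect_K vect_W[OF X] vect_K \<iota>(1) linear_map_id(2)]
  let ?L = "\<lambda>x. tensor_map (W X) K \<iota> id (tensor_map ?PS K id \<pi> x)"
  note L = linear_map_comp[OF \<iota>i i\<pi>]
  have Lt: "?L (tens ?PS H (gen q) (gen (q, p))) = tens (W X) K (b q) (sym X (b' q) (b p))"
    if pq: "p \<in> P n" "q \<in> P n" for p q
  proof -
    have "tensor_map ?PS K id \<pi> (tens ?PS H (gen q) (gen (q, p))) = tens ?PS K (gen q) (\<pi> (gen (q, p)))"
      using tensor_map_tens[OF vPS vect_H vPS vect_K linear_map_id(2) linear_map_\<pi> genPS[OF pq(2)] gen_in_H[OF pq(2,1)]]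
      by simp
    then show ?thesis
      using tensor_map_tens[OF vPS vect_K vect_W[OF X] vect_K \<iota>(1) linear_map_id(2) genPS[OF pq(2)] \<pi>_closed[OF gen_in_H[OF pq(2,1)]]]
        \<iota>(2)[OF pq(2)] \<pi>b[OF pq] by simp
  qed
  have om: "omega_space C Vh X = W X" by (simp add: omega_space_def hom_space_def)
  have oc: "omega_coaction C I Vh lam X = (\<lambda>v. \<Oplus>\<^bsub>?T\<^esub>c\<in>?B. tens (W X) K c (sym X (?B' c) v))"
    by (simp add: omega_coaction_def Let_def om fun_eq_iff)
  note obs = omega_basis_dual_system[OF X]
  have Bm: "c \<in> omega X" "?B' c \<in> coomega X" if "c \<in> ?B" for c
    using obs that by (auto simp: dual_system_def)
  note bt = bilinear_tens[OF vect_W[OF X] vect_K]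
  have oc_lin: "linear_map (W X) ?T (omega_coaction C I Vh lam X)"
    unfolding oc
  proof (rule linear_map_finsum_fun[OF vect_W[OF X] vT])
    fix c assume c: "c \<in> ?B"
    have 1: "linear_map K ?T (tens (W X) K c)" by (rule bilinear_right[OF bt]) (use Bm[OF c] in simp)
    have 2: "linear_map (W X) K (sym X (?B' c))" by (rule bilinear_right[OF bilinear_sym_K[OF X]]) (use Bm[OF c] in simp)
    show "linear_map (W X) ?T (\<lambda>v. tens (W X) K c (sym X (?B' c) v))" by (rule linear_map_comp[OF 1 2])
  qed
  have lhs: "linear_map (free_space (P n)) ?T (\<lambda>x. ?L (path_coaction G n x))"
    using linear_map_comp[OF L co_lin] by (simp only: PS)
  have rhs: "linear_map (free_space (P n)) ?T (\<lambda>x. omega_coaction C I Vh lam X (\<iota> x))"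
    using linear_map_comp[OF oc_lin \<iota>(1)] by (simp only: PS)
  have gens: "?L (path_coaction G n (gen p)) = omega_coaction C I Vh lam X (\<iota> (gen p))" if p: "p \<in> P n" for p
  proof -
    have "path_coaction G n (gen p) = ?c p"
      unfolding co using c p by (intro lin_ext_gen[OF vT]) auto
    then have "?L (path_coaction G n (gen p)) = (\<Oplus>\<^bsub>?T\<^esub>q\<in>P n. ?L (tens ?PS H (gen q) (gen (q, p))))"
      using genPS p by (simp only:) (intro linear_map_finsum[OF vT vT L]; auto intro!: tens_closed gen_in_H)
    also have "\<dots> = (\<Oplus>\<^bsub>?T\<^esub>q\<in>P n. tens (W X) K (b q) (sym X (b' q) (b p)))"
      using Lt p b X by (intro T.finsum_cong' refl) (auto intro!: tens_closed sym_closed_K)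
    also have "\<dots> = (\<Oplus>\<^bsub>?T\<^esub>c\<in>?B. tens (W X) K (id c) (sym X (?B' c) (b p)))"
    proof (rule dual_system_independent[OF obs ds vT])
      have 1: "linear_map (coW X) K (\<lambda>\<xi>. sym X \<xi> (b p))"
        by (rule bilinear_left[OF bilinear_sym_K[OF X]]) (use b(1)[OF p] in simp)
      show "bilinear (W X) (coW X) ?T (\<lambda>x \<xi>. tens (W X) K x (sym X \<xi> (b p)))"
        by (rule bilinear_comp[OF bt linear_map_id(1) 1])
    qed
    finally show ?thesis using \<iota>(2)[OF p] by (simp add: oc)
  qed
  show ?thesis
    unfolding pushforward_coaction_def comp_apply
    by (rule free_space_linear_eq[OF vT lhs rhs gens]) (use x in \<open>simp_all add: PS\<close>)
qed

text \<open>The resolution of \<open>M\<close> by edges is reindexed by paths of length one; the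
  \<open>undefined\<close> branch for vertices is never reached on these. The object is
  \<open>M\<close> and not \<open>path_obj 1\<close>, so \<open>\<pi>_edge\<close> supplies the
  matrix coefficients.\<close>

lemma edge_coaction:
  assumes "x \<in> carrier (path_space G 1)"
  defines "\<iota> \<equiv> edge_ident (omega_space C Vh M) eM"
  shows "tensor_map (omega_space C Vh M) K \<iota> id (pushforward_coaction (path_space G 1) K \<pi> (path_coaction G 1) x)
    = omega_coaction C I Vh lam M (\<iota> x)"
proof -
  let ?f = "case_gpath (\<lambda>_. undefined) (\<lambda>es. eM (hd es))" and ?f' = "case_gpath (\<lambda>_. undefined) (\<lambda>es. eM' (hd es))"
  have om: "omega_space C Vh M = W M" by (simp add: omega_space_def hom_space_def)
  have P1: "P 1 = (\<lambda>a. Edges [a]) ` arcs G"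
  proof
    show "P 1 \<subseteq> (\<lambda>a. Edges [a]) ` arcs G"
    proof
      fix p assume "p \<in> P 1"
      then obtain es where "p = Edges es" "length es = 1" "set es \<subseteq> arcs G" by (cases p) auto
      then show "p \<in> (\<lambda>a. Edges [a]) ` arcs G" by (cases es) auto
    qed
  qed auto
  have "inj_on (\<lambda>a. Edges [a]) (arcs G)" by (simp add: inj_on_def)
  then have "resolution M ((\<lambda>a. Edges [a]) ` arcs G) ?f ?f' (psrc G)"
    by (rule resolution_reindex[OF resolution_edge]) simp_all
  then have ds: "dual_system M (P 1) ?f ?f'" unfolding P1 by (rule resolution_dual_system)
  have f: "?f \<in> P 1 \<rightarrow> carrier (W M)" unfolding P1 by auto
  note vW = vect_W[OF M_Obj]
  have i: "\<iota> = lin_ext (W M) ?f" by (simp add: \<iota>_def edge_ident_def om)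
  show ?thesis
    unfolding om
  proof (rule coaction_pushforward[OF ds _ _ _ assms(1)])
    show "linear_map (path_space G 1) (W M) \<iota>"
      unfolding i path_space_def by (rule linear_map_lin_ext[OF vW f])
    show "\<iota> (gen p) = ?f p" if "p \<in> P 1" for p
      unfolding i using f that by (intro lin_ext_gen[OF vW]) auto
    show "\<pi> (gen (q, p)) = sym M (?f' q) (?f p)" if "p \<in> P 1" "q \<in> P 1" for p q
      using that unfolding P1 by (auto simp: \<pi>_edge)
  qed
qed

lemma vertex_coaction:
  assumes "x \<in> carrier (path_space G 0)"
  defines "\<iota> \<equiv> vertex_ident (omega_space C Vh (unit_obj C)) (unit_vec C Vh lam)"
  shows "tensor_map (omega_space C Vh (unit_obj C)) K \<iota> id (pushforward_coaction (path_space G 0) K \<pi> (path_coaction G 0) x)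
    = omega_coaction C I Vh lam (unit_obj C) (\<iota> x)"
proof -
  let ?U = "unit_obj C"
  let ?f = "case_gpath (unit_vec C Vh lam) (\<lambda>_. undefined)" and ?f' = "case_gpath (unit_covec C Vh lam) (\<lambda>_. undefined)"
  have om: "omega_space C Vh ?U = W ?U" by (simp add: omega_space_def hom_space_def)
  have P0: "P 0 = Vertex ` I" by (simp add: paths_0)
  have "inj_on Vertex I" by (simp add: inj_on_def)
  then have "resolution ?U (Vertex ` I) ?f ?f' (psrc G)"
    by (rule resolution_reindex[OF resolution_unit]) simp_all
  then have ds: "dual_system ?U (P 0) ?f ?f'" unfolding P0 by (rule resolution_dual_system)
  have f: "?f \<in> P 0 \<rightarrow> carrier (W ?U)" unfolding P0 by auto
  note vW = vect_W[OF unit_Obj]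
  have i: "\<iota> = lin_ext (W ?U) ?f" by (simp add: \<iota>_def vertex_ident_def om)
  show ?thesis
    unfolding om
  proof (rule coaction_pushforward[OF ds _ _ _ assms(1)])
    show "linear_map (path_space G 0) (W ?U) \<iota>"
      unfolding i path_space_def by (rule linear_map_lin_ext[OF vW f])
    show "\<iota> (gen p) = ?f p" if "p \<in> P 0" for p
      unfolding i using f that by (intro lin_ext_gen[OF vW]) auto
    show "\<pi> (gen (q, p)) = sym ?U (?f' q) (?f p)" if "p \<in> P 0" "q \<in> P 0" for p q
      using that unfolding P0 by (auto simp: \<pi>_vertex)
  qed
qed

end

theorem theorem3p8:
  fixes C :: "('k::field, 'o, 'm::ab_group_add) aut_cat"
    and I :: "'i set" and V :: "'i \<Rightarrow> 'o"
    and Vh :: 'o and inc prj :: "'i \<Rightarrow> 'm"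
    and M :: 'o
    and G :: "('i, 'e) pre_digraph" and e :: "'e \<Rightarrow> 'm"
  assumes "left_autonomous_category C"
    and "additive_category C"
    and "finite_dim_homs C"
    and "finitely_split_semisimple C I V"
    and "direct_sum C I V Vh inc prj"
    and "generates_fusion C I V M"
    and "dimension_graph C I V M G e"
  shows
    "let U = unit_obj C;
         lam = (\<lambda>j. inc j \<cdot>\<^bsub>C\<^esub> prj j);
         H = coend C I Vh lam;
         eM = edge_vec C inc prj M G e;
         eM' = dual_basis C I Vh lam M (arcs G) eM
     in \<exists>\<pi>. wba_surjection (graph_wba G) H \<pi> \<and>
        (\<forall>j\<in>verts G. \<forall>l\<in>verts G.
           \<pi> (gen (Vertex j, Vertex l))
           = coend_sym C Vh U (unit_covec C Vh lam j) (unit_vec C Vh lam l)) \<and>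
        (\<forall>p\<in>arcs G. \<forall>q\<in>arcs G.
           \<pi> (gen (Edges [p], Edges [q])) = coend_sym C Vh M (eM' p) (eM q)) \<and>
        (let W = omega_space C Vh M; \<iota> = edge_ident W eM in
         \<forall>x\<in>carrier (path_space G 1).
           tensor_map W H \<iota> id
             (pushforward_coaction (path_space G 1) H \<pi> (path_coaction G 1) x)
           = omega_coaction C I Vh lam M (\<iota> x)) \<and>
        (let W = omega_space C Vh U; \<iota> = vertex_ident W (unit_vec C Vh lam) in
         \<forall>x\<in>carrier (path_space G 0).
           tensor_map W H \<iota> id
             (pushforward_coaction (path_space G 0) H \<pi> (path_coaction G 0) x)
           = omega_coaction C I Vh lam U (\<iota> x))"
proof -
  interpret left_autonomous_category C by fact
  interpret F: fusion_graph C I V Vh inc prj M G e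
    by unfold_locales (fact assms)+
  show ?thesis
    unfolding Let_def
    using F.wba_surjection_\<pi> F.\<pi>_vertex F.\<pi>_edge F.edge_coaction F.vertex_coaction F.verts_G
    by (intro exI[of _ F.\<pi>] conjI ballI) simp_all
qed

end
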